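(* Let $L>0$ and $\theta_0,\theta_1\in(-\pi,\pi)\setminus\{0\}$. Then there exists $\ell^*\in(0,L)$ such that for any $\ell\in(\ell^*,L)$ the bending energy $\mathsf{B}$ has a unique minimiser $\gamma_\ell$ in the set $\mathcal{A}^L_{\ell,\theta_0,\theta_1}$. In addition: (a) If $\theta_0\theta_1<0$, then $\gamma_\ell$ has strictly monotone tangential angle from $\theta_0$ to $\theta_1$; in particular, $\gamma_\ell$ has no inflection point. (b) If $\theta_0\theta_1>0$, then $\gamma_\ell$ has strictly monotone curvature with a unique zero; in particular, $\gamma_\ell$ has exactly one inflection point. Finally, in the limit $\ell\to L$, the rescaled curve defined by $$\hat\gamma_\ell(s):=\frac{1}{\varepsilon_\ell}\gamma_\ell(\varepsilon_\ell s),\qquad \varepsilon_\ell:=\frac{L-\ell}{4\sqrt2\left(\sin^2\frac{\theta_0}{4}+\sin^2\frac{\theta_1}{4}\right)},$$ converges locally smoothly to the borderline elastica $\gamma_B^{\theta_0}$. The symmetric convergence holds at the other endpoint: the curve $s\mapsto\frac{1}{\varepsilon_\ell}\big((\ell,0)^\top-\gamma_\ell(L-\varepsilon_\ell s)\big)$ converges locally smoothly to $\gamma_B^{\theta_1}$ as $\ell\to L$.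
   Context: For $L>0$, $W^{2,2}_{\mathrm{arc}}(0,L;\mathbf{R}^2)$ denotes the set of $\gamma\in W^{2,2}(0,L;\mathbf{R}^2)$ with $|\gamma'|\equiv 1$. The signed curvature $k$ is defined by $\gamma''=kN$, where $N$ is the counterclockwise rotation of $\gamma'$ by $\pi/2$; the bending energy is $\mathsf{B}[\gamma]=\int_0^L k^2\,ds$. A tangential angle of $\gamma$ is a continuous function $\theta$ with $\gamma'=(\cos\theta,\sin\theta)^\top$. An inflection point is a point where the signed curvature changes sign. For $\ell\in[0,L)$ and $\theta_0,\theta_1\in(-\pi,\pi]$, $\mathcal{A}^L_{\ell,\theta_0,\theta_1}$ is the set of $\gamma\in W^{2,2}_{\mathrm{arc}}(0,L;\mathbf{R}^2)$ with $\gamma(0)=(0,0)^\top$, $\gamma(L)=(\ell,0)^\top$, $\gamma'(0)=(\cos\theta_0,\sin\theta_0)^\top$, $\gamma'(L)=(\cos\theta_1,\sin\theta_1)^\top$. For $\theta\in(-\pi,\pi)\setminus\{0\}$, the borderline elastica with initial angle $\theta$ is the curve $\gamma_B^{\theta}:[0,\infty)\to\mathbf{R}^2$, $$\gamma_B^{\theta}(s)=\int_0^s\begin{pmatrix}\cos\varphi(u+u_0)\\ \operatorname{sign}(\theta)\,\sin\varphi(u+u_0)\end{pmatrix}du,\qquad \varphi(u)=4\arctan\big(e^{-u/\sqrt2}\big),$$ with $u_0=-\sqrt2\log\big(\tan\frac{|\theta|}{4}\big)>0$ (so $\varphi(u_0)=|\theta|$). Locally smooth convergence means convergence in $C^j([0,R])$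 for every $R>0$ and every integer $j\ge0$ (the rescaled curves are defined on $[0,L/\varepsilon_\ell]$, and $L/\varepsilon_\ell\to\infty$). *)

theory Defs
  imports "HOL-Analysis.Analysis"
begin

subsection \<open>Spaces of continuously differentiable functions\<close>

text \<open>Derivatives are taken within \<open>S\<close>, hence are one-sided at the end points of an interval.\<close>

fun nth_deriv_on :: "real set \<Rightarrow> nat \<Rightarrow> (real \<Rightarrow> 'a::real_normed_vector) \<Rightarrow> real \<Rightarrow> 'a" where
  "nth_deriv_on S 0 f = f"
| "nth_deriv_on S (Suc n) f = (\<lambda>t. vector_derivative (nth_deriv_on S n f) (at t within S))"

definition Ck_on :: "nat \<Rightarrow> real set \<Rightarrow> (real \<Rightarrow> 'a::real_normed_vector) \<Rightarrow> bool" where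
  "Ck_on j S f \<longleftrightarrow>
     (\<forall>i<j. \<forall>t\<in>S. nth_deriv_on S i f differentiable (at t within S)) \<and>
     continuous_on S (nth_deriv_on S j f)"

definition Ck_tendsto_on ::
  "nat \<Rightarrow> real set \<Rightarrow> ('b \<Rightarrow> real \<Rightarrow> 'a::real_normed_vector) \<Rightarrow> (real \<Rightarrow> 'a) \<Rightarrow> 'b filter \<Rightarrow> bool" where
  "Ck_tendsto_on j S f g F \<longleftrightarrow>
     Ck_on j S g \<and> (\<forall>\<^sub>F x in F. Ck_on j S (f x)) \<and>
     (\<forall>i\<le>j. uniform_limit S (\<lambda>x. nth_deriv_on S i (f x)) (nth_deriv_on S i g) F)"

definition locally_smooth_tendsto ::
  "('b \<Rightarrow> real \<Rightarrow> 'a::real_normed_vector) \<Rightarrow> (real \<Rightarrow> 'a) \<Rightarrow> 'b filter \<Rightarrow> bool" where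
  "locally_smooth_tendsto f g F \<longleftrightarrow> (\<forall>R>0. \<forall>j. Ck_tendsto_on j {0..R} f g F)"

subsection \<open>The Sobolev space of curves\<close>

definition test_function :: "real \<Rightarrow> (real \<Rightarrow> real) \<Rightarrow> bool" where
  "test_function L \<phi> \<longleftrightarrow>
     (\<forall>j. Ck_on j UNIV \<phi>) \<and> (\<exists>a b. 0 < a \<and> b < L \<and> (\<forall>t. t \<notin> {a..b} \<longrightarrow> \<phi> t = 0))"

definition locally_integrable :: "real \<Rightarrow> (real \<Rightarrow> 'a::euclidean_space) \<Rightarrow> bool" where
  "locally_integrable L f \<longleftrightarrow> (\<forall>a b. 0 < a \<and> b < L \<longrightarrow> set_integrable lebesgue {a..b} f)"

definition has_weak_deriv ::
  "real \<Rightarrow> (real \<Rightarrow> 'a::euclidean_space) \<Rightarrow> (real \<Rightarrow> 'a) \<Rightarrow> bool" where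
  "has_weak_deriv L f g \<longleftrightarrow>
     locally_integrable L f \<and> locally_integrable L g \<and>
     (\<forall>\<phi>. test_function L \<phi> \<longrightarrow>
        (LINT s:{0<..<L}|lebesgue. vector_derivative \<phi> (at s) *\<^sub>R f s) =
        - (LINT s:{0<..<L}|lebesgue. \<phi> s *\<^sub>R g s))"

definition L2_on :: "real set \<Rightarrow> (real \<Rightarrow> 'a::euclidean_space) \<Rightarrow> bool" where
  "L2_on S f \<longleftrightarrow>
     set_borel_measurable lebesgue S f \<and> set_integrable lebesgue S (\<lambda>s. (norm (f s))\<^sup>2)"

definition W22 :: "real \<Rightarrow> (real \<Rightarrow> 'a::euclidean_space) set" where
  "W22 L = {\<gamma>. \<exists>v w. L2_on {0<..<L} \<gamma> \<and> L2_on {0<..<L} v \<and> L2_on {0<..<L} w \<and>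
                    has_weak_deriv L \<gamma> v \<and> has_weak_deriv L v w}"

definition velocity :: "real \<Rightarrow> (real \<Rightarrow> real^2) \<Rightarrow> real \<Rightarrow> real^2" where
  "velocity L \<gamma> s = vector_derivative \<gamma> (at s within {0..L})"

text \<open>
  By the embedding of \<open>W\<^sup>2\<^sup>,\<^sup>2(0,L)\<close> into \<open>C\<^sup>1([0,L])\<close>, a Sobolev curve is represented by
  its unique continuously differentiable representative on \<open>[0,L]\<close>, so that point values of
  the curve and of its velocity make sense up to the end points. Values outside \<open>[0,L]\<close> are
  irrelevant, so two such functions are the same curve iff they agree on \<open>[0,L]\<close>.
\<close>

definition W22_arc :: "real \<Rightarrow> (real \<Rightarrow> real^2) set" where
  "W22_arc L = {\<gamma> \<in> W22 L. Ck_on 1 {0..L} \<gamma> \<and> (\<forall>s\<in>{0..L}. norm (velocity L \<gamma> s) = 1)}"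

subsection \<open>Curvature, bending energy, tangential angle\<close>

definition rot90 :: "real^2 \<Rightarrow> real^2" where
  "rot90 v = vector [- (v $ 2), v $ 1]"

text \<open>
  \<open>\<gamma>'' = k N\<close> with \<open>\<gamma>''\<close> the weak derivative of \<open>\<gamma>'\<close>; this determines \<open>k\<close> only almost
  everywhere, and \<open>curvature\<close> picks an arbitrary representative. Everything derived from
  \<open>curvature\<close> below is insensitive to null sets.
\<close>

definition is_curvature :: "real \<Rightarrow> (real \<Rightarrow> real^2) \<Rightarrow> (real \<Rightarrow> real) \<Rightarrow> bool" where
  "is_curvature L \<gamma> k \<longleftrightarrow>
     L2_on {0<..<L} k \<and>
     has_weak_deriv L (velocity L \<gamma>) (\<lambda>s. k s *\<^sub>R rot90 (velocity L \<gamma> s))"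

definition curvature :: "real \<Rightarrow> (real \<Rightarrow> real^2) \<Rightarrow> real \<Rightarrow> real" where
  "curvature L \<gamma> = (SOME k. is_curvature L \<gamma> k)"

definition bending_energy :: "real \<Rightarrow> (real \<Rightarrow> real^2) \<Rightarrow> real" where
  "bending_energy L \<gamma> = (LINT s:{0<..<L}|lebesgue. (curvature L \<gamma> s)\<^sup>2)"

definition inflection_point :: "real \<Rightarrow> (real \<Rightarrow> real^2) \<Rightarrow> real \<Rightarrow> bool" where
  "inflection_point L \<gamma> s \<longleftrightarrow>
     s \<in> {0<..<L} \<and>
     (\<exists>\<delta>>0. \<exists>\<sigma>\<in>{-1, 1}. {s-\<delta><..<s+\<delta>} \<subseteq> {0<..<L} \<and>
        (AE t in lebesgue. t \<in> {s-\<delta><..<s} \<longrightarrow> \<sigma> * curvature L \<gamma> t < 0) \<and>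
        (AE t in lebesgue. t \<in> {s<..<s+\<delta>} \<longrightarrow> \<sigma> * curvature L \<gamma> t > 0))"

definition unit_vec :: "real \<Rightarrow> real^2" where
  "unit_vec \<theta> = vector [cos \<theta>, sin \<theta>]"

definition tangential_angle :: "real \<Rightarrow> (real \<Rightarrow> real^2) \<Rightarrow> (real \<Rightarrow> real) \<Rightarrow> bool" where
  "tangential_angle L \<gamma> \<theta> \<longleftrightarrow>
     continuous_on {0..L} \<theta> \<and> (\<forall>s\<in>{0..L}. velocity L \<gamma> s = unit_vec (\<theta> s))"

definition strictly_monotone_on :: "real set \<Rightarrow> (real \<Rightarrow> real) \<Rightarrow> bool" where
  "strictly_monotone_on S f \<longleftrightarrow> strict_mono_on S f \<or> strict_antimono_on S f"

subsection \<open>The clamped boundary value problem and the borderline elastica\<close>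

definition admissible :: "real \<Rightarrow> real \<Rightarrow> real \<Rightarrow> real \<Rightarrow> (real \<Rightarrow> real^2) set" where
  "admissible L l \<theta>0 \<theta>1 =
     {\<gamma> \<in> W22_arc L. \<gamma> 0 = vector [0, 0] \<and> \<gamma> L = vector [l, 0] \<and>
        velocity L \<gamma> 0 = unit_vec \<theta>0 \<and> velocity L \<gamma> L = unit_vec \<theta>1}"

definition energy_minimiser ::
  "real \<Rightarrow> real \<Rightarrow> real \<Rightarrow> real \<Rightarrow> (real \<Rightarrow> real^2) \<Rightarrow> bool" where
  "energy_minimiser L l \<theta>0 \<theta>1 \<gamma> \<longleftrightarrow>
     \<gamma> \<in> admissible L l \<theta>0 \<theta>1 \<and>
     (\<forall>\<eta>\<in>admissible L l \<theta>0 \<theta>1. bending_energy L \<gamma> \<le> bending_energy L \<eta>)"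

definition borderline_angle :: "real \<Rightarrow> real" where
  "borderline_angle u = 4 * arctan (exp (- u / sqrt 2))"

definition borderline_shift :: "real \<Rightarrow> real" where
  "borderline_shift \<theta> = - sqrt 2 * ln (tan (\<bar>\<theta>\<bar> / 4))"

definition borderline_elastica :: "real \<Rightarrow> real \<Rightarrow> real^2" where
  "borderline_elastica \<theta> s =
     integral {0..s} (\<lambda>u. vector [cos (borderline_angle (u + borderline_shift \<theta>)),
                                  sgn \<theta> * sin (borderline_angle (u + borderline_shift \<theta>))])"

definition rescaling_factor :: "real \<Rightarrow> real \<Rightarrow> real \<Rightarrow> real \<Rightarrow> real" where
  "rescaling_factor L \<theta>0 \<theta>1 l =
     (L - l) / (4 * sqrt 2 * ((sin (\<theta>0 / 4))\<^sup>2 + (sin (\<theta>1 / 4))\<^sup>2))"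

end

theory Submission
  imports Defs "HOL-Real_Asymp.Real_Asymp"
begin

text \<open>Writing a competitor as \<open>\<gamma>' = (cos x, sin x)\<close>, the closing conditions fix \<open>\<integral>cos x\<close> and
  \<open>\<integral>sin x\<close>, so minimising \<open>\<integral>x'\<^sup>2\<close> is the same as minimising the pendulum action
  \<open>\<integral>x'\<^sup>2 + 4 \<rho> sin\<^sup>2 ((x - \<alpha>) / 2)\<close> for any tilt \<open>\<alpha>\<close>. If \<open>\<Theta>\<close> solves
  \<open>\<Theta>'' = \<rho> sin (\<Theta> - \<alpha>)\<close> with \<open>\<bar>\<Theta> - \<alpha>\<bar> < \<pi>\<close>, completing squares in the variable
  \<open>2 sin ((x - \<alpha>) / 2)\<close> shows that \<open>\<Theta>\<close> is the only minimiser among the lifts with the same end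
  values of \<open>sin ((x - \<alpha>) / 2)\<close>. The end directions determine \<open>x\<close> only modulo \<open>2 \<pi>\<close>, and the
  lifts with the opposite end value contain an additional half turn, which is too expensive
  when the curve is almost straight.

  The solutions are explicit: \<open>sin ((\<Theta> - \<alpha>) / 2) = (a sinh (W - w) + b sinh w) / sinh W\<close> in a
  suitable time \<open>w \<in> [0, W]\<close>. As \<open>W \<longrightarrow> \<infinity>\<close> the closing conditions decouple to leading order: the
  height is balanced by the tilt \<open>\<alpha> = \<beta> / W\<close> and the relative length defect is a constant over \<open>W\<close>.
  The Poincare-Miranda theorem therefore provides \<open>(W, \<beta>)\<close> for every small defect. The shape of
  the minimiser is read off the formula, and the rescaled pendulum equation converges to the
  borderline equation \<open>\<phi>'' = sin \<phi> / 2\<close> together with its initial data, so Gronwall's inequality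
  gives the smooth convergence.\<close>

section \<open>Absolutely continuous functions\<close>

text \<open>Existence is not obtained from compactness: any pendulum solution that meets the closing
  conditions is shown to be the minimiser by direct comparison. Hence nothing has to be known about
  uniqueness or regularity of the pair \<open>(W, \<beta>)\<close> chosen for a given defect: two
  admissible choices give the same curve, and all asymptotic estimates are uniform for \<beta> in
  [-5, 5]. The obstacle is that the comparison sees only the sine of the half angle, so lifts of
  different parity must be separated by a quantitative gap. This is where straightness enters: in
  the limit the action of the solution, divided by sqrt \<rho>, is 16 - 8 cos (\<theta>0 / 2) - 8
  cos (\<theta>1 / 2), which lies below the cost 16 - 8 |cos (\<theta>0 / 2) - cos (\<theta>1 / 2)|
  of an additional half turn. The second obstacle is regularity: competitors have only square
  integrable curvature, so every identity along a competitor is one of absolutely continuous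
  functions, and the calculus rules are obtained in integrated form.\<close>

definition ac_deriv :: "real \<Rightarrow> real \<Rightarrow> (real \<Rightarrow> 'a::euclidean_space) \<Rightarrow> (real \<Rightarrow> 'a) \<Rightarrow> bool" where
  "ac_deriv a b f g \<longleftrightarrow> g absolutely_integrable_on {a..b} \<and>
     (\<forall>s t. a \<le> s \<and> s \<le> t \<and> t \<le> b \<longrightarrow> f t - f s = integral {s..t} g)"

lemma ac_derivD:
  assumes "ac_deriv a b f g" "a \<le> s" "s \<le> t" "t \<le> b"
  shows "f t - f s = integral {s..t} g"
  using assms unfolding ac_deriv_def by auto

lemma ac_deriv_absint: "ac_deriv a b f g \<Longrightarrow> g absolutely_integrable_on {a..b}"
  unfolding ac_deriv_def by auto

lemma ac_deriv_continuous_on: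
  assumes "ac_deriv a b f g"
  shows "continuous_on {a..b} f"
proof -
  have "continuous_on {a..b} (\<lambda>t. f a + integral {a..t} g)"
    using ac_deriv_absint[OF assms]
    by (intro continuous_intros indefinite_integral_continuous_1 set_lebesgue_integral_eq_integral(1))
  moreover have "f a + integral {a..t} g = f t" if "t \<in> {a..b}" for t
    using ac_derivD[OF assms, of a t] that by (simp add: algebra_simps)
  ultimately show ?thesis by (subst continuous_on_cong[OF refl, of _ _ "\<lambda>t. f a + integral {a..t} g"]) auto
qed

lemma ac_deriv_C1:
  assumes "\<And>t. t \<in> {a..b} \<Longrightarrow> (f has_vector_derivative g t) (at t within {a..b})"
    and "continuous_on {a..b} g"
  shows "ac_deriv a b f g"
  unfolding ac_deriv_def
proof (intro conjI allI impI)
  show "g absolutely_integrable_on {a..b}"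
    using assms(2) by (intro absolutely_integrable_continuous_real)
  fix s t assume st: "a \<le> s \<and> s \<le> t \<and> t \<le> b"
  have "(g has_integral (f t - f s)) {s..t}"
    using st by (intro fundamental_theorem_of_calculus)
      (auto intro: has_vector_derivative_within_subset[OF assms(1)])
  thus "f t - f s = integral {s..t} g" by (simp add: integral_unique)
qed

lemma ac_deriv_cong:
  assumes "ac_deriv a b f g" "\<And>t. t \<in> {a..b} \<Longrightarrow> f' t = f t" "\<And>t. t \<in> {a..b} \<Longrightarrow> g' t = g t"
  shows "ac_deriv a b f' g'"
  unfolding ac_deriv_def
proof (intro conjI allI impI)
  show "g' absolutely_integrable_on {a..b}"
    using ac_deriv_absint[OF assms(1)] assms(3)
    by (subst set_integrable_cong[where f'=g]) auto
  fix s t assume st: "a \<le> s \<and> s \<le> t \<and> t \<le> b"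
  have "integral {s..t} g' = integral {s..t} g"
    using st assms(3) by (intro Henstock_Kurzweil_Integration.integral_cong) auto
  thus "f' t - f' s = integral {s..t} g'"
    using ac_derivD[OF assms(1), of s t] st assms(2)[of s] assms(2)[of t] by auto
qed

lemma ac_deriv_add:
  assumes "ac_deriv a b f f'" "ac_deriv a b g g'"
  shows "ac_deriv a b (\<lambda>t. f t + g t) (\<lambda>t. f' t + g' t)"
  unfolding ac_deriv_def
proof (intro conjI allI impI)
  show "(\<lambda>t. f' t + g' t) absolutely_integrable_on {a..b}"
    using assms[THEN ac_deriv_absint] by (rule set_integral_add)
  fix s t assume st: "a \<le> s \<and> s \<le> t \<and> t \<le> b"
  have "f' integrable_on {s..t}" "g' integrable_on {s..t}"
    using assms[THEN ac_deriv_absint] st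
    by (auto intro!: integrable_on_subinterval[OF set_lebesgue_integral_eq_integral(1)])
  hence "integral {s..t} (\<lambda>t. f' t + g' t) = integral {s..t} f' + integral {s..t} g'"
    by (rule Henstock_Kurzweil_Integration.integral_add)
  thus "f t + g t - (f s + g s) = integral {s..t} (\<lambda>t. f' t + g' t)"
    using assms[THEN ac_derivD, of s t] st by (simp add: algebra_simps)
qed

lemma ac_deriv_linear:
  assumes "ac_deriv a b f f'" "bounded_linear h"
  shows "ac_deriv a b (\<lambda>t. h (f t)) (\<lambda>t. h (f' t))"
  unfolding ac_deriv_def
proof (intro conjI allI impI)
  show "(\<lambda>t. h (f' t)) absolutely_integrable_on {a..b}"
    using absolutely_integrable_linear[OF ac_deriv_absint[OF assms(1)] assms(2)] by (simp add: o_def)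
  fix s t assume st: "a \<le> s \<and> s \<le> t \<and> t \<le> b"
  have "f' integrable_on {s..t}"
    using assms(1)[THEN ac_deriv_absint] st
    by (auto intro!: integrable_on_subinterval[OF set_lebesgue_integral_eq_integral(1)])
  hence "integral {s..t} (\<lambda>t. h (f' t)) = h (integral {s..t} f')"
    using integral_linear[OF _ assms(2)] by (simp add: o_def)
  thus "h (f t) - h (f s) = integral {s..t} (\<lambda>t. h (f' t))"
    using assms(1)[THEN ac_derivD, of s t] st linear_diff[OF bounded_linear.linear[OF assms(2)]] by metis
qed

text \<open>A continuity argument via bisection replaces almost everywhere differentiability.\<close>

lemma locally_small_increments_eq:
  fixes D h :: "real \<Rightarrow> real"
  assumes ab: "a \<le> b" and h: "h integrable_on {a..b}"
    and loc: "\<And>e x. e > 0 \<Longrightarrow> x \<in> {a..b} \<Longrightarrow>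
      \<exists>d>0. \<forall>s t. a \<le> s \<and> s \<le> x \<and> x \<le> t \<and> t \<le> b \<and> t - s < d \<longrightarrow> \<bar>D t - D s\<bar> \<le> e * integral {s..t} h"
  shows "D b = D a"
proof -
  have "\<bar>D b - D a\<bar> \<le> e * integral {a..b} h" if e: "e > 0" for e
  proof -
    \<comment> \<open>The bound is additive over adjacent intervals because \<open>integral\<close>
      is, so it suffices to have it near each point; this is what \<open>Bolzano\<close> asks
      for.\<close>
    define P where "P s t \<longleftrightarrow> (a \<le> s \<and> t \<le> b \<longrightarrow> \<bar>D t - D s\<bar> \<le> e * integral {s..t} h)" for s t
    have "P a b"
      using ab
    proof (induct rule: Bolzano)
      case (trans u v w)
      show ?case unfolding P_def
      proof
        assume *: "a \<le> u \<and> w \<le> b"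
        have "integral {u..v} h + integral {v..w} h = integral {u..w} h"
          using * trans h by (intro Henstock_Kurzweil_Integration.integral_combine) (auto intro: integrable_on_subinterval)
        moreover have "\<bar>D v - D u\<bar> \<le> e * integral {u..v} h" "\<bar>D w - D v\<bar> \<le> e * integral {v..w} h"
          using trans * unfolding P_def by auto
        ultimately have "\<bar>D v - D u\<bar> + \<bar>D w - D v\<bar> \<le> e * integral {u..w} h"
          by (metis add_mono distrib_left)
        thus "\<bar>D w - D u\<bar> \<le> e * integral {u..w} h" by linarith
      qed
    next
      case (local x)
      then obtain d where d: "d > 0" "\<And>s t. a \<le> s \<Longrightarrow> s \<le> x \<Longrightarrow> x \<le> t \<Longrightarrow> t \<le> b \<Longrightarrow> t - s < d \<Longrightarrow>
          \<bar>D t - D s\<bar> \<le> e * integral {s..t} h"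
        using loc[OF e, of x] by auto
      show ?case unfolding P_def by (rule exI[of _ d]) (use d in simp)
    qed
    thus ?thesis unfolding P_def by auto
  qed
  \<comment> \<open>\<open>h\<close> carries no sign, so its integral is replaced by its modulus
    before \<open>e\<close> is rescaled.\<close>
  hence *: "\<bar>D b - D a\<bar> \<le> e * \<bar>integral {a..b} h\<bar>" if "e > 0" for e
    using order.trans[OF _ mult_left_mono[of "integral {a..b} h" "\<bar>integral {a..b} h\<bar>" e]] that by auto
  have "\<bar>D b - D a\<bar> \<le> 0"
  proof (rule field_le_epsilon)
    fix e :: real assume "e > 0"
    show "\<bar>D b - D a\<bar> \<le> 0 + e"
      using \<open>e > 0\<close>
      by (intro order.trans[OF *[of "e / (\<bar>integral {a..b} h\<bar> + 1)"]]) (auto simp: field_simps)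
  qed
  thus ?thesis by simp
qed

section \<open>Product and chain rule for absolutely continuous functions\<close>

lemma absolutely_integrable_continuous_mult:
  fixes f g :: "real \<Rightarrow> real"
  assumes "continuous_on {a..b} f" "g absolutely_integrable_on {a..b}"
  shows "(\<lambda>t. f t * g t) absolutely_integrable_on {a..b}"
proof (rule absolutely_integrable_bounded_measurable_product_real[OF _ _ _ assms(2)])
  show "f \<in> borel_measurable (lebesgue_on {a..b})"
    using assms(1) by (intro continuous_imp_measurable_on_sets_lebesgue) auto
  show "bounded (f ` {a..b})"
    using assms(1) compact_continuous_image compact_imp_bounded by blast
qed auto

lemma continuous_on_real_near:
  fixes f :: "real \<Rightarrow> real"
  assumes "continuous_on {a..b} f" "x \<in> {a..b}" "e > 0"
  obtains d where "d > 0" "\<And>y. y \<in> {a..b} \<Longrightarrow> \<bar>y - x\<bar> < d \<Longrightarrow> \<bar>f y - f x\<bar> < e"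
  using assms unfolding continuous_on_iff dist_real_def by (metis (no_types))

lemma integral_abs_bound_mult:
  fixes u p q h :: "real \<Rightarrow> real"
  assumes "u integrable_on {s..t}" "h integrable_on {s..t}"
    and "\<And>r. r \<in> {s..t} \<Longrightarrow> \<bar>u r\<bar> \<le> e * h r"
  shows "\<bar>integral {s..t} u\<bar> \<le> e * integral {s..t} h"
proof -
  have "norm (integral {s..t} u) \<le> integral {s..t} (\<lambda>r. e * h r)"
    using assms by (intro integral_norm_bound_integral integrable_on_mult_right) auto
  thus ?thesis by simp
qed

text \<open>On a short interval [p, q] around x the increment of the defect is the integral of (f q
  - f r) g' r + (g p - g r) f' r. Both differences are small by continuity, so the increment is
  small against the integral of |f'| + |g'|, and \<open>locally_small_increments_eq\<close>
  applies.\<close>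

lemma ac_deriv_mult:
  fixes f g :: "real \<Rightarrow> real"
  assumes F: "ac_deriv a b f f'" and G: "ac_deriv a b g g'"
  shows "ac_deriv a b (\<lambda>t. f t * g t) (\<lambda>t. f t * g' t + g t * f' t)"
proof -
  let ?k = "\<lambda>t. f t * g' t + g t * f' t"
  have cf: "continuous_on {a..b} f" and cg: "continuous_on {a..b} g"
    using F G by (auto intro: ac_deriv_continuous_on)
  have ai: "(\<lambda>t. f t * g' t) absolutely_integrable_on {a..b}" "(\<lambda>t. g t * f' t) absolutely_integrable_on {a..b}"
    using absolutely_integrable_continuous_mult[OF cf ac_deriv_absint[OF G]]
      absolutely_integrable_continuous_mult[OF cg ac_deriv_absint[OF F]] by auto
  have kai: "?k absolutely_integrable_on {a..b}" using ai by (rule set_integral_add)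
  have ki: "?k integrable_on {a..b}" using kai by (rule set_lebesgue_integral_eq_integral)
  have hai: "(\<lambda>t. \<bar>f' t\<bar> + \<bar>g' t\<bar>) absolutely_integrable_on {a..b}"
    using ac_deriv_absint[OF F] ac_deriv_absint[OF G] by (intro set_integral_add set_integrable_abs)
  have hi: "(\<lambda>t. \<bar>f' t\<bar> + \<bar>g' t\<bar>) integrable_on {a..b}" using hai by (rule set_lebesgue_integral_eq_integral)
  have f'i: "f' integrable_on {a..b}" and g'i: "g' integrable_on {a..b}"
    using F G by (auto dest!: ac_deriv_absint intro: set_lebesgue_integral_eq_integral)
  have "f t * g t - f s * g s = integral {s..t} ?k" if st: "a \<le> s" "s \<le> t" "t \<le> b" for s t
  proof -
    define D where "D r = f r * g r - integral {s..r} ?k" for r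
    have sub: "{s..t} \<subseteq> {a..b}" using st by auto
    have "D t = D s"
    proof (rule locally_small_increments_eq[where D=D and a=s and b=t and h="\<lambda>t. \<bar>f' t\<bar> + \<bar>g' t\<bar>"])
      show "s \<le> t" by fact
      show "(\<lambda>t. \<bar>f' t\<bar> + \<bar>g' t\<bar>) integrable_on {s..t}" using integrable_on_subinterval[OF hi sub] .
      fix e x :: real assume e: "e > 0" and x: "x \<in> {s..t}"
      hence xab: "x \<in> {a..b}" using sub by auto
      obtain d1 where d1: "d1 > 0" "\<And>y. y \<in> {a..b} \<Longrightarrow> \<bar>y - x\<bar> < d1 \<Longrightarrow> \<bar>f y - f x\<bar> < e/2"
        using continuous_on_real_near[OF cf xab, of "e/2"] e by (metis half_gt_zero)
      obtain d2 where d2: "d2 > 0" "\<And>y. y \<in> {a..b} \<Longrightarrow> \<bar>y - x\<bar> < d2 \<Longrightarrow> \<bar>g y - g x\<bar> < e/2"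
        using continuous_on_real_near[OF cg xab, of "e/2"] e by (metis half_gt_zero)
      show "\<exists>d>0. \<forall>s' t'. s \<le> s' \<and> s' \<le> x \<and> x \<le> t' \<and> t' \<le> t \<and> t' - s' < d \<longrightarrow>
               \<bar>D t' - D s'\<bar> \<le> e * integral {s'..t'} (\<lambda>t. \<bar>f' t\<bar> + \<bar>g' t\<bar>)"
      proof (intro exI conjI allI impI)
        show "min d1 d2 > 0" using d1 d2 by auto
        fix p q assume pq: "s \<le> p \<and> p \<le> x \<and> x \<le> q \<and> q \<le> t \<and> q - p < min d1 d2"
        have subp: "{p..q} \<subseteq> {a..b}" using pq st by auto
        have ints: "f' integrable_on {p..q}" "g' integrable_on {p..q}" "?k integrable_on {p..q}"
           "(\<lambda>t. \<bar>f' t\<bar> + \<bar>g' t\<bar>) integrable_on {p..q}"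
          using integrable_on_subinterval[OF _ subp] f'i g'i ki hi by auto
        have ints2: "(\<lambda>r. f q * g' r) integrable_on {p..q}" "(\<lambda>r. g p * f' r) integrable_on {p..q}"
          using ints by (auto intro: integrable_on_mult_right)
        have "integral {s..p} ?k + integral {p..q} ?k = integral {s..q} ?k"
          using pq st by (intro Henstock_Kurzweil_Integration.integral_combine integrable_on_subinterval[OF ki]) auto
        \<comment> \<open>This splitting freezes one factor at each end point, so that both
          remaining increments are integrals over [p, q].\<close>
        hence "D q - D p = f q * (g q - g p) + g p * (f q - f p) - integral {p..q} ?k"
          unfolding D_def by (simp add: algebra_simps)
        also have "\<dots> = f q * integral {p..q} g' + g p * integral {p..q} f' - integral {p..q} ?k"
          using ac_derivD[OF F, of p q] ac_derivD[OF G, of p q] pq st by simp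
        also have "\<dots> = integral {p..q} (\<lambda>r. f q * g' r + g p * f' r - ?k r)"
          using ints ints2 by (simp add: Henstock_Kurzweil_Integration.integral_diff
              Henstock_Kurzweil_Integration.integral_add Henstock_Kurzweil_Integration.integrable_add)
        finally have eq: "D q - D p = integral {p..q} (\<lambda>r. f q * g' r + g p * f' r - ?k r)" .
        show "\<bar>D q - D p\<bar> \<le> e * integral {p..q} (\<lambda>t. \<bar>f' t\<bar> + \<bar>g' t\<bar>)"
          unfolding eq
        proof (rule integral_abs_bound_mult)
          show "(\<lambda>r. f q * g' r + g p * f' r - ?k r) integrable_on {p..q}"
            by (rule Henstock_Kurzweil_Integration.integrable_diff[OF Henstock_Kurzweil_Integration.integrable_add[OF ints2] ints(3)])
          fix r assume r: "r \<in> {p..q}"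
          have *: "r \<in> {a..b}" "q \<in> {a..b}" "p \<in> {a..b}" using r subp pq st by auto
          have "\<bar>f q - f x\<bar> < e/2" "\<bar>f r - f x\<bar> < e/2" "\<bar>g p - g x\<bar> < e/2" "\<bar>g r - g x\<bar> < e/2"
            using r pq d1(2)[OF *(1)] d1(2)[OF *(2)] d2(2)[OF *(1)] d2(2)[OF *(3)] by auto
          hence **: "\<bar>f q - f r\<bar> \<le> e" "\<bar>g p - g r\<bar> \<le> e" by linarith+
          have "f q * g' r + g p * f' r - ?k r = (f q - f r) * g' r + (g p - g r) * f' r"
            by (simp add: algebra_simps)
          also have "\<bar>\<dots>\<bar> \<le> \<bar>f q - f r\<bar> * \<bar>g' r\<bar> + \<bar>g p - g r\<bar> * \<bar>f' r\<bar>"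
            by (metis abs_mult abs_triangle_ineq)
          also have "\<dots> \<le> e * \<bar>g' r\<bar> + e * \<bar>f' r\<bar>"
            using ** by (intro add_mono mult_right_mono) auto
          finally show "\<bar>f q * g' r + g p * f' r - ?k r\<bar> \<le> e * (\<bar>f' r\<bar> + \<bar>g' r\<bar>)"
            by (simp add: algebra_simps)
        qed (use ints in auto)
      qed
    qed
    thus ?thesis unfolding D_def by simp
  qed
  thus ?thesis unfolding ac_deriv_def using kai by auto
qed

text \<open>The scheme for products again: by the mean value theorem the increment of \<phi> along f
  is \<open>\<phi>' \<xi>\<close> times the integral of f', and
  \<open>\<phi>' \<xi> - \<phi>' (f r)\<close> is small because \<xi> and f r are both close to f
  x.\<close>

lemma ac_deriv_compose:
  fixes f :: "real \<Rightarrow> real"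
  assumes F: "ac_deriv a b f f'" and phi: "\<And>x. (\<phi> has_real_derivative \<phi>' x) (at x)"
    and cphi: "continuous_on UNIV \<phi>'"
  shows "ac_deriv a b (\<lambda>t. \<phi> (f t)) (\<lambda>t. \<phi>' (f t) * f' t)"
proof -
  let ?k = "\<lambda>t. \<phi>' (f t) * f' t"
  have cf: "continuous_on {a..b} f"
    using F by (auto intro: ac_deriv_continuous_on)
  have cpf: "continuous_on {a..b} (\<lambda>t. \<phi>' (f t))"
    using continuous_on_compose2[OF cphi cf] by auto
  have kai: "?k absolutely_integrable_on {a..b}"
    using absolutely_integrable_continuous_mult[OF cpf ac_deriv_absint[OF F]] .
  have ki: "?k integrable_on {a..b}" using kai by (rule set_lebesgue_integral_eq_integral)
  have hai: "(\<lambda>t. \<bar>f' t\<bar>) absolutely_integrable_on {a..b}"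
    using ac_deriv_absint[OF F] by (rule set_integrable_abs)
  have hi: "(\<lambda>t. \<bar>f' t\<bar>) integrable_on {a..b}" using hai by (rule set_lebesgue_integral_eq_integral)
  have f'i: "f' integrable_on {a..b}"
    using F by (auto dest!: ac_deriv_absint intro: set_lebesgue_integral_eq_integral)
  have "\<phi> (f t) - \<phi> (f s) = integral {s..t} ?k" if st: "a \<le> s" "s \<le> t" "t \<le> b" for s t
  proof -
    define D where "D r = \<phi> (f r) - integral {s..r} ?k" for r
    have sub: "{s..t} \<subseteq> {a..b}" using st by auto
    have "D t = D s"
    proof (rule locally_small_increments_eq[where D=D and a=s and b=t and h="\<lambda>t. \<bar>f' t\<bar>"])
      show "s \<le> t" by fact
      show "(\<lambda>t. \<bar>f' t\<bar>) integrable_on {s..t}" using integrable_on_subinterval[OF hi sub] .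
      fix e x :: real assume e: "e > 0" and x: "x \<in> {s..t}"
      hence xab: "x \<in> {a..b}" using sub by auto
      have "isCont \<phi>' (f x)" using cphi by (simp add: continuous_on_eq_continuous_at)
      then obtain d0 where d0: "d0 > 0" "\<And>y. \<bar>y - f x\<bar> < d0 \<Longrightarrow> \<bar>\<phi>' y - \<phi>' (f x)\<bar> < e/2"
        using e unfolding continuous_at_eps_delta dist_real_def by (metis half_gt_zero)
      obtain d where d: "d > 0" "\<And>y. y \<in> {a..b} \<Longrightarrow> \<bar>y - x\<bar> < d \<Longrightarrow> \<bar>f y - f x\<bar> < d0"
        using continuous_on_real_near[OF cf xab d0(1)] by metis
      show "\<exists>d>0. \<forall>s' t'. s \<le> s' \<and> s' \<le> x \<and> x \<le> t' \<and> t' \<le> t \<and> t' - s' < d \<longrightarrow>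
               \<bar>D t' - D s'\<bar> \<le> e * integral {s'..t'} (\<lambda>t. \<bar>f' t\<bar>)"
      proof (intro exI conjI allI impI)
        show "d > 0" by fact
        fix p q assume pq: "s \<le> p \<and> p \<le> x \<and> x \<le> q \<and> q \<le> t \<and> q - p < d"
        have subp: "{p..q} \<subseteq> {a..b}" using pq st by auto
        have ints: "f' integrable_on {p..q}" "?k integrable_on {p..q}"
           "(\<lambda>t. \<bar>f' t\<bar>) integrable_on {p..q}"
          using integrable_on_subinterval[OF _ subp] f'i ki hi by auto
        have near: "\<bar>f p - f x\<bar> < d0" "\<bar>f q - f x\<bar> < d0"
          using pq subp st by (auto intro!: d(2))
        have "\<exists>\<xi>. \<bar>\<xi> - f x\<bar> < d0 \<and> \<phi> (f q) - \<phi> (f p) = (f q - f p) * \<phi>' \<xi>"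
        proof (cases "f q" "f p" rule: linorder_cases)
          case less
          then obtain z where "f q < z" "z < f p" "\<phi> (f p) - \<phi> (f q) = (f p - f q) * \<phi>' z"
            using MVT2[OF less phi] by blast
          thus ?thesis using near by (intro exI[of _ z]) (auto simp: algebra_simps)
        next
          case greater
          then obtain z where "f p < z" "z < f q" "\<phi> (f q) - \<phi> (f p) = (f q - f p) * \<phi>' z"
            using MVT2[OF greater phi] by blast
          thus ?thesis using near by (intro exI[of _ z]) (auto simp: algebra_simps)
        next
          case equal
          thus ?thesis using near by (intro exI[of _ "f p"]) auto
        qed
        then obtain \<xi> where \<xi>: "\<bar>\<xi> - f x\<bar> < d0" "\<phi> (f q) - \<phi> (f p) = (f q - f p) * \<phi>' \<xi>" by blast
        have "integral {s..p} ?k + integral {p..q} ?k = integral {s..q} ?k"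
          using pq st by (intro Henstock_Kurzweil_Integration.integral_combine integrable_on_subinterval[OF ki]) auto
        hence "D q - D p = (f q - f p) * \<phi>' \<xi> - integral {p..q} ?k"
          unfolding D_def \<xi>(2)[symmetric] by (simp add: algebra_simps)
        also have "\<dots> = \<phi>' \<xi> * integral {p..q} f' - integral {p..q} ?k"
          using ac_derivD[OF F, of p q] pq st by simp
        also have "\<dots> = integral {p..q} (\<lambda>r. \<phi>' \<xi> * f' r - ?k r)"
          using ints integrable_on_mult_right[OF ints(1), of "\<phi>' \<xi>"] by (simp add: Henstock_Kurzweil_Integration.integral_diff)
        finally have eq: "D q - D p = integral {p..q} (\<lambda>r. \<phi>' \<xi> * f' r - ?k r)" .
        show "\<bar>D q - D p\<bar> \<le> e * integral {p..q} (\<lambda>t. \<bar>f' t\<bar>)"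
          unfolding eq
        proof (rule integral_abs_bound_mult)
          show "(\<lambda>r. \<phi>' \<xi> * f' r - ?k r) integrable_on {p..q}"
            using ints by (intro Henstock_Kurzweil_Integration.integrable_diff integrable_on_mult_right)
          fix r assume r: "r \<in> {p..q}"
          have "\<bar>f r - f x\<bar> < d0" using r pq subp by (intro d(2)) auto
          hence "\<bar>\<phi>' (f r) - \<phi>' (f x)\<bar> < e/2" "\<bar>\<phi>' \<xi> - \<phi>' (f x)\<bar> < e/2"
            using d0(2)[of "f r"] d0(2)[of \<xi>] \<xi>(1) by auto
          hence **: "\<bar>\<phi>' \<xi> - \<phi>' (f r)\<bar> \<le> e" by linarith
          have "\<phi>' \<xi> * f' r - ?k r = (\<phi>' \<xi> - \<phi>' (f r)) * f' r"
            by (simp add: algebra_simps)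
          thus "\<bar>\<phi>' \<xi> * f' r - ?k r\<bar> \<le> e * \<bar>f' r\<bar>"
            using mult_right_mono[OF **, of "\<bar>f' r\<bar>"] by (simp add: abs_mult)
        qed (use ints in auto)
      qed
    qed
    thus ?thesis unfolding D_def by simp
  qed
  thus ?thesis unfolding ac_deriv_def using kai by auto
qed

section \<open>A density is determined almost everywhere by its indefinite integral\<close>

lemma AE_zero_of_zero_indefinite_integral_real:
  fixes g :: "real \<Rightarrow> real"
  assumes g: "g absolutely_integrable_on {a..b}" and ab: "a \<le> b"
    and zero: "\<And>t. a \<le> t \<Longrightarrow> t \<le> b \<Longrightarrow> integral {a..t} g = 0"
  shows "AE t in lebesgue. t \<in> {a..b} \<longrightarrow> g t = 0"
proof -
  define G where "G t = indicator {a..b} t *\<^sub>R g t" for t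
  have GI: "integrable lebesgue G" using g unfolding set_integrable_def G_def .
  \<comment> \<open>Vanishing integrals over half lines extend to all Borel sets, since the half
    lines form an intersection-stable generator.\<close>
  have half: "set_lebesgue_integral lebesgue {..c} G = 0" for c
  proof (cases "a \<le> c")
    case True
    have "set_lebesgue_integral lebesgue {..c} G = set_lebesgue_integral lebesgue {a..min b c} g"
      unfolding set_lebesgue_integral_def G_def
      by (intro Bochner_Integration.integral_cong) (auto simp: indicator_def)
    also have "\<dots> = integral {a..min b c} g"
      using g by (intro set_lebesgue_integral_eq_integral set_integrable_subset[OF g]) auto
    also have "\<dots> = 0" using True ab by (intro zero) auto
    finally show ?thesis .
  next
    case False
    have "set_lebesgue_integral lebesgue {..c} G = set_lebesgue_integral lebesgue {} g"
      unfolding set_lebesgue_integral_def G_def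
      using False by (intro Bochner_Integration.integral_cong) (auto simp: indicator_def)
    thus ?thesis by (simp add: set_lebesgue_integral_def)
  qed
  have SI: "set_integrable lebesgue A G" if "A \<in> sets lebesgue" for A
    using integrable_mult_indicator[OF that GI] unfolding set_integrable_def .
  have total: "integral\<^sup>L lebesgue G = 0"
  proof -
    have "integral\<^sup>L lebesgue G = set_lebesgue_integral lebesgue {..b} G"
      unfolding set_lebesgue_integral_def G_def
      by (intro Bochner_Integration.integral_cong) (auto simp: indicator_def)
    thus ?thesis by (simp add: half)
  qed
  have sig: "sigma_sets UNIV (range (\<lambda>a::real. {..a})) = sets borel"
    by (subst borel_eq_atMost) simp
  have leb: "A \<in> sets lebesgue" if "A \<in> sigma_sets UNIV (range (\<lambda>a::real. {..a}))" for A
    using that unfolding sig by (intro sets_completionI_sets) simp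
  have borel0: "set_lebesgue_integral lebesgue A G = 0" if A: "A \<in> sets (borel::real measure)" for A
  proof -
    have A': "A \<in> sigma_sets UNIV (range (\<lambda>a::real. {..a}))"
      using A unfolding sig .
    have "Int_stable (range (\<lambda>a::real. {..a}))"
    proof (intro Int_stableI, clarify)
      fix x y :: real
      have "{..x} \<inter> {..y} = {..min x y}" by auto
      thus "{..x} \<inter> {..y} \<in> range (\<lambda>a::real. {..a})" by auto
    qed
    moreover have "range (\<lambda>a::real. {..a}) \<subseteq> Pow UNIV" by simp
    ultimately show ?thesis using A'
    proof (induct rule: sigma_sets_induct_disjoint)
      case (basic A) thus ?case by (auto simp: half)
    next
      case empty thus ?case by (simp add: set_lebesgue_integral_def)
    next
      case (compl A)
      have m: "A \<in> sets lebesgue" using compl(1) by (rule leb)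
      have "integral\<^sup>L lebesgue G = set_lebesgue_integral lebesgue (A \<union> (UNIV - A)) G"
        unfolding set_lebesgue_integral_def by simp
      also have "\<dots> = set_lebesgue_integral lebesgue A G + set_lebesgue_integral lebesgue (UNIV - A) G"
        using m by (intro set_integral_Un SI) auto
      finally show ?case using compl total by simp
    next
      case (union A)
      have m: "A i \<in> sets lebesgue" for i using union(2) by (auto intro: leb)
      have "set_lebesgue_integral lebesgue (\<Union>i. A i) G = (\<Sum>i. set_lebesgue_integral lebesgue (A i) G)"
        using union(1) m by (intro lebesgue_integral_countable_add SI) (auto simp: disjoint_family_on_def)
      thus ?case using union by simp
    qed
  qed
  have "AE t in lebesgue. G t = 0"
  proof (rule density_unique_real[OF GI])
    fix A assume A: "A \<in> sets (lebesgue::real measure)"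
    \<comment> \<open>A Lebesgue set differs from its Borel part by a null set, so
      \<open>borel0\<close> reaches all measurable sets.\<close>
    have mp: "main_part lborel A \<in> sets borel" using main_part_sets[OF A] by simp
    have np: "null_part lborel A \<in> null_sets lebesgue"
      using null_part[OF A] by (metis null_sets_completion_subset null_sets_completionI)
    have "AE t in lebesgue. t \<notin> null_part lborel A" using np by (rule AE_not_in)
    hence "AE t in lebesgue. indicator A t *\<^sub>R G t = indicator (main_part lborel A) t *\<^sub>R G t"
    proof eventually_elim
      case (elim t)
      hence "t \<in> A \<longleftrightarrow> t \<in> main_part lborel A" using main_part_null_part_Un[OF A] by blast
      thus ?case by (simp add: indicator_def)
    qed
    hence "set_lebesgue_integral lebesgue A G = set_lebesgue_integral lebesgue (main_part lborel A) G"
      unfolding set_lebesgue_integral_def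
      using borel_measurable_integrable[OF SI[OF A, unfolded set_integrable_def]]
        borel_measurable_integrable[OF SI[OF sets_completionI_sets, unfolded set_integrable_def], of "main_part lborel A"] mp
      by (intro integral_cong_AE) auto
    thus "set_lebesgue_integral lebesgue A G = set_lebesgue_integral lebesgue A (\<lambda>x. 0)"
      using borel0[OF mp] by (simp add: set_lebesgue_integral_def)
  qed simp
  thus ?thesis unfolding G_def by eventually_elim (auto simp: indicator_def)
qed

lemma AE_zero_of_zero_indefinite_integral:
  fixes g :: "real \<Rightarrow> 'a::euclidean_space"
  assumes g: "g absolutely_integrable_on {a..b}" and ab: "a \<le> b"
    and zero: "\<And>t. a \<le> t \<Longrightarrow> t \<le> b \<Longrightarrow> integral {a..t} g = 0"
  shows "AE t in lebesgue. t \<in> {a..b} \<longrightarrow> g t = 0"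
proof -
  have "AE t in lebesgue. t \<in> {a..b} \<longrightarrow> g t \<bullet> i = 0" for i
  proof (rule AE_zero_of_zero_indefinite_integral_real[OF _ ab])
    show "(\<lambda>t. g t \<bullet> i) absolutely_integrable_on {a..b}"
      using absolutely_integrable_linear[OF g bounded_linear_inner_left] by (simp add: o_def)
    fix t assume t: "a \<le> t" "t \<le> b"
    have "g integrable_on {a..t}"
      using t integrable_on_subinterval[OF set_lebesgue_integral_eq_integral(1)[OF g]] by auto
    hence "integral {a..t} (\<lambda>t. g t \<bullet> i) = integral {a..t} g \<bullet> i"
      using integral_linear[OF _ bounded_linear_inner_left] by (simp add: o_def)
    thus "integral {a..t} (\<lambda>t. g t \<bullet> i) = 0" using zero[OF t] by simp
  qed
  hence "AE t in lebesgue. \<forall>i\<in>Basis. t \<in> {a..b} \<longrightarrow> g t \<bullet> i = 0"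
    by (intro AE_finite_allI) auto
  thus ?thesis by eventually_elim (auto intro: euclidean_eqI)
qed

section \<open>Test functions and weak derivatives\<close>

text \<open>\<open>nth_deriv_on\<close> puts each new derivative outside; here the first derivative
  is moved inside, which is the form needed for induction on the order. Nontriviality of the filters
  makes the derivative within S unique.\<close>

lemma nth_deriv_on_Suc:
  assumes nt: "\<And>t. t \<in> S \<Longrightarrow> at t within S \<noteq> bot"
    and der: "\<And>t. t \<in> S \<Longrightarrow> (f has_vector_derivative g t) (at t within S)" and "t \<in> S"
  shows "nth_deriv_on S (Suc i) f t = nth_deriv_on S i g t"
  using assms(3)
proof (induction i arbitrary: t)
  case 0
  thus ?case using vector_derivative_within[OF nt[OF 0] der[OF 0]] by simp
next
  case (Suc i)
  have "(nth_deriv_on S (Suc i) f has_vector_derivative y) (at t within S) \<longleftrightarrow>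
        (nth_deriv_on S i g has_vector_derivative y) (at t within S)" for y
    using Suc by (auto elim!: has_vector_derivative_transform[rotated 2] simp del: nth_deriv_on.simps)
  thus ?case unfolding nth_deriv_on.simps(2)[of S "Suc i"] nth_deriv_on.simps(2)[of S i g] vector_derivative_def by simp
qed

lemma Ck_on_Suc:
  assumes nt: "\<And>t. t \<in> S \<Longrightarrow> at t within S \<noteq> bot"
    and der: "\<And>t. t \<in> S \<Longrightarrow> (f has_vector_derivative g t) (at t within S)" and g: "Ck_on n S g"
  shows "Ck_on (Suc n) S f"
  unfolding Ck_on_def
proof (intro conjI allI ballI impI)
  fix i t assume i: "i < Suc n" and t: "t \<in> S"
  show "nth_deriv_on S i f differentiable (at t within S)"
  proof (cases i)
    case 0
    thus ?thesis using der[OF t] by (auto simp: has_vector_derivative_def differentiable_def)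
  next
    case (Suc j)
    have "nth_deriv_on S j g differentiable (at t within S)" using g i t Suc unfolding Ck_on_def by auto
    then obtain D where "(nth_deriv_on S j g has_derivative D) (at t within S)" unfolding differentiable_def by auto
    hence "(nth_deriv_on S (Suc j) f has_derivative D) (at t within S)"
      using nth_deriv_on_Suc[OF nt der] t by (auto elim!: has_derivative_transform[rotated 2] simp del: nth_deriv_on.simps)
    thus ?thesis using Suc unfolding differentiable_def by auto
  qed
next
  have "continuous_on S (nth_deriv_on S n g)" using g unfolding Ck_on_def by auto
  thus "continuous_on S (nth_deriv_on S (Suc n) f)"
    using nth_deriv_on_Suc[OF nt der] by (simp cong: continuous_on_cong del: nth_deriv_on.simps)
qed

section \<open>Smooth cut-off functions\<close>

text \<open>Explicit derivative witnesses make closure under sums, products and inverses a plain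
  induction; \<open>Ck_real_imp_Ck_on\<close> translates back.\<close>

fun Ck_real :: "nat \<Rightarrow> (real \<Rightarrow> real) \<Rightarrow> bool" where
  "Ck_real 0 f \<longleftrightarrow> continuous_on UNIV f"
| "Ck_real (Suc n) f \<longleftrightarrow> (\<exists>g. (\<forall>x. (f has_real_derivative g x) (at x)) \<and> Ck_real n g)"

lemma Ck_real_imp_continuous: "Ck_real n f \<Longrightarrow> continuous_on UNIV f"
proof (cases n)
  case (Suc m)
  assume "Ck_real n f"
  then obtain g where g: "\<forall>x. (f has_real_derivative g x) (at x)" using Suc by auto
  thus ?thesis by (intro DERIV_continuous_on[where D=g]) auto
qed simp

lemma Ck_real_SucI: "(\<And>x. (f has_real_derivative g x) (at x)) \<Longrightarrow> Ck_real n g \<Longrightarrow> Ck_real (Suc n) f"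
  unfolding Ck_real.simps by (rule exI[of _ g]) simp

lemma Ck_real_SucD: "Ck_real (Suc n) f \<Longrightarrow> Ck_real n f"
proof (induction n arbitrary: f)
  case 0 thus ?case using Ck_real_imp_continuous[OF 0] by simp
next
  case (Suc n)
  obtain g where g0: "(\<forall>x. (f has_real_derivative g x) (at x)) \<and> Ck_real (Suc n) g"
    using Ck_real.simps(2)[THEN iffD1, OF Suc.prems] ..
  have *: "\<And>x. (f has_real_derivative g x) (at x)" "Ck_real (Suc n) g" using g0 by auto
  show ?case by (rule Ck_real_SucI[OF *(1) Suc.IH[OF *(2)]])
qed

lemma Ck_real_add: "Ck_real n f \<Longrightarrow> Ck_real n g \<Longrightarrow> Ck_real n (\<lambda>x. f x + g x)"
proof (induction n arbitrary: f g)
  case (Suc n)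
  obtain f' where f'0: "(\<forall>x. (f has_real_derivative f' x) (at x)) \<and> Ck_real n f'"
    using Ck_real.simps(2)[THEN iffD1, OF Suc.prems(1)] ..
  have f': "\<And>x. (f has_real_derivative f' x) (at x)" "Ck_real n f'" using f'0 by auto
  obtain g' where g'0: "(\<forall>x. (g has_real_derivative g' x) (at x)) \<and> Ck_real n g'"
    using Ck_real.simps(2)[THEN iffD1, OF Suc.prems(2)] ..
  have g': "\<And>x. (g has_real_derivative g' x) (at x)" "Ck_real n g'" using g'0 by auto
  show ?case by (rule Ck_real_SucI[OF DERIV_add[OF f'(1) g'(1)] Suc.IH[OF f'(2) g'(2)]])
qed (simp add: continuous_on_add)

lemma Ck_real_const: "Ck_real n (\<lambda>x. c)"
proof (induction n arbitrary: c)
  case (Suc n)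
  show ?case by (rule Ck_real_SucI[OF DERIV_const Suc.IH])
qed simp

lemma Ck_real_mult: "Ck_real n f \<Longrightarrow> Ck_real n g \<Longrightarrow> Ck_real n (\<lambda>x. f x * g x)"
proof (induction n arbitrary: f g)
  case (Suc n)
  obtain f' where f'0: "(\<forall>x. (f has_real_derivative f' x) (at x)) \<and> Ck_real n f'"
    using Ck_real.simps(2)[THEN iffD1, OF Suc.prems(1)] ..
  have f': "\<And>x. (f has_real_derivative f' x) (at x)" "Ck_real n f'" using f'0 by auto
  obtain g' where g'0: "(\<forall>x. (g has_real_derivative g' x) (at x)) \<and> Ck_real n g'"
    using Ck_real.simps(2)[THEN iffD1, OF Suc.prems(2)] ..
  have g': "\<And>x. (g has_real_derivative g' x) (at x)" "Ck_real n g'" using g'0 by auto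
  have "Ck_real n f" "Ck_real n g" using Suc.prems[THEN Ck_real_SucD] by this+
  hence "Ck_real n (\<lambda>x. f' x * g x + g' x * f x)" using f' g' by (intro Ck_real_add Suc.IH)
  from Ck_real_SucI[OF DERIV_mult[OF f'(1) g'(1)] this] show ?case .
qed (simp add: continuous_on_mult)

lemma Ck_real_affine: "Ck_real n f \<Longrightarrow> Ck_real n (\<lambda>x. f (c * x + d))"
proof (induction n arbitrary: f)
  case (Suc n)
  obtain f' where f'0: "(\<forall>x. (f has_real_derivative f' x) (at x)) \<and> Ck_real n f'"
    using Ck_real.simps(2)[THEN iffD1, OF Suc.prems] ..
  have *: "\<And>x. (f has_real_derivative f' x) (at x)" "Ck_real n f'" using f'0 by auto
  have "Ck_real n (\<lambda>x. f' (c * x + d) * c)" by (rule Ck_real_mult[OF Suc.IH[OF *(2)] Ck_real_const])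
  moreover have D: "((\<lambda>x. f (c * x + d)) has_real_derivative f' (c * x + d) * c) (at x)" for x
  proof -
    have "((\<lambda>x. c * x + d) has_real_derivative c) (at x)" by (auto intro!: derivative_eq_intros)
    from DERIV_chain2[OF *(1) this] show ?thesis .
  qed
  ultimately show ?case by (intro Ck_real_SucI[OF D])
next
  case 0
  have "continuous_on UNIV (\<lambda>x. c * x + d)" by (intro continuous_intros)
  from continuous_on_compose2[OF _ this, of UNIV f] show ?case using 0 by simp
qed

lemma Ck_real_inverse:
  assumes "\<And>x. f x > 0"
  shows "Ck_real n f \<Longrightarrow> Ck_real n (\<lambda>x. inverse (f x))"
proof (induction n)
  case 0
  have "f x \<noteq> 0" for x using assms[of x] by simp
  thus ?case using 0 by (simp add: continuous_on_inverse)
next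
  case (Suc n)
  obtain f' where f'0: "(\<forall>x. (f has_real_derivative f' x) (at x)) \<and> Ck_real n f'"
    using Ck_real.simps(2)[THEN iffD1, OF Suc.prems] ..
  have *: "\<And>x. (f has_real_derivative f' x) (at x)" "Ck_real n f'" using f'0 by auto
  have "Ck_real n (\<lambda>x. inverse (f x))" using Suc.IH[OF Ck_real_SucD[OF Suc.prems]] .
  hence "Ck_real n (\<lambda>x. (-1) * (f' x * (inverse (f x) * inverse (f x))))"
    using * by (intro Ck_real_mult[OF Ck_real_const] Ck_real_mult)
  moreover have D: "((\<lambda>x. inverse (f x)) has_real_derivative (-1) * (f' x * (inverse (f x) * inverse (f x)))) (at x)" for x
    using DERIV_inverse'[OF *(1), of x] assms[of x] by (simp add: mult_ac)
  ultimately show ?case by (intro Ck_real_SucI[OF D])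
qed

lemma Ck_real_imp_Ck_on: "Ck_real n f \<Longrightarrow> Ck_on n UNIV f"
proof (induction n arbitrary: f)
  case 0 thus ?case by (auto simp: Ck_on_def)
next
  case (Suc n)
  obtain f' where f'0: "(\<forall>x. (f has_real_derivative f' x) (at x)) \<and> Ck_real n f'"
    using Ck_real.simps(2)[THEN iffD1, OF Suc.prems] ..
  have *: "\<And>x. (f has_real_derivative f' x) (at x)" "Ck_real n f'" using f'0 by auto
  show ?case
    by (rule Ck_on_Suc[where g=f'])
      (use * Suc.IH[OF *(2)] in \<open>simp_all flip: has_real_derivative_iff_has_vector_derivative\<close>)
qed

text \<open>The family is closed under differentiation: with y = 1 / x, the derivative of p(y) exp
  (-y) is y^2 (p(y) - p'(y)) exp (-y). Smoothness of all members is then a single induction.\<close>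

definition flat_exp :: "real poly \<Rightarrow> real \<Rightarrow> real" where
  "flat_exp p x = (if x > 0 then poly p (1/x) * exp (- (1/x)) else 0)"

lemma poly_times_exp_tendsto_0: "((\<lambda>y::real. y ^ k * poly p y * exp (-y)) \<longlongrightarrow> 0) at_top"
proof (induction p arbitrary: k)
  case 0 thus ?case by simp
next
  case (pCons a p)
  have "((\<lambda>y. a * (y ^ k / exp y) + y ^ Suc k * poly p y * exp (-y)) \<longlongrightarrow> a * 0 + 0) at_top"
    by (rule tendsto_add[OF tendsto_mult[OF tendsto_const tendsto_power_div_exp_0] pCons.IH])
  moreover have "(\<lambda>y. a * (y ^ k / exp y) + y ^ Suc k * poly p y * exp (-y)) =
     (\<lambda>y. y ^ k * poly (pCons a p) y * exp (-y))"
    by (rule ext) (simp add: distrib_left distrib_right exp_minus divide_inverse mult_ac)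
  ultimately show ?case by simp
qed

lemma DERIV_flat_exp:
  "(flat_exp p has_real_derivative flat_exp ([:0,0,1:] * (p - pderiv p)) x) (at x)"
proof (cases x "0::real" rule: linorder_cases)
  case less
  have "((\<lambda>x. 0) has_real_derivative 0) (at x)" by simp
  moreover have "\<forall>\<^sub>F y in nhds x. flat_exp p y = 0"
    using eventually_nhds_in_open[of "{..<0}" x] less by (auto elim!: eventually_mono simp: flat_exp_def)
  ultimately have "(flat_exp p has_real_derivative 0) (at x)"
    by (subst DERIV_cong_ev[OF refl _ refl]) auto
  thus ?thesis using less by (simp add: flat_exp_def)
next
  case greater
  have "((\<lambda>x. poly p (1/x) * exp (- (1/x))) has_real_derivative
      (poly (pderiv p) (1/x) * (- (1/x^2))) * exp (- (1/x)) + (exp (-(1/x)) * (1/x^2)) * poly p (1/x)) (at x)"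
    using greater
    by (auto intro!: derivative_eq_intros DERIV_chain2[OF poly_DERIV] simp: power2_eq_square)
  moreover have "\<forall>\<^sub>F y in nhds x. flat_exp p y = poly p (1/y) * exp (- (1/y))"
    using eventually_nhds_in_open[of "{0<..}" x] greater by (auto elim!: eventually_mono simp: flat_exp_def)
  ultimately have "(flat_exp p has_real_derivative
      (poly (pderiv p) (1/x) * (- (1/x^2))) * exp (- (1/x)) + (exp (-(1/x)) * (1/x^2)) * poly p (1/x)) (at x)"
    by (subst DERIV_cong_ev[OF refl _ refl]) auto
  thus ?thesis using greater by (simp add: flat_exp_def algebra_simps power2_eq_square)
next
  case equal
  have L: "((\<lambda>h. flat_exp p h / h) \<longlongrightarrow> 0) (at_left 0)"
    by (rule tendsto_eventually) (auto simp: flat_exp_def eventually_at_left_field intro: exI[of _ "-1"])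
  have "((\<lambda>h. (1/h) ^ 1 * poly p (1/h) * exp (-(1/h))) \<longlongrightarrow> 0) (at_right (0::real))"
    by (rule filterlim_compose[OF poly_times_exp_tendsto_0])
      (simp add: filterlim_inverse_at_top_right divide_inverse)
  hence R: "((\<lambda>h. flat_exp p h / h) \<longlongrightarrow> 0) (at_right 0)"
    by (rule Lim_transform_eventually) (auto simp: flat_exp_def eventually_at_right_field intro!: exI[of _ 1])
  have "((\<lambda>h. flat_exp p h / h) \<longlongrightarrow> 0) (at 0)" using L R by (simp add: filterlim_split_at)
  thus ?thesis using equal by (simp add: DERIV_def flat_exp_def)
qed

lemma Ck_real_flat_exp: "Ck_real n (flat_exp p)"
proof (induction n arbitrary: p)
  case 0
  show ?case using DERIV_continuous_on[OF DERIV_flat_exp[of p]] by simp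
next
  case (Suc n)
  show ?case by (rule Ck_real_SucI[OF DERIV_flat_exp Suc.IH])
qed

text \<open>The denominator is positive because x and 1 - x are never both nonpositive.\<close>

definition smooth_step :: "real \<Rightarrow> real" where
  "smooth_step x = flat_exp 1 x * inverse (flat_exp 1 x + flat_exp 1 (1 - x))"

lemma flat_exp_sum_pos: "flat_exp 1 x + flat_exp 1 (1 - x) > 0"
proof -
  have "flat_exp 1 y \<ge> 0" "y > 0 \<Longrightarrow> flat_exp 1 y > 0" for y by (simp_all add: flat_exp_def)
  from this(1)[of x] this(2)[of x] this(1)[of "1-x"] this(2)[of "1-x"] show ?thesis
    by (cases "x > 0") linarith+
qed

lemma Ck_real_smooth_step: "Ck_real n smooth_step"
proof -
  have "Ck_real n (\<lambda>x. flat_exp 1 (1 - x))"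
    using Ck_real_affine[OF Ck_real_flat_exp, of n 1 "-1" 1] by simp
  from Ck_real_mult[OF Ck_real_flat_exp Ck_real_inverse[OF flat_exp_sum_pos
    Ck_real_add[OF Ck_real_flat_exp this]]]
  show ?thesis unfolding smooth_step_def[abs_def] .
qed

lemma smooth_step_0: "x \<le> 0 \<Longrightarrow> smooth_step x = 0"
  and smooth_step_1: "x \<ge> 1 \<Longrightarrow> smooth_step x = 1"
  and smooth_step_ge_0: "smooth_step x \<ge> 0"
  and smooth_step_le_1: "smooth_step x \<le> 1"
proof -
  have nn: "flat_exp 1 y \<ge> 0" for y by (simp add: flat_exp_def)
  show "x \<le> 0 \<Longrightarrow> smooth_step x = 0" by (simp add: smooth_step_def flat_exp_def)
  show "x \<ge> 1 \<Longrightarrow> smooth_step x = 1" by (simp add: smooth_step_def flat_exp_def)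
  show "smooth_step x \<ge> 0" using flat_exp_sum_pos[of x] nn[of x] unfolding smooth_step_def
    by (intro mult_nonneg_nonneg) auto
  show "smooth_step x \<le> 1" using flat_exp_sum_pos[of x] nn[of x] nn[of "1-x"] unfolding smooth_step_def
    by (simp add: divide_inverse[symmetric])
qed

section \<open>Approximate identities and increments of weakly differentiable functions\<close>

lemma smooth_step_derivative:
  obtains \<sigma> M where "\<And>x. (smooth_step has_real_derivative \<sigma> x) (at x)" "continuous_on UNIV \<sigma>"
    "\<And>x. x < 0 \<or> x > 1 \<Longrightarrow> \<sigma> x = 0" "M > 0" "\<And>x. \<bar>\<sigma> x\<bar> \<le> M"
proof -
  obtain \<sigma> where \<sigma>0: "(\<forall>x. (smooth_step has_real_derivative \<sigma> x) (at x)) \<and> Ck_real 0 \<sigma>"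
    using Ck_real.simps(2)[THEN iffD1, OF Ck_real_smooth_step[of "Suc 0"]] ..
  have \<sigma>: "\<And>x. (smooth_step has_real_derivative \<sigma> x) (at x)" "continuous_on UNIV \<sigma>" using \<sigma>0 by auto
  have z: "\<sigma> x = 0" if x: "x < 0 \<or> x > 1" for x
  proof -
    have "\<exists>c. \<forall>\<^sub>F y in nhds x. smooth_step y = c"
    proof (cases "x < 0")
      case True
      thus ?thesis using eventually_nhds_in_open[of "{..<0}" x]
        by (intro exI[of _ 0]) (auto elim!: eventually_mono simp: smooth_step_0)
    next
      case False
      thus ?thesis using eventually_nhds_in_open[of "{1<..}" x] x
        by (intro exI[of _ 1]) (auto elim!: eventually_mono simp: smooth_step_1)
    qed
    then obtain c where c: "\<forall>\<^sub>F y in nhds x. smooth_step y = c" ..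
    have "((\<lambda>_. c) has_real_derivative \<sigma> x) (at x)"
      using DERIV_cong_ev[OF refl c refl] \<sigma>(1) by blast
    thus ?thesis using DERIV_const[of c] DERIV_unique by blast
  qed
  have "compact (\<sigma> ` {0..1})" using \<sigma>(2) by (intro compact_continuous_image) (auto intro: continuous_on_subset)
  hence "bounded (\<sigma> ` {0..1})" by (rule compact_imp_bounded)
  then obtain M where M: "M > 0" "\<forall>y\<in>\<sigma> ` {0..1}. norm y \<le> M" unfolding bounded_pos by auto
  have "\<bar>\<sigma> x\<bar> \<le> M" for x using z[of x] M by (cases "x < 0 \<or> x > 1") auto
  from that[OF \<sigma> z M(1) this] show ?thesis .
qed

text \<open>The rescaled derivative of \<open>smooth_step\<close> is a one-sided approximate
  identity at c: its integral is 1 because the step rises from 0 to 1, and its bound M / h is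
  compensated by the length h of the interval.\<close>

lemma integral_steep_step_tendsto:
  fixes f :: "real \<Rightarrow> 'a::euclidean_space"
  assumes \<sigma>: "\<And>x. (smooth_step has_real_derivative \<sigma> x) (at x)" "continuous_on UNIV \<sigma>" "\<And>x. \<bar>\<sigma> x\<bar> \<le> M"
    and f: "continuous_on {c..d} f" and cd: "c < d"
    and h: "\<And>n. h n > 0" "\<And>n. c + h n \<le> d" "h \<longlonglongrightarrow> 0"
  shows "(\<lambda>n. integral {c..c + h n} (\<lambda>t. (\<sigma> ((t - c) / h n) / h n) *\<^sub>R f t)) \<longlonglongrightarrow> f c"
proof (rule LIMSEQ_I)
  fix e :: real assume e: "e > 0"
  have M: "M \<ge> 0" using \<sigma>(3)[of 0] by linarith
  define e' where "e' = e / (2 * (M + 1))"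
  have e': "e' > 0" using e M by (simp add: e'_def)
  obtain \<delta> where \<delta>: "\<delta> > 0" "\<And>t. t \<in> {c..d} \<Longrightarrow> dist t c < \<delta> \<Longrightarrow> dist (f t) (f c) < e'"
    using f cd e' unfolding continuous_on_iff by (metis atLeastAtMost_iff less_imp_le order_refl)
  have "\<forall>\<^sub>F n in sequentially. h n < \<delta>" using h(3) \<delta>(1) by (rule order_tendstoD)
  then obtain N where N: "\<And>n. n \<ge> N \<Longrightarrow> h n < \<delta>" unfolding eventually_sequentially by auto
  show "\<exists>no. \<forall>n\<ge>no. norm (integral {c..c + h n} (\<lambda>t. (\<sigma> ((t - c) / h n) / h n) *\<^sub>R f t) - f c) < e"
  proof (intro exI allI impI)
    fix n assume n: "n \<ge> N"
    let ?I = "{c..c + h n}" let ?A = "\<lambda>t. \<sigma> ((t - c) / h n) / h n"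
    have sub: "?I \<subseteq> {c..d}" using h(2)[of n] by auto
    have cA: "continuous_on S ?A" for S using h(1)[of n]
      by (intro continuous_intros continuous_on_compose2[OF \<sigma>(2)]) auto
    have cf: "continuous_on ?I f" using f sub continuous_on_subset by blast
    have "(?A has_integral (smooth_step ((c + h n - c) / h n) - smooth_step ((c - c) / h n))) ?I"
    proof (rule fundamental_theorem_of_calculus)
      show "c \<le> c + h n" using h(1)[of n] by simp
      fix t
      have "((\<lambda>t. smooth_step ((t - c) / h n)) has_real_derivative \<sigma> ((t - c) / h n) * (1 / h n)) (at t within ?I)"
        by (rule DERIV_chain2[OF \<sigma>(1)]) (use h(1)[of n] in \<open>auto intro!: derivative_eq_intros\<close>)
      thus "((\<lambda>t. smooth_step ((t - c) / h n)) has_vector_derivative ?A t) (at t within ?I)"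
        by (simp add: has_real_derivative_iff_has_vector_derivative)
    qed
    hence hi: "(?A has_integral 1) ?I" using h(1)[of n] by (simp add: smooth_step_0 smooth_step_1)
    hence hi': "((\<lambda>t. ?A t *\<^sub>R f c) has_integral (1 *\<^sub>R f c)) ?I"
      using has_integral_linear[OF hi bounded_linear_scaleR_left] by (simp add: o_def)
    have i1: "(\<lambda>t. ?A t *\<^sub>R f t) integrable_on ?I"
      by (intro integrable_continuous_real continuous_on_scaleR cA cf)
    have "integral ?I (\<lambda>t. ?A t *\<^sub>R f t) - f c = integral ?I (\<lambda>t. ?A t *\<^sub>R f t) - integral ?I (\<lambda>t. ?A t *\<^sub>R f c)"
      using integral_unique[OF hi'] by simp
    also have "\<dots> = integral ?I (\<lambda>t. ?A t *\<^sub>R f t - ?A t *\<^sub>R f c)"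
      using i1 hi' by (subst Henstock_Kurzweil_Integration.integral_diff) auto
    also have "norm \<dots> \<le> M / h n * e' * (c + h n - c)"
    proof (rule integral_bound)
      show "c \<le> c + h n" using h(1)[of n] by simp
      show "continuous_on ?I (\<lambda>t. ?A t *\<^sub>R f t - ?A t *\<^sub>R f c)"
        by (intro continuous_on_diff continuous_on_scaleR cA cf continuous_on_const)
      fix t assume t: "t \<in> ?I"
      have "dist (f t) (f c) < e'" using t sub N[OF n] by (intro \<delta>(2)) (auto simp: dist_real_def)
      hence "norm (f t - f c) \<le> e'" by (simp add: dist_norm)
      moreover have "\<bar>?A t\<bar> \<le> M / h n" using \<sigma>(3) h(1)[of n] by (simp add: abs_divide divide_right_mono)
      ultimately have "\<bar>?A t\<bar> * norm (f t - f c) \<le> M / h n * e'" using M h(1)[of n]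
        by (intro mult_mono) auto
      thus "norm (?A t *\<^sub>R f t - ?A t *\<^sub>R f c) \<le> M / h n * e'"
        by (simp add: scaleR_diff_right[symmetric])
    qed
    also have "\<dots> = M * e'" using h(1)[of n] by simp
    also have "\<dots> < e" using e M by (simp add: e'_def field_simps add_nonneg_pos)
    finally show "norm (integral ?I (\<lambda>t. ?A t *\<^sub>R f t) - f c) < e" .
  qed
qed

text \<open>The test functions are smoothed indicators of [a, b], rising on [a, a + h] and falling
  on [b, b + h]. Their derivatives are differences of approximate identities, so one side of the
  weak identity tends to f a - f b; the other tends to the integral of -g by dominated
  convergence.\<close>

lemma weak_deriv_increment:
  fixes f g :: "real \<Rightarrow> 'a::euclidean_space"
  assumes wd: "has_weak_deriv L f g" and f: "continuous_on {0<..<L} f" and ab: "0 < a" "a < b" "b < L"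
  shows "f b - f a = integral {a..b} g"
proof -
  obtain \<sigma> M where \<sigma>: "\<And>x. (smooth_step has_real_derivative \<sigma> x) (at x)" "continuous_on UNIV \<sigma>"
    and \<sigma>0: "\<And>x. x < 0 \<or> x > 1 \<Longrightarrow> \<sigma> x = 0" and "M > 0" and \<sigma>M: "\<And>x. \<bar>\<sigma> x\<bar> \<le> M"
    by (rule smooth_step_derivative) (rule that)
  \<comment> \<open>Half the distance from b to L, so that the falling flank stays inside the open
    interval.\<close>
  define h0 where "h0 = (L - b) / 2"
  have h0: "h0 > 0" "b + h0 < L" using ab by (auto simp: h0_def field_simps)
  define h where "h n = h0 / real (Suc n)" for n
  have h: "h n > 0" "h n \<le> h0" for n using h0 by (auto simp: h_def field_simps)
  have hlim: "h \<longlonglongrightarrow> 0" unfolding h_def using tendsto_mult_right_zero[OF LIMSEQ_inverse_real_of_nat, of h0] by (simp add: divide_inverse)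
  define \<phi> where "\<phi> n t = smooth_step ((t - a) / h n) - smooth_step ((t - b) / h n)" for n t
  define \<psi> where "\<psi> c n t = \<sigma> ((t - c) / h n) / h n" for c n t
  have \<phi>': "(\<phi> n has_real_derivative (\<psi> a n t - \<psi> b n t)) (at t)" for n t
  proof -
    have "((\<lambda>t. smooth_step ((t - c) / h n)) has_real_derivative \<sigma> ((t - c) / h n) * (1 / h n)) (at t)" for c
      by (rule DERIV_chain2[OF \<sigma>(1)]) (use h(1)[of n] in \<open>auto intro!: derivative_eq_intros\<close>)
    from DERIV_diff[OF this[of a] this[of b]] show ?thesis unfolding \<phi>_def[abs_def] \<psi>_def by simp
  qed
  have \<psi>0: "\<psi> c n t = 0" if "t \<notin> {c..c + h n}" for c n t
    using that h(1)[of n] by (auto simp: \<psi>_def field_simps intro!: \<sigma>0)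
  have \<phi>supp: "\<phi> n t = 0" if "t \<notin> {a..b + h0}" for n t
  proof (cases "t < a")
    case True
    thus ?thesis using ab h(1)[of n] by (simp add: \<phi>_def smooth_step_0 divide_le_0_iff)
  next
    case False
    hence "t > b + h n" "t > a + h n" using that h(2)[of n] ab by auto
    thus ?thesis using h(1)[of n] by (simp add: \<phi>_def smooth_step_1 field_simps)
  qed
  have test: "test_function L (\<phi> n)" for n
    unfolding test_function_def
  proof (intro conjI allI)
    fix j
    have "Ck_real j (\<lambda>t. smooth_step ((t - c) / h n))" for c
      using Ck_real_affine[OF Ck_real_smooth_step, of j "1 / h n" "- c / h n"] by (simp add: diff_divide_distrib)
    from Ck_real_add[OF this[of a] Ck_real_mult[OF Ck_real_const[of _ "-1"] this[of b]]]
    have "Ck_real j (\<phi> n)" unfolding \<phi>_def[abs_def] by simp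
    thus "Ck_on j UNIV (\<phi> n)" by (rule Ck_real_imp_Ck_on)
    show "\<exists>a b. 0 < a \<and> b < L \<and> (\<forall>t. t \<notin> {a..b} \<longrightarrow> \<phi> n t = 0)"
      using ab h0 \<phi>supp by (intro exI[of _ a] exI[of _ "b + h0"]) auto
  qed
  have cf: "continuous_on {c..d} f" if "0 < c" "d < L" for c d
    using that f by (auto intro: continuous_on_subset)
  have c\<psi>: "continuous_on S (\<psi> c n)" for c n S
    unfolding \<psi>_def using h(1)[of n] by (intro continuous_intros continuous_on_compose2[OF \<sigma>(2)]) auto
  have lhs1: "(LINT s:{0<..<L}|lebesgue. \<psi> c n s *\<^sub>R f s) = integral {c..c + h n} (\<lambda>t. \<psi> c n t *\<^sub>R f t)"
    and lhs1i: "set_integrable lebesgue {0<..<L} (\<lambda>s. \<psi> c n s *\<^sub>R f s)"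
    if c: "0 < c" "c \<le> b" for c n
  proof -
    have c': "c + h n < L" using c h(2)[of n] h0 by auto
    have ind: "indicator {0<..<L} s *\<^sub>R (\<psi> c n s *\<^sub>R f s) = indicator {c..c + h n} s *\<^sub>R (\<psi> c n s *\<^sub>R f s)" for s
      using c c' \<psi>0[of s c n] by (auto simp: indicator_def)
    have ai: "(\<lambda>t. \<psi> c n t *\<^sub>R f t) absolutely_integrable_on {c..c + h n}"
      using c c' by (intro absolutely_integrable_continuous_real continuous_on_scaleR c\<psi> cf) auto
    show "set_integrable lebesgue {0<..<L} (\<lambda>s. \<psi> c n s *\<^sub>R f s)"
      using ai unfolding set_integrable_def ind .
    show "(LINT s:{0<..<L}|lebesgue. \<psi> c n s *\<^sub>R f s) = integral {c..c + h n} (\<lambda>t. \<psi> c n t *\<^sub>R f t)"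
      using set_lebesgue_integral_eq_integral(2)[OF ai] unfolding set_lebesgue_integral_def ind .
  qed
  have lhs: "(LINT s:{0<..<L}|lebesgue. vector_derivative (\<phi> n) (at s) *\<^sub>R f s) =
      integral {a..a + h n} (\<lambda>t. \<psi> a n t *\<^sub>R f t) - integral {b..b + h n} (\<lambda>t. \<psi> b n t *\<^sub>R f t)" for n
  proof -
    have "vector_derivative (\<phi> n) (at s) = \<psi> a n s - \<psi> b n s" for s
      using \<phi>' by (intro vector_derivative_at) (simp add: has_real_derivative_iff_has_vector_derivative)
    thus ?thesis using ab lhs1[of a n] lhs1[of b n] lhs1i[of a n] lhs1i[of b n]
      by (simp add: scaleR_diff_left)
  qed
  have lim1: "(\<lambda>n. integral {c..c + h n} (\<lambda>t. \<psi> c n t *\<^sub>R f t)) \<longlonglongrightarrow> f c" if c: "0 < c" "c \<le> b" for c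
    unfolding \<psi>_def
    by (rule integral_steep_step_tendsto[OF \<sigma> \<sigma>M, of _ "c + h0"]) (use c h h0 hlim in \<open>auto intro!: cf\<close>)
  have gi: "set_integrable lebesgue {a..b + h0} g"
    using wd ab h0 unfolding has_weak_deriv_def locally_integrable_def by auto
  let ?G = "\<lambda>s. indicator {a..b + h0} s *\<^sub>R g s"
  have lim2: "(\<lambda>n. LINT s:{0<..<L}|lebesgue. \<phi> n s *\<^sub>R g s) \<longlonglongrightarrow> (LINT s:{a..b}|lebesgue. g s)"
    unfolding set_lebesgue_integral_def
  proof (rule integral_dominated_convergence[where w="\<lambda>s. norm (?G s)"])
    show "integrable lebesgue (\<lambda>s. norm (?G s))"
      using gi unfolding set_integrable_def by (rule integrable_norm)
    show "(\<lambda>s. indicat_real {a..b} s *\<^sub>R g s) \<in> borel_measurable lebesgue"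
      using set_integrable_subset[OF gi, of "{a..b}"] h0 unfolding set_integrable_def
      by (intro borel_measurable_integrable) auto
    fix n
    have eq: "indicat_real {0<..<L} s *\<^sub>R \<phi> n s *\<^sub>R g s = \<phi> n s *\<^sub>R ?G s" for s
      using \<phi>supp[of s n] ab h0 by (auto simp: indicator_def)
    have "\<phi> n \<in> borel_measurable borel"
      using \<phi>'[of n] by (intro borel_measurable_continuous_onI DERIV_continuous_on)
    hence "\<phi> n \<in> borel_measurable lebesgue" by (intro measurable_completion) simp
    moreover have "?G \<in> borel_measurable lebesgue" using gi unfolding set_integrable_def by (rule borel_measurable_integrable)
    ultimately show "(\<lambda>s. indicat_real {0<..<L} s *\<^sub>R \<phi> n s *\<^sub>R g s) \<in> borel_measurable lebesgue"
      unfolding eq by (rule borel_measurable_scaleR)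
    have "\<bar>\<phi> n s\<bar> \<le> 1" for s
      using smooth_step_ge_0[of "(s-a)/h n"] smooth_step_ge_0[of "(s-b)/h n"]
        smooth_step_le_1[of "(s-a)/h n"] smooth_step_le_1[of "(s-b)/h n"] unfolding \<phi>_def by linarith
    hence "norm (\<phi> n s *\<^sub>R ?G s) \<le> norm (?G s)" for s
      unfolding norm_scaleR by (intro mult_left_le_one_le) auto
    thus "AE s in lebesgue. norm (indicat_real {0<..<L} s *\<^sub>R \<phi> n s *\<^sub>R g s) \<le> norm (?G s)"
      unfolding eq by simp
  next
    \<comment> \<open>At s = a every test function vanishes whereas the limiting indicator is 1;
      this point is discarded.\<close>
    have "AE s in lebesgue. s \<noteq> a" using AE_lborel_singleton by (rule AE_completion)
    thus "AE s in lebesgue. (\<lambda>n. indicat_real {0<..<L} s *\<^sub>R \<phi> n s *\<^sub>R g s) \<longlonglongrightarrow> indicat_real {a..b} s *\<^sub>R g s"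
    proof eventually_elim
      case (elim s)
      have step: "\<forall>\<^sub>F n in sequentially. smooth_step ((s - c) / h n) = (if s \<le> c then 0 else 1)" for c
      proof (cases "s \<le> c")
        case True
        thus ?thesis using h(1) by (auto simp: smooth_step_0 divide_le_0_iff less_imp_le)
      next
        case False
        hence "\<forall>\<^sub>F n in sequentially. h n < s - c" by (intro order_tendstoD(2)[OF hlim]) simp
        thus ?thesis
        proof eventually_elim
          case (elim n)
          thus ?case using False h(1)[of n] by (simp add: smooth_step_1)
        qed
      qed
      have "\<forall>\<^sub>F n in sequentially. indicat_real {0<..<L} s *\<^sub>R \<phi> n s *\<^sub>R g s = indicat_real {a..b} s *\<^sub>R g s"
        using step[of a] step[of b]
      proof eventually_elim
        case (elim n)
        thus ?case using ab \<open>s \<noteq> a\<close> unfolding \<phi>_def by (auto simp: indicator_def)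
      qed
      thus ?case by (rule tendsto_eventually)
    qed
  qed
  have eqn: "(LINT s:{0<..<L}|lebesgue. \<phi> n s *\<^sub>R g s) =
      integral {b..b + h n} (\<lambda>t. \<psi> b n t *\<^sub>R f t) - integral {a..a + h n} (\<lambda>t. \<psi> a n t *\<^sub>R f t)" for n
  proof -
    have "(LINT s:{0<..<L}|lebesgue. vector_derivative (\<phi> n) (at s) *\<^sub>R f s) =
        - (LINT s:{0<..<L}|lebesgue. \<phi> n s *\<^sub>R g s)"
      using wd test[of n] unfolding has_weak_deriv_def by blast
    from arg_cong[OF this[unfolded lhs], of uminus] show ?thesis by simp
  qed
  have "(\<lambda>n. LINT s:{0<..<L}|lebesgue. \<phi> n s *\<^sub>R g s) \<longlonglongrightarrow> f b - f a"
    unfolding eqn using ab by (intro tendsto_diff lim1) auto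
  from LIMSEQ_unique[OF this lim2] have "f b - f a = (LINT s:{a..b}|lebesgue. g s)" .
  thus ?thesis using set_integrable_subset[OF gi, of "{a..b}"] h0
    by (simp add: set_lebesgue_integral_eq_integral(2))
qed

lemma ac_deriv_cong_AE:
  fixes f :: "real \<Rightarrow> 'a::euclidean_space"
  assumes F: "ac_deriv a b f g" and AE: "AE t in lebesgue. t \<in> {a..b} \<longrightarrow> g t = g' t"
  shows "ac_deriv a b f g'"
proof -
  obtain N where N: "N \<in> null_sets lebesgue" "{t \<in> space lebesgue. \<not> (t \<in> {a..b} \<longrightarrow> g t = g' t)} \<subseteq> N"
    using AE unfolding eventually_ae_filter by blast
  have neg: "negligible N" using N(1) by (simp add: negligible_iff_null_sets)
  have eq: "g' t = g t" if "t \<in> {a..b} - N" for t using N(2) that by auto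
  show ?thesis unfolding ac_deriv_def
  proof (intro conjI allI impI)
    show "g' absolutely_integrable_on {a..b}"
      using absolutely_integrable_spike[OF ac_deriv_absint[OF F] neg eq] .
    fix s t assume st: "a \<le> s \<and> s \<le> t \<and> t \<le> b"
    have "integral {s..t} g' = integral {s..t} g"
      by (rule integral_spike[OF neg]) (use eq st in auto)
    thus "f t - f s = integral {s..t} g'" using ac_derivD[OF F] st by simp
  qed
qed

lemma ac_deriv_unique_AE:
  fixes f :: "real \<Rightarrow> 'a::euclidean_space"
  assumes F: "ac_deriv a b f g" and G: "ac_deriv a b f g'" and "a \<le> b"
  shows "AE t in lebesgue. t \<in> {a..b} \<longrightarrow> g t = g' t"
proof -
  have "ac_deriv a b (\<lambda>t. f t + - f t) (\<lambda>t. g t + - g' t)"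
    using ac_deriv_add[OF F ac_deriv_linear[OF G bounded_linear_minus[OF bounded_linear_ident]]] .
  hence D: "ac_deriv a b (\<lambda>t. 0) (\<lambda>t. g t - g' t)" by simp
  have "AE t in lebesgue. t \<in> {a..b} \<longrightarrow> g t - g' t = 0"
    by (rule AE_zero_of_zero_indefinite_integral[OF ac_deriv_absint[OF D] assms(3)])
      (use ac_derivD[OF D] in auto)
  thus ?thesis by simp
qed

lemma ac_deriv_0_const:
  assumes "ac_deriv a b f (\<lambda>t. 0)" "t \<in> {a..b}"
  shows "f t = f a"
  using ac_derivD[OF assms(1), of a t] assms(2) by simp

lemma L2_on_imp_absolutely_integrable:
  fixes g :: "real \<Rightarrow> 'a::euclidean_space"
  assumes "L2_on {0<..<L} g"
  shows "g absolutely_integrable_on {0..L}"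
proof -
  have m: "(\<lambda>x. indicat_real {0<..<L} x *\<^sub>R g x) \<in> borel_measurable lebesgue"
    and i: "set_integrable lebesgue {0<..<L} (\<lambda>s. (norm (g s))\<^sup>2)"
    using assms unfolding L2_on_def set_borel_measurable_def by auto
  have c: "(\<lambda>s. 1::real) absolutely_integrable_on {0<..<L}"
    by (rule set_integrable_subset[OF absolutely_integrable_continuous_real[of 0 L]]) auto
  have "set_integrable lebesgue {0<..<L} (\<lambda>s. 1 + (norm (g s))\<^sup>2)"
    using c i by (rule set_integral_add)
  hence "set_integrable lebesgue {0<..<L} g"
  proof (rule set_integrable_bound)
    show "set_borel_measurable lebesgue {0<..<L} g" using m unfolding set_borel_measurable_def .
    have "norm (g s) \<le> 1 + (norm (g s))\<^sup>2" for s
    proof -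
      have "2 * norm (g s) \<le> 1 + (norm (g s))\<^sup>2"
        using zero_le_power2[of "norm (g s) - 1"] by (simp add: power2_diff)
      thus ?thesis using norm_ge_zero[of "g s"] by linarith
    qed
    thus "AE x in lebesgue. x \<in> {0<..<L} \<longrightarrow> norm (g x) \<le> norm (1 + (norm (g x))\<^sup>2)"
      by (intro AE_I2) (simp add: abs_of_nonneg add_nonneg_nonneg)
  qed
  thus ?thesis
    by (rule absolutely_integrable_spike_set)
      (rule negligible_subset[of "{0,L}"], simp, force)+
qed

text \<open>By the interior increments, f minus the indefinite integral of g is constant on the open
  interval; continuity extends this to the end points.\<close>

lemma weak_deriv_imp_ac_deriv:
  fixes f g :: "real \<Rightarrow> 'a::euclidean_space"
  assumes wd: "has_weak_deriv L f g" and f: "continuous_on {0..L} f"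
    and g: "g absolutely_integrable_on {0..L}" and L: "L > 0"
  shows "ac_deriv 0 L f g"
proof -
  have gi: "g integrable_on {0..L}" using g by (rule set_lebesgue_integral_eq_integral)
  have cG: "continuous_on {0..L} (\<lambda>t. integral {0..t} g)" by (rule indefinite_integral_continuous_1[OF gi])
  define D where "D t = f t - integral {0..t} g" for t
  have cD: "continuous_on {0..L} D" unfolding D_def by (intro continuous_on_diff f cG)
  have sub: "{0<..<L} \<subseteq> {0..L}" by auto
  have Dmid: "D t = D (L/2)" if t: "t \<in> {0<..<L}" for t
  proof -
    have *: "D v = D u" if uv: "0 < u" "u < v" "v < L" for u v
    proof -
      have "f v - f u = integral {u..v} g"
        using weak_deriv_increment[OF wd continuous_on_subset[OF f sub] uv] .
      moreover have "integral {0..u} g + integral {u..v} g = integral {0..v} g"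
        using uv by (intro Henstock_Kurzweil_Integration.integral_combine integrable_on_subinterval[OF gi]) auto
      ultimately show ?thesis unfolding D_def by (simp add: algebra_simps)
    qed
    show ?thesis using *[of t "L/2"] *[of "L/2" t] t L by (cases t "L/2" rule: linorder_cases) auto
  qed
  have Dall: "D t = D (L/2)" if "t \<in> {0..L}" for t
  proof (rule continuous_constant_on_closure[of "{0<..<L}" D])
    show "continuous_on (closure {0<..<L}) D" using cD L by simp
    show "t \<in> closure {0<..<L}" using that L by simp
  qed (rule Dmid)
  show ?thesis unfolding ac_deriv_def
  proof (intro conjI allI impI)
    fix s t assume st: "0 \<le> s \<and> s \<le> t \<and> t \<le> L"
    have "integral {0..s} g + integral {s..t} g = integral {0..t} g"
      using st by (intro Henstock_Kurzweil_Integration.integral_combine integrable_on_subinterval[OF gi]) auto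
    hence I: "integral {s..t} g = integral {0..t} g - integral {0..s} g" by (metis add_diff_cancel_left')
    have "D t = D s" using Dall[of s] Dall[of t] st by auto
    thus "f t - f s = integral {s..t} g" unfolding I D_def by (simp add: algebra_simps)
  qed (fact g)
qed

lemma test_function_derivative:
  assumes "test_function L \<phi>"
  shows "(\<phi> has_vector_derivative vector_derivative \<phi> (at t)) (at t)"
    and "continuous_on UNIV (\<lambda>t. vector_derivative \<phi> (at t))"
    and "continuous_on UNIV \<phi>"
    and "\<phi> 0 = 0" "\<phi> L = 0"
proof -
  have C: "Ck_on 1 UNIV \<phi>" using assms unfolding test_function_def by auto
  hence "\<phi> differentiable (at t)" for t unfolding Ck_on_def by auto
  thus d: "(\<phi> has_vector_derivative vector_derivative \<phi> (at t)) (at t)" for t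
    by (simp add: vector_derivative_works)
  show "continuous_on UNIV (\<lambda>t. vector_derivative \<phi> (at t))"
    using C unfolding Ck_on_def by simp
  show "continuous_on UNIV \<phi>"
    using d by (intro continuous_at_imp_continuous_on) (auto intro: has_vector_derivative_continuous)
  obtain a b where "0 < a" "b < L" and z: "\<And>t. t \<notin> {a..b} \<Longrightarrow> \<phi> t = 0"
    using assms unfolding test_function_def by blast
  thus "\<phi> 0 = 0" "\<phi> L = 0" using z[of 0] z[of L] by auto
qed

lemma continuous_UNIV_scaleR_absolutely_integrable:
  fixes g :: "real \<Rightarrow> 'a::euclidean_space" and \<phi> :: "real \<Rightarrow> real"
  assumes c: "continuous_on UNIV \<phi>" and g: "g absolutely_integrable_on {a..b}"
  shows "(\<lambda>t. \<phi> t *\<^sub>R g t) absolutely_integrable_on {a..b}"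
proof (subst absolutely_integrable_componentwise_iff, intro ballI)
  fix i :: 'a
  have "(\<lambda>t. g t \<bullet> i) absolutely_integrable_on {a..b}"
    using absolutely_integrable_linear[OF g bounded_linear_inner_left] by (simp add: o_def)
  from absolutely_integrable_continuous_mult[OF continuous_on_subset[OF c subset_UNIV] this]
  show "(\<lambda>t. \<phi> t *\<^sub>R g t \<bullet> i) absolutely_integrable_on {a..b}" by simp
qed

lemma set_integral_open_interval:
  fixes g :: "real \<Rightarrow> 'a::euclidean_space"
  assumes "g absolutely_integrable_on {a..b}"
  shows "(LINT s:{a<..<b}|lebesgue. g s) = integral {a..b} g"
proof -
  have "set_integrable lebesgue {a<..<b} g" using assms by (rule set_integrable_subset) auto
  hence "(LINT s:{a<..<b}|lebesgue. g s) = integral {a<..<b} g" by (rule set_lebesgue_integral_eq_integral(2))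
  thus ?thesis by (simp add: integral_open_interval_real)
qed

text \<open>Componentwise integration by parts; the boundary terms vanish because a test function is
  zero at 0 and L.\<close>

lemma ac_deriv_imp_weak_deriv:
  fixes f g :: "real \<Rightarrow> 'a::euclidean_space"
  assumes F: "ac_deriv 0 L f g" and L: "L > 0"
  shows "has_weak_deriv L f g"
  unfolding has_weak_deriv_def
proof (intro conjI allI impI)
  have fi: "f absolutely_integrable_on {0..L}"
    using ac_deriv_continuous_on[OF F] by (rule absolutely_integrable_continuous_real)
  have gi: "g absolutely_integrable_on {0..L}" using F by (rule ac_deriv_absint)
  show "locally_integrable L f" "locally_integrable L g"
    unfolding locally_integrable_def by (auto intro: set_integrable_subset[OF fi] set_integrable_subset[OF gi])
  fix \<phi> assume T: "test_function L \<phi>"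
  note \<phi> = test_function_derivative[OF T]
  let ?d = "\<lambda>s. vector_derivative \<phi> (at s)"
  have i1: "(\<lambda>s. ?d s *\<^sub>R f s) absolutely_integrable_on {0..L}"
    by (rule continuous_UNIV_scaleR_absolutely_integrable[OF \<phi>(2) fi])
  have i2: "(\<lambda>s. \<phi> s *\<^sub>R g s) absolutely_integrable_on {0..L}"
    by (rule continuous_UNIV_scaleR_absolutely_integrable[OF \<phi>(3) gi])
  have P: "ac_deriv 0 L \<phi> ?d"
    using has_vector_derivative_at_within[OF \<phi>(1)] continuous_on_subset[OF \<phi>(2) subset_UNIV]
    by (rule ac_deriv_C1)
  have eq: "integral {0..L} (\<lambda>s. ?d s *\<^sub>R f s) \<bullet> i = - integral {0..L} (\<lambda>s. \<phi> s *\<^sub>R g s) \<bullet> i" for i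
  proof -
    have "ac_deriv 0 L (\<lambda>s. f s \<bullet> i) (\<lambda>s. g s \<bullet> i)"
      using ac_deriv_linear[OF F bounded_linear_inner_left] .
    from ac_derivD[OF ac_deriv_mult[OF P this], of 0 L]
    have "0 = integral {0..L} (\<lambda>t. \<phi> t * (g t \<bullet> i) + f t \<bullet> i * ?d t)" using L \<phi>(4,5) by simp
    also have "\<dots> = integral {0..L} (\<lambda>t. (\<phi> t *\<^sub>R g t + ?d t *\<^sub>R f t) \<bullet> i)"
      by (simp add: inner_add_left mult.commute)
    also have "\<dots> = integral {0..L} (\<lambda>t. \<phi> t *\<^sub>R g t + ?d t *\<^sub>R f t) \<bullet> i"
      using integral_linear[OF _ bounded_linear_inner_left, of "\<lambda>t. \<phi> t *\<^sub>R g t + ?d t *\<^sub>R f t" "{0..L}" i]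
        Henstock_Kurzweil_Integration.integrable_add[OF i2[THEN set_lebesgue_integral_eq_integral(1)] i1[THEN set_lebesgue_integral_eq_integral(1)]]
      by (simp add: o_def)
    also have "\<dots> = (integral {0..L} (\<lambda>s. \<phi> s *\<^sub>R g s) + integral {0..L} (\<lambda>s. ?d s *\<^sub>R f s)) \<bullet> i"
      using i1[THEN set_lebesgue_integral_eq_integral(1)] i2[THEN set_lebesgue_integral_eq_integral(1)]
      by (subst Henstock_Kurzweil_Integration.integral_add) auto
    finally show ?thesis unfolding inner_add_left inner_minus_left by linarith
  qed
  have "integral {0..L} (\<lambda>s. ?d s *\<^sub>R f s) = - integral {0..L} (\<lambda>s. \<phi> s *\<^sub>R g s)"
    by (rule euclidean_eqI) (rule eq)
  thus "(LINT s:{0<..<L}|lebesgue. ?d s *\<^sub>R f s) = - (LINT s:{0<..<L}|lebesgue. \<phi> s *\<^sub>R g s)"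
    using set_integral_open_interval[OF i1] set_integral_open_interval[OF i2] by simp
qed

section \<open>Tangential angles of arclength curves\<close>

lemma vector_2_eq: "(vector [a, b] :: real^2) = a *\<^sub>R vector [1, 0] + b *\<^sub>R vector [0, 1]"
  by (simp add: vec_eq_iff forall_2)

lemma has_vector_derivative_vector_2:
  assumes "(f has_real_derivative a) (at t within S)" "(g has_real_derivative b) (at t within S)"
  shows "((\<lambda>t. vector [f t, g t] :: real^2) has_vector_derivative vector [a, b]) (at t within S)"
proof -
  have "((\<lambda>t. f t *\<^sub>R c) has_vector_derivative a *\<^sub>R c) (at t within S)" "((\<lambda>t. g t *\<^sub>R c) has_vector_derivative b *\<^sub>R c) (at t within S)"
    for c :: "real^2"
    using has_vector_derivative_scaleR[OF assms(1) has_vector_derivative_const, of c]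
      has_vector_derivative_scaleR[OF assms(2) has_vector_derivative_const, of c] by simp_all
  thus ?thesis unfolding vector_2_eq[of "f _"] vector_2_eq[of a] by (rule has_vector_derivative_add)
qed

lemma unit_vec_nth [simp]: "unit_vec \<theta> $ 1 = cos \<theta>" "unit_vec \<theta> $ 2 = sin \<theta>"
  by (simp_all add: unit_vec_def)

lemma rot90_nth [simp]: "rot90 v $ 1 = - (v $ 2)" "rot90 v $ 2 = v $ 1"
  by (simp_all add: rot90_def)

lemma norm_sq_2: "(norm (v::real^2))\<^sup>2 = (v $ 1)\<^sup>2 + (v $ 2)\<^sup>2"
  unfolding power2_norm_eq_inner inner_vec_def by (simp add: sum_2 power2_eq_square)

lemma norm_unit_vec [simp]: "norm (unit_vec \<theta>) = 1"
  using norm_sq_2[of "unit_vec \<theta>"] by (simp add: power2_eq_1_iff) (metis norm_not_less_zero zero_less_one neg_less_0_iff_less)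

lemma norm_rot90 [simp]: "norm (rot90 v) = norm v"
  using norm_sq_2[of v] norm_sq_2[of "rot90 v"] power2_eq_iff_nonneg[of "norm (rot90 v)" "norm v"] by simp

lemma continuous_on_unit_vec: "continuous_on (S :: real set) f \<Longrightarrow> continuous_on S (\<lambda>t. unit_vec (f t))"
  unfolding unit_vec_def vector_2_eq[of "cos _"]
  by (intro continuous_on_add continuous_on_scaleR continuous_on_cos continuous_on_sin continuous_on_const)

lemma unit_vec_has_vector_derivative:
  assumes "(\<theta> has_real_derivative k) (at t within S)"
  shows "((\<lambda>t. unit_vec (\<theta> t)) has_vector_derivative k *\<^sub>R rot90 (unit_vec (\<theta> t))) (at t within S)"
proof -
  have c: "((\<lambda>t. cos (\<theta> t)) has_real_derivative - sin (\<theta> t) * k) (at t within S)"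
    by (rule DERIV_chain2[OF DERIV_cos assms])
  have s: "((\<lambda>t. sin (\<theta> t)) has_real_derivative cos (\<theta> t) * k) (at t within S)"
    by (rule DERIV_chain2[OF DERIV_sin assms])
  have "k *\<^sub>R rot90 (unit_vec (\<theta> t)) = vector [- sin (\<theta> t) * k, cos (\<theta> t) * k]"
    by (simp add: vec_eq_iff forall_2)
  thus ?thesis using has_vector_derivative_vector_2[OF c s] unfolding unit_vec_def by simp
qed

lemma continuous_on_rot90: "continuous_on S f \<Longrightarrow> continuous_on S (\<lambda>t. rot90 (f t))"
  unfolding rot90_def vector_2_eq[of "- _"] by (intro continuous_intros)

lemma at_within_Icc_nontrivial: "a < b \<Longrightarrow> t \<in> {a..b} \<Longrightarrow> at t within {a..b} \<noteq> bot" for a b t :: real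
  by (simp add: trivial_limit_within islimpt_Icc)

lemma absolutely_integrable_scaleR_continuous:
  fixes f :: "real \<Rightarrow> 'a::euclidean_space" and k :: "real \<Rightarrow> real"
  assumes f: "continuous_on {a..b} f" and k: "k absolutely_integrable_on {a..b}"
  shows "(\<lambda>t. k t *\<^sub>R f t) absolutely_integrable_on {a..b}"
proof (subst absolutely_integrable_componentwise_iff, intro ballI)
  fix i :: 'a
  have "continuous_on {a..b} (\<lambda>t. f t \<bullet> i)" using f by (intro continuous_on_inner continuous_on_const)
  from absolutely_integrable_continuous_mult[OF this k]
  show "(\<lambda>t. k t *\<^sub>R f t \<bullet> i) absolutely_integrable_on {a..b}" by (simp add: mult.commute)
qed

lemma set_lebesgue_integral_cong_AE_integrable:
  fixes f g :: "real \<Rightarrow> 'a::euclidean_space"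
  assumes "set_integrable lebesgue A f" "set_integrable lebesgue A g"
    and "AE t in lebesgue. t \<in> A \<longrightarrow> f t = g t"
  shows "set_lebesgue_integral lebesgue A f = set_lebesgue_integral lebesgue A g"
  unfolding set_lebesgue_integral_def
proof (rule integral_cong_AE)
  show "(\<lambda>x. indicator A x *\<^sub>R f x) \<in> borel_measurable lebesgue" "(\<lambda>x. indicator A x *\<^sub>R g x) \<in> borel_measurable lebesgue"
    using assms(1,2)[unfolded set_integrable_def, THEN borel_measurable_integrable] by this+
  show "AE x in lebesgue. indicat_real A x *\<^sub>R f x = indicat_real A x *\<^sub>R g x"
    using assms(3) by eventually_elim (auto simp: indicator_def)
qed

lemma W22_arc_velocity:
  assumes "\<gamma> \<in> W22_arc L"
  shows "s \<in> {0..L} \<Longrightarrow> (\<gamma> has_vector_derivative velocity L \<gamma> s) (at s within {0..L})"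
    and "continuous_on {0..L} (velocity L \<gamma>)"
proof -
  have C: "Ck_on 1 {0..L} \<gamma>" using assms unfolding W22_arc_def by auto
  show "s \<in> {0..L} \<Longrightarrow> (\<gamma> has_vector_derivative velocity L \<gamma> s) (at s within {0..L})"
    using C unfolding Ck_on_def velocity_def by (simp add: vector_derivative_works)
  have "nth_deriv_on {0..L} 1 \<gamma> = velocity L \<gamma>" by (rule ext) (simp add: velocity_def)
  thus "continuous_on {0..L} (velocity L \<gamma>)" using C unfolding Ck_on_def by simp
qed

text \<open>\<open>W22\<close> provides some weak derivative v of \<gamma>, a priori unrelated to
  the pointwise \<open>velocity\<close>. Both are densities of \<gamma>, hence agree almost
  everywhere, and the weak derivative of v passes to \<open>velocity\<close>.\<close>

lemma W22_arc_velocity_ac_deriv: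
  assumes \<gamma>: "\<gamma> \<in> W22_arc L" and L: "L > 0"
  obtains w where "ac_deriv 0 L (velocity L \<gamma>) w" "L2_on {0<..<L} w"
proof -
  let ?V = "velocity L \<gamma>"
  obtain v w where v: "L2_on {0<..<L} v" and w: "L2_on {0<..<L} w" and wd: "has_weak_deriv L \<gamma> v" "has_weak_deriv L v w"
    using \<gamma> unfolding W22_arc_def W22_def by blast
  have cV: "continuous_on {0..L} ?V" by (rule W22_arc_velocity(2)[OF \<gamma>])
  have D1: "ac_deriv 0 L \<gamma> ?V" by (rule ac_deriv_C1[OF W22_arc_velocity(1)[OF \<gamma>] cV])
  have vi: "v absolutely_integrable_on {0..L}" by (rule L2_on_imp_absolutely_integrable[OF v])
  have Vi: "?V absolutely_integrable_on {0..L}" by (rule absolutely_integrable_continuous_real[OF cV])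
  have wi: "w absolutely_integrable_on {0..L}" by (rule L2_on_imp_absolutely_integrable[OF w])
  have D2: "ac_deriv 0 L \<gamma> v"
    by (rule weak_deriv_imp_ac_deriv[OF wd(1) ac_deriv_continuous_on[OF D1] vi L])
  have AE: "AE t in lebesgue. t \<in> {0..L} \<longrightarrow> v t = ?V t"
    by (rule ac_deriv_unique_AE[OF D2 D1]) (use L in simp)
  have "has_weak_deriv L ?V w" unfolding has_weak_deriv_def
  proof (intro conjI allI impI)
    show "locally_integrable L ?V" unfolding locally_integrable_def
      by (auto intro: set_integrable_subset[OF Vi])
    show "locally_integrable L w" using wd(2) unfolding has_weak_deriv_def by blast
    fix \<phi> assume T: "test_function L \<phi>"
    let ?d = "\<lambda>s. vector_derivative \<phi> (at s)"
    have i: "(\<lambda>s. ?d s *\<^sub>R f s) absolutely_integrable_on {0..L}" if "f absolutely_integrable_on {0..L}" for f :: "real \<Rightarrow> real^2"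
      by (rule continuous_UNIV_scaleR_absolutely_integrable[OF test_function_derivative(2)[OF T] that])
    have "(LINT s:{0<..<L}|lebesgue. ?d s *\<^sub>R ?V s) = (LINT s:{0<..<L}|lebesgue. ?d s *\<^sub>R v s)"
    proof (rule set_lebesgue_integral_cong_AE_integrable)
      show "set_integrable lebesgue {0<..<L} (\<lambda>s. ?d s *\<^sub>R ?V s)" "set_integrable lebesgue {0<..<L} (\<lambda>s. ?d s *\<^sub>R v s)"
        by (rule set_integrable_subset[OF i[OF Vi]] set_integrable_subset[OF i[OF vi]]; force)+
      show "AE t in lebesgue. t \<in> {0<..<L} \<longrightarrow> ?d t *\<^sub>R ?V t = ?d t *\<^sub>R v t"
        using AE by eventually_elim auto
    qed
    also have "\<dots> = - (LINT s:{0<..<L}|lebesgue. \<phi> s *\<^sub>R w s)"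
      using wd(2) T unfolding has_weak_deriv_def by blast
    finally show "(LINT s:{0<..<L}|lebesgue. ?d s *\<^sub>R ?V s) = - (LINT s:{0<..<L}|lebesgue. \<phi> s *\<^sub>R w s)" .
  qed
  from weak_deriv_imp_ac_deriv[OF this cV wi L] w show ?thesis by (rule that)
qed

lemma ac_deriv_indefinite:
  fixes k :: "real \<Rightarrow> 'a::euclidean_space"
  assumes k: "k absolutely_integrable_on {a..b}"
  shows "ac_deriv a b (\<lambda>s. c + integral {a..s} k) k"
  unfolding ac_deriv_def
proof (intro conjI allI impI)
  have ki: "k integrable_on {a..b}" using k by (rule set_lebesgue_integral_eq_integral)
  fix s t assume st: "a \<le> s \<and> s \<le> t \<and> t \<le> b"
  have "integral {a..s} k + integral {s..t} k = integral {a..t} k"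
    using st by (intro Henstock_Kurzweil_Integration.integral_combine integrable_on_subinterval[OF ki]) auto
  thus "c + integral {a..t} k - (c + integral {a..s} k) = integral {s..t} k" by (metis add_diff_cancel_left add_diff_cancel_left')
qed (fact k)

lemma L2_on_square_integrable:
  fixes k :: "real \<Rightarrow> real"
  assumes "L2_on {0<..<L} k"
  shows "(\<lambda>s. (k s)\<^sup>2) absolutely_integrable_on {0..L}"
proof -
  have "set_integrable lebesgue {0<..<L} (\<lambda>s. (k s)\<^sup>2)" using assms unfolding L2_on_def by simp
  thus ?thesis
    by (rule absolutely_integrable_spike_set)
      (rule negligible_subset[of "{0,L}"], simp, force)+
qed

lemma L2_on_continuous:
  fixes f :: "real \<Rightarrow> 'a::euclidean_space"
  assumes f: "continuous_on {0..L} f"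
  shows "L2_on {0<..<L} f"
proof -
  have "set_integrable lebesgue {0<..<L} f"
    by (rule set_integrable_subset[OF absolutely_integrable_continuous_real[OF f]]) force+
  hence "set_borel_measurable lebesgue {0<..<L} f"
    unfolding set_integrable_def set_borel_measurable_def by (rule borel_measurable_integrable)
  moreover have "continuous_on {0..L} (\<lambda>s. (norm (f s))\<^sup>2)" using f by (intro continuous_on_power continuous_on_norm)
  hence "set_integrable lebesgue {0<..<L} (\<lambda>s. (norm (f s))\<^sup>2)"
    by (intro set_integrable_subset[OF absolutely_integrable_continuous_real]) force+
  ultimately show ?thesis unfolding L2_on_def by blast
qed

section \<open>Curvature, bending energy and the angle of a Sobolev curve\<close>

lemma is_curvature_ac_deriv:
  assumes \<gamma>: "\<gamma> \<in> W22_arc L" and L: "L > 0" and k: "is_curvature L \<gamma> k"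
  shows "ac_deriv 0 L (velocity L \<gamma>) (\<lambda>s. k s *\<^sub>R rot90 (velocity L \<gamma> s))"
proof -
  have cV: "continuous_on {0..L} (velocity L \<gamma>)" by (rule W22_arc_velocity(2)[OF \<gamma>])
  have ki: "k absolutely_integrable_on {0..L}"
    using k unfolding is_curvature_def by (intro L2_on_imp_absolutely_integrable) blast
  have "has_weak_deriv L (velocity L \<gamma>) (\<lambda>s. k s *\<^sub>R rot90 (velocity L \<gamma> s))"
    using k unfolding is_curvature_def by blast
  from weak_deriv_imp_ac_deriv[OF this cV absolutely_integrable_scaleR_continuous[OF continuous_on_rot90[OF cV] ki] L]
  show ?thesis .
qed

lemma is_curvature_unique_AE:
  assumes \<gamma>: "\<gamma> \<in> W22_arc L" and L: "L > 0" and k: "is_curvature L \<gamma> k" "is_curvature L \<gamma> k'"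
  shows "AE t in lebesgue. t \<in> {0..L} \<longrightarrow> k t = k' t"
proof -
  have "AE t in lebesgue. t \<in> {0..L} \<longrightarrow> k t *\<^sub>R rot90 (velocity L \<gamma> t) = k' t *\<^sub>R rot90 (velocity L \<gamma> t)"
    using ac_deriv_unique_AE[OF is_curvature_ac_deriv[OF \<gamma> L k(1)] is_curvature_ac_deriv[OF \<gamma> L k(2)]] L by simp
  moreover have "rot90 (velocity L \<gamma> t) \<noteq> 0" if "t \<in> {0..L}" for t
    using \<gamma> that unfolding W22_arc_def by (metis (mono_tags, lifting) mem_Collect_eq norm_rot90 norm_zero zero_neq_one)
  ultimately show ?thesis by (auto elim!: eventually_mono)
qed

lemma curvature_AE_eq:
  assumes \<gamma>: "\<gamma> \<in> W22_arc L" and L: "L > 0" and k: "is_curvature L \<gamma> k"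
  shows "AE t in lebesgue. t \<in> {0..L} \<longrightarrow> curvature L \<gamma> t = k t"
proof -
  have "is_curvature L \<gamma> (curvature L \<gamma>)" unfolding curvature_def by (rule someI[of "is_curvature L \<gamma>", OF k])
  from is_curvature_unique_AE[OF \<gamma> L this k] show ?thesis .
qed

lemma bending_energy_eq:
  assumes \<gamma>: "\<gamma> \<in> W22_arc L" and L: "L > 0" and k: "is_curvature L \<gamma> k"
  shows "bending_energy L \<gamma> = integral {0..L} (\<lambda>s. (k s)\<^sup>2)"
proof -
  have c: "is_curvature L \<gamma> (curvature L \<gamma>)" unfolding curvature_def by (rule someI[of "is_curvature L \<gamma>", OF k])
  have i: "(\<lambda>s. (h s)\<^sup>2) absolutely_integrable_on {0..L}" if "is_curvature L \<gamma> h" for h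
    using that unfolding is_curvature_def by (intro L2_on_square_integrable) blast
  have "bending_energy L \<gamma> = (LINT s:{0<..<L}|lebesgue. (k s)\<^sup>2)"
    unfolding bending_energy_def
  proof (rule set_lebesgue_integral_cong_AE_integrable)
    show "set_integrable lebesgue {0<..<L} (\<lambda>s. (curvature L \<gamma> s)\<^sup>2)" "set_integrable lebesgue {0<..<L} (\<lambda>s. (k s)\<^sup>2)"
      by (rule set_integrable_subset[OF i[OF c]] set_integrable_subset[OF i[OF k]]; force)+
    show "AE t in lebesgue. t \<in> {0<..<L} \<longrightarrow> (curvature L \<gamma> t)\<^sup>2 = (k t)\<^sup>2"
      using curvature_AE_eq[OF \<gamma> L k] by (auto elim!: eventually_mono)
  qed
  thus ?thesis using set_integral_open_interval[OF i[OF k]] by simp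
qed

lemma AE_zero_ac_deriv:
  assumes D: "ac_deriv a b f g" and AE: "AE t in lebesgue. t \<in> {a..b} \<longrightarrow> g t = 0" and t: "t \<in> {a..b}"
  shows "f t = f a"
  by (rule ac_deriv_0_const[OF ac_deriv_cong_AE[OF D AE] t])

text \<open>The identities below are the Frenet equations for the curve and the rotated frame; the angle
  is obtained by integrating the curvature, so no lifting argument is needed.\<close>

lemma W22_arc_tangential_angle:
  assumes \<gamma>: "\<gamma> \<in> W22_arc L" and L: "L > 0" and ini: "velocity L \<gamma> 0 = unit_vec \<theta>0"
  obtains \<theta> k where "ac_deriv 0 L \<theta> k" "\<theta> 0 = \<theta>0" "is_curvature L \<gamma> k"
    "\<And>s. s \<in> {0..L} \<Longrightarrow> velocity L \<gamma> s = unit_vec (\<theta> s)"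
    "(\<lambda>s. (k s)\<^sup>2) absolutely_integrable_on {0..L}"
proof -
  let ?V = "velocity L \<gamma>"
  obtain w where D: "ac_deriv 0 L ?V w" and w: "L2_on {0<..<L} w"
    by (rule W22_arc_velocity_ac_deriv[OF \<gamma> L]) (rule that)
  have cV: "continuous_on {0..L} ?V" by (rule W22_arc_velocity(2)[OF \<gamma>])
  define V1 V2 w1 w2 where "V1 t = ?V t $ 1" and "V2 t = ?V t $ 2" and "w1 t = w t $ 1" and "w2 t = w t $ 2" for t
  have D1: "ac_deriv 0 L V1 w1" and D2: "ac_deriv 0 L V2 w2"
    unfolding V1_def[abs_def] V2_def[abs_def] w1_def[abs_def] w2_def[abs_def]
    by (rule ac_deriv_linear[OF D bounded_linear_vec_nth])+
  have c1: "continuous_on {0..L} V1" and c2: "continuous_on {0..L} V2"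
    by (rule ac_deriv_continuous_on[OF D1], rule ac_deriv_continuous_on[OF D2])
  have unit: "(V1 t)\<^sup>2 + (V2 t)\<^sup>2 = 1" if "t \<in> {0..L}" for t
    using \<gamma> that norm_sq_2[of "?V t"] unfolding W22_arc_def V1_def V2_def by simp
  \<comment> \<open>The normal component of the acceleration; the tangential one vanishes almost
    everywhere by differentiating |V|^2 = 1.\<close>
  define k where "k t = V1 t * w2 t - V2 t * w1 t" for t
  have ki: "k absolutely_integrable_on {0..L}"
    unfolding k_def[abs_def]
    by (intro set_integral_diff absolutely_integrable_continuous_mult c1 c2 ac_deriv_absint[OF D1] ac_deriv_absint[OF D2])
  have N: "ac_deriv 0 L (\<lambda>t. V1 t * V1 t + V2 t * V2 t)
      (\<lambda>t. (V1 t * w1 t + V1 t * w1 t) + (V2 t * w2 t + V2 t * w2 t))"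
    by (rule ac_deriv_add[OF ac_deriv_mult[OF D1 D1] ac_deriv_mult[OF D2 D2]])
  have "ac_deriv 0 L (\<lambda>t. 1::real) (\<lambda>t. (V1 t * w1 t + V1 t * w1 t) + (V2 t * w2 t + V2 t * w2 t))"
    by (rule ac_deriv_cong[OF N]) (use unit in \<open>simp_all add: power2_eq_square\<close>)
  moreover have "ac_deriv 0 L (\<lambda>t. 1::real) (\<lambda>t. 0)"
    by (rule ac_deriv_C1) (auto intro!: derivative_eq_intros)
  ultimately have "AE t in lebesgue. t \<in> {0..L} \<longrightarrow> (V1 t * w1 t + V1 t * w1 t) + (V2 t * w2 t + V2 t * w2 t) = 0"
    by (rule ac_deriv_unique_AE) (use L in simp)
  hence fr: "AE t in lebesgue. t \<in> {0..L} \<longrightarrow> w1 t = - k t * V2 t \<and> w2 t = k t * V1 t"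
  proof eventually_elim
    case (elim t)
    show ?case
    proof
      assume t: "t \<in> {0..L}"
      have z: "V1 t * w1 t + V2 t * w2 t = 0" using elim t by simp
      have u: "V1 t * V1 t + V2 t * V2 t = 1" using unit[OF t] by (simp add: power2_eq_square)
      have "w1 t * (V1 t * V1 t + V2 t * V2 t) = V1 t * (V1 t * w1 t + V2 t * w2 t) - k t * V2 t"
        "w2 t * (V1 t * V1 t + V2 t * V2 t) = V2 t * (V1 t * w1 t + V2 t * w2 t) + k t * V1 t"
        unfolding k_def by (simp_all add: algebra_simps)
      thus "w1 t = - k t * V2 t \<and> w2 t = k t * V1 t" unfolding z u by simp
    qed
  qed
  define \<theta> where "\<theta> s = \<theta>0 + integral {0..s} k" for s
  have T: "ac_deriv 0 L \<theta> k" unfolding \<theta>_def[abs_def] by (rule ac_deriv_indefinite[OF ki])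
  have T0: "\<theta> 0 = \<theta>0" unfolding \<theta>_def by simp
  have dc: "ac_deriv 0 L (\<lambda>t. cos (\<theta> t)) (\<lambda>t. - sin (\<theta> t) * k t)"
    by (rule ac_deriv_compose[OF T DERIV_cos]) (intro continuous_intros)
  have ds: "ac_deriv 0 L (\<lambda>t. sin (\<theta> t)) (\<lambda>t. cos (\<theta> t) * k t)"
    by (rule ac_deriv_compose[OF T DERIV_sin]) (intro continuous_intros)
  have dc': "ac_deriv 0 L (\<lambda>t. - cos (\<theta> t)) (\<lambda>t. - (- sin (\<theta> t) * k t))"
    using ac_deriv_linear[OF dc bounded_linear_minus[OF bounded_linear_ident]] .
  \<comment> \<open>\<open>C\<close> and \<open>S\<close> are the inner products of V with
    \<open>unit_vec (\<theta> t)\<close> and with its clockwise rotation. By the Frenet equations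
    both have zero density, so they keep their initial values 1 and 0.\<close>
  have C: "V1 t * cos (\<theta> t) + V2 t * sin (\<theta> t) = 1" if t: "t \<in> {0..L}" for t
  proof -
    have "V1 t * cos (\<theta> t) + V2 t * sin (\<theta> t) = V1 0 * cos (\<theta> 0) + V2 0 * sin (\<theta> 0)"
    proof (rule AE_zero_ac_deriv[OF ac_deriv_add[OF ac_deriv_mult[OF D1 dc] ac_deriv_mult[OF D2 ds]] _ t])
      show "AE t in lebesgue. t \<in> {0..L} \<longrightarrow> V1 t * (- sin (\<theta> t) * k t) + cos (\<theta> t) * w1 t +
          (V2 t * (cos (\<theta> t) * k t) + sin (\<theta> t) * w2 t) = 0"
        using fr by eventually_elim (simp add: algebra_simps)
    qed
    also have "\<dots> = 1" using ini unfolding V1_def V2_def T0 by (simp flip: power2_eq_square)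
    finally show ?thesis .
  qed
  have S: "V1 t * sin (\<theta> t) + V2 t * (- cos (\<theta> t)) = 0" if t: "t \<in> {0..L}" for t
  proof -
    have "V1 t * sin (\<theta> t) + V2 t * (- cos (\<theta> t)) = V1 0 * sin (\<theta> 0) + V2 0 * (- cos (\<theta> 0))"
    proof (rule AE_zero_ac_deriv[OF ac_deriv_add[OF ac_deriv_mult[OF D1 ds] ac_deriv_mult[OF D2 dc']] _ t])
      show "AE t in lebesgue. t \<in> {0..L} \<longrightarrow> V1 t * (cos (\<theta> t) * k t) + sin (\<theta> t) * w1 t +
          (V2 t * (- (- sin (\<theta> t) * k t)) + - cos (\<theta> t) * w2 t) = 0"
        using fr by eventually_elim (simp add: algebra_simps)
    qed
    also have "\<dots> = 0" using ini unfolding V1_def V2_def T0 by simp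
    finally show ?thesis .
  qed
  have V: "?V t = unit_vec (\<theta> t)" if t: "t \<in> {0..L}" for t
  proof -
    have u: "cos (\<theta> t) * cos (\<theta> t) + sin (\<theta> t) * sin (\<theta> t) = 1"
      using sin_cos_squared_add2[of "\<theta> t"] by (simp add: power2_eq_square)
    have "v1 * (c * c + s * s) = c * (v1 * c + v2 * s) + s * (v1 * s + v2 * (- c))"
      "v2 * (c * c + s * s) = s * (v1 * c + v2 * s) - c * (v1 * s + v2 * (- c))" for v1 v2 c s :: real
      by (simp_all add: algebra_simps)
    from this(1)[of "V1 t" "cos (\<theta> t)" "sin (\<theta> t)" "V2 t"] this(2)[of "V2 t" "cos (\<theta> t)" "sin (\<theta> t)" "V1 t"]
    have "V1 t * (cos (\<theta> t) * cos (\<theta> t) + sin (\<theta> t) * sin (\<theta> t)) =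
        cos (\<theta> t) * (V1 t * cos (\<theta> t) + V2 t * sin (\<theta> t)) + sin (\<theta> t) * (V1 t * sin (\<theta> t) + V2 t * (- cos (\<theta> t)))"
      "V2 t * (cos (\<theta> t) * cos (\<theta> t) + sin (\<theta> t) * sin (\<theta> t)) =
        sin (\<theta> t) * (V1 t * cos (\<theta> t) + V2 t * sin (\<theta> t)) - cos (\<theta> t) * (V1 t * sin (\<theta> t) + V2 t * (- cos (\<theta> t)))" .
    hence "V1 t = cos (\<theta> t)" "V2 t = sin (\<theta> t)" unfolding C[OF t] S[OF t] u by simp_all
    thus ?thesis unfolding V1_def V2_def by (simp add: vec_eq_iff forall_2)
  qed
  have k_le: "\<bar>k t\<bar> \<le> norm (w t)" if t: "t \<in> {0..L}" for t
  proof -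
    \<comment> \<open>Lagrange's identity: the acceleration dominates k, which makes k square
      integrable.\<close>
    have "(k t)\<^sup>2 + (V1 t * w1 t + V2 t * w2 t)\<^sup>2 = ((V1 t)\<^sup>2 + (V2 t)\<^sup>2) * ((w1 t)\<^sup>2 + (w2 t)\<^sup>2)"
      unfolding k_def by (simp add: power2_eq_square algebra_simps)
    also have "\<dots> = (norm (w t))\<^sup>2" using unit[OF t] norm_sq_2[of "w t"] unfolding w1_def w2_def by simp
    finally have "(k t)\<^sup>2 \<le> (norm (w t))\<^sup>2" using zero_le_power2[of "V1 t * w1 t + V2 t * w2 t"] by linarith
    thus ?thesis using abs_le_square_iff[of "k t" "norm (w t)"] by simp
  qed
  have km: "set_borel_measurable lebesgue {0<..<L} k"
    using set_integrable_subset[OF ki, of "{0<..<L}"] unfolding set_integrable_def set_borel_measurable_def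
    by (intro borel_measurable_integrable) force
  have L2k: "L2_on {0<..<L} k" unfolding L2_on_def
  proof
    show "set_integrable lebesgue {0<..<L} (\<lambda>s. (norm (k s))\<^sup>2)"
    proof (rule set_integrable_bound)
      show "set_integrable lebesgue {0<..<L} (\<lambda>s. (norm (w s))\<^sup>2)" using w unfolding L2_on_def by blast
      have "(\<lambda>x. (indicat_real {0<..<L} x *\<^sub>R k x)\<^sup>2) \<in> borel_measurable lebesgue"
        using km unfolding set_borel_measurable_def by (rule borel_measurable_power)
      moreover have "(\<lambda>x. (indicat_real {0<..<L} x *\<^sub>R k x)\<^sup>2) = (\<lambda>x. indicat_real {0<..<L} x *\<^sub>R (norm (k x))\<^sup>2)"
        by (rule ext) (simp add: indicator_def)
      ultimately show "set_borel_measurable lebesgue {0<..<L} (\<lambda>s. (norm (k s))\<^sup>2)"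
        unfolding set_borel_measurable_def by simp
      have "(norm (k t))\<^sup>2 \<le> (norm (w t))\<^sup>2" if "t \<in> {0<..<L}" for t
        using k_le[of t] that by (intro power_mono) auto
      thus "AE x in lebesgue. x \<in> {0<..<L} \<longrightarrow> norm ((norm (k x))\<^sup>2) \<le> norm ((norm (w x))\<^sup>2)"
        by (intro AE_I2) simp
    qed
  qed (fact km)
  have "AE t in lebesgue. t \<in> {0..L} \<longrightarrow> w t = k t *\<^sub>R rot90 (?V t)"
    using fr
  proof eventually_elim
    case (elim t)
    thus ?case unfolding w1_def w2_def V1_def V2_def by (simp add: vec_eq_iff forall_2)
  qed
  from ac_deriv_imp_weak_deriv[OF ac_deriv_cong_AE[OF D this] L]
  have "is_curvature L \<gamma> k" unfolding is_curvature_def using L2k by blast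
  from that[OF T T0 this V L2_on_square_integrable[OF L2k]] show ?thesis .
qed

lemma W22_arc_displacement:
  assumes "\<gamma> \<in> W22_arc L" and "s \<in> {0..L}"
  shows "((velocity L \<gamma>) has_integral (\<gamma> s - \<gamma> 0)) {0..s}"
proof (rule fundamental_theorem_of_calculus)
  show "0 \<le> s" using assms(2) by simp
  fix t assume "t \<in> {0..s}"
  thus "(\<gamma> has_vector_derivative velocity L \<gamma> t) (at t within {0..s})"
    using assms(2) by (intro has_vector_derivative_within_subset[OF W22_arc_velocity(1)[OF assms(1)]]) auto
qed

section \<open>Curves generated by a continuously differentiable angle\<close>

context
  fixes L :: real and \<theta> k :: "real \<Rightarrow> real" and \<gamma> :: "real \<Rightarrow> real^2"
  assumes L: "L > 0" and d\<theta>: "\<And>s. s \<in> {0..L} \<Longrightarrow> (\<theta> has_real_derivative k s) (at s within {0..L})"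
    and ck: "continuous_on {0..L} k" and \<gamma>: "\<And>s. \<gamma> s = integral {0..s} (\<lambda>u. unit_vec (\<theta> u))"
begin

lemma curve_of_angle_continuous: "continuous_on {0..L} (\<lambda>s. unit_vec (\<theta> s))"
  by (rule continuous_on_unit_vec[OF DERIV_continuous_on[OF d\<theta>]])

lemma curve_of_angle_derivative:
  assumes "s \<in> {0..L}"
  shows "(\<gamma> has_vector_derivative unit_vec (\<theta> s)) (at s within {0..L})"
  unfolding \<gamma>[abs_def] by (rule integral_has_vector_derivative[OF curve_of_angle_continuous assms])

lemma curve_of_angle_velocity: "s \<in> {0..L} \<Longrightarrow> velocity L \<gamma> s = unit_vec (\<theta> s)"
  unfolding velocity_def
  by (rule vector_derivative_within[OF at_within_Icc_nontrivial[OF L] curve_of_angle_derivative])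

lemma curve_of_angle_ac_deriv:
  "ac_deriv 0 L (\<lambda>s. unit_vec (\<theta> s)) (\<lambda>s. k s *\<^sub>R rot90 (unit_vec (\<theta> s)))"
  by (rule ac_deriv_C1[OF unit_vec_has_vector_derivative[OF d\<theta>]], assumption)
    (intro continuous_on_scaleR continuous_on_rot90 curve_of_angle_continuous ck)

lemma curve_of_angle_W22_arc: "\<gamma> \<in> W22_arc L"
proof -
  have 1: "ac_deriv 0 L \<gamma> (\<lambda>s. unit_vec (\<theta> s))"
    by (rule ac_deriv_C1[OF curve_of_angle_derivative curve_of_angle_continuous])
  have "\<gamma> \<in> W22 L" unfolding W22_def mem_Collect_eq
  proof (intro exI conjI)
    show "L2_on {0<..<L} \<gamma>" by (rule L2_on_continuous[OF ac_deriv_continuous_on[OF 1]])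
    show "L2_on {0<..<L} (\<lambda>s. unit_vec (\<theta> s))" by (rule L2_on_continuous[OF curve_of_angle_continuous])
    show "L2_on {0<..<L} (\<lambda>s. k s *\<^sub>R rot90 (unit_vec (\<theta> s)))"
      by (intro L2_on_continuous continuous_on_scaleR continuous_on_rot90 curve_of_angle_continuous ck)
    show "has_weak_deriv L \<gamma> (\<lambda>s. unit_vec (\<theta> s))" by (rule ac_deriv_imp_weak_deriv[OF 1 L])
    show "has_weak_deriv L (\<lambda>s. unit_vec (\<theta> s)) (\<lambda>s. k s *\<^sub>R rot90 (unit_vec (\<theta> s)))"
      by (rule ac_deriv_imp_weak_deriv[OF curve_of_angle_ac_deriv L])
  qed
  moreover have "Ck_on (Suc 0) {0..L} \<gamma>"
  proof (rule Ck_on_Suc[OF at_within_Icc_nontrivial[OF L] curve_of_angle_derivative])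
    show "Ck_on 0 {0..L} (\<lambda>s. unit_vec (\<theta> s))" using curve_of_angle_continuous by (simp add: Ck_on_def)
  qed
  ultimately show ?thesis unfolding W22_arc_def using curve_of_angle_velocity by simp
qed

lemma curve_of_angle_is_curvature: "is_curvature L \<gamma> k"
  unfolding is_curvature_def
proof
  show "L2_on {0<..<L} k" by (rule L2_on_continuous[OF ck])
  have "ac_deriv 0 L (velocity L \<gamma>) (\<lambda>s. k s *\<^sub>R rot90 (velocity L \<gamma> s))"
    by (rule ac_deriv_cong[OF curve_of_angle_ac_deriv]) (simp_all add: curve_of_angle_velocity)
  thus "has_weak_deriv L (velocity L \<gamma>) (\<lambda>s. k s *\<^sub>R rot90 (velocity L \<gamma> s))"
    by (rule ac_deriv_imp_weak_deriv[OF _ L])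
qed

end

section \<open>Calibration of the pendulum action\<close>

text \<open>The potential equals 2 \<rho> (1 - cos x). The density k is a separate argument because
  a competitor x is only absolutely continuous, which determines k up to null sets.\<close>

definition pendulum_action :: "real \<Rightarrow> real \<Rightarrow> (real \<Rightarrow> real) \<Rightarrow> (real \<Rightarrow> real) \<Rightarrow> real" where
  "pendulum_action L \<rho> x k = integral {0..L} (\<lambda>s. (k s)\<^sup>2 + 4 * \<rho> * (sin (x s / 2))\<^sup>2)"

lemma ac_deriv_half_angle:
  fixes x k :: "real \<Rightarrow> real"
  assumes "ac_deriv 0 L x k"
  shows "ac_deriv 0 L (\<lambda>s. 2 * sin (x s / 2)) (\<lambda>s. cos (x s / 2) * k s)"
    and "ac_deriv 0 L (\<lambda>s. cos (x s / 2)) (\<lambda>s. - sin (x s / 2) / 2 * k s)"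
proof -
  show "ac_deriv 0 L (\<lambda>s. 2 * sin (x s / 2)) (\<lambda>s. cos (x s / 2) * k s)"
    by (rule ac_deriv_compose[OF assms, where \<phi>="\<lambda>u. 2 * sin (u / 2)"])
       (auto intro!: derivative_eq_intros continuous_intros)
  show "ac_deriv 0 L (\<lambda>s. cos (x s / 2)) (\<lambda>s. - sin (x s / 2) / 2 * k s)"
    by (rule ac_deriv_compose[OF assms, where \<phi>="\<lambda>u. cos (u / 2)"])
       (auto intro!: derivative_eq_intros continuous_intros)
qed

context
  fixes L \<rho> :: real and X K :: "real \<Rightarrow> real"
  assumes L: "L > 0" and \<rho>: "\<rho> > 0"
    and dX: "\<And>s. s \<in> {0..L} \<Longrightarrow> (X has_real_derivative K s) (at s within {0..L})"
    and dK: "\<And>s. s \<in> {0..L} \<Longrightarrow> (K has_real_derivative \<rho> * sin (X s)) (at s within {0..L})"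
    and cosX: "\<And>s. s \<in> {0..L} \<Longrightarrow> cos (X s / 2) > 0"
begin

text \<open>With y = 2 sin (X / 2) the kinetic term is y'^2 / (1 - y^2 / 4), and its conjugate
  momentum is twice this quotient.\<close>

definition slope :: "real \<Rightarrow> real" where "slope s = K s / cos (X s / 2)"

text \<open>The Euler-Lagrange equation for y = 2 sin (X / 2). The factor \<rho> + slope^2 / 4
  reappears as the coefficient of the square in the calibration, and its positivity is the convexity
  exploited there.\<close>

lemma slope_derivative:
  assumes s: "s \<in> {0..L}"
  shows "(slope has_real_derivative (\<rho> + (slope s)\<^sup>2 / 4) * (2 * sin (X s / 2))) (at s within {0..L})"
proof -
  let ?c = "cos (X s / 2)"
  have c: "?c \<noteq> 0" using cosX[OF s] by simp
  have dh: "((\<lambda>s. X s / 2) has_real_derivative K s / 2) (at s within {0..L})"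
    using DERIV_cdivide[OF dX[OF s], of 2] .
  have dc: "((\<lambda>s. cos (X s / 2)) has_real_derivative - sin (X s / 2) * (K s / 2)) (at s within {0..L})"
    by (rule DERIV_chain2[OF DERIV_cos dh])
  have "(slope has_real_derivative (\<rho> * sin (X s) * ?c - K s * (- sin (X s / 2) * (K s / 2))) / (?c * ?c)) (at s within {0..L})"
    unfolding slope_def[abs_def] by (rule DERIV_divide[OF dK[OF s] dc c])
  moreover have "sin (X s) = 2 * sin (X s / 2) * ?c" using sin_double[of "X s / 2"] by simp
  hence "(\<rho> * sin (X s) * ?c - K s * (- sin (X s / 2) * (K s / 2))) / (?c * ?c) = (\<rho> + (slope s)\<^sup>2 / 4) * (2 * sin (X s / 2))"
    using c unfolding slope_def by (simp add: field_simps power2_eq_square)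
  ultimately show ?thesis by simp
qed

lemma continuous_X: "continuous_on {0..L} X" by (rule DERIV_continuous_on[OF dX])
lemma continuous_K: "continuous_on {0..L} K" by (rule DERIV_continuous_on[OF dK])
lemma continuous_slope: "continuous_on {0..L} slope" by (rule DERIV_continuous_on[OF slope_derivative])

lemma slope_ac_deriv: "ac_deriv 0 L slope (\<lambda>s. (\<rho> + (slope s)\<^sup>2 / 4) * (2 * sin (X s / 2)))"
proof (rule ac_deriv_C1)
  show "continuous_on {0..L} (\<lambda>s. (\<rho> + (slope s)\<^sup>2 / 4) * (2 * sin (X s / 2)))"
    by (intro continuous_intros continuous_X continuous_slope) simp_all
qed (use slope_derivative in \<open>simp add: has_real_derivative_iff_has_vector_derivative\<close>)

lemma solution_ac_deriv: "ac_deriv 0 L X K"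
  by (rule ac_deriv_C1) (use dX continuous_K in \<open>simp_all add: has_real_derivative_iff_has_vector_derivative\<close>)

text \<open>Completing squares: in the variable \<open>2 sin (x/2)\<close> the action is convex, and \<open>slope\<close> is
  the calibrating momentum.\<close>

lemma calibration_identity:
  assumes x: "ac_deriv 0 L x k" and k2: "(\<lambda>s. (k s)\<^sup>2) absolutely_integrable_on {0..L}"
  shows "pendulum_action L \<rho> x k =
     integral {0..L} (\<lambda>s. (k s - slope s * cos (x s / 2))\<^sup>2)
     + integral {0..L} (\<lambda>s. (\<rho> + (slope s)\<^sup>2 / 4) * (2 * sin (x s / 2) - 2 * sin (X s / 2))\<^sup>2)
     + 2 * (slope L * (2 * sin (x L / 2)) - slope 0 * (2 * sin (x 0 / 2)))
     - integral {0..L} (\<lambda>s. (\<rho> + (slope s)\<^sup>2 / 4) * (2 * sin (X s / 2))\<^sup>2 + (slope s)\<^sup>2)"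
proof -
  let ?E1 = "\<lambda>s. (k s - slope s * cos (x s / 2))\<^sup>2"
  let ?E2 = "\<lambda>s. (\<rho> + (slope s)\<^sup>2 / 4) * (2 * sin (x s / 2) - 2 * sin (X s / 2))\<^sup>2"
  let ?E3 = "\<lambda>s. slope s * (cos (x s / 2) * k s) + 2 * sin (x s / 2) * ((\<rho> + (slope s)\<^sup>2 / 4) * (2 * sin (X s / 2)))"
  let ?E4 = "\<lambda>s. (\<rho> + (slope s)\<^sup>2 / 4) * (2 * sin (X s / 2))\<^sup>2 + (slope s)\<^sup>2"
  have cx: "continuous_on {0..L} x" by (rule ac_deriv_continuous_on[OF x])
  have prod: "ac_deriv 0 L (\<lambda>s. slope s * (2 * sin (x s / 2))) ?E3"
    by (rule ac_deriv_mult[OF slope_ac_deriv ac_deriv_half_angle(1)[OF x]])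
  have i3: "?E3 integrable_on {0..L}" by (rule set_lebesgue_integral_eq_integral(1)[OF ac_deriv_absint[OF prod]])
  have I3: "integral {0..L} ?E3 = slope L * (2 * sin (x L / 2)) - slope 0 * (2 * sin (x 0 / 2))"
    using ac_derivD[OF prod, of 0 L] L by simp
  have i2: "?E2 integrable_on {0..L}"
    by (intro integrable_continuous_real continuous_intros continuous_X continuous_slope cx) simp_all
  have i4: "?E4 integrable_on {0..L}"
    by (intro integrable_continuous_real continuous_intros continuous_X continuous_slope) simp_all
  have i1: "?E1 integrable_on {0..L}"
  proof -
    have "continuous_on {0..L} (\<lambda>s. 2 * (slope s * cos (x s / 2)))"
      by (intro continuous_intros continuous_slope cx) simp_all
    from absolutely_integrable_continuous_mult[OF this ac_deriv_absint[OF x]]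
    have j1: "(\<lambda>s. 2 * (slope s * cos (x s / 2)) * k s) integrable_on {0..L}" by (rule set_lebesgue_integral_eq_integral)
    have j2: "(\<lambda>s. (slope s * cos (x s / 2))\<^sup>2) integrable_on {0..L}"
      by (intro integrable_continuous_real continuous_intros continuous_slope cx) simp_all
    have "(\<lambda>s. (k s)\<^sup>2 - 2 * (slope s * cos (x s / 2)) * k s + (slope s * cos (x s / 2))\<^sup>2) integrable_on {0..L}"
      by (intro Henstock_Kurzweil_Integration.integrable_add Henstock_Kurzweil_Integration.integrable_diff j1 j2
           set_lebesgue_integral_eq_integral(1)[OF k2])
    thus ?thesis by (simp add: power2_diff algebra_simps)
  qed
  \<comment> \<open>The mixed terms of the two squares cancel against 2 E3, the density of the
    boundary term; E4 involves only the fixed solution.\<close>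
  have pw: "(k s)\<^sup>2 + 4 * \<rho> * (sin (x s / 2))\<^sup>2 = ?E1 s + ?E2 s + 2 * ?E3 s - ?E4 s" for s
  proof -
    have c2: "(cos (x s / 2))\<^sup>2 = 1 - (sin (x s / 2))\<^sup>2" by (rule cos_squared_eq)
    have "?E1 s + ?E2 s + 2 * ?E3 s - ?E4 s =
      (k s)\<^sup>2 + (slope s)\<^sup>2 * (cos (x s / 2))\<^sup>2 + 4 * (\<rho> + (slope s)\<^sup>2 / 4) * (sin (x s / 2))\<^sup>2 - (slope s)\<^sup>2"
      by (simp add: power2_eq_square algebra_simps)
    thus ?thesis unfolding c2 by (simp add: power2_eq_square algebra_simps)
  qed
  have "((\<lambda>s. ?E1 s + ?E2 s + 2 * ?E3 s - ?E4 s) has_integral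
     (integral {0..L} ?E1 + integral {0..L} ?E2 + 2 * integral {0..L} ?E3 - integral {0..L} ?E4)) {0..L}"
    by (intro has_integral_add has_integral_diff has_integral_mult_right integrable_integral i1 i2 i3 i4)
  hence "((\<lambda>s. (k s)\<^sup>2 + 4 * \<rho> * (sin (x s / 2))\<^sup>2) has_integral
     (integral {0..L} ?E1 + integral {0..L} ?E2 + 2 * integral {0..L} ?E3 - integral {0..L} ?E4)) {0..L}"
    unfolding pw .
  thus ?thesis unfolding pendulum_action_def I3 by (rule integral_unique)
qed

lemma pendulum_action_solution:
  "pendulum_action L \<rho> X K = 2 * (slope L * (2 * sin (X L / 2)) - slope 0 * (2 * sin (X 0 / 2)))
     - integral {0..L} (\<lambda>s. (\<rho> + (slope s)\<^sup>2 / 4) * (2 * sin (X s / 2))\<^sup>2 + (slope s)\<^sup>2)"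
proof -
  have "(\<lambda>s. (K s)\<^sup>2) absolutely_integrable_on {0..L}"
    by (intro absolutely_integrable_continuous_real continuous_intros continuous_K)
  moreover have "integral {0..L} (\<lambda>s. (K s - slope s * cos (X s / 2))\<^sup>2) = integral {0..L} (\<lambda>s. 0)"
  proof (rule Henstock_Kurzweil_Integration.integral_cong)
    fix s assume "s \<in> {0..L}"
    thus "(K s - slope s * cos (X s / 2))\<^sup>2 = 0" using cosX[of s] unfolding slope_def by simp
  qed
  ultimately show ?thesis using calibration_identity[OF solution_ac_deriv] by simp
qed

text \<open>With equal end values, \<open>calibration_identity\<close> leaves two nonnegative
  integrals as the excess. If the excess is zero, the continuous second integrand vanishes
  everywhere, and its coefficient is at least \<rho>.\<close>

lemma pendulum_action_minimal:
  assumes x: "ac_deriv 0 L x k" and k2: "(\<lambda>s. (k s)\<^sup>2) absolutely_integrable_on {0..L}"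
    and ends: "sin (x 0 / 2) = sin (X 0 / 2)" "sin (x L / 2) = sin (X L / 2)"
  shows "pendulum_action L \<rho> X K \<le> pendulum_action L \<rho> x k"
    and "pendulum_action L \<rho> x k \<le> pendulum_action L \<rho> X K \<Longrightarrow> s \<in> {0..L} \<Longrightarrow> sin (x s / 2) = sin (X s / 2)"
proof -
  let ?E1 = "\<lambda>s. (k s - slope s * cos (x s / 2))\<^sup>2"
  let ?E2 = "\<lambda>s. (\<rho> + (slope s)\<^sup>2 / 4) * (2 * sin (x s / 2) - 2 * sin (X s / 2))\<^sup>2"
  have eq: "pendulum_action L \<rho> x k = pendulum_action L \<rho> X K + integral {0..L} ?E1 + integral {0..L} ?E2"
    unfolding calibration_identity[OF x k2] pendulum_action_solution ends by simp
  have nn1: "0 \<le> integral {0..L} ?E1"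
  \<comment> \<open>\<open>integral\<close> is 0 by default for a non-integrable function, so the
    sign is right in either case.\<close>
  proof (cases "?E1 integrable_on {0..L}")
    case True thus ?thesis by (rule Henstock_Kurzweil_Integration.integral_nonneg) simp
  qed (simp add: not_integrable_integral)
  have nn: "?E2 s \<ge> 0" for s using \<rho> by (simp add: add_nonneg_nonneg)
  have cx: "continuous_on {0..L} x" by (rule ac_deriv_continuous_on[OF x])
  have c2: "continuous_on {0..L} ?E2"
    by (intro continuous_intros continuous_X continuous_slope cx) simp_all
  have nn2: "0 \<le> integral {0..L} ?E2"
    by (rule Henstock_Kurzweil_Integration.integral_nonneg[OF integrable_continuous_real[OF c2] nn])
  show "pendulum_action L \<rho> X K \<le> pendulum_action L \<rho> x k" using eq nn1 nn2 by linarith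
  assume le: "pendulum_action L \<rho> x k \<le> pendulum_action L \<rho> X K" and s: "s \<in> {0..L}"
  have "integral {0..L} ?E2 = 0" using le eq nn1 nn2 by linarith
  hence "?E2 s = 0" using integral_eq_0_iff[OF c2 L nn] s by blast
  moreover have "\<rho> + (slope s)\<^sup>2 / 4 \<noteq> 0" using \<rho> zero_le_power2[of "slope s"] by linarith
  ultimately show "sin (x s / 2) = sin (X s / 2)" by simp
qed

end

section \<open>Lower bounds for competitors of odd parity\<close>

text \<open>The inequality k^2 + 4 \<rho> sin^2 (x / 2) \<ge> 4 sqrt \<rho> |sin (x / 2)| |k| bounds
  the action below by 8 sqrt \<rho> times the total variation of cos (x / 2), here estimated through
  the intermediate point t.\<close>

lemma pendulum_action_lower_bound:
  assumes x: "ac_deriv 0 L x k" and k2: "(\<lambda>s. (k s)\<^sup>2) absolutely_integrable_on {0..L}"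
    and \<rho>: "\<rho> > 0" and t: "t \<in> {0..L}"
  shows "8 * sqrt \<rho> * (\<bar>cos (x t / 2) - cos (x 0 / 2)\<bar> + \<bar>cos (x L / 2) - cos (x t / 2)\<bar>) \<le> pendulum_action L \<rho> x k"
proof -
  let ?z = "\<lambda>s. cos (x s / 2)" and ?z' = "\<lambda>s. - sin (x s / 2) / 2 * k s"
  have z: "ac_deriv 0 L ?z ?z'" by (rule ac_deriv_half_angle(2)[OF x])
  have cx: "continuous_on {0..L} x" by (rule ac_deriv_continuous_on[OF x])
  have ai: "?z' absolutely_integrable_on {0..L}" by (rule ac_deriv_absint[OF z])
  have absi: "(\<lambda>s. \<bar>?z' s\<bar>) integrable_on {0..L}"
    by (rule set_lebesgue_integral_eq_integral(1)[OF set_integrable_abs[OF ai]])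
  have inc: "\<bar>?z v - ?z u\<bar> \<le> integral {u..v} (\<lambda>s. \<bar>?z' s\<bar>)" if "0 \<le> u" "u \<le> v" "v \<le> L" for u v
  proof -
    have sub: "{u..v} \<subseteq> {0..L}" using that by auto
    have "norm (integral {u..v} ?z') \<le> integral {u..v} (\<lambda>s. \<bar>?z' s\<bar>)"
      by (rule integral_norm_bound_integral)
       (use integrable_on_subinterval[OF absi sub] integrable_on_subinterval[OF set_lebesgue_integral_eq_integral(1)[OF ai] sub] in simp_all)
    thus ?thesis using ac_derivD[OF z that] by simp
  qed
  have "\<bar>?z t - ?z 0\<bar> + \<bar>?z L - ?z t\<bar> \<le> integral {0..t} (\<lambda>s. \<bar>?z' s\<bar>) + integral {t..L} (\<lambda>s. \<bar>?z' s\<bar>)"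
    using t by (intro add_mono inc) auto
  also have "\<dots> = integral {0..L} (\<lambda>s. \<bar>?z' s\<bar>)"
    using t by (intro Henstock_Kurzweil_Integration.integral_combine absi) auto
  finally have "8 * sqrt \<rho> * (\<bar>?z t - ?z 0\<bar> + \<bar>?z L - ?z t\<bar>) \<le> 8 * sqrt \<rho> * integral {0..L} (\<lambda>s. \<bar>?z' s\<bar>)"
    using \<rho> by (intro mult_left_mono) auto
  also have "\<dots> = integral {0..L} (\<lambda>s. 8 * sqrt \<rho> * \<bar>?z' s\<bar>)" by simp
  also have "\<dots> \<le> pendulum_action L \<rho> x k"
    unfolding pendulum_action_def
  proof (rule integral_le)
    show "(\<lambda>s. 8 * sqrt \<rho> * \<bar>?z' s\<bar>) integrable_on {0..L}" using absi by (rule integrable_on_mult_right)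
    show "(\<lambda>s. (k s)\<^sup>2 + 4 * \<rho> * (sin (x s / 2))\<^sup>2) integrable_on {0..L}"
      by (intro Henstock_Kurzweil_Integration.integrable_add set_lebesgue_integral_eq_integral(1)[OF k2]
           integrable_continuous_real continuous_intros cx) simp_all
    fix s assume "s \<in> {0..L}"
    have "0 \<le> (\<bar>k s\<bar> - 2 * sqrt \<rho> * \<bar>sin (x s / 2)\<bar>)\<^sup>2" by simp
    also have "\<dots> = (k s)\<^sup>2 + 4 * \<rho> * (sin (x s / 2))\<^sup>2 - 4 * sqrt \<rho> * (\<bar>sin (x s / 2)\<bar> * \<bar>k s\<bar>)"
      using \<rho> by (simp add: power2_diff power_mult_distrib)
    finally show "8 * sqrt \<rho> * \<bar>?z' s\<bar> \<le> (k s)\<^sup>2 + 4 * \<rho> * (sin (x s / 2))\<^sup>2"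
      by (simp add: abs_mult mult_ac)
  qed
  finally show ?thesis .
qed

text \<open>A competitor whose half angle changes its parity pays for an additional half turn.\<close>

lemma pendulum_action_odd_lower_bound:
  assumes x: "ac_deriv 0 L x k" and k2: "(\<lambda>s. (k s)\<^sup>2) absolutely_integrable_on {0..L}"
    and \<rho>: "\<rho> > 0" and L: "L > 0" and \<eta>: "0 < \<eta>" "\<eta> < 1"
    and ends: "cos (x 0 / 2) = c0" "cos (x L / 2) = - c1"
  shows "min (8 * sqrt \<rho> * (2 - 2 * \<eta> - \<bar>c0 - c1\<bar>)) (4 * \<rho> * \<eta> * L) \<le> pendulum_action L \<rho> x k"
\<comment> \<open>Either the direction comes close to the axis, and cos (x / 2) has to travel from
  c0 to nearly 1 or -1 and on to -c1; or sin^2 (x / 2) stays above \<eta> and the potential alone is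
  large.\<close>
proof (cases "\<exists>t\<in>{0..L}. \<bar>cos (x t / 2)\<bar> \<ge> 1 - \<eta>")
  case True
  then obtain t where t: "t \<in> {0..L}" "\<bar>cos (x t / 2)\<bar> \<ge> 1 - \<eta>" by blast
  have "2 - 2 * \<eta> - \<bar>c0 - c1\<bar> \<le> \<bar>cos (x t / 2) - c0\<bar> + \<bar>- c1 - cos (x t / 2)\<bar>"
    using t(2) by linarith
  hence "8 * sqrt \<rho> * (2 - 2 * \<eta> - \<bar>c0 - c1\<bar>) \<le> 8 * sqrt \<rho> * (\<bar>cos (x t / 2) - c0\<bar> + \<bar>- c1 - cos (x t / 2)\<bar>)"
    using \<rho> by (intro mult_left_mono) auto
  also have "\<dots> \<le> pendulum_action L \<rho> x k"
    using pendulum_action_lower_bound[OF x k2 \<rho> t(1)] unfolding ends .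
  finally show ?thesis by simp
next
  case False
  have cx: "continuous_on {0..L} x" by (rule ac_deriv_continuous_on[OF x])
  have "4 * \<rho> * \<eta> * L = integral {0..L} (\<lambda>s. 4 * \<rho> * \<eta>)" using L by simp
  also have "\<dots> \<le> pendulum_action L \<rho> x k"
    unfolding pendulum_action_def
  proof (rule integral_le)
    show "(\<lambda>s. (k s)\<^sup>2 + 4 * \<rho> * (sin (x s / 2))\<^sup>2) integrable_on {0..L}"
      by (intro Henstock_Kurzweil_Integration.integrable_add set_lebesgue_integral_eq_integral(1)[OF k2]
           integrable_continuous_real continuous_intros cx) simp_all
    fix s assume "s \<in> {0..L}"
    hence "\<bar>cos (x s / 2)\<bar> \<le> 1 - \<eta>" using False by force
    hence "(cos (x s / 2))\<^sup>2 \<le> (1 - \<eta>)\<^sup>2" using power_mono[of "\<bar>cos (x s / 2)\<bar>" "1 - \<eta>" 2] by simp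
    also have "\<dots> \<le> 1 - \<eta>"
      using mult_left_le_one_le[of "1 - \<eta>" "1 - \<eta>"] \<eta> by (simp add: power2_eq_square)
    finally have "\<eta> \<le> (sin (x s / 2))\<^sup>2" using sin_squared_eq[of "x s / 2"] by linarith
    hence "4 * \<rho> * \<eta> \<le> 4 * \<rho> * (sin (x s / 2))\<^sup>2" using \<rho> by (intro mult_left_mono) auto
    thus "4 * \<rho> * \<eta> \<le> (k s)\<^sup>2 + 4 * \<rho> * (sin (x s / 2))\<^sup>2" using zero_le_power2[of "k s"] by linarith
  qed (rule integrable_const_ivl)
  finally show ?thesis by simp
qed

text \<open>The squares of the cosines agree, so cos (x / 2) cannot vanish; starting positive, it
  stays positive by continuity.\<close>

lemma cos_half_eq_of_sin_half_eq:
  fixes x X :: "real \<Rightarrow> real"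
  assumes cx: "continuous_on {0..L} x" and cosX: "\<And>s. s \<in> {0..L} \<Longrightarrow> cos (X s / 2) > 0"
    and eq: "\<And>s. s \<in> {0..L} \<Longrightarrow> sin (x s / 2) = sin (X s / 2)"
    and ini: "cos (x 0 / 2) > 0" and s: "s \<in> {0..L}"
  shows "cos (x s / 2) = cos (X s / 2)"
proof -
  have sq: "(cos (x t / 2))\<^sup>2 = (cos (X t / 2))\<^sup>2" if "t \<in> {0..L}" for t
    using eq[OF that] by (simp add: cos_squared_eq)
  have "cos (x s / 2) > 0"
  proof (rule ccontr)
    assume neg: "\<not> cos (x s / 2) > 0"
    have "continuous_on {0..s} (\<lambda>t. cos (x t / 2))"
      by (intro continuous_intros continuous_on_subset[OF cx]) (use s in auto)
    moreover have "cos (x s / 2) \<le> 0" "0 \<le> cos (x 0 / 2)" "0 \<le> s" using neg ini s by auto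
    ultimately obtain t where "0 \<le> t" "t \<le> s" "cos (x t / 2) = 0"
      using IVT2'[of "\<lambda>t. cos (x t / 2)" s 0 0] by blast
    thus False using sq[of t] cosX[of t] s by simp
  qed
  thus ?thesis using sq[OF s] cosX[OF s] by (simp add: power2_eq_iff_nonneg)
qed

lemma integral_unit_vec:
  fixes \<theta> :: "real \<Rightarrow> real"
  assumes c: "continuous_on {0..L} \<theta>"
  shows "integral {0..L} (\<lambda>s. unit_vec (\<theta> s)) =
    vector [integral {0..L} (\<lambda>s. cos (\<theta> s)), integral {0..L} (\<lambda>s. sin (\<theta> s))]"
proof -
  have i: "(\<lambda>s. unit_vec (\<theta> s)) integrable_on {0..L}"
    by (rule integrable_continuous_real[OF continuous_on_unit_vec[OF c]])
  have "integral {0..L} (\<lambda>s. unit_vec (\<theta> s)) $ j = integral {0..L} (\<lambda>s. unit_vec (\<theta> s) $ j)" for j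
    using integral_linear[OF i bounded_linear_vec_nth[of j]] by (simp add: o_def)
  thus ?thesis by (simp add: vec_eq_iff forall_2)
qed

lemma cos_half_angle: "cos y = 1 - 2 * (sin (y / 2))\<^sup>2" for y :: real
  using cos_double_sin[of "y / 2"] by simp

lemma sin_half_angle: "sin y = 2 * sin (y / 2) * cos (y / 2)" for y :: real
  using sin_double[of "y / 2"] by simp

lemma pendulum_action_closing:
  fixes \<theta> k :: "real \<Rightarrow> real"
  assumes \<theta>: "ac_deriv 0 L \<theta> k" and k2: "(\<lambda>s. (k s)\<^sup>2) absolutely_integrable_on {0..L}" and L: "L > 0"
    and close: "integral {0..L} (\<lambda>s. cos (\<theta> s)) = l" "integral {0..L} (\<lambda>s. sin (\<theta> s)) = 0"
  shows "pendulum_action L \<rho> (\<lambda>s. \<theta> s - \<alpha>) k = integral {0..L} (\<lambda>s. (k s)\<^sup>2) + 2 * \<rho> * (L - cos \<alpha> * l)"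
proof -
  have c: "continuous_on {0..L} \<theta>" by (rule ac_deriv_continuous_on[OF \<theta>])
  have i1: "(\<lambda>s. cos (\<theta> s)) integrable_on {0..L}" and i2: "(\<lambda>s. sin (\<theta> s)) integrable_on {0..L}"
    by (intro integrable_continuous_real continuous_on_cos continuous_on_sin c)+
  have one: "((\<lambda>s. 1::real) has_integral L) {0..L}" using has_integral_const_real[of "1::real" 0 L] L by simp
  have "((\<lambda>s. (k s)\<^sup>2 + 2 * \<rho> * (1 - (cos \<alpha> * cos (\<theta> s) + sin \<alpha> * sin (\<theta> s)))) has_integral
    (integral {0..L} (\<lambda>s. (k s)\<^sup>2) + 2 * \<rho> * (L - (cos \<alpha> * l + sin \<alpha> * 0)))) {0..L}"
    using integrable_integral[OF i1] integrable_integral[OF i2] unfolding close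
    by (intro has_integral_add has_integral_diff has_integral_mult_right integrable_integral
        one set_lebesgue_integral_eq_integral(1)[OF k2])
  moreover have "2 * \<rho> * (1 - (cos \<alpha> * cos (\<theta> s) + sin \<alpha> * sin (\<theta> s))) = 4 * \<rho> * (sin ((\<theta> s - \<alpha>) / 2))\<^sup>2" for s
  proof -
    have "cos \<alpha> * cos (\<theta> s) + sin \<alpha> * sin (\<theta> s) = cos (\<theta> s - \<alpha>)"
      by (simp add: cos_diff)
    also have "\<dots> = 1 - 2 * (sin ((\<theta> s - \<alpha>) / 2))\<^sup>2" by (rule cos_half_angle)
    finally show ?thesis by simp
  qed
  ultimately show ?thesis unfolding pendulum_action_def using L by (simp add: integral_unique)
qed

lemma unit_vec_eq_iff: "unit_vec x = unit_vec y \<longleftrightarrow> (\<exists>n::int. x = y + 2 * pi * n)"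
  using sin_cos_eq_iff[of x y] by (auto simp: vec_eq_iff forall_2)

text \<open>\<open>gap\<close> excludes the competitors whose final angle differs from \<theta>1 by
  an odd multiple of 2 \<pi>. The even ones fall under the calibration, whose end conditions involve
  only the sines of the half angles.\<close>

theorem unique_minimiser:
  fixes \<Theta> K :: "real \<Rightarrow> real"
  assumes L: "L > 0" and \<rho>: "\<rho> > 0"
    and d\<Theta>: "\<And>s. s \<in> {0..L} \<Longrightarrow> (\<Theta> has_real_derivative K s) (at s within {0..L})"
    and dK: "\<And>s. s \<in> {0..L} \<Longrightarrow> (K has_real_derivative \<rho> * sin (\<Theta> s - \<alpha>)) (at s within {0..L})"
    and cosX: "\<And>s. s \<in> {0..L} \<Longrightarrow> cos ((\<Theta> s - \<alpha>) / 2) > 0"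
    and ends: "\<Theta> 0 = \<theta>0" "\<Theta> L = \<theta>1"
    and close: "integral {0..L} (\<lambda>s. cos (\<Theta> s)) = l" "integral {0..L} (\<lambda>s. sin (\<Theta> s)) = 0"
    and \<eta>: "0 < \<eta>" "\<eta> < 1"
    and gap: "pendulum_action L \<rho> (\<lambda>s. \<Theta> s - \<alpha>) K <
      min (8 * sqrt \<rho> * (2 - 2 * \<eta> - \<bar>cos ((\<theta>0 - \<alpha>) / 2) - cos ((\<theta>1 - \<alpha>) / 2)\<bar>)) (4 * \<rho> * \<eta> * L)"
    and \<gamma>: "\<And>s. \<gamma> s = integral {0..s} (\<lambda>u. unit_vec (\<Theta> u))"
  shows "energy_minimiser L l \<theta>0 \<theta>1 \<gamma>"
    and "energy_minimiser L l \<theta>0 \<theta>1 \<zeta> \<Longrightarrow> s \<in> {0..L} \<Longrightarrow> \<zeta> s = \<gamma> s"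
proof -
  let ?X = "\<lambda>s. \<Theta> s - \<alpha>"
  have dX: "(?X has_real_derivative K s) (at s within {0..L})" if "s \<in> {0..L}" for s
    using DERIV_diff[OF d\<Theta>[OF that] DERIV_const[of \<alpha>]] by simp
  have cK: "continuous_on {0..L} K" by (rule DERIV_continuous_on[OF dK])
  have c\<Theta>: "continuous_on {0..L} \<Theta>" by (rule DERIV_continuous_on[OF d\<Theta>])
  have D\<Theta>: "ac_deriv 0 L \<Theta> K"
    by (rule ac_deriv_C1) (use d\<Theta> cK in \<open>simp_all add: has_real_derivative_iff_has_vector_derivative\<close>)
  have K2: "(\<lambda>s. (K s)\<^sup>2) absolutely_integrable_on {0..L}"
    by (intro absolutely_integrable_continuous_real continuous_intros cK)
  note curve = curve_of_angle_velocity[OF L d\<Theta> cK \<gamma>] curve_of_angle_W22_arc[OF L d\<Theta> cK \<gamma>]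
    curve_of_angle_is_curvature[OF L d\<Theta> cK \<gamma>]
  have adm: "\<gamma> \<in> admissible L l \<theta>0 \<theta>1"
  proof -
    have "\<gamma> 0 = vector [0, 0]" unfolding \<gamma> by (simp add: vec_eq_iff forall_2)
    moreover have "\<gamma> L = vector [l, 0]" unfolding \<gamma> integral_unit_vec[OF c\<Theta>] close ..
    moreover have "velocity L \<gamma> 0 = unit_vec \<theta>0" "velocity L \<gamma> L = unit_vec \<theta>1"
      using curve(1)[of 0] curve(1)[of L] L ends by simp_all
    ultimately show ?thesis unfolding admissible_def using curve(2) by simp
  qed
  have B\<gamma>: "bending_energy L \<gamma> = integral {0..L} (\<lambda>s. (K s)\<^sup>2)"
    by (rule bending_energy_eq[OF curve(2) L curve(3)])
  have A\<gamma>: "pendulum_action L \<rho> ?X K = bending_energy L \<gamma> + 2 * \<rho> * (L - cos \<alpha> * l)"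
    unfolding B\<gamma> by (rule pendulum_action_closing[OF D\<Theta> K2 L close])
  have main: "bending_energy L \<gamma> \<le> bending_energy L \<zeta> \<and>
     (bending_energy L \<zeta> \<le> bending_energy L \<gamma> \<longrightarrow> (\<forall>s\<in>{0..L}. \<zeta> s = \<gamma> s))"
    if \<zeta>: "\<zeta> \<in> admissible L l \<theta>0 \<theta>1" for \<zeta>
  proof -
    have W: "\<zeta> \<in> W22_arc L" and \<zeta>0: "\<zeta> 0 = vector [0, 0]" and \<zeta>L: "\<zeta> L = vector [l, 0]"
      and v0: "velocity L \<zeta> 0 = unit_vec \<theta>0" and vL: "velocity L \<zeta> L = unit_vec \<theta>1"
      using \<zeta> unfolding admissible_def by auto
    obtain \<theta> k where \<theta>: "ac_deriv 0 L \<theta> k" and \<theta>0: "\<theta> 0 = \<theta>0" and k: "is_curvature L \<zeta> k"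
      and V: "\<And>s. s \<in> {0..L} \<Longrightarrow> velocity L \<zeta> s = unit_vec (\<theta> s)"
      and k2: "(\<lambda>s. (k s)\<^sup>2) absolutely_integrable_on {0..L}"
      by (rule W22_arc_tangential_angle[OF W L v0]) (rule that)
    have c\<theta>: "continuous_on {0..L} \<theta>" by (rule ac_deriv_continuous_on[OF \<theta>])
    have pos: "\<zeta> s = integral {0..s} (\<lambda>u. unit_vec (\<theta> u))" if s: "s \<in> {0..L}" for s
    proof -
      have "\<zeta> s = integral {0..s} (velocity L \<zeta>)"
        using integral_unique[OF W22_arc_displacement[OF W s]] \<zeta>0 by (simp add: vec_eq_iff forall_2)
      also have "\<dots> = integral {0..s} (\<lambda>u. unit_vec (\<theta> u))"
        by (rule Henstock_Kurzweil_Integration.integral_cong) (use s V in auto)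
      finally show ?thesis .
    qed
    have "vector [l, 0] = (vector [integral {0..L} (\<lambda>s. cos (\<theta> s)), integral {0..L} (\<lambda>s. sin (\<theta> s))] :: real^2)"
      using pos[of L] L \<zeta>L integral_unit_vec[OF c\<theta>] by simp
    hence close': "integral {0..L} (\<lambda>s. cos (\<theta> s)) = l" "integral {0..L} (\<lambda>s. sin (\<theta> s)) = 0"
      by (simp_all add: vec_eq_iff forall_2)
    have B\<zeta>: "bending_energy L \<zeta> = integral {0..L} (\<lambda>s. (k s)\<^sup>2)" by (rule bending_energy_eq[OF W L k])
    let ?x = "\<lambda>s. \<theta> s - \<alpha>"
    have A\<zeta>: "pendulum_action L \<rho> ?x k = bending_energy L \<zeta> + 2 * \<rho> * (L - cos \<alpha> * l)"
      unfolding B\<zeta> by (rule pendulum_action_closing[OF \<theta> k2 L close'])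
    have dx: "ac_deriv 0 L ?x k"
    proof -
      have "ac_deriv 0 L (\<lambda>s. - \<alpha>) (\<lambda>s. 0)" by (rule ac_deriv_C1) (auto intro!: derivative_eq_intros)
      from ac_deriv_add[OF \<theta> this] show ?thesis by simp
    qed
    have "unit_vec (\<theta> L) = unit_vec \<theta>1" using V[of L] vL L by simp
    \<comment> \<open>The half angle changes by n \<pi>: even n preserves its sine and cosine, odd n
      negates both.\<close>
    then obtain n :: int where n: "\<theta> L = \<theta>1 + 2 * pi * n" unfolding unit_vec_eq_iff by blast
    have half: "?x L / 2 = (\<theta>1 - \<alpha>) / 2 + pi * n" unfolding n by (simp add: field_simps)
    show ?thesis
    proof (cases "even n")
      case True
      hence e1: "sin (?x L / 2) = sin (?X L / 2)"
        unfolding half ends by (simp add: sin_add)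
      have e0: "sin (?x 0 / 2) = sin (?X 0 / 2)" unfolding \<theta>0 ends ..
      have min1: "pendulum_action L \<rho> ?X K \<le> pendulum_action L \<rho> ?x k"
        by (rule pendulum_action_minimal(1)[OF L \<rho> dX dK cosX dx k2 e0 e1])
      have min2: "sin (?x u / 2) = sin (?X u / 2)"
        if "pendulum_action L \<rho> ?x k \<le> pendulum_action L \<rho> ?X K" "u \<in> {0..L}" for u
        by (rule pendulum_action_minimal(2)[OF L \<rho> dX dK cosX dx k2 e0 e1 that])
      have "bending_energy L \<gamma> \<le> bending_energy L \<zeta>" using min1 A\<gamma> A\<zeta> by linarith
      moreover have "\<zeta> s = \<gamma> s" if le: "bending_energy L \<zeta> \<le> bending_energy L \<gamma>" and s: "s \<in> {0..L}" for s
      proof -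
        \<comment> \<open>Equality of actions gives equal sines of the half angle; equal cosines
          follow from the positive initial cosine, hence equal directions and equal curves.\<close>
        have seq: "sin (?x u / 2) = sin (?X u / 2)" if "u \<in> {0..L}" for u
          using min2[OF _ that] le A\<gamma> A\<zeta> by linarith
        have ceq: "cos (?x u / 2) = cos (?X u / 2)" if u: "u \<in> {0..L}" for u
        proof (rule cos_half_eq_of_sin_half_eq[OF ac_deriv_continuous_on[OF dx] cosX seq _ u])
          show "0 < cos ((\<theta> 0 - \<alpha>) / 2)" using cosX[of 0] L unfolding \<theta>0 ends by simp
        qed
        have "unit_vec (\<theta> u) = unit_vec (\<Theta> u)" if u: "u \<in> {0..L}" for u
        proof -
          have "cos (?x u) = cos (?X u)" "sin (?x u) = sin (?X u)"
            unfolding cos_half_angle[of "?x u"] cos_half_angle[of "?X u"] sin_half_angle[of "?x u"] sin_half_angle[of "?X u"]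
              seq[OF u] ceq[OF u] by simp_all
          hence "cos (?x u + \<alpha>) = cos (?X u + \<alpha>)" "sin (?x u + \<alpha>) = sin (?X u + \<alpha>)"
            unfolding cos_add sin_add by simp_all
          thus ?thesis by (simp add: vec_eq_iff forall_2)
        qed
        thus ?thesis unfolding pos[OF s] \<gamma> using s
          by (intro Henstock_Kurzweil_Integration.integral_cong) auto
      qed
      ultimately show ?thesis by blast
    next
      case False
      have c0: "cos (?x 0 / 2) = cos ((\<theta>0 - \<alpha>) / 2)" unfolding \<theta>0 ..
      have c1: "cos (?x L / 2) = - cos ((\<theta>1 - \<alpha>) / 2)"
        unfolding half using False by (simp add: cos_add)
      have "pendulum_action L \<rho> ?X K < pendulum_action L \<rho> ?x k"
        using pendulum_action_odd_lower_bound[OF dx k2 \<rho> L \<eta> c0 c1] gap by linarith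
      thus ?thesis using A\<gamma> A\<zeta> by linarith
    qed
  qed
  show "energy_minimiser L l \<theta>0 \<theta>1 \<gamma>" unfolding energy_minimiser_def using adm main by blast
  assume "energy_minimiser L l \<theta>0 \<theta>1 \<zeta>" "s \<in> {0..L}"
  thus "\<zeta> s = \<gamma> s" using main[of \<zeta>] adm unfolding energy_minimiser_def by blast
qed

section \<open>Explicit elasticae\<close>

text \<open>The derivative of the inverse is two-sided even at the end points. For this, g is
  extended by its end values, so that its primitive is increasing on a larger open interval.\<close>

lemma inverse_of_positive_integral:
  fixes g :: "real \<Rightarrow> real"
  assumes W: "W > 0" and cg: "continuous_on {0..W} g" and pos: "\<And>w. w \<in> {0..W} \<Longrightarrow> g w > 0"
  obtains \<omega> where "\<omega> 0 = 0" "\<omega> (integral {0..W} g) = W"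
    "\<And>t. t \<in> {0..integral {0..W} g} \<Longrightarrow> \<omega> t \<in> {0..W}"
    "\<And>t. t \<in> {0..integral {0..W} g} \<Longrightarrow> (\<omega> has_real_derivative inverse (g (\<omega> t))) (at t)"
proof -
  define cl where "cl w = max 0 (min W w)" for w :: real
  define G where "G w = integral {-1..w} (\<lambda>w. g (cl w)) - integral {-1..0} (\<lambda>w. g (cl w))" for w
  let ?S = "{-1<..<W + 1}"
  have cl: "cl w \<in> {0..W}" for w using W by (auto simp: cl_def)
  have clid: "w \<in> {0..W} \<Longrightarrow> cl w = w" for w by (auto simp: cl_def)
  have ccl: "continuous_on S cl" for S unfolding cl_def[abs_def] by (intro continuous_intros)
  have cgc: "continuous_on S (\<lambda>w. g (cl w))" for S
    by (rule continuous_on_compose2[OF cg ccl]) (use cl in auto)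
  have dG: "(G has_real_derivative g (cl w)) (at w)" if w: "w \<in> ?S" for w
  proof -
    have "((\<lambda>w. integral {-1..w} (\<lambda>w. g (cl w))) has_vector_derivative g (cl w)) (at w within {-1..W+1})"
      by (rule integral_has_vector_derivative[OF cgc]) (use w in auto)
    moreover have "at w within {-1..W+1} = at w" by (rule at_within_interior) (use w in simp)
    ultimately have "((\<lambda>w. integral {-1..w} (\<lambda>w. g (cl w))) has_real_derivative g (cl w)) (at w)"
      unfolding has_real_derivative_iff_has_vector_derivative by metis
    from DERIV_diff[OF this DERIV_const] show ?thesis unfolding G_def[abs_def] by simp
  qed
  have contG: "continuous_on ?S G"
    by (rule DERIV_continuous_on[OF has_field_derivative_at_within[OF dG]])
  have mono: "G u < G v" if "u < v" "u \<in> ?S" "v \<in> ?S" for u v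
  proof (rule DERIV_pos_imp_increasing[OF that(1)])
    fix w assume "u \<le> w" "w \<le> v"
    hence "w \<in> ?S" using that by auto
    thus "\<exists>y. (G has_real_derivative y) (at w) \<and> y > 0" using dG pos[OF cl] by blast
  qed
  have inj: "inj_on G ?S"
  proof (rule inj_onI)
    fix u v assume "u \<in> ?S" "v \<in> ?S" "G u = G v"
    thus "u = v" using mono[of u v] mono[of v u] by (cases u v rule: linorder_cases) auto
  qed
  define \<omega> where "\<omega> = inv_into ?S G"
  have inv: "\<omega> (G w) = w" if "w \<in> ?S" for w unfolding \<omega>_def using inj that by (rule inv_into_f_f)
  have G0: "G 0 = 0" unfolding G_def by simp
  have GW: "G W = integral {0..W} g"
  proof -
    have "integral {-1..0} (\<lambda>w. g (cl w)) + integral {0..W} (\<lambda>w. g (cl w)) = integral {-1..W} (\<lambda>w. g (cl w))"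
      using W by (intro Henstock_Kurzweil_Integration.integral_combine integrable_continuous_real cgc) auto
    moreover have "integral {0..W} (\<lambda>w. g (cl w)) = integral {0..W} g"
      by (rule Henstock_Kurzweil_Integration.integral_cong) (use clid in auto)
    ultimately show ?thesis unfolding G_def by linarith
  qed
  have surj: "\<exists>w\<in>{0..W}. G w = t" if t: "t \<in> {0..integral {0..W} g}" for t
  proof -
    have "continuous_on {0..W} G" by (rule continuous_on_subset[OF contG]) (use W in auto)
    thus ?thesis using IVT'[of G 0 t W] t W G0 GW by auto
  qed
  show ?thesis
  proof (rule that)
    show "\<omega> 0 = 0" using inv[of 0] W G0 by simp
    show "\<omega> (integral {0..W} g) = W" using inv[of W] W GW by simp
    fix t assume t: "t \<in> {0..integral {0..W} g}"
    then obtain w where w: "w \<in> {0..W}" "G w = t" using surj by blast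
    hence wS: "w \<in> ?S" by auto
    have \<omega>t: "\<omega> t = w" using inv[OF wS] w by simp
    show "\<omega> t \<in> {0..W}" using \<omega>t w by simp
    have "(\<omega> has_derivative (*) (inverse (g (cl w)))) (at (G w))"
    proof (rule has_derivative_inverse_strong[OF open_greaterThanLessThan wS contG inv])
      show "(G has_derivative (*) (g (cl w))) (at w)" using dG[OF wS] unfolding has_field_derivative_def .
      show "(*) (g (cl w)) \<circ> (*) (inverse (g (cl w))) = id" using pos[OF cl, of w] by (auto simp: fun_eq_iff)
    qed
    hence "(\<omega> has_real_derivative inverse (g (cl w))) (at (G w))" unfolding has_field_derivative_def .
    thus "(\<omega> has_real_derivative inverse (g (\<omega> t))) (at t)" using w clid[OF w(1)] \<omega>t by simp
  qed
qed

text \<open>With \<open>X = \<Theta> - \<alpha>\<close> and \<open>sin (X / 2) = elastica_sin W a b w\<close>, the elastica of length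
  \<open>elastica_time W a b\<close> with \<open>X'' = sin X\<close> satisfies \<open>dw/ds = cos (X / 2)\<close>; the potential is
  \<open>\<integral>(1 - cos X) ds\<close>, the impulse is \<open>\<integral>sin X ds\<close>, and the energy is the constant value of
  \<open>(X' / 2)\<^sup>2 - sin\<^sup>2 (X / 2)\<close>.\<close>

definition elastica_sin :: "real \<Rightarrow> real \<Rightarrow> real \<Rightarrow> real \<Rightarrow> real" where
  "elastica_sin W a b w = (a * sinh (W - w) + b * sinh w) / sinh W"

definition elastica_slope :: "real \<Rightarrow> real \<Rightarrow> real \<Rightarrow> real \<Rightarrow> real" where
  "elastica_slope W a b w = (b * cosh w - a * cosh (W - w)) / sinh W"

definition elastica_cos :: "real \<Rightarrow> real \<Rightarrow> real \<Rightarrow> real \<Rightarrow> real" where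
  "elastica_cos W a b w = sqrt (1 - (elastica_sin W a b w)\<^sup>2)"

definition elastica_time :: "real \<Rightarrow> real \<Rightarrow> real \<Rightarrow> real" where
  "elastica_time W a b = integral {0..W} (\<lambda>w. 1 / elastica_cos W a b w)"

definition elastica_potential :: "real \<Rightarrow> real \<Rightarrow> real \<Rightarrow> real" where
  "elastica_potential W a b = integral {0..W} (\<lambda>w. 2 * (elastica_sin W a b w)\<^sup>2 / elastica_cos W a b w)"

definition elastica_impulse :: "real \<Rightarrow> real \<Rightarrow> real \<Rightarrow> real" where
  "elastica_impulse W a b = 2 * (a + b) * ((cosh W - 1) / sinh W)"

definition elastica_energy :: "real \<Rightarrow> real \<Rightarrow> real \<Rightarrow> real" where
  "elastica_energy W a b = (a\<^sup>2 + b\<^sup>2 - 2 * a * b * cosh W) / (sinh W)\<^sup>2"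

lemma elastica_sin_derivative [derivative_intros]:
  "(elastica_sin W a b has_real_derivative elastica_slope W a b w) (at w within S)"
proof -
  have "((\<lambda>w. (a * sinh (W - w) + b * sinh w) / sinh W) has_real_derivative
      (a * (cosh (W - w) * (0 - 1)) + b * (cosh w * 1)) / sinh W) (at w within S)"
    by (intro DERIV_cdivide DERIV_add DERIV_cmult has_field_derivative_sinh DERIV_diff DERIV_const DERIV_ident)
  thus ?thesis unfolding elastica_sin_def[abs_def] elastica_slope_def by (simp add: algebra_simps)
qed

lemma elastica_slope_derivative [derivative_intros]:
  "(elastica_slope W a b has_real_derivative elastica_sin W a b w) (at w within S)"
proof -
  have "((\<lambda>w. (b * cosh w - a * cosh (W - w)) / sinh W) has_real_derivative
      (b * (sinh w * 1) - a * (sinh (W - w) * (0 - 1))) / sinh W) (at w within S)"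
    by (intro DERIV_cdivide DERIV_diff DERIV_cmult has_field_derivative_cosh DERIV_const DERIV_ident)
  thus ?thesis unfolding elastica_sin_def elastica_slope_def[abs_def] by (simp add: algebra_simps)
qed

lemma elastica_sin_ends: "W > 0 \<Longrightarrow> elastica_sin W a b 0 = a" "W > 0 \<Longrightarrow> elastica_sin W a b W = b"
  by (simp_all add: elastica_sin_def)

lemma sinh_superadditive: "x \<ge> 0 \<Longrightarrow> y \<ge> 0 \<Longrightarrow> sinh x + sinh y \<le> sinh (x + y)" for x y :: real
  using mult_left_mono[of 1 "cosh y" "sinh x"] mult_left_mono[of 1 "cosh x" "sinh y"]
  by (simp add: sinh_add cosh_real_ge_1 mult.commute)

lemma elastica_sin_bound:
  assumes W: "W > 0" and w: "w \<in> {0..W}" and ab: "\<bar>a\<bar> \<le> m" "\<bar>b\<bar> \<le> m"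
  shows "\<bar>elastica_sin W a b w\<bar> \<le> m * (sinh (W - w) + sinh w) / sinh W" "\<bar>elastica_sin W a b w\<bar> \<le> m"
proof -
  have s: "sinh W > 0" "sinh w \<ge> 0" "sinh (W - w) \<ge> 0" using W w by auto
  have "\<bar>a * sinh (W - w) + b * sinh w\<bar> \<le> \<bar>a\<bar> * sinh (W - w) + \<bar>b\<bar> * sinh w"
    using abs_triangle_ineq[of "a * sinh (W - w)" "b * sinh w"] s by (simp add: abs_mult)
  also have "\<dots> \<le> m * sinh (W - w) + m * sinh w" using ab s by (intro add_mono mult_right_mono) auto
  finally show 1: "\<bar>elastica_sin W a b w\<bar> \<le> m * (sinh (W - w) + sinh w) / sinh W"
    unfolding elastica_sin_def using s by (simp add: abs_divide divide_right_mono distrib_left)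
  have "m * (sinh (W - w) + sinh w) \<le> m * sinh W"
    using sinh_superadditive[of "W - w" w] w ab by (intro mult_left_mono) auto
  hence "m * (sinh (W - w) + sinh w) / sinh W \<le> m" using s by (simp add: divide_le_eq)
  thus "\<bar>elastica_sin W a b w\<bar> \<le> m" using 1 by linarith
qed

text \<open>\<open>elastica_sin\<close> solves f'' = f, so f'^2 - f^2 is conserved; the addition
  theorem for cosh evaluates the constant.\<close>

lemma elastica_energy_eq:
  assumes "W > 0"
  shows "(elastica_slope W a b w)\<^sup>2 = (elastica_sin W a b w)\<^sup>2 + elastica_energy W a b"
proof -
  have s: "sinh W \<noteq> 0" using assms by simp
  have c: "cosh W = cosh w * cosh (W - w) + sinh w * sinh (W - w)"
    using cosh_add[of w "W - w"] by simp
  have h: "(cosh w)\<^sup>2 - (sinh w)\<^sup>2 = 1" "(cosh (W - w))\<^sup>2 - (sinh (W - w))\<^sup>2 = 1"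
    by (simp_all add: cosh_square_eq)
  have "(b * cosh w - a * cosh (W - w))\<^sup>2 - (a * sinh (W - w) + b * sinh w)\<^sup>2 =
     b\<^sup>2 * ((cosh w)\<^sup>2 - (sinh w)\<^sup>2) + a\<^sup>2 * ((cosh (W - w))\<^sup>2 - (sinh (W - w))\<^sup>2) - 2 * a * b * cosh W"
    unfolding c by (simp add: power2_eq_square algebra_simps)
  hence "(b * cosh w - a * cosh (W - w))\<^sup>2 = (a * sinh (W - w) + b * sinh w)\<^sup>2 + (a\<^sup>2 + b\<^sup>2 - 2 * a * b * cosh W)"
    unfolding h by simp
  thus ?thesis unfolding elastica_slope_def elastica_sin_def elastica_energy_def
    using s by (simp add: power_divide add_divide_distrib[symmetric])
qed

context
  fixes W a b :: real
  assumes W: "W > 0" and a: "\<bar>a\<bar> < 1" and b: "\<bar>b\<bar> < 1"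
begin

lemma elastica_sin_lt_1: "w \<in> {0..W} \<Longrightarrow> \<bar>elastica_sin W a b w\<bar> < 1"
  using elastica_sin_bound(2)[OF W, of w a "max \<bar>a\<bar> \<bar>b\<bar>" b] a b by auto

lemma elastica_cos_pos: "w \<in> {0..W} \<Longrightarrow> elastica_cos W a b w > 0"
  unfolding elastica_cos_def using elastica_sin_lt_1[of w] abs_square_less_1[of "elastica_sin W a b w"] by simp

lemma elastica_sin_continuous: "continuous_on S (elastica_sin W a b)"
  by (rule DERIV_continuous_on[OF elastica_sin_derivative])

lemma elastica_cos_continuous: "continuous_on S (elastica_cos W a b)"
  unfolding elastica_cos_def[abs_def] by (intro continuous_intros elastica_sin_continuous)

lemma elastica_time_pos: "elastica_time W a b > 0"
proof -
  have c: "continuous_on {0..W} (\<lambda>w. 1 / elastica_cos W a b w)"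
    using elastica_cos_pos by (intro continuous_intros elastica_cos_continuous) force
  have "W = integral {0..W} (\<lambda>w. 1)" using W by simp
  also have "\<dots> \<le> elastica_time W a b" unfolding elastica_time_def
  proof (rule integral_le[OF _ integrable_continuous_real[OF c]])
    fix w assume w: "w \<in> {0..W}"
    have "elastica_cos W a b w \<le> 1" unfolding elastica_cos_def by simp
    thus "1 \<le> 1 / elastica_cos W a b w" using elastica_cos_pos[OF w] by simp
  qed (rule integrable_const_ivl)
  finally show ?thesis using W by linarith
qed

text \<open>The parameter \<open>w\<close> uniformises the pendulum equation: along a solution \<open>\<Theta>\<close> one has
  \<open>sin ((\<Theta> - \<alpha>) / 2) = elastica_sin w\<close> where \<open>dw/ds\<close> is proportional to \<open>cos ((\<Theta> - \<alpha>) / 2)\<close>.\<close>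

lemma elastica_parametrisation:
  fixes L \<alpha> :: real
  assumes L: "L > 0"
  defines "T \<equiv> elastica_time W a b" and "I \<equiv> elastica_potential W a b" and "J \<equiv> elastica_impulse W a b"
  obtains \<nu> \<Theta> K where
    "\<nu> 0 = 0" "\<nu> L = W" "\<And>s. s \<in> {0..L} \<Longrightarrow> \<nu> s \<in> {0..W}" "strict_mono_on {0..L} \<nu>" "continuous_on {0..L} \<nu>"
    "\<And>s. \<Theta> s = \<alpha> + 2 * arcsin (elastica_sin W a b (\<nu> s))"
    "\<And>s. K s = 2 * T / L * elastica_slope W a b (\<nu> s)"
    "\<And>s. s \<in> {0..L} \<Longrightarrow> (\<Theta> has_real_derivative K s) (at s within {0..L})"
    "\<And>s. s \<in> {0..L} \<Longrightarrow> (K has_real_derivative (T / L)\<^sup>2 * sin (\<Theta> s - \<alpha>)) (at s within {0..L})"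
    "\<And>s. s \<in> {0..L} \<Longrightarrow> cos ((\<Theta> s - \<alpha>) / 2) > 0"
    "integral {0..L} (\<lambda>s. sin (\<Theta> s)) = L / T * (J * cos \<alpha> + sin \<alpha> * (T - I))"
    "integral {0..L} (\<lambda>s. cos (\<Theta> s)) = L / T * (cos \<alpha> * (T - I) - sin \<alpha> * J)"
    "pendulum_action L ((T / L)\<^sup>2) (\<lambda>s. \<Theta> s - \<alpha>) K = T / L * (4 * I + 4 * elastica_energy W a b * T)"
proof -
  let ?f = "elastica_sin W a b" and ?f' = "elastica_slope W a b" and ?c = "elastica_cos W a b"
  have T: "T > 0" unfolding T_def by (rule elastica_time_pos)
  have cinv: "continuous_on {0..W} (\<lambda>w. 1 / ?c w)"
    using elastica_cos_pos by (intro continuous_intros elastica_cos_continuous) force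
  obtain \<omega> where \<omega>: "\<omega> 0 = 0" "\<omega> T = W" and \<omega>in: "\<And>t. t \<in> {0..T} \<Longrightarrow> \<omega> t \<in> {0..W}"
    and d\<omega>: "\<And>t. t \<in> {0..T} \<Longrightarrow> (\<omega> has_real_derivative inverse (1 / ?c (\<omega> t))) (at t)"
    using inverse_of_positive_integral[OF W cinv, folded elastica_time_def, folded T_def] elastica_cos_pos by (metis divide_pos_pos zero_less_one)
  \<comment> \<open>\<omega> inverts the indefinite integral of 1 / cos, so its derivative is the
    cosine; the factor T / L fits the total time T to the length L.\<close>
  define \<nu> where "\<nu> s = \<omega> (T / L * s)" for s
  define \<Theta> where "\<Theta> s = \<alpha> + 2 * arcsin (?f (\<nu> s))" for s
  define K where "K s = 2 * T / L * ?f' (\<nu> s)" for s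
  have arg: "T / L * s \<in> {0..T}" if "s \<in> {0..L}" for s
    using that L T by (simp add: divide_le_eq mult_left_mono)
  have \<nu>in: "\<nu> s \<in> {0..W}" if "s \<in> {0..L}" for s unfolding \<nu>_def using \<omega>in[OF arg[OF that]] .
  have \<nu>0: "\<nu> 0 = 0" and \<nu>L: "\<nu> L = W" unfolding \<nu>_def using \<omega> L by simp_all
  have d\<nu>: "(\<nu> has_real_derivative ?c (\<nu> s) * (T / L)) (at s)" if "s \<in> {0..L}" for s
    using DERIV_chain2[where f=\<omega>, OF d\<omega>[OF arg[OF that]] DERIV_cmult_Id] unfolding \<nu>_def[abs_def] by simp
  have cpos: "?c (\<nu> s) > 0" if "s \<in> {0..L}" for s using elastica_cos_pos[OF \<nu>in[OF that]] .
  have cont\<nu>: "continuous_on {0..L} \<nu>"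
    by (rule DERIV_continuous_on[OF has_field_derivative_at_within[OF d\<nu>]])
  have mono: "strict_mono_on {0..L} \<nu>"
  proof (rule strict_mono_onI)
    fix r s assume rs: "r \<in> {0..L}" "s \<in> {0..L}" "r < s"
    show "\<nu> r < \<nu> s"
    proof (rule DERIV_pos_imp_increasing[OF rs(3)])
      fix x assume "r \<le> x" "x \<le> s"
      hence x: "x \<in> {0..L}" using rs by auto
      show "\<exists>y. (\<nu> has_real_derivative y) (at x) \<and> y > 0"
        using d\<nu>[OF x] cpos[OF x] T L by (intro exI[of _ "?c (\<nu> x) * (T / L)"]) simp
    qed
  qed
  have flt: "\<bar>?f (\<nu> s)\<bar> < 1" if "s \<in> {0..L}" for s using elastica_sin_lt_1[OF \<nu>in[OF that]] .
  have half: "(\<Theta> s - \<alpha>) / 2 = arcsin (?f (\<nu> s))" for s unfolding \<Theta>_def by simp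
  have sin\<Theta>: "sin ((\<Theta> s - \<alpha>) / 2) = ?f (\<nu> s)" if "s \<in> {0..L}" for s
    unfolding half using flt[OF that] by simp
  have cos\<Theta>: "cos ((\<Theta> s - \<alpha>) / 2) = ?c (\<nu> s)" if "s \<in> {0..L}" for s
    unfolding half elastica_cos_def using flt[OF that] by (simp add: cos_arcsin)
  have d\<Theta>: "(\<Theta> has_real_derivative K s) (at s within {0..L})" if s: "s \<in> {0..L}" for s
  proof -
    have d1: "((\<lambda>s. ?f (\<nu> s)) has_real_derivative ?f' (\<nu> s) * (?c (\<nu> s) * (T / L))) (at s)"
      by (rule DERIV_chain2[OF elastica_sin_derivative d\<nu>[OF s]])
    have "(arcsin has_real_derivative inverse (sqrt (1 - (?f (\<nu> s))\<^sup>2))) (at (?f (\<nu> s)))"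
      by (rule DERIV_arcsin) (use flt[OF s] in auto)
    from DERIV_chain2[OF this d1]
    have d2: "((\<lambda>s. arcsin (?f (\<nu> s))) has_real_derivative inverse (?c (\<nu> s)) * (?f' (\<nu> s) * (?c (\<nu> s) * (T / L)))) (at s)"
      unfolding elastica_cos_def .
    have eq: "inverse (?c (\<nu> s)) * (?f' (\<nu> s) * (?c (\<nu> s) * (T / L))) = ?f' (\<nu> s) * (T / L)"
      using cpos[OF s] by simp
    have "((\<lambda>s. \<alpha> + 2 * arcsin (?f (\<nu> s))) has_real_derivative 0 + 2 * (?f' (\<nu> s) * (T / L))) (at s)"
      by (rule DERIV_add[OF DERIV_const DERIV_cmult[OF d2[unfolded eq]]])
    hence "(\<Theta> has_real_derivative K s) (at s)" unfolding \<Theta>_def[abs_def] K_def by (simp add: mult_ac)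
    thus ?thesis by (rule has_field_derivative_at_within)
  qed
  have dK: "(K has_real_derivative (T / L)\<^sup>2 * sin (\<Theta> s - \<alpha>)) (at s within {0..L})" if s: "s \<in> {0..L}" for s
  proof -
    have "(K has_real_derivative 2 * T / L * (?f (\<nu> s) * (?c (\<nu> s) * (T / L)))) (at s)"
      unfolding K_def[abs_def] by (intro DERIV_cmult DERIV_chain2[OF elastica_slope_derivative d\<nu>[OF s]])
    moreover have "2 * T / L * (?f (\<nu> s) * (?c (\<nu> s) * (T / L))) = (T / L)\<^sup>2 * sin (\<Theta> s - \<alpha>)"
      unfolding sin_half_angle[of "\<Theta> s - \<alpha>"] sin\<Theta>[OF s] cos\<Theta>[OF s] by (simp add: power2_eq_square)
    ultimately show ?thesis by (simp add: has_field_derivative_at_within)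
  qed
  have c\<Theta>: "continuous_on {0..L} \<Theta>" by (rule DERIV_continuous_on[OF d\<Theta>])
  \<comment> \<open>sin (\<Theta> - \<alpha>) is a multiple of K', so its integral is a difference
    of end slopes.\<close>
  have Is: "((\<lambda>s. sin (\<Theta> s - \<alpha>)) has_integral L / T * J) {0..L}"
  proof -
    have "((\<lambda>s. (T / L)\<^sup>2 * sin (\<Theta> s - \<alpha>)) has_integral K L - K 0) {0..L}"
      by (rule fundamental_theorem_of_calculus[where f=K]) (use L dK in \<open>simp_all add: has_real_derivative_iff_has_vector_derivative\<close>)
    from has_integral_mult_right[OF this, of "inverse ((T / L)\<^sup>2)"]
    have "((\<lambda>s. sin (\<Theta> s - \<alpha>)) has_integral inverse ((T / L)\<^sup>2) * (K L - K 0)) {0..L}"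
      using T L by (simp add: mult.assoc[symmetric])
    moreover have sl: "?f' W - ?f' 0 = (a + b) * ((cosh W - 1) / sinh W)"
      unfolding elastica_slope_def by (simp add: diff_divide_distrib[symmetric] algebra_simps)
    have "K L - K 0 = 2 * T / L * (?f' W - ?f' 0)"
      unfolding K_def \<nu>0 \<nu>L by (simp only: right_diff_distrib)
    hence "K L - K 0 = T / L * J" unfolding sl J_def elastica_impulse_def by simp
    hence "inverse ((T / L)\<^sup>2) * (K L - K 0) = L / T * J" using T L by (simp add: power2_eq_square)
    ultimately show ?thesis by simp
  qed
  \<comment> \<open>Substitution through the primitive M: the derivative of \<nu> cancels the cosine
    in the denominator.\<close>
  have If: "((\<lambda>s. 2 * (?f (\<nu> s))\<^sup>2) has_integral L / T * I) {0..L}"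
  proof -
    let ?g = "\<lambda>w. 2 * (?f w)\<^sup>2 / ?c w"
    have cg: "continuous_on {0..W} ?g"
      using elastica_cos_pos by (intro continuous_intros elastica_cos_continuous elastica_sin_continuous) force
    define M where "M w = integral {0..w} ?g" for w
    have dM: "(M has_real_derivative ?g w) (at w within {0..W})" if "w \<in> {0..W}" for w
      unfolding M_def[abs_def] has_real_derivative_iff_has_vector_derivative
      by (rule integral_has_vector_derivative[OF cg that])
    have "((\<lambda>s. 2 * (?f (\<nu> s))\<^sup>2 * (T / L)) has_integral M (\<nu> L) - M (\<nu> 0)) {0..L}"
    proof (rule fundamental_theorem_of_calculus[where f="\<lambda>s. M (\<nu> s)"])
      fix s assume s: "s \<in> {0..L}"
      have d: "((\<lambda>s. M (\<nu> s)) has_real_derivative ?g (\<nu> s) * (?c (\<nu> s) * (T / L))) (at s within {0..L})"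
      proof (rule DERIV_image_chain[where f=M and g=\<nu>, unfolded o_def])
        show "(M has_real_derivative ?g (\<nu> s)) (at (\<nu> s) within \<nu> ` {0..L})"
          by (rule DERIV_subset[OF dM[OF \<nu>in[OF s]]]) (use \<nu>in in blast)
        show "(\<nu> has_real_derivative ?c (\<nu> s) * (T / L)) (at s within {0..L})"
          by (rule has_field_derivative_at_within[OF d\<nu>[OF s]])
      qed
      have e: "?g (\<nu> s) * (?c (\<nu> s) * (T / L)) = 2 * (?f (\<nu> s))\<^sup>2 * (T / L)" using cpos[OF s] by simp
      show "((\<lambda>s. M (\<nu> s)) has_vector_derivative 2 * (?f (\<nu> s))\<^sup>2 * (T / L)) (at s within {0..L})"
        using d unfolding e has_real_derivative_iff_has_vector_derivative .
    qed (use L in simp)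
    moreover have "M (\<nu> L) - M (\<nu> 0) = I" unfolding \<nu>0 \<nu>L M_def I_def elastica_potential_def by simp
    ultimately have "((\<lambda>s. 2 * (?f (\<nu> s))\<^sup>2 * (T / L)) has_integral I) {0..L}" by simp
    from has_integral_mult_right[OF this, of "L / T"] show ?thesis using T L by (simp add: mult_ac)
  qed
  have one: "((\<lambda>s. 1::real) has_integral L) {0..L}" using has_integral_const_real[of "1::real" 0 L] L by simp
  have Ic: "((\<lambda>s. cos (\<Theta> s - \<alpha>)) has_integral L - L / T * I) {0..L}"
  proof (rule has_integral_eq[OF _ has_integral_diff[OF one If]])
    fix s assume s: "s \<in> {0..L}"
    show "1 - 2 * (?f (\<nu> s))\<^sup>2 = cos (\<Theta> s - \<alpha>)" unfolding cos_half_angle[of "\<Theta> s - \<alpha>"] sin\<Theta>[OF s] ..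
  qed
  have ring1: "x * J * c + x * y * z = x * (J * c + z * y)" and ring2: "x * y * c - x * J * z = x * (c * y - z * J)"
    for x y c z :: real by (simp_all add: algebra_simps)
  have LT: "L - L / T * I = L / T * (T - I)" using T by (simp add: field_simps)
  show ?thesis
  proof (rule that)
    show "\<nu> 0 = 0" "\<nu> L = W" by fact+
    show "\<Theta> s = \<alpha> + 2 * arcsin (?f (\<nu> s))" "K s = 2 * T / L * ?f' (\<nu> s)" for s by (rule \<Theta>_def, rule K_def)
    show "cos ((\<Theta> s - \<alpha>) / 2) > 0" if "s \<in> {0..L}" for s unfolding cos\<Theta>[OF that] by (rule cpos[OF that])
    have "((\<lambda>s. sin (\<Theta> s - \<alpha>) * cos \<alpha> + cos (\<Theta> s - \<alpha>) * sin \<alpha>) has_integral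
        L / T * J * cos \<alpha> + (L - L / T * I) * sin \<alpha>) {0..L}"
      by (intro has_integral_add has_integral_mult_left Is Ic)
    moreover have "sin (\<Theta> s - \<alpha>) * cos \<alpha> + cos (\<Theta> s - \<alpha>) * sin \<alpha> = sin (\<Theta> s)" for s
      using sin_add[of "\<Theta> s - \<alpha>" \<alpha>] by simp
    ultimately show "integral {0..L} (\<lambda>s. sin (\<Theta> s)) = L / T * (J * cos \<alpha> + sin \<alpha> * (T - I))"
      unfolding LT using ring1 by (simp only: integral_unique)
    have "((\<lambda>s. cos (\<Theta> s - \<alpha>) * cos \<alpha> - sin (\<Theta> s - \<alpha>) * sin \<alpha>) has_integral
        (L - L / T * I) * cos \<alpha> - L / T * J * sin \<alpha>) {0..L}"
      by (intro has_integral_diff has_integral_mult_left Is Ic)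
    moreover have "cos (\<Theta> s - \<alpha>) * cos \<alpha> - sin (\<Theta> s - \<alpha>) * sin \<alpha> = cos (\<Theta> s)" for s
      using cos_add[of "\<Theta> s - \<alpha>" \<alpha>] by simp
    ultimately show "integral {0..L} (\<lambda>s. cos (\<Theta> s)) = L / T * (cos \<alpha> * (T - I) - sin \<alpha> * J)"
      unfolding LT using ring2 by (simp only: integral_unique)
    \<comment> \<open>Conservation of energy makes the integrand of the action affine in the squared
      sine, so it reduces to the integral already computed.\<close>
    have "((\<lambda>s. 4 * (T / L)\<^sup>2 * (2 * (?f (\<nu> s))\<^sup>2) + 4 * (T / L)\<^sup>2 * elastica_energy W a b * 1) has_integral
      4 * (T / L)\<^sup>2 * (L / T * I) + 4 * (T / L)\<^sup>2 * elastica_energy W a b * L) {0..L}"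
      by (intro has_integral_add has_integral_mult_right If one)
    hence "((\<lambda>s. (K s)\<^sup>2 + 4 * (T / L)\<^sup>2 * (sin ((\<Theta> s - \<alpha>) / 2))\<^sup>2) has_integral
      4 * (T / L)\<^sup>2 * (L / T * I) + 4 * (T / L)\<^sup>2 * elastica_energy W a b * L) {0..L}"
    proof (rule has_integral_eq[rotated])
      fix s assume s: "s \<in> {0..L}"
      have "(K s)\<^sup>2 = 4 * (T / L)\<^sup>2 * (?f' (\<nu> s))\<^sup>2" unfolding K_def by (simp add: power2_eq_square)
      also have "\<dots> = 4 * (T / L)\<^sup>2 * ((?f (\<nu> s))\<^sup>2 + elastica_energy W a b)" unfolding elastica_energy_eq[OF W] ..
      finally show "4 * (T / L)\<^sup>2 * (2 * (?f (\<nu> s))\<^sup>2) + 4 * (T / L)\<^sup>2 * elastica_energy W a b * 1 =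
        (K s)\<^sup>2 + 4 * (T / L)\<^sup>2 * (sin ((\<Theta> s - \<alpha>) / 2))\<^sup>2"
        unfolding sin\<Theta>[OF s] by (simp add: algebra_simps)
    qed
    moreover have "4 * (T / L)\<^sup>2 * (L / T * I) + 4 * (T / L)\<^sup>2 * elastica_energy W a b * L =
       T / L * (4 * I + 4 * elastica_energy W a b * T)"
      using T L by (simp add: power2_eq_square field_simps)
    ultimately show "pendulum_action L ((T / L)\<^sup>2) (\<lambda>s. \<Theta> s - \<alpha>) K = T / L * (4 * I + 4 * elastica_energy W a b * T)"
      unfolding pendulum_action_def by (simp add: integral_unique)
  qed (use \<nu>in mono cont\<nu> d\<Theta> dK in auto)
qed

end

section \<open>Asymptotics of the elastica integrals for large W\<close>

text \<open>On the left half f' is close to -f, on the right half to f. As c = sqrt (1 - f^2) has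
  derivative -f f' / c, the integrand 2 f^2 / c is nearly 2 c' on the left and -2 c' on the right,
  which integrates to the main term.\<close>

lemma elastica_potential_estimate:
  assumes W: "W > 0" and ab: "\<bar>a\<bar> \<le> m" "\<bar>b\<bar> \<le> m" and m: "m < 1"
  shows "\<bar>elastica_potential W a b - (4 * elastica_cos W a b (W / 2) - 2 * sqrt (1 - a\<^sup>2) - 2 * sqrt (1 - b\<^sup>2))\<bar>
     \<le> 4 * W * exp (W / 2) / sinh W / sqrt (1 - m\<^sup>2)"
proof -
  let ?f = "elastica_sin W a b" and ?f' = "elastica_slope W a b" and ?c = "elastica_cos W a b"
  have a1: "\<bar>a\<bar> < 1" and b1: "\<bar>b\<bar> < 1" and m0: "0 \<le> m" using ab m by auto
  have cp: "?c w > 0" if "w \<in> {0..W}" for w by (rule elastica_cos_pos[OF W a1 b1 that])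
  have cont: "continuous_on S ?f" "continuous_on S ?c" for S
    by (rule elastica_sin_continuous[OF W a1 b1], rule elastica_cos_continuous[OF W a1 b1])
  define cm where "cm = sqrt (1 - m\<^sup>2)"
  have cm: "cm > 0" unfolding cm_def using m m0 abs_square_less_1[of m] by simp
  have cge: "?c w \<ge> cm" if w: "w \<in> {0..W}" for w
  proof -
    have "(?f w)\<^sup>2 \<le> m\<^sup>2" using elastica_sin_bound(2)[OF W w ab] m0 by (simp add: abs_le_square_iff[symmetric])
    thus ?thesis unfolding cm_def elastica_cos_def by simp
  qed
  have dc: "(?c has_real_derivative - (?f w * ?f' w / ?c w)) (at w within S)" if w: "w \<in> {0..W}" for w S
  proof -
    have "1 - (?f w)\<^sup>2 > 0" using elastica_sin_lt_1[OF W a1 b1 w] abs_square_less_1[of "?f w"] by simp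
    note sq = DERIV_real_sqrt[OF this]
    have inner: "((\<lambda>w. 1 - (?f w)\<^sup>2) has_real_derivative (0 - (?f' w * ?f w + ?f' w * ?f w))) (at w within S)"
      using DERIV_diff[OF DERIV_const[of 1] DERIV_mult[OF elastica_sin_derivative[of W a b w S] elastica_sin_derivative[of W a b w S]]]
      by (simp only: power2_eq_square)
    from DERIV_chain2[OF sq inner]
    have "(?c has_real_derivative inverse (?c w) / 2 * (0 - (?f' w * ?f w + ?f' w * ?f w))) (at w within S)"
      unfolding elastica_cos_def .
    moreover have "inverse z / 2 * (0 - (p * q + p * q)) = - (q * p / z)" for z p q :: real
      by (cases "z = 0") (auto simp: field_simps)
    ultimately show ?thesis by (simp only:)
  qed
  have s0: "sinh W > 0" using W by simp
  \<comment> \<open>On the left half f + f', and on the right half f - f', combines an exponential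
    with exponent at most W / 2 and one with exponent at most 0, divided by sinh W.\<close>
  define \<delta> where "\<delta> = 2 * exp (W / 2) / sinh W"
  have \<delta>: "\<delta> \<ge> 0" unfolding \<delta>_def using s0 by simp
  \<comment> \<open>Both halves at once: \<sigma> = 1 for the left, \<sigma> = -1 for the
    right.\<close>
  have half: "\<bar>integral {u..v} (\<lambda>w. 2 * (?f w)\<^sup>2 / ?c w) - \<sigma> * 2 * (?c v - ?c u)\<bar> \<le> 2 * \<delta> / cm * (v - u)"
    if uv: "0 \<le> u" "u \<le> v" "v \<le> W" and \<sigma>: "\<sigma> = 1 \<or> \<sigma> = -1"
      and small: "\<And>w. w \<in> {u..v} \<Longrightarrow> \<bar>?f w + \<sigma> * ?f' w\<bar> \<le> \<delta>" for u v \<sigma>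
  proof -
    have sub: "{u..v} \<subseteq> {0..W}" using uv by auto
    have ne: "?c w \<noteq> 0" if "w \<in> {u..v}" for w using cp[of w] sub that by auto
    have c1: "continuous_on {u..v} (\<lambda>w. 2 * (?f w)\<^sup>2 / ?c w)"
      by (intro continuous_intros cont) (use ne in auto)
    have h: "((\<lambda>w. - (?f w * ?f' w / ?c w)) has_integral ?c v - ?c u) {u..v}"
      by (rule fundamental_theorem_of_calculus[OF uv(2)])
        (rule dc[unfolded has_real_derivative_iff_has_vector_derivative], use sub in blast)
    have h2: "((\<lambda>w. 2 * (?f w)\<^sup>2 / ?c w - \<sigma> * 2 * (- (?f w * ?f' w / ?c w))) has_integral
        integral {u..v} (\<lambda>w. 2 * (?f w)\<^sup>2 / ?c w) - \<sigma> * 2 * (?c v - ?c u)) {u..v}"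
      by (intro has_integral_diff has_integral_mult_right h integrable_integral integrable_continuous_real c1)
    have "norm (integral {u..v} (\<lambda>w. 2 * (?f w)\<^sup>2 / ?c w) - \<sigma> * 2 * (?c v - ?c u)) \<le> 2 * \<delta> / cm * measure lborel {u..v}"
    proof (rule has_integral_bound_real[OF _ finite.emptyI h2])
      show "0 \<le> 2 * \<delta> / cm" using \<delta> cm by simp
      fix w assume "w \<in> {u..v} - {}"
      hence w: "w \<in> {u..v}" "w \<in> {0..W}" using sub by auto
      have "2 * (?f w)\<^sup>2 / ?c w - \<sigma> * 2 * (- (?f w * ?f' w / ?c w)) = 2 * (?f w * (?f w + \<sigma> * ?f' w)) / ?c w"
        using ne[OF w(1)] by (simp add: field_simps power2_eq_square)
      also have "norm \<dots> = 2 * (\<bar>?f w\<bar> * \<bar>?f w + \<sigma> * ?f' w\<bar>) / ?c w" using cp[OF w(2)] by (simp add: abs_mult)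
      also have "\<dots> \<le> 2 * (1 * \<delta>) / cm"
        using elastica_sin_lt_1[OF W a1 b1 w(2)] small[OF w(1)] cge[OF w(2)] cm
        by (intro frac_le mult_left_mono mult_mono) auto
      finally show "norm (2 * (?f w)\<^sup>2 / ?c w - \<sigma> * 2 * (- (?f w * ?f' w / ?c w))) \<le> 2 * \<delta> / cm" by simp
    qed
    thus ?thesis using uv by simp
  qed
  have ex: "exp w + exp (0::real) \<le> 2 * exp (W / 2)" if "w \<in> {0..W/2}" for w
  proof -
    have "exp w \<le> exp (W / 2)" "exp (0::real) \<le> exp (W / 2)" using that W by (simp_all only: exp_le_cancel_iff) auto
    thus ?thesis by linarith
  qed
  have bnd: "\<bar>p * exp x - q * exp y\<bar> / sinh W \<le> \<delta>" if "\<bar>p\<bar> < 1" "\<bar>q\<bar> < 1" "x \<in> {0..W/2}" "y \<le> 0" for p q x y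
  proof -
    have "\<bar>p * exp x - q * exp y\<bar> \<le> \<bar>p\<bar> * exp x + \<bar>q\<bar> * exp y"
      using abs_triangle_ineq4[of "p * exp x" "q * exp y"] by (simp add: abs_mult)
    also have "\<dots> \<le> 1 * exp x + 1 * exp 0" using that by (intro add_mono mult_mono) auto
    also have "\<dots> \<le> 2 * exp (W / 2)" using ex[OF that(3)] by simp
    finally show ?thesis unfolding \<delta>_def using s0 by (simp add: divide_right_mono)
  qed
  have se: "sinh x - cosh x = - exp (- x)" "sinh x + cosh x = exp x" for x :: real
    by (simp_all add: sinh_minus_cosh sinh_plus_cosh)
  have 1: "\<bar>integral {0..W/2} (\<lambda>w. 2 * (?f w)\<^sup>2 / ?c w) - 1 * 2 * (?c (W/2) - ?c 0)\<bar> \<le> 2 * \<delta> / cm * (W/2 - 0)"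
  proof (rule half)
    fix w assume w: "w \<in> {0..W/2}"
    have "?f w + 1 * ?f' w = (a * (sinh (W - w) - cosh (W - w)) + b * (sinh w + cosh w)) / sinh W"
      unfolding elastica_sin_def elastica_slope_def by (simp add: add_divide_distrib[symmetric] algebra_simps)
    also have "\<dots> = (b * exp w - a * exp (- (W - w))) / sinh W" unfolding se by simp
    finally have "\<bar>?f w + 1 * ?f' w\<bar> = \<bar>b * exp w - a * exp (- (W - w))\<bar> / sinh W" using s0 by (simp add: abs_divide)
    thus "\<bar>?f w + 1 * ?f' w\<bar> \<le> \<delta>" using bnd[OF b1 a1 w, of "- (W - w)"] w W by auto
  qed (use W in auto)
  have 2: "\<bar>integral {W/2..W} (\<lambda>w. 2 * (?f w)\<^sup>2 / ?c w) - (-1) * 2 * (?c W - ?c (W/2))\<bar> \<le> 2 * \<delta> / cm * (W - W/2)"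
  proof (rule half)
    fix w assume w: "w \<in> {W/2..W}"
    have "?f w + (-1) * ?f' w = (a * (sinh (W - w) + cosh (W - w)) + b * (sinh w - cosh w)) / sinh W"
      unfolding elastica_sin_def elastica_slope_def by (simp add: add_divide_distrib diff_divide_distrib distrib_left right_diff_distrib)
    also have "\<dots> = (a * exp (W - w) - b * exp (- w)) / sinh W" unfolding se by simp
    finally have "\<bar>?f w + (-1) * ?f' w\<bar> = \<bar>a * exp (W - w) - b * exp (- w)\<bar> / sinh W" using s0 by (simp add: abs_divide)
    thus "\<bar>?f w + (-1) * ?f' w\<bar> \<le> \<delta>" using bnd[OF a1 b1, of "W - w" "- w"] w W by auto
  qed (use W in auto)
  have cI: "continuous_on {0..W} (\<lambda>w. 2 * (?f w)\<^sup>2 / ?c w)"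
    by (intro continuous_intros cont) (use cp in force)
  have "integral {0..W/2} (\<lambda>w. 2 * (?f w)\<^sup>2 / ?c w) + integral {W/2..W} (\<lambda>w. 2 * (?f w)\<^sup>2 / ?c w) = elastica_potential W a b"
    unfolding elastica_potential_def
    using W by (intro Henstock_Kurzweil_Integration.integral_combine integrable_continuous_real cI) auto
  moreover have "?c 0 = sqrt (1 - a\<^sup>2)" "?c W = sqrt (1 - b\<^sup>2)"
    unfolding elastica_cos_def elastica_sin_ends[OF W] by simp_all
  moreover have "2 * \<delta> / cm * (W/2 - 0) + 2 * \<delta> / cm * (W - W/2) = 2 * \<delta> * W / cm" by (simp add: field_simps)
  moreover have "2 * \<delta> * W / cm = 4 * W * exp (W / 2) / sinh W / sqrt (1 - m\<^sup>2)"
    unfolding \<delta>_def cm_def by simp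
  moreover have "\<bar>i - (4 * z - 2 * p - 2 * q)\<bar> \<le> r"
    if "i1 + i2 = i" "c0 = p" "cW = q" "x1 + x2 = y" "y = r" "\<bar>i1 - 1 * 2 * (z - c0)\<bar> \<le> x1" "\<bar>i2 - (-1) * 2 * (cW - z)\<bar> \<le> x2"
    for i i1 i2 z p q r c0 cW x1 x2 y :: real
  proof -
    have "i - (4 * z - 2 * p - 2 * q) = (i1 - 1 * 2 * (z - c0)) + (i2 - (-1) * 2 * (cW - z))"
      unfolding that(1-3)[symmetric] by simp
    moreover have "\<bar>(i1 - 1 * 2 * (z - c0)) + (i2 - (-1) * 2 * (cW - z))\<bar> \<le> x1 + x2"
      by (rule order_trans[OF abs_triangle_ineq add_mono[OF that(6,7)]])
    ultimately show ?thesis using that(4,5) by simp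
  qed
  ultimately show ?thesis using 1 2 by blast
qed

text \<open>From c^2 = 1 - f^2 and 0 < c \<le> 1 follows 1 \<le> 1 / c \<le> 1 + f^2 / c. The time
  thus exceeds W by at most half the potential, which stays bounded as W grows.\<close>

lemma elastica_time_estimate:
  assumes W: "W > 0" and a: "\<bar>a\<bar> < 1" and b: "\<bar>b\<bar> < 1"
  shows "W \<le> elastica_time W a b" "elastica_time W a b \<le> W + elastica_potential W a b / 2"
proof -
  let ?f = "elastica_sin W a b" and ?c = "elastica_cos W a b"
  have cp: "?c w > 0" if "w \<in> {0..W}" for w by (rule elastica_cos_pos[OF W a b that])
  have c1: "continuous_on {0..W} (\<lambda>w. 1 / ?c w)" "continuous_on {0..W} (\<lambda>w. 2 * (?f w)\<^sup>2 / ?c w)"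
    by (rule continuous_on_divide, (intro continuous_intros elastica_cos_continuous[OF W a b] elastica_sin_continuous[OF W a b])+,
        use cp in force)+
  have one: "((\<lambda>s. 1::real) has_integral W) {0..W}" using has_integral_const_real[of "1::real" 0 W] W by simp
  have pw: "1 \<le> 1 / ?c w \<and> 1 / ?c w \<le> 1 + 2 * (?f w)\<^sup>2 / ?c w * (1/2)" if w: "w \<in> {0..W}" for w
  proof -
    have le: "?c w \<le> 1" unfolding elastica_cos_def by simp
    have "(?f w)\<^sup>2 < 1" using elastica_sin_lt_1[OF W a b w] abs_square_less_1 by blast
    hence "(?f w)\<^sup>2 = 1 - (?c w)\<^sup>2" unfolding elastica_cos_def by simp
    moreover have "(?c w)\<^sup>2 \<le> ?c w" using le cp[OF w] by (simp add: power2_eq_square mult_left_le_one_le less_imp_le)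
    ultimately have "1 \<le> ?c w + (?f w)\<^sup>2" by linarith
    thus ?thesis using le cp[OF w] by (simp add: field_simps)
  qed
  have i1: "((\<lambda>w. 1 / ?c w) has_integral elastica_time W a b) {0..W}"
    unfolding elastica_time_def by (rule integrable_integral[OF integrable_continuous_real[OF c1(1)]])
  have i2: "((\<lambda>w. 2 * (?f w)\<^sup>2 / ?c w) has_integral elastica_potential W a b) {0..W}"
    unfolding elastica_potential_def by (rule integrable_integral[OF integrable_continuous_real[OF c1(2)]])
  show "W \<le> elastica_time W a b" by (rule has_integral_le[OF one i1]) (use pw in blast)
  have "((\<lambda>w. 1 + 2 * (?f w)\<^sup>2 / ?c w * (1/2)) has_integral W + elastica_potential W a b * (1/2)) {0..W}"
    by (intro has_integral_add has_integral_mult_left one i2)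
  from has_integral_le[OF i1 this] pw show "elastica_time W a b \<le> W + elastica_potential W a b / 2" by simp
qed

context
  fixes F :: "'x filter" and W a b :: "'x \<Rightarrow> real" and A B :: real
  assumes W: "filterlim W at_top F" and a: "(a \<longlongrightarrow> A) F" and b: "(b \<longlongrightarrow> B) F"
    and A: "\<bar>A\<bar> < 1" and B: "\<bar>B\<bar> < 1"
begin

text \<open>The error bound for the potential degenerates when the end sines approach modulus 1;
  halfway between the limits and 1 there is a common bound m.\<close>

lemma eventually_elastica_regime:
  obtains m where "m < 1" "\<forall>\<^sub>F x in F. W x > 0 \<and> \<bar>a x\<bar> \<le> m \<and> \<bar>b x\<bar> \<le> m"
proof -
  define m where "m = (max \<bar>A\<bar> \<bar>B\<bar> + 1) / 2"
  have m: "m < 1" "\<bar>A\<bar> < m" "\<bar>B\<bar> < m" unfolding m_def using A B by auto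
  have "\<forall>\<^sub>F x in F. W x > 0" by (rule filterlim_at_top_dense[THEN iffD1, OF W, rule_format])
  moreover have "\<forall>\<^sub>F x in F. \<bar>a x\<bar> < m" by (rule order_tendstoD(2)[OF tendsto_rabs[OF a] m(2)])
  moreover have "\<forall>\<^sub>F x in F. \<bar>b x\<bar> < m" by (rule order_tendstoD(2)[OF tendsto_rabs[OF b] m(3)])
  ultimately have "\<forall>\<^sub>F x in F. W x > 0 \<and> \<bar>a x\<bar> \<le> m \<and> \<bar>b x\<bar> \<le> m" by eventually_elim auto
  with m(1) show ?thesis by (rule that)
qed

lemma elastica_potential_tendsto:
  "((\<lambda>x. elastica_potential (W x) (a x) (b x)) \<longlongrightarrow> 4 - 2 * sqrt (1 - A\<^sup>2) - 2 * sqrt (1 - B\<^sup>2)) F"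
proof -
  obtain m where m: "m < 1" and ev: "\<forall>\<^sub>F x in F. W x > 0 \<and> \<bar>a x\<bar> \<le> m \<and> \<bar>b x\<bar> \<le> m"
    by (rule eventually_elastica_regime) (rule that)
  have "((\<lambda>w::real. sinh (w / 2) / sinh w) \<longlongrightarrow> 0) at_top" by real_asymp
  from filterlim_compose[OF this W] have r: "((\<lambda>x. sinh (W x / 2) / sinh (W x)) \<longlongrightarrow> 0) F" .
  \<comment> \<open>The value of \<open>elastica_sin\<close> at W / 2: in the middle the direction
    becomes parallel to the tilted axis.\<close>
  have mid: "((\<lambda>x. (a x + b x) * (sinh (W x / 2) / sinh (W x))) \<longlongrightarrow> (A + B) * 0) F"
    by (intro tendsto_mult tendsto_add a b r)
  have "((\<lambda>x. sqrt (1 - ((a x + b x) * (sinh (W x / 2) / sinh (W x)))\<^sup>2)) \<longlongrightarrow> sqrt (1 - ((A + B) * 0)\<^sup>2)) F"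
    by (rule tendsto_real_sqrt[OF tendsto_diff[OF tendsto_const tendsto_power[OF mid]]])
  hence cmid: "((\<lambda>x. elastica_cos (W x) (a x) (b x) (W x / 2)) \<longlongrightarrow> 1) F"
    unfolding elastica_cos_def elastica_sin_def by (simp add: distrib_right)
  have "((\<lambda>w::real. 4 * w * exp (w / 2) / sinh w) \<longlongrightarrow> 0) at_top" by real_asymp
  from filterlim_compose[OF this W] have e: "((\<lambda>x. 4 * W x * exp (W x / 2) / sinh (W x)) \<longlongrightarrow> 0) F" .
  have e': "((\<lambda>x. 4 * W x * exp (W x / 2) / sinh (W x) / sqrt (1 - m\<^sup>2)) \<longlongrightarrow> 0) F"
    by (rule tendsto_divide_zero[OF e])
  have L: "((\<lambda>x. 4 * elastica_cos (W x) (a x) (b x) (W x / 2) - 2 * sqrt (1 - (a x)\<^sup>2) - 2 * sqrt (1 - (b x)\<^sup>2)) \<longlongrightarrow>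
     4 * 1 - 2 * sqrt (1 - A\<^sup>2) - 2 * sqrt (1 - B\<^sup>2)) F"
    by (intro tendsto_intros cmid a b)
  have "((\<lambda>x. elastica_potential (W x) (a x) (b x) -
      (4 * elastica_cos (W x) (a x) (b x) (W x / 2) - 2 * sqrt (1 - (a x)\<^sup>2) - 2 * sqrt (1 - (b x)\<^sup>2))) \<longlongrightarrow> 0) F"
  proof (rule Lim_null_comparison[OF _ e'])
    show "\<forall>\<^sub>F x in F. norm (elastica_potential (W x) (a x) (b x) -
      (4 * elastica_cos (W x) (a x) (b x) (W x / 2) - 2 * sqrt (1 - (a x)\<^sup>2) - 2 * sqrt (1 - (b x)\<^sup>2)))
      \<le> 4 * W x * exp (W x / 2) / sinh (W x) / sqrt (1 - m\<^sup>2)"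
      using ev
    proof eventually_elim
      case (elim x)
      thus ?case using elastica_potential_estimate[of "W x" "a x" m "b x"] m by simp
    qed
  qed
  from tendsto_add[OF this L] show ?thesis by simp
qed

lemma elastica_time_tendsto: "((\<lambda>x. elastica_time (W x) (a x) (b x) / W x) \<longlongrightarrow> 1) F"
proof -
  obtain m where m: "m < 1" and ev: "\<forall>\<^sub>F x in F. W x > 0 \<and> \<bar>a x\<bar> \<le> m \<and> \<bar>b x\<bar> \<le> m"
    by (rule eventually_elastica_regime) (rule that)
  have i: "((\<lambda>x. inverse (W x)) \<longlongrightarrow> 0) F" by (rule tendsto_inverse_0_at_top[OF W])
  have u: "((\<lambda>x. 1 + elastica_potential (W x) (a x) (b x) / 2 * inverse (W x)) \<longlongrightarrow>
     1 + (4 - 2 * sqrt (1 - A\<^sup>2) - 2 * sqrt (1 - B\<^sup>2)) / 2 * 0) F"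
    by (intro tendsto_add tendsto_mult tendsto_const tendsto_divide elastica_potential_tendsto i) simp
  show ?thesis
  proof (rule tendsto_sandwich[OF _ _ tendsto_const[of 1] u[simplified]])
    show "\<forall>\<^sub>F x in F. 1 \<le> elastica_time (W x) (a x) (b x) / W x" using ev
    proof eventually_elim
      case (elim x) thus ?case using elastica_time_estimate(1)[of "W x" "a x" "b x"] m by simp
    qed
    show "\<forall>\<^sub>F x in F. elastica_time (W x) (a x) (b x) / W x \<le> 1 + elastica_potential (W x) (a x) (b x) * inverse (W x) / 2" using ev
    proof eventually_elim
      case (elim x) thus ?case using elastica_time_estimate(2)[of "W x" "a x" "b x"] m by (simp add: field_simps)
    qed
  qed
qed

lemma elastica_impulse_tendsto: "((\<lambda>x. elastica_impulse (W x) (a x) (b x)) \<longlongrightarrow> 2 * (A + B)) F"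
proof -
  have "((\<lambda>w::real. (cosh w - 1) / sinh w) \<longlongrightarrow> 1) at_top" by real_asymp
  from filterlim_compose[OF this W] have r: "((\<lambda>x. (cosh (W x) - 1) / sinh (W x)) \<longlongrightarrow> 1) F" .
  have "((\<lambda>x. 2 * (a x + b x) * ((cosh (W x) - 1) / sinh (W x))) \<longlongrightarrow> 2 * (A + B) * 1) F"
    by (intro tendsto_mult tendsto_add tendsto_const a b r)
  thus ?thesis unfolding elastica_impulse_def by simp
qed

text \<open>The energy is of order exp (- W), while the time is of order W.\<close>

lemma elastica_energy_tendsto:
  "((\<lambda>x. elastica_energy (W x) (a x) (b x) * elastica_time (W x) (a x) (b x)) \<longlongrightarrow> 0) F"
proof -
  have "((\<lambda>w::real. w / (sinh w)\<^sup>2) \<longlongrightarrow> 0) at_top" "((\<lambda>w::real. cosh w * w / (sinh w)\<^sup>2) \<longlongrightarrow> 0) at_top" by real_asymp+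
  from this[THEN filterlim_compose, OF W]
  have r: "((\<lambda>x. W x / (sinh (W x))\<^sup>2) \<longlongrightarrow> 0) F" "((\<lambda>x. cosh (W x) * W x / (sinh (W x))\<^sup>2) \<longlongrightarrow> 0) F" .
  have "((\<lambda>x. (((a x)\<^sup>2 + (b x)\<^sup>2) * (W x / (sinh (W x))\<^sup>2) - 2 * a x * b x * (cosh (W x) * W x / (sinh (W x))\<^sup>2))
      * (elastica_time (W x) (a x) (b x) / W x)) \<longlongrightarrow> ((A\<^sup>2 + B\<^sup>2) * 0 - 2 * A * B * 0) * 1) F"
    by (intro tendsto_mult tendsto_diff tendsto_add tendsto_power tendsto_const a b r elastica_time_tendsto)
  moreover have "\<forall>\<^sub>F x in F. W x > 0" by (rule filterlim_at_top_dense[THEN iffD1, OF W, rule_format])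
  hence "\<forall>\<^sub>F x in F. (((a x)\<^sup>2 + (b x)\<^sup>2) * (W x / (sinh (W x))\<^sup>2) - 2 * a x * b x * (cosh (W x) * W x / (sinh (W x))\<^sup>2))
      * (elastica_time (W x) (a x) (b x) / W x) = elastica_energy (W x) (a x) (b x) * elastica_time (W x) (a x) (b x)"
    by eventually_elim (simp add: elastica_energy_def field_simps)
  ultimately show ?thesis by (simp add: tendsto_cong)
qed

lemma elastica_slope_tendsto:
  "((\<lambda>x. elastica_slope (W x) (a x) (b x) 0) \<longlongrightarrow> - A) F"
  "((\<lambda>x. elastica_slope (W x) (a x) (b x) (W x)) \<longlongrightarrow> B) F"
proof -
  have "((\<lambda>w::real. 1 / sinh w) \<longlongrightarrow> 0) at_top" "((\<lambda>w::real. cosh w / sinh w) \<longlongrightarrow> 1) at_top" by real_asymp+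
  from this[THEN filterlim_compose, OF W]
  have r: "((\<lambda>x. 1 / sinh (W x)) \<longlongrightarrow> 0) F" "((\<lambda>x. cosh (W x) / sinh (W x)) \<longlongrightarrow> 1) F" .
  have "((\<lambda>x. b x * (1 / sinh (W x)) - a x * (cosh (W x) / sinh (W x))) \<longlongrightarrow> B * 0 - A * 1) F"
    "((\<lambda>x. b x * (cosh (W x) / sinh (W x)) - a x * (1 / sinh (W x))) \<longlongrightarrow> B * 1 - A * 0) F"
    by (intro tendsto_mult tendsto_diff a b r)+
  thus "((\<lambda>x. elastica_slope (W x) (a x) (b x) 0) \<longlongrightarrow> - A) F"
    "((\<lambda>x. elastica_slope (W x) (a x) (b x) (W x)) \<longlongrightarrow> B) F"
    unfolding elastica_slope_def by (simp_all add: diff_divide_distrib)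
qed

end

section \<open>Choice of the parameters\<close>

text \<open>Brouwer's theorem is applied to the map sending (x, y) to (x + f, y - g), clamped to the
  rectangle. If f or g is nonzero at a fixed point, the clamp is active there, and the point lies on
  a side whose sign condition excludes that value.\<close>

lemma poincare_miranda_2:
  fixes f g :: "real \<times> real \<Rightarrow> real"
  assumes le: "a1 \<le> b1" "a2 \<le> b2"
    and f: "continuous_on ({a1..b1} \<times> {a2..b2}) f" and g: "continuous_on ({a1..b1} \<times> {a2..b2}) g"
    and fs: "\<And>y. y \<in> {a2..b2} \<Longrightarrow> f (a1, y) \<ge> 0" "\<And>y. y \<in> {a2..b2} \<Longrightarrow> f (b1, y) \<le> 0"
    and gs: "\<And>x. x \<in> {a1..b1} \<Longrightarrow> g (x, a2) \<le> 0" "\<And>x. x \<in> {a1..b1} \<Longrightarrow> g (x, b2) \<ge> 0"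
  obtains x y where "x \<in> {a1..b1}" "y \<in> {a2..b2}" "f (x, y) = 0" "g (x, y) = 0"
proof -
  let ?S = "{a1..b1} \<times> {a2..b2}"
  define \<phi> where "\<phi> z = (max a1 (min b1 (fst z + f z)), max a2 (min b2 (snd z - g z)))" for z
  have "compact ?S" "convex ?S" "?S \<noteq> {}" using le by (auto intro!: compact_Times convex_Times)
  moreover have "continuous_on ?S \<phi>" unfolding \<phi>_def[abs_def] by (intro continuous_intros f g)
  moreover have "\<phi> \<in> ?S \<rightarrow> ?S" using le unfolding \<phi>_def by auto
  ultimately obtain z where z: "z \<in> ?S" "\<phi> z = z" by (rule brouwer)
  obtain x y where xy: "z = (x, y)" by (cases z)
  have x: "x \<in> {a1..b1}" and y: "y \<in> {a2..b2}" using z(1) unfolding xy by auto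
  have e1: "x = max a1 (min b1 (x + f (x, y)))" and e2: "y = max a2 (min b2 (y - g (x, y)))"
    using z(2) unfolding xy \<phi>_def by simp_all
  have "f (x, y) = 0"
  proof (rule ccontr)
    assume "f (x, y) \<noteq> 0"
    hence "(f (x, y) > 0 \<and> x = b1) \<or> (f (x, y) < 0 \<and> x = a1)" using e1 x by (auto simp: max_def min_def split: if_splits)
    thus False using fs[OF y] by auto
  qed
  moreover have "g (x, y) = 0"
  proof (rule ccontr)
    assume "g (x, y) \<noteq> 0"
    hence "(g (x, y) > 0 \<and> y = a2) \<or> (g (x, y) < 0 \<and> y = b2)" using e2 y by (auto simp: max_def min_def split: if_splits)
    thus False using gs[OF x] by auto
  qed
  ultimately show ?thesis using that x y by blast
qed

lemma integral_rescale_unit: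
  fixes h :: "real \<Rightarrow> real"
  assumes W: "W > 0" and c: "continuous_on {0..W} h"
  shows "integral {0..W} h = integral {0..1} (\<lambda>u. W * h (W * u))"
proof -
  have "((\<lambda>u. W *\<^sub>R h (W * u)) has_integral integral {W * 0..W * 1} h) {0..1}"
  proof (rule has_integral_substitution[OF _ _ _ c])
    show "(\<lambda>u. W * u) ` {0..1} \<subseteq> {0..W}" using W by (auto simp: mult_left_le)
    show "((*) W has_real_derivative W) (at x within {0..1})" for x by (rule DERIV_cmult_Id)
  qed (use W in auto)
  hence "((\<lambda>u. W * h (W * u)) has_integral integral {0..W} h) {0..1}" by simp
  from integral_unique[OF this] show ?thesis by (rule sym)
qed

text \<open>The interval [0, W] moves with the parameter. After rescaling to [0, 1] the domain is
  fixed and the integrand is jointly continuous.\<close>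

lemma elastica_integrals_continuous:
  fixes wf af bf :: "'z::topological_space \<Rightarrow> real"
  assumes c: "continuous_on S wf" "continuous_on S af" "continuous_on S bf"
    and pos: "\<And>z. z \<in> S \<Longrightarrow> wf z > 0" and lt: "\<And>z. z \<in> S \<Longrightarrow> \<bar>af z\<bar> < 1" "\<And>z. z \<in> S \<Longrightarrow> \<bar>bf z\<bar> < 1"
  shows "continuous_on S (\<lambda>z. elastica_time (wf z) (af z) (bf z))"
    and "continuous_on S (\<lambda>z. elastica_potential (wf z) (af z) (bf z))"
proof -
  have in01: "wf z * u \<in> {0..wf z}" if "z \<in> S" "u \<in> {0..1}" for z u
    using pos[OF that(1)] that(2) by (auto simp: mult_left_le)
  have cp: "elastica_cos (wf z) (af z) (bf z) (wf z * u) > 0" if "z \<in> S" "u \<in> {0..1}" for z u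
    using elastica_cos_pos[OF pos lt in01] that by blast
  have fs: "continuous_on (S \<times> {0..1}) (\<lambda>x. h (fst x))" if "continuous_on S h" for h :: "'z \<Rightarrow> real"
    by (rule continuous_on_compose2[OF that continuous_on_fst[OF continuous_on_id]]) auto
  have sn: "continuous_on (S \<times> {0..1::real}) snd" by (rule continuous_on_snd[OF continuous_on_id])
  have cs: "continuous_on (S \<times> {0..1}) (\<lambda>x. elastica_sin (wf (fst x)) (af (fst x)) (bf (fst x)) (wf (fst x) * snd x))"
    unfolding elastica_sin_def
    by (intro continuous_on_divide continuous_on_add continuous_on_mult continuous_on_sinh continuous_on_diff fs c sn)
      (use pos in \<open>force\<close>)
  have cc: "continuous_on (S \<times> {0..1}) (\<lambda>x. elastica_cos (wf (fst x)) (af (fst x)) (bf (fst x)) (wf (fst x) * snd x))"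
    unfolding elastica_cos_def by (intro continuous_on_real_sqrt continuous_on_diff continuous_on_const continuous_on_power cs)
  have nz: "elastica_cos (wf (fst x)) (af (fst x)) (bf (fst x)) (wf (fst x) * snd x) \<noteq> 0" if "x \<in> S \<times> {0..1}" for x
    using cp[of "fst x" "snd x"] that by auto
  have t: "continuous_on S (\<lambda>z. integral (cbox 0 1) (\<lambda>u. wf z * (1 / elastica_cos (wf z) (af z) (bf z) (wf z * u))))"
    by (rule integral_continuous_on_param)
      (unfold split_beta box_real, intro continuous_on_mult continuous_on_divide continuous_on_const cc fs c ballI nz)
  have p: "continuous_on S (\<lambda>z. integral (cbox 0 1) (\<lambda>u. wf z * (2 * (elastica_sin (wf z) (af z) (bf z) (wf z * u))\<^sup>2 / elastica_cos (wf z) (af z) (bf z) (wf z * u))))"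
    by (rule integral_continuous_on_param)
      (unfold split_beta box_real, intro continuous_on_mult continuous_on_divide continuous_on_const continuous_on_power cs cc fs c ballI nz)
  have cW: "continuous_on {0..wf z} (elastica_cos (wf z) (af z) (bf z))" "continuous_on {0..wf z} (elastica_sin (wf z) (af z) (bf z))"
    if "z \<in> S" for z
    by (rule elastica_cos_continuous[OF pos[OF that] lt(1)[OF that] lt(2)[OF that]],
        rule elastica_sin_continuous[OF pos[OF that] lt(1)[OF that] lt(2)[OF that]])
  have nW: "\<forall>w\<in>{0..wf z}. elastica_cos (wf z) (af z) (bf z) w \<noteq> 0" if "z \<in> S" for z
    using elastica_cos_pos[OF pos[OF that] lt(1)[OF that] lt(2)[OF that]] by force
  show "continuous_on S (\<lambda>z. elastica_time (wf z) (af z) (bf z))"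
  proof (rule continuous_on_cong[THEN iffD2, OF refl _ t])
    fix z assume z: "z \<in> S"
    show "elastica_time (wf z) (af z) (bf z) = integral (cbox 0 1) (\<lambda>u. wf z * (1 / elastica_cos (wf z) (af z) (bf z) (wf z * u)))"
      unfolding elastica_time_def box_real
      by (rule integral_rescale_unit[OF pos[OF z]]) (intro continuous_on_divide continuous_on_const cW z nW)
  qed
  show "continuous_on S (\<lambda>z. elastica_potential (wf z) (af z) (bf z))"
  proof (rule continuous_on_cong[THEN iffD2, OF refl _ p])
    fix z assume z: "z \<in> S"
    show "elastica_potential (wf z) (af z) (bf z) = integral (cbox 0 1) (\<lambda>u. wf z * (2 * (elastica_sin (wf z) (af z) (bf z) (wf z * u))\<^sup>2 / elastica_cos (wf z) (af z) (bf z) (wf z * u)))"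
      unfolding elastica_potential_def box_real
      by (rule integral_rescale_unit[OF pos[OF z]])
        (intro continuous_on_divide continuous_on_mult continuous_on_power continuous_on_const cW z nW)
  qed
qed

section \<open>Asymptotics of the closing conditions\<close>

text \<open>A parameter is a pair \<open>z = (W, \<beta>)\<close>. The height of the curve is asymptotically
  \<open>2 (sin (\<theta>0 / 2) + sin (\<theta>1 / 2)) + \<beta>\<close>, whose zeros satisfy \<open>\<bar>\<beta>\<bar> < 5\<close> for large \<open>W\<close>.\<close>

definition tilt :: "real \<times> real \<Rightarrow> real" where "tilt z = snd z / fst z"

definition end_sin :: "real \<Rightarrow> real \<times> real \<Rightarrow> real" where "end_sin \<theta> z = sin ((\<theta> - tilt z) / 2)"

definition param_filter :: "(real \<times> real) filter" where "param_filter = at_top \<times>\<^sub>F principal {-5..5}"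

lemma eventually_param_filter:
  "eventually P param_filter \<longleftrightarrow> (\<exists>W1. \<forall>W\<ge>W1. \<forall>\<beta>\<in>{-5..5}. P (W, \<beta>))"
proof
  assume "eventually P param_filter"
  then obtain Pf Pg where "eventually Pf at_top" "\<forall>\<beta>\<in>{-5..5}. Pg \<beta>" "\<And>x y. Pf x \<Longrightarrow> Pg y \<Longrightarrow> P (x, y)"
    unfolding param_filter_def eventually_prod_filter eventually_principal by blast
  thus "\<exists>W1. \<forall>W\<ge>W1. \<forall>\<beta>\<in>{-5..5}. P (W, \<beta>)" unfolding eventually_at_top_linorder by blast
next
  assume "\<exists>W1. \<forall>W\<ge>W1. \<forall>\<beta>\<in>{-5..5}. P (W, \<beta>)"
  then obtain W1 where "\<forall>W\<ge>W1. \<forall>\<beta>\<in>{-5..5}. P (W, \<beta>)" ..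
  thus "eventually P param_filter"
    unfolding param_filter_def eventually_prod_filter eventually_principal
    by (intro exI[of _ "\<lambda>W. W \<ge> W1"] exI[of _ "\<lambda>\<beta>. \<beta> \<in> {-5..5}"]) (auto simp: eventually_ge_at_top)
qed

lemma param_filter_fst: "filterlim fst at_top param_filter"
  unfolding filterlim_at_top eventually_param_filter by auto

lemma eventually_param_pos: "\<forall>\<^sub>F z in param_filter. fst z > 0"
  by (rule filterlim_at_top_dense[THEN iffD1, OF param_filter_fst, rule_format])

lemma eventually_param_bound: "\<forall>\<^sub>F z in param_filter. \<bar>snd z\<bar> \<le> 5"
  unfolding eventually_param_filter by auto

lemma param_inverse_tendsto: "((\<lambda>z. inverse (fst z)) \<longlongrightarrow> 0) param_filter"
  by (rule tendsto_inverse_0_at_top[OF param_filter_fst])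

lemma tilt_tendsto: "(tilt \<longlongrightarrow> 0) param_filter"
proof (rule Lim_null_comparison)
  show "((\<lambda>z. 5 * inverse (fst z)) \<longlongrightarrow> 0) param_filter"
    by (rule tendsto_mult_right_zero[OF param_inverse_tendsto])
  show "\<forall>\<^sub>F z in param_filter. norm (tilt z) \<le> 5 * inverse (fst z)"
    using eventually_param_pos eventually_param_bound
    by eventually_elim (simp add: tilt_def field_simps abs_divide)
qed

lemma end_sin_tendsto: "(end_sin \<theta> \<longlongrightarrow> sin (\<theta> / 2)) param_filter"
proof -
  have "((\<lambda>z. sin ((\<theta> - tilt z) / 2)) \<longlongrightarrow> sin ((\<theta> - 0) / 2)) param_filter"
    by (intro tendsto_sin tendsto_divide tendsto_diff tendsto_const tilt_tendsto) simp
  thus ?thesis unfolding end_sin_def[abs_def] by simp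
qed

context
  fixes \<theta>0 \<theta>1 :: real
  assumes \<theta>0: "\<theta>0 \<in> {-pi<..<pi} - {0}" and \<theta>1: "\<theta>1 \<in> {-pi<..<pi} - {0}"
begin

definition time_of :: "real \<times> real \<Rightarrow> real" where "time_of z = elastica_time (fst z) (end_sin \<theta>0 z) (end_sin \<theta>1 z)"
definition potential_of :: "real \<times> real \<Rightarrow> real" where "potential_of z = elastica_potential (fst z) (end_sin \<theta>0 z) (end_sin \<theta>1 z)"
definition impulse_of :: "real \<times> real \<Rightarrow> real" where "impulse_of z = elastica_impulse (fst z) (end_sin \<theta>0 z) (end_sin \<theta>1 z)"
definition energy_of :: "real \<times> real \<Rightarrow> real" where "energy_of z = elastica_energy (fst z) (end_sin \<theta>0 z) (end_sin \<theta>1 z)"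
definition slope_of :: "real \<times> real \<Rightarrow> real \<Rightarrow> real" where "slope_of z = elastica_slope (fst z) (end_sin \<theta>0 z) (end_sin \<theta>1 z)"
text \<open>By \<open>elastica_parametrisation\<close> the final ordinate of the curve is L / T
  times this quantity.\<close>

definition height_of :: "real \<times> real \<Rightarrow> real" where
  "height_of z = impulse_of z * cos (tilt z) + sin (tilt z) * (time_of z - potential_of z)"
text \<open>One minus the final abscissa divided by L, that is (L - l) / L for a curve ending at (l,
  0).\<close>

definition defect_of :: "real \<times> real \<Rightarrow> real" where
  "defect_of z = 1 - (cos (tilt z) * (time_of z - potential_of z) - sin (tilt z) * impulse_of z) / time_of z"
text \<open>The limit of the potential: each end layer approaches a half-infinite borderline
  elastica, on which, in the normalisation X'' = sin X, the integral of 1 - cos X is 4 sin^2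
  (\<theta> / 4).\<close>

definition layer_mass :: real where "layer_mass = 4 * ((sin (\<theta>0 / 4))\<^sup>2 + (sin (\<theta>1 / 4))\<^sup>2)"

lemma half_angle_bounds:
  assumes "\<theta> \<in> {-pi<..<pi} - {0}"
  shows "\<bar>sin (\<theta> / 2)\<bar> < 1" "cos (\<theta> / 2) > 0" "sqrt (1 - (sin (\<theta> / 2))\<^sup>2) = cos (\<theta> / 2)" "sin (\<theta> / 2) * \<theta> > 0"
    "cos (\<theta> / 2) = 1 - 2 * (sin (\<theta> / 4))\<^sup>2" "(sin (\<theta> / 4))\<^sup>2 > 0"
proof -
  show c: "cos (\<theta> / 2) > 0" using assms by (intro cos_gt_zero_pi) auto
  have "(sin (\<theta> / 2))\<^sup>2 < 1" using c unfolding sin_squared_eq by simp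
  thus "\<bar>sin (\<theta> / 2)\<bar> < 1" by (simp add: abs_square_less_1)
  show "sqrt (1 - (sin (\<theta> / 2))\<^sup>2) = cos (\<theta> / 2)" using c unfolding sin_squared_eq by simp
  show "cos (\<theta> / 2) = 1 - 2 * (sin (\<theta> / 4))\<^sup>2" using cos_half_angle[of "\<theta> / 2"] by simp
  have s: "sin (\<theta> / c) * \<theta> > 0" if "c \<ge> 2" for c
  proof (cases "\<theta> > 0")
    case True
    have "\<theta> / c \<le> \<theta> / 1" using True that by (intro divide_left_mono) auto
    hence "sin (\<theta> / c) > 0" using assms True that by (intro sin_gt_zero) auto
    thus ?thesis using True by simp
  next
    case False
    hence neg: "\<theta> < 0" using assms by auto
    have p: "- \<theta> / c > 0" using neg that by (intro divide_pos_pos) auto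
    have "(- \<theta>) / c \<le> (- \<theta>) / 1" using neg that by (intro divide_left_mono) auto
    hence "- \<theta> / c < pi" using assms neg by auto
    with p have "sin (- \<theta> / c) > 0" by (rule sin_gt_zero)
    hence "sin (\<theta> / c) < 0" by simp
    thus ?thesis using neg by (simp add: mult_neg_neg)
  qed
  show "sin (\<theta> / 2) * \<theta> > 0" using s[of 2] by simp
  have "sin (\<theta> / 4) \<noteq> 0" using s[of 4] by auto
  thus "(sin (\<theta> / 4))\<^sup>2 > 0" by simp
qed

lemmas regime = param_filter_fst end_sin_tendsto[of \<theta>0] end_sin_tendsto[of \<theta>1]
  half_angle_bounds(1)[OF \<theta>0] half_angle_bounds(1)[OF \<theta>1]

lemma layer_mass_pos: "layer_mass > 0"
  unfolding layer_mass_def using half_angle_bounds(6)[OF \<theta>0] half_angle_bounds(6)[OF \<theta>1]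
  by (intro mult_pos_pos add_pos_pos) simp_all

lemma layer_mass_eq: "layer_mass = 4 - 2 * cos (\<theta>0 / 2) - 2 * cos (\<theta>1 / 2)"
  unfolding layer_mass_def half_angle_bounds(5)[OF \<theta>0] half_angle_bounds(5)[OF \<theta>1] by simp

lemma potential_of_tendsto: "(potential_of \<longlongrightarrow> layer_mass) param_filter"
  using elastica_potential_tendsto[OF regime]
  unfolding potential_of_def[abs_def] layer_mass_eq half_angle_bounds(3)[OF \<theta>0] half_angle_bounds(3)[OF \<theta>1] .

lemma time_of_tendsto: "((\<lambda>z. time_of z / fst z) \<longlongrightarrow> 1) param_filter"
  using elastica_time_tendsto[OF regime] unfolding time_of_def .

lemma impulse_of_tendsto: "(impulse_of \<longlongrightarrow> 2 * (sin (\<theta>0 / 2) + sin (\<theta>1 / 2))) param_filter"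
  using elastica_impulse_tendsto[OF regime] unfolding impulse_of_def[abs_def] .

lemma energy_of_tendsto: "((\<lambda>z. energy_of z * time_of z) \<longlongrightarrow> 0) param_filter"
  using elastica_energy_tendsto[OF regime] unfolding energy_of_def time_of_def .

lemma slope_of_tendsto: "((\<lambda>z. slope_of z 0) \<longlongrightarrow> - sin (\<theta>0 / 2)) param_filter"
  "((\<lambda>z. slope_of z (fst z)) \<longlongrightarrow> sin (\<theta>1 / 2)) param_filter"
  using elastica_slope_tendsto[OF regime] unfolding slope_of_def .

lemma eventually_end_sin_lt_1: "\<forall>\<^sub>F z in param_filter. \<bar>end_sin \<theta>0 z\<bar> < 1 \<and> \<bar>end_sin \<theta>1 z\<bar> < 1"
  using order_tendstoD(2)[OF tendsto_rabs[OF end_sin_tendsto[of \<theta>0]] half_angle_bounds(1)[OF \<theta>0]]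
    order_tendstoD(2)[OF tendsto_rabs[OF end_sin_tendsto[of \<theta>1]] half_angle_bounds(1)[OF \<theta>1]]
  by eventually_elim simp

lemma eventually_time_of_bounds:
  "\<forall>\<^sub>F z in param_filter. fst z \<le> time_of z \<and> time_of z \<le> fst z + potential_of z / 2"
  using eventually_param_pos eventually_end_sin_lt_1
  by eventually_elim (simp add: time_of_def potential_of_def elastica_time_estimate)

text \<open>The time is of order W and the tilt of order 1 / W: one factor of the tilt balances the
  time, the other makes the product vanish.\<close>

lemma time_tilt_sq_tendsto: "((\<lambda>z. time_of z * (tilt z)\<^sup>2) \<longlongrightarrow> 0) param_filter"
proof -
  have "((\<lambda>z. \<bar>time_of z / fst z\<bar> * (5 * \<bar>tilt z\<bar>)) \<longlongrightarrow> \<bar>1\<bar> * (5 * \<bar>0\<bar>)) param_filter"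
    by (intro tendsto_mult tendsto_const tendsto_rabs time_of_tendsto tilt_tendsto)
  hence 1: "((\<lambda>z. \<bar>time_of z / fst z\<bar> * (5 * \<bar>tilt z\<bar>)) \<longlongrightarrow> 0) param_filter" by simp
  show ?thesis
  proof (rule Lim_null_comparison[OF _ 1])
    show "\<forall>\<^sub>F z in param_filter. norm (time_of z * (tilt z)\<^sup>2) \<le> \<bar>time_of z / fst z\<bar> * (5 * \<bar>tilt z\<bar>)"
      using eventually_param_pos eventually_param_bound
    proof eventually_elim
      case (elim z)
      have "time_of z * (tilt z)\<^sup>2 = time_of z / fst z * (snd z * tilt z)"
        using elim by (simp add: tilt_def power2_eq_square)
      thus ?case
        using mult_left_mono[OF mult_right_mono[OF elim(2) abs_ge_zero[of "tilt z"]] abs_ge_zero[of "time_of z / fst z"]]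
        by (simp only: abs_mult real_norm_def)
    qed
  qed
qed

lemma abs_sin_minus_le: "\<bar>sin x - x\<bar> \<le> x\<^sup>2" for x :: real
proof -
  have "\<bar>sin x - (\<Sum>m<2. sin_coeff m * x ^ m)\<bar> \<le> inverse (fact 2) * \<bar>x\<bar> ^ 2" by (rule Maclaurin_sin_bound)
  moreover have "(\<Sum>m<2. sin_coeff m * x ^ m) = x" by (simp add: numeral_2_eq_2 sin_coeff_def)
  moreover have "inverse (fact 2) * \<bar>x\<bar> ^ 2 \<le> x\<^sup>2" by simp
  ultimately show ?thesis by linarith
qed

text \<open>The product of the time and sin (tilt) is \<beta> up to vanishing errors, because the
  tilt times W is \<beta> and the time minus W is bounded. A tilt of order 1 / W thus moves the
  height by a quantity of order one.\<close>

lemma height_of_tendsto: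
  "((\<lambda>z. height_of z - (2 * (sin (\<theta>0 / 2) + sin (\<theta>1 / 2)) + snd z)) \<longlongrightarrow> 0) param_filter"
proof -
  let ?j = "2 * (sin (\<theta>0 / 2) + sin (\<theta>1 / 2))"
  have c: "((\<lambda>z. cos (tilt z)) \<longlongrightarrow> 1) param_filter" using tendsto_cos[OF tilt_tendsto] by simp
  have s: "((\<lambda>z. sin (tilt z)) \<longlongrightarrow> 0) param_filter" using tendsto_sin[OF tilt_tendsto] by simp
  have j: "((\<lambda>z. impulse_of z * cos (tilt z) - ?j) \<longlongrightarrow> ?j * 1 - ?j) param_filter"
    by (intro tendsto_diff tendsto_mult tendsto_const impulse_of_tendsto c)
  have p: "((\<lambda>z. sin (tilt z) * potential_of z) \<longlongrightarrow> 0 * layer_mass) param_filter"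
    by (intro tendsto_mult s potential_of_tendsto)
  have t: "((\<lambda>z. sin (tilt z) * time_of z - snd z) \<longlongrightarrow> 0) param_filter"
  proof (rule Lim_null_comparison)
    have "((\<lambda>z. time_of z * (tilt z)\<^sup>2 + \<bar>tilt z\<bar> * (potential_of z / 2)) \<longlongrightarrow> 0 + \<bar>0\<bar> * (layer_mass / 2)) param_filter"
      by (intro tendsto_add tendsto_mult tendsto_rabs tendsto_divide tendsto_const time_tilt_sq_tendsto tilt_tendsto potential_of_tendsto) simp
    thus "((\<lambda>z. time_of z * (tilt z)\<^sup>2 + \<bar>tilt z\<bar> * (potential_of z / 2)) \<longlongrightarrow> 0) param_filter" by simp
    show "\<forall>\<^sub>F z in param_filter. norm (sin (tilt z) * time_of z - snd z) \<le> time_of z * (tilt z)\<^sup>2 + \<bar>tilt z\<bar> * (potential_of z / 2)"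
      using eventually_param_pos eventually_time_of_bounds
    proof eventually_elim
      case (elim z)
      have "sin (tilt z) * time_of z - snd z = time_of z * (sin (tilt z) - tilt z) + tilt z * (time_of z - fst z)"
        using elim(1) unfolding tilt_def by (simp add: field_simps)
      also have "\<bar>\<dots>\<bar> \<le> \<bar>time_of z * (sin (tilt z) - tilt z)\<bar> + \<bar>tilt z * (time_of z - fst z)\<bar>" by (rule abs_triangle_ineq)
      also have "\<dots> \<le> time_of z * (tilt z)\<^sup>2 + \<bar>tilt z\<bar> * (potential_of z / 2)"
        unfolding abs_mult using elim abs_sin_minus_le[of "tilt z"] by (intro add_mono mult_mono) auto
      finally show ?case by simp
    qed
  qed
  have lim: "((\<lambda>z. (impulse_of z * cos (tilt z) - ?j) + (sin (tilt z) * time_of z - snd z) - sin (tilt z) * potential_of z) \<longlongrightarrow>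
     (?j * 1 - ?j) + 0 - 0 * layer_mass) param_filter"
    by (intro tendsto_diff[OF tendsto_add[OF j t] p])
  have eq: "(impulse_of z * cos (tilt z) - ?j) + (sin (tilt z) * time_of z - snd z) - sin (tilt z) * potential_of z =
     height_of z - (?j + snd z)" for z unfolding height_of_def by (simp add: algebra_simps)
  have "(?j * 1 - ?j) + 0 - 0 * layer_mass = 0" by simp
  with lim show ?thesis unfolding eq by (simp only:)
qed

text \<open>With time T, potential I, impulse J and tilt \<alpha>, the product of W and the defect
  is (T (1 - cos \<alpha>) + I cos \<alpha> + J sin \<alpha>) / (T / W). The first term is quadratic
  in the tilt, the last tends to 0, and only the potential survives.\<close>

lemma defect_of_tendsto: "((\<lambda>z. fst z * defect_of z) \<longlongrightarrow> layer_mass) param_filter"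
proof -
  let ?j = "2 * (sin (\<theta>0 / 2) + sin (\<theta>1 / 2))"
  have c: "((\<lambda>z. cos (tilt z)) \<longlongrightarrow> 1) param_filter" using tendsto_cos[OF tilt_tendsto] by simp
  have s: "((\<lambda>z. sin (tilt z)) \<longlongrightarrow> 0) param_filter" using tendsto_sin[OF tilt_tendsto] by simp
  have t: "((\<lambda>z. time_of z * (1 - cos (tilt z))) \<longlongrightarrow> 0) param_filter"
  proof (rule Lim_null_comparison[OF _ time_tilt_sq_tendsto])
    show "\<forall>\<^sub>F z in param_filter. norm (time_of z * (1 - cos (tilt z))) \<le> time_of z * (tilt z)\<^sup>2"
      using eventually_param_pos eventually_time_of_bounds
    proof eventually_elim
      case (elim z)
      have "\<bar>sin (tilt z / 2)\<bar> \<le> \<bar>tilt z / 2\<bar>" by (rule abs_sin_x_le_abs_x)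
      hence "(sin (tilt z / 2))\<^sup>2 \<le> (tilt z / 2)\<^sup>2" by (simp only: abs_le_square_iff)
      hence "4 * (sin (tilt z / 2))\<^sup>2 \<le> (tilt z)\<^sup>2" by (simp add: power_divide)
      hence "1 - cos (tilt z) \<le> (tilt z)\<^sup>2" unfolding cos_half_angle[of "tilt z"]
        using zero_le_power2[of "sin (tilt z / 2)"] by linarith
      thus ?case using elim by (simp add: abs_mult mult_left_mono)
    qed
  qed
  have "((\<lambda>z. (time_of z * (1 - cos (tilt z)) + potential_of z * cos (tilt z) + sin (tilt z) * impulse_of z) / (time_of z / fst z))
     \<longlongrightarrow> (0 + layer_mass * 1 + 0 * ?j) / 1) param_filter"
    by (intro tendsto_divide tendsto_add tendsto_mult t s c potential_of_tendsto impulse_of_tendsto time_of_tendsto) simp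
  moreover have "\<forall>\<^sub>F z in param_filter. (time_of z * (1 - cos (tilt z)) + potential_of z * cos (tilt z) + sin (tilt z) * impulse_of z) / (time_of z / fst z)
     = fst z * defect_of z"
    using eventually_param_pos eventually_time_of_bounds
  proof eventually_elim
    case (elim z)
    hence "time_of z \<noteq> 0" "fst z \<noteq> 0" by auto
    thus ?case unfolding defect_of_def by (simp add: field_simps)
  qed
  ultimately show ?thesis by (simp add: tendsto_cong)
qed

text \<open>In units of sqrt \<rho>, the limiting bound for odd competitors exceeds the limiting
  action by 16 (min (cos (\<theta>0 / 2)) (cos (\<theta>1 / 2)) - \<open>gap_margin\<close>); a
  quarter of the minimum keeps this positive.\<close>

definition gap_margin :: real where "gap_margin = min (cos (\<theta>0 / 2)) (cos (\<theta>1 / 2)) / 4"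

text \<open>The two inequalities for \<open>potential_of\<close> state that the action of the elastica is less than
  the lower bound in \<open>pendulum_action_odd_lower_bound\<close>.\<close>

definition good_param :: "real \<times> real \<Rightarrow> bool" where
  "good_param z \<longleftrightarrow> fst z > 0 \<and> \<bar>\<theta>0 - tilt z\<bar> < pi \<and> \<bar>\<theta>1 - tilt z\<bar> < pi \<and>
     end_sin \<theta>0 z * \<theta>0 > 0 \<and> end_sin \<theta>1 z * \<theta>1 > 0 \<and>
     \<bar>height_of z - (2 * (sin (\<theta>0 / 2) + sin (\<theta>1 / 2)) + snd z)\<bar> < 1 / 2 \<and>
     layer_mass / 2 < fst z * defect_of z \<and> fst z * defect_of z < 2 * layer_mass \<and>
     4 * potential_of z + 4 * (energy_of z * time_of z) <
       8 * (2 - 2 * gap_margin - \<bar>cos ((\<theta>0 - tilt z) / 2) - cos ((\<theta>1 - tilt z) / 2)\<bar>) \<and>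
     4 * potential_of z + 4 * (energy_of z * time_of z) < 4 * time_of z * gap_margin \<and>
     slope_of z 0 * \<theta>0 < 0 \<and> slope_of z (fst z) * \<theta>1 > 0"

lemma gap_margin: "0 < gap_margin" "gap_margin < 1"
proof -
  show "0 < gap_margin" unfolding gap_margin_def using half_angle_bounds(2)[OF \<theta>0] half_angle_bounds(2)[OF \<theta>1] by simp
  have "cos (\<theta>0 / 2) \<le> 1" by simp
  thus "gap_margin < 1" unfolding gap_margin_def by linarith
qed

lemma eventually_good_param: "eventually good_param param_filter"
proof -
  let ?s0 = "sin (\<theta>0 / 2)" and ?s1 = "sin (\<theta>1 / 2)" and ?c0 = "cos (\<theta>0 / 2)" and ?c1 = "cos (\<theta>1 / 2)"
  have t: "((\<lambda>z. \<bar>\<theta> - tilt z\<bar>) \<longlongrightarrow> \<bar>\<theta> - 0\<bar>) param_filter" for \<theta>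
    by (intro tendsto_rabs tendsto_diff tendsto_const tilt_tendsto)
  have e1: "\<forall>\<^sub>F z in param_filter. \<bar>\<theta>0 - tilt z\<bar> < pi" by (rule order_tendstoD(2)[OF t]) (use \<theta>0 in auto)
  have e2: "\<forall>\<^sub>F z in param_filter. \<bar>\<theta>1 - tilt z\<bar> < pi" by (rule order_tendstoD(2)[OF t]) (use \<theta>1 in auto)
  have e3: "\<forall>\<^sub>F z in param_filter. end_sin \<theta>0 z * \<theta>0 > 0"
    by (rule order_tendstoD(1)[OF tendsto_mult[OF end_sin_tendsto tendsto_const] half_angle_bounds(4)[OF \<theta>0]])
  have e4: "\<forall>\<^sub>F z in param_filter. end_sin \<theta>1 z * \<theta>1 > 0"
    by (rule order_tendstoD(1)[OF tendsto_mult[OF end_sin_tendsto tendsto_const] half_angle_bounds(4)[OF \<theta>1]])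
  have e5: "\<forall>\<^sub>F z in param_filter. \<bar>height_of z - (2 * (?s0 + ?s1) + snd z)\<bar> < 1 / 2"
    by (rule order_tendstoD(2)[OF tendsto_rabs[OF height_of_tendsto]]) simp
  have e6: "\<forall>\<^sub>F z in param_filter. layer_mass / 2 < fst z * defect_of z"
    by (rule order_tendstoD(1)[OF defect_of_tendsto]) (use layer_mass_pos in simp)
  have e7: "\<forall>\<^sub>F z in param_filter. fst z * defect_of z < 2 * layer_mass"
    by (rule order_tendstoD(2)[OF defect_of_tendsto]) (use layer_mass_pos in simp)
  have act: "((\<lambda>z. 4 * potential_of z + 4 * (energy_of z * time_of z)) \<longlongrightarrow> 4 * layer_mass + 4 * 0) param_filter"
    by (intro tendsto_add tendsto_mult tendsto_const potential_of_tendsto energy_of_tendsto)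
  have ct: "((\<lambda>z. cos ((\<theta> - tilt z) / 2)) \<longlongrightarrow> cos ((\<theta> - 0) / 2)) param_filter" for \<theta>
    by (intro tendsto_cos tendsto_divide tendsto_diff tendsto_const tilt_tendsto) simp
  have gt: "((\<lambda>z. 8 * (2 - 2 * gap_margin - \<bar>cos ((\<theta>0 - tilt z) / 2) - cos ((\<theta>1 - tilt z) / 2)\<bar>)) \<longlongrightarrow>
      8 * (2 - 2 * gap_margin - \<bar>cos ((\<theta>0 - 0) / 2) - cos ((\<theta>1 - 0) / 2)\<bar>)) param_filter"
    by (intro tendsto_mult tendsto_diff tendsto_const tendsto_rabs ct)
  have lt: "4 * layer_mass + 4 * 0 < 8 * (2 - 2 * gap_margin - \<bar>cos ((\<theta>0 - 0) / 2) - cos ((\<theta>1 - 0) / 2)\<bar>)"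
    using half_angle_bounds(2)[OF \<theta>0] half_angle_bounds(2)[OF \<theta>1]
    unfolding layer_mass_eq gap_margin_def by (simp add: min_def abs_if)
  have e8: "\<forall>\<^sub>F z in param_filter. 4 * potential_of z + 4 * (energy_of z * time_of z) <
       8 * (2 - 2 * gap_margin - \<bar>cos ((\<theta>0 - tilt z) / 2) - cos ((\<theta>1 - tilt z) / 2)\<bar>)"
    using order_tendstoD(1)[OF tendsto_diff[OF gt act], of 0] lt by (simp add: less_diff_eq)
  \<comment> \<open>The left side is bounded while the time grows with W, so W only has to pass a
    fixed threshold.\<close>
  have e9: "\<forall>\<^sub>F z in param_filter. 4 * potential_of z + 4 * (energy_of z * time_of z) < 4 * time_of z * gap_margin"
  proof -
    have "\<forall>\<^sub>F z in param_filter. 4 * potential_of z + 4 * (energy_of z * time_of z) < 4 * layer_mass + 1"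
      by (rule order_tendstoD(2)[OF act]) simp
    moreover have "\<forall>\<^sub>F z in param_filter. fst z > (4 * layer_mass + 1) / (4 * gap_margin)"
      by (rule filterlim_at_top_dense[THEN iffD1, OF param_filter_fst, rule_format])
    ultimately show ?thesis using eventually_time_of_bounds
    proof eventually_elim
      case (elim z)
      have "4 * layer_mass + 1 < fst z * (4 * gap_margin)" using elim(2) gap_margin by (simp add: divide_less_eq)
      also have "\<dots> \<le> time_of z * (4 * gap_margin)" using elim(3) gap_margin by (intro mult_right_mono) auto
      finally show ?case using elim(1) by (simp add: mult_ac)
    qed
  qed
  have e10: "\<forall>\<^sub>F z in param_filter. slope_of z 0 * \<theta>0 < 0"
    by (rule order_tendstoD(2)[OF tendsto_mult[OF slope_of_tendsto(1) tendsto_const]]) (use half_angle_bounds(4)[OF \<theta>0] in simp)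
  have e11: "\<forall>\<^sub>F z in param_filter. slope_of z (fst z) * \<theta>1 > 0"
    by (rule order_tendstoD(1)[OF tendsto_mult[OF slope_of_tendsto(2) tendsto_const]]) (rule half_angle_bounds(4)[OF \<theta>1])
  show ?thesis
    using eventually_param_pos e1 e2 e3 e4 e5 e6 e7 e8 e9 e10 e11
    unfolding good_param_def[abs_def] by eventually_elim blast
qed

lemma end_sin_lt_1: "\<bar>\<theta> - tilt z\<bar> < pi \<Longrightarrow> \<bar>end_sin \<theta> z\<bar> < 1"
proof -
  assume "\<bar>\<theta> - tilt z\<bar> < pi"
  hence "cos ((\<theta> - tilt z) / 2) > 0" by (intro cos_gt_zero_pi) auto
  hence "(sin ((\<theta> - tilt z) / 2))\<^sup>2 < 1" unfolding sin_squared_eq by simp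
  thus "\<bar>end_sin \<theta> z\<bar> < 1" unfolding end_sin_def by (simp add: abs_square_less_1)
qed

text \<open>On a rectangle of good parameters, W governs the defect, which lies between
  \<open>layer_mass / 2\<close> and \<open>2 * layer_mass\<close> divided by W, and \<beta> governs
  the height. This gives the sign conditions of \<open>poincare_miranda_2\<close>.\<close>

lemma exists_good_param:
  obtains \<delta>0 where "\<delta>0 > 0"
    "\<And>\<delta>. 0 < \<delta> \<Longrightarrow> \<delta> < \<delta>0 \<Longrightarrow> \<exists>z. good_param z \<and> snd z \<in> {-5..5} \<and> height_of z = 0 \<and> defect_of z = \<delta>"
proof -
  obtain W0 where W0: "\<forall>W\<ge>W0. \<forall>\<beta>\<in>{-5..5}. good_param (W, \<beta>)"
    using eventually_good_param unfolding eventually_param_filter by blast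
  define W1 where "W1 = max W0 1"
  have good: "good_param (W, \<beta>)" if "W \<ge> W1" "\<beta> \<in> {-5..5}" for W \<beta> using W0 that unfolding W1_def by auto
  have W1: "W1 > 0" unfolding W1_def by simp
  show ?thesis
  \<comment> \<open>On the side W = W1 the defect exceeds this value, hence every \<delta> below
    it.\<close>
  proof (rule that[of "layer_mass / 2 / W1"])
    show "layer_mass / 2 / W1 > 0" using layer_mass_pos W1 by simp
    fix \<delta> assume \<delta>: "0 < \<delta>" "\<delta> < layer_mass / 2 / W1"
    \<comment> \<open>Chosen such that 2 \<open>layer_mass\<close> / W2 \<le> \<delta>, which pushes
      the defect below \<delta> on the opposite side.\<close>
    define W2 where "W2 = max W1 (2 * layer_mass / \<delta>)"
    let ?S = "{W1..W2} \<times> {-5..5::real}"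
    have gS: "good_param z" if "z \<in> ?S" for z using good[of "fst z" "snd z"] that by auto
    have p: "fst z > 0" "\<bar>end_sin \<theta>0 z\<bar> < 1" "\<bar>end_sin \<theta>1 z\<bar> < 1" if "z \<in> ?S" for z
      using gS[OF that] end_sin_lt_1 unfolding good_param_def by blast+
    have cf: "continuous_on ?S fst" "continuous_on ?S snd" by (intro continuous_on_fst continuous_on_snd continuous_on_id)+
    have ct: "continuous_on ?S tilt" unfolding tilt_def[abs_def] by (rule continuous_on_divide[OF cf(2,1)]) (use p(1) in force)
    have ce: "continuous_on ?S (end_sin \<theta>)" for \<theta>
      unfolding end_sin_def[abs_def] by (intro continuous_on_sin continuous_on_divide continuous_on_diff continuous_on_const ct) simp
    have cT: "continuous_on ?S time_of" unfolding time_of_def[abs_def]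
      by (rule elastica_integrals_continuous(1)[OF cf(1) ce ce p])
    have cI: "continuous_on ?S potential_of" unfolding potential_of_def[abs_def]
      by (rule elastica_integrals_continuous(2)[OF cf(1) ce ce p])
    have cJ: "continuous_on ?S impulse_of" unfolding impulse_of_def[abs_def] elastica_impulse_def
      by (intro continuous_on_mult continuous_on_add continuous_on_divide continuous_on_diff continuous_on_const
          continuous_on_cosh continuous_on_sinh cf ce) (use p(1) in force)
    have T0: "time_of z \<noteq> 0" if "z \<in> ?S" for z
      unfolding time_of_def using elastica_time_pos[OF p(1)[OF that] p(2)[OF that] p(3)[OF that]] by simp
    have cH: "continuous_on ?S height_of" unfolding height_of_def[abs_def]
      by (intro continuous_on_mult continuous_on_add continuous_on_diff continuous_on_sin continuous_on_cos cJ cT cI ct)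
    have cD: "continuous_on ?S (\<lambda>z. defect_of z - \<delta>)" unfolding defect_of_def
      by (intro continuous_on_mult continuous_on_divide continuous_on_diff continuous_on_sin continuous_on_cos continuous_on_const cJ cT cI ct)
        (use T0 in blast)
    have le: "W1 \<le> W2" "(-5::real) \<le> 5" unfolding W2_def by auto
    obtain x y where xy: "x \<in> {W1..W2}" "y \<in> {-5..5}" "defect_of (x, y) - \<delta> = 0" "height_of (x, y) = 0"
    proof (rule poincare_miranda_2[OF le cD cH])
      fix y :: real assume y: "y \<in> {-5..5}"
      have "layer_mass / 2 < W1 * defect_of (W1, y)" using good[OF order_refl y] unfolding good_param_def by simp
      hence "layer_mass / 2 / W1 < defect_of (W1, y)" using W1 by (simp add: divide_less_eq mult.commute)
      thus "0 \<le> defect_of (W1, y) - \<delta>" using \<delta> by linarith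
      have "W2 * defect_of (W2, y) < 2 * layer_mass" using good[OF le(1) y] unfolding good_param_def by simp
      moreover have "2 * layer_mass / \<delta> \<le> W2" unfolding W2_def by simp
      hence "2 * layer_mass \<le> W2 * \<delta>" using \<delta> by (simp add: divide_le_eq)
      ultimately have "W2 * defect_of (W2, y) < W2 * \<delta>" by linarith
      thus "defect_of (W2, y) - \<delta> \<le> 0" using W1 le(1) by simp
    next
      fix x assume "x \<in> {W1..W2}"
      hence x: "x \<ge> W1" by simp
      have "\<bar>height_of (x, -5) - (2 * (sin (\<theta>0 / 2) + sin (\<theta>1 / 2)) + - 5)\<bar> < 1 / 2"
        "\<bar>height_of (x, 5) - (2 * (sin (\<theta>0 / 2) + sin (\<theta>1 / 2)) + 5)\<bar> < 1 / 2"
        using good[OF x, of "-5"] good[OF x, of 5] unfolding good_param_def by simp_all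
      hence h: "height_of (x, -5) < 2 * (sin (\<theta>0 / 2) + sin (\<theta>1 / 2)) - 5 + 1 / 2"
        "2 * (sin (\<theta>0 / 2) + sin (\<theta>1 / 2)) + 5 - 1 / 2 < height_of (x, 5)"
        unfolding abs_less_iff by linarith+
      have s: "sin (\<theta>0 / 2) + sin (\<theta>1 / 2) \<le> 2" "- 2 \<le> sin (\<theta>0 / 2) + sin (\<theta>1 / 2)"
        using sin_le_one[of "\<theta>0 / 2"] sin_le_one[of "\<theta>1 / 2"] sin_ge_minus_one[of "\<theta>0 / 2"] sin_ge_minus_one[of "\<theta>1 / 2"] by linarith+
      have "2 * (sin (\<theta>0 / 2) + sin (\<theta>1 / 2)) \<le> 2 * 2" using s(1) by (rule mult_left_mono) simp
      hence "2 * (sin (\<theta>0 / 2) + sin (\<theta>1 / 2)) - 5 + 1 / 2 \<le> 0" by (simp add: field_simps)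
      with h(1) show "height_of (x, -5) \<le> 0" by (rule order.trans[OF less_imp_le])
      have "2 * (- 2) \<le> 2 * (sin (\<theta>0 / 2) + sin (\<theta>1 / 2))" using s(2) by (rule mult_left_mono) simp
      hence "0 \<le> 2 * (sin (\<theta>0 / 2) + sin (\<theta>1 / 2)) + 5 - 1 / 2" by (simp add: field_simps)
      from this less_imp_le[OF h(2)] show "0 \<le> height_of (x, 5)" by (rule order.trans)
    qed (rule that)
    have "good_param (x, y)" by (rule gS) (use xy in simp)
    thus "\<exists>z. good_param z \<and> snd z \<in> {-5..5} \<and> height_of z = 0 \<and> defect_of z = \<delta>"
      using xy by (intro exI[of _ "(x, y)"]) simp
  qed
qed

end

section \<open>Smooth convergence of rescaled curves\<close>

text \<open>Like \<open>Ck_real\<close>, but for families: the eventual derivatives are supplied as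
  witnesses, so that sums and products go by induction on the order.\<close>

fun smooth_conv :: "nat \<Rightarrow> real \<Rightarrow> ('b \<Rightarrow> real \<Rightarrow> 'a::real_normed_vector) \<Rightarrow> (real \<Rightarrow> 'a) \<Rightarrow> 'b filter \<Rightarrow> bool" where
  "smooth_conv 0 R f g F \<longleftrightarrow> (\<forall>\<^sub>F x in F. continuous_on {0..R} (f x)) \<and> continuous_on {0..R} g \<and> uniform_limit {0..R} f g F"
| "smooth_conv (Suc j) R f g F \<longleftrightarrow> uniform_limit {0..R} f g F \<and> (\<exists>f' g'.
     (\<forall>\<^sub>F x in F. \<forall>t\<in>{0..R}. (f x has_vector_derivative f' x t) (at t within {0..R})) \<and>
     (\<forall>t\<in>{0..R}. (g has_vector_derivative g' t) (at t within {0..R})) \<and> smooth_conv j R f' g' F)"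

lemma smooth_conv_SucI:
  assumes "uniform_limit {0..R} f g F"
    and "\<forall>\<^sub>F x in F. \<forall>t\<in>{0..R}. (f x has_vector_derivative f' x t) (at t within {0..R})"
    and "\<And>t. t \<in> {0..R} \<Longrightarrow> (g has_vector_derivative g' t) (at t within {0..R})"
    and "smooth_conv j R f' g' F"
  shows "smooth_conv (Suc j) R f g F"
  unfolding smooth_conv.simps using assms(1,3)
  by (intro conjI exI[of _ f'] exI[of _ g'] ballI assms(2,4)) simp_all

lemma smooth_conv_uniform_limit: "smooth_conv j R f g F \<Longrightarrow> uniform_limit {0..R} f g F"
  by (cases j) simp_all

lemma smooth_conv_continuous:
  fixes f :: "'b \<Rightarrow> real \<Rightarrow> 'a::real_normed_vector"
  assumes "smooth_conv j R f g F"
  shows "continuous_on {0..R} g" "\<forall>\<^sub>F x in F. continuous_on {0..R} (f x)"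
proof -
  have "continuous_on {0..R} g \<and> (\<forall>\<^sub>F x in F. continuous_on {0..R} (f x))"
  proof (cases j)
    case 0
    thus ?thesis using assms by simp
  next
    case (Suc i)
    obtain f' where f0: "\<exists>g'. (\<forall>\<^sub>F x in F. \<forall>t\<in>{0..R}. (f x has_vector_derivative f' x t) (at t within {0..R})) \<and>
       (\<forall>t\<in>{0..R}. (g has_vector_derivative g' t) (at t within {0..R})) \<and> smooth_conv i R f' g' F"
      using assms unfolding Suc smooth_conv.simps by blast
    then obtain g' where f: "\<forall>\<^sub>F x in F. \<forall>t\<in>{0..R}. (f x has_vector_derivative f' x t) (at t within {0..R})"
      and g: "\<forall>t\<in>{0..R}. (g has_vector_derivative g' t) (at t within {0..R})" by blast
    have "continuous_on {0..R} h" if "\<forall>t\<in>{0..R}. (h has_vector_derivative h' t) (at t within {0..R})" for h h' :: "real \<Rightarrow> 'a"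
      unfolding continuous_on_eq_continuous_within using that has_vector_derivative_continuous by blast
    from this[OF g] eventually_mono[OF f this] show ?thesis by blast
  qed
  thus "continuous_on {0..R} g" "\<forall>\<^sub>F x in F. continuous_on {0..R} (f x)" by blast+
qed

lemma smooth_conv_0: "smooth_conv j R f g F \<Longrightarrow> smooth_conv 0 R f g F"
  using smooth_conv_continuous[of j R f g F] smooth_conv_uniform_limit[of j R f g F] by simp

lemma smooth_conv_SucE:
  assumes "smooth_conv (Suc j) R f g F"
  shows "\<exists>f' g'. (\<forall>\<^sub>F x in F. \<forall>t\<in>{0..R}. (f x has_vector_derivative f' x t) (at t within {0..R})) \<and>
     (\<forall>t\<in>{0..R}. (g has_vector_derivative g' t) (at t within {0..R})) \<and> smooth_conv j R f' g' F"
  using assms unfolding smooth_conv.simps by (rule conjunct2)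

lemma smooth_conv_SucD: "smooth_conv (Suc j) R f g F \<Longrightarrow> smooth_conv j R f g F"
proof (induction j arbitrary: f g)
  case 0
  thus ?case by (rule smooth_conv_0)
next
  case (Suc j)
  obtain f' g' where d: "\<forall>\<^sub>F x in F. \<forall>t\<in>{0..R}. (f x has_vector_derivative f' x t) (at t within {0..R})"
     "\<forall>t\<in>{0..R}. (g has_vector_derivative g' t) (at t within {0..R})" "smooth_conv (Suc j) R f' g' F"
    using smooth_conv_SucE[OF Suc.prems] by blast
  show ?case
    by (rule smooth_conv_SucI[OF smooth_conv_uniform_limit[OF Suc.prems] d(1) bspec[OF d(2)] Suc.IH[OF d(3)]])
qed

lemma smooth_conv_add:
  "smooth_conv j R f g F \<Longrightarrow> smooth_conv j R p q F \<Longrightarrow> smooth_conv j R (\<lambda>x t. f x t + p x t) (\<lambda>t. g t + q t) F"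
proof (induction j arbitrary: f g p q)
  case 0
  have "\<forall>\<^sub>F x in F. continuous_on {0..R} (\<lambda>t. f x t + p x t)"
    using smooth_conv_continuous(2)[OF 0(1)] smooth_conv_continuous(2)[OF 0(2)]
    by eventually_elim (rule continuous_on_add)
  moreover have "continuous_on {0..R} (\<lambda>t. g t + q t)"
    by (rule continuous_on_add[OF smooth_conv_continuous(1)[OF 0(1)] smooth_conv_continuous(1)[OF 0(2)]])
  moreover have "uniform_limit {0..R} (\<lambda>x t. f x t + p x t) (\<lambda>t. g t + q t) F"
    by (rule uniform_limit_add[OF smooth_conv_uniform_limit[OF 0(1)] smooth_conv_uniform_limit[OF 0(2)]])
  ultimately show ?case unfolding smooth_conv.simps by blast
next
  case (Suc j)
  obtain f' g' where d: "\<forall>\<^sub>F x in F. \<forall>t\<in>{0..R}. (f x has_vector_derivative f' x t) (at t within {0..R})"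
     "\<forall>t\<in>{0..R}. (g has_vector_derivative g' t) (at t within {0..R})" "smooth_conv j R f' g' F"
    using smooth_conv_SucE[OF Suc.prems(1)] by blast
  obtain p' q' where e: "\<forall>\<^sub>F x in F. \<forall>t\<in>{0..R}. (p x has_vector_derivative p' x t) (at t within {0..R})"
     "\<forall>t\<in>{0..R}. (q has_vector_derivative q' t) (at t within {0..R})" "smooth_conv j R p' q' F"
    using smooth_conv_SucE[OF Suc.prems(2)] by blast
  show ?case
  proof (rule smooth_conv_SucI[OF _ _ _ Suc.IH[OF d(3) e(3)]])
    show "uniform_limit {0..R} (\<lambda>x t. f x t + p x t) (\<lambda>t. g t + q t) F"
      by (rule uniform_limit_add[OF smooth_conv_uniform_limit[OF Suc.prems(1)] smooth_conv_uniform_limit[OF Suc.prems(2)]])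
    show "\<forall>\<^sub>F x in F. \<forall>t\<in>{0..R}. ((\<lambda>t. f x t + p x t) has_vector_derivative f' x t + p' x t) (at t within {0..R})"
      using d(1) e(1) by eventually_elim (simp add: has_vector_derivative_add)
    show "((\<lambda>t. g t + q t) has_vector_derivative g' t + q' t) (at t within {0..R})" if "t \<in> {0..R}" for t
      using d(2) e(2) that by (simp add: has_vector_derivative_add)
  qed
qed

lemma smooth_conv_const:
  fixes c :: "'b \<Rightarrow> 'a::real_normed_vector"
  assumes "(c \<longlongrightarrow> d) F"
  shows "smooth_conv j R (\<lambda>x t. c x) (\<lambda>t. d) F"
proof -
  have z: "smooth_conv i R (\<lambda>x t. 0::'a) (\<lambda>t. 0) F" for i
  proof (induction i)
    case 0 show ?case by (simp add: uniform_limit_const)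
  next
    case (Suc i)
    show ?case by (rule smooth_conv_SucI[OF _ _ _ Suc]) (simp_all add: uniform_limit_const)
  qed
  have u: "uniform_limit {0..R} (\<lambda>x t. c x) (\<lambda>t. d) F"
    using tendstoD[OF assms] by (intro uniform_limitI) (auto elim!: eventually_mono)
  show ?thesis
  proof (cases j)
    case 0 thus ?thesis using u by simp
  next
    case (Suc i)
    show ?thesis unfolding Suc by (rule smooth_conv_SucI[OF u _ _ z]) simp_all
  qed
qed

text \<open>The product rule mixes orders, so the induction uses that convergence of order j + 1
  includes order j. Uniform convergence of products comes from boundedness of the continuous limits
  on a compact interval.\<close>

lemma smooth_conv_scaleR:
  fixes p :: "'b \<Rightarrow> real \<Rightarrow> 'a::real_normed_vector" and f :: "'b \<Rightarrow> real \<Rightarrow> real"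
  shows "smooth_conv j R f g F \<Longrightarrow> smooth_conv j R p q F \<Longrightarrow> smooth_conv j R (\<lambda>x t. f x t *\<^sub>R p x t) (\<lambda>t. g t *\<^sub>R q t) F"
proof (induction j arbitrary: f g p q)
  have ul: "uniform_limit {0..R} (\<lambda>x t. h x t *\<^sub>R r x t) (\<lambda>t. k t *\<^sub>R l t) F"
    if "smooth_conv i R h k F" "smooth_conv i R r l F"
    for i and h :: "'b \<Rightarrow> real \<Rightarrow> real" and k and r :: "'b \<Rightarrow> real \<Rightarrow> 'a" and l
  proof (rule bounded_bilinear.bounded_uniform_limit[OF bounded_bilinear_scaleR])
    show "uniform_limit {0..R} h k F" "uniform_limit {0..R} r l F"
      by (rule smooth_conv_uniform_limit[OF that(1)], rule smooth_conv_uniform_limit[OF that(2)])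
    show "bounded (k ` {0..R})"
      by (rule compact_imp_bounded[OF compact_continuous_image[OF smooth_conv_continuous(1)[OF that(1)] compact_Icc]])
    show "bounded (l ` {0..R})"
      by (rule compact_imp_bounded[OF compact_continuous_image[OF smooth_conv_continuous(1)[OF that(2)] compact_Icc]])
  qed
  {
    case 0
    have "\<forall>\<^sub>F x in F. continuous_on {0..R} (\<lambda>t. f x t *\<^sub>R p x t)"
      using smooth_conv_continuous(2)[OF 0(1)] smooth_conv_continuous(2)[OF 0(2)]
      by eventually_elim (rule continuous_on_scaleR)
    moreover have "continuous_on {0..R} (\<lambda>t. g t *\<^sub>R q t)"
      by (rule continuous_on_scaleR[OF smooth_conv_continuous(1)[OF 0(1)] smooth_conv_continuous(1)[OF 0(2)]])
    ultimately show ?case using ul[OF 0] unfolding smooth_conv.simps by blast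
  next
    case (Suc j)
    obtain f' g' where d: "\<forall>\<^sub>F x in F. \<forall>t\<in>{0..R}. (f x has_vector_derivative f' x t) (at t within {0..R})"
       "\<forall>t\<in>{0..R}. (g has_vector_derivative g' t) (at t within {0..R})" "smooth_conv j R f' g' F"
      using smooth_conv_SucE[OF Suc.prems(1)] by blast
    obtain p' q' where e: "\<forall>\<^sub>F x in F. \<forall>t\<in>{0..R}. (p x has_vector_derivative p' x t) (at t within {0..R})"
       "\<forall>t\<in>{0..R}. (q has_vector_derivative q' t) (at t within {0..R})" "smooth_conv j R p' q' F"
      using smooth_conv_SucE[OF Suc.prems(2)] by blast
    have prod: "((\<lambda>t. h t *\<^sub>R r t) has_vector_derivative h t *\<^sub>R r' + h' *\<^sub>R r t) (at t within {0..R})"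
      if "(h has_vector_derivative h') (at t within {0..R})" "(r has_vector_derivative r') (at t within {0..R})"
      for h :: "real \<Rightarrow> real" and r :: "real \<Rightarrow> 'a" and h' r' t
      using has_vector_derivative_scaleR[OF that(1)[folded has_real_derivative_iff_has_vector_derivative] that(2)] .
    show ?case
    proof (rule smooth_conv_SucI[OF ul[OF Suc.prems] _ _
        smooth_conv_add[OF Suc.IH[OF smooth_conv_SucD[OF Suc.prems(1)] e(3)] Suc.IH[OF d(3) smooth_conv_SucD[OF Suc.prems(2)]]]])
      show "\<forall>\<^sub>F x in F. \<forall>t\<in>{0..R}. ((\<lambda>t. f x t *\<^sub>R p x t) has_vector_derivative f x t *\<^sub>R p' x t + f' x t *\<^sub>R p x t) (at t within {0..R})"
        using d(1) e(1) by eventually_elim (simp add: prod)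
      show "((\<lambda>t. g t *\<^sub>R q t) has_vector_derivative g t *\<^sub>R q' t + g' t *\<^sub>R q t) (at t within {0..R})" if "t \<in> {0..R}" for t
        using d(2) e(2) that by (simp add: prod)
    qed
  }
qed

lemma smooth_conv_imp_Ck_tendsto_on:
  assumes R: "R > 0"
  shows "smooth_conv j R f g F \<Longrightarrow> Ck_tendsto_on j {0..R} f g F"
proof (induction j arbitrary: f g)
  case 0
  have "\<forall>\<^sub>F x in F. Ck_on 0 {0..R} (f x)" using smooth_conv_continuous(2)[OF 0] unfolding Ck_on_def by simp
  thus ?case using smooth_conv_continuous(1)[OF 0] smooth_conv_uniform_limit[OF 0]
    unfolding Ck_tendsto_on_def Ck_on_def by simp
next
  case (Suc j)
  obtain f' g' where d: "\<forall>\<^sub>F x in F. \<forall>t\<in>{0..R}. (f x has_vector_derivative f' x t) (at t within {0..R})"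
     "\<forall>t\<in>{0..R}. (g has_vector_derivative g' t) (at t within {0..R})" "smooth_conv j R f' g' F"
    using smooth_conv_SucE[OF Suc.prems] by blast
  have IH: "Ck_on j {0..R} g'" "\<forall>\<^sub>F x in F. Ck_on j {0..R} (f' x)"
    "\<And>i. i \<le> j \<Longrightarrow> uniform_limit {0..R} (\<lambda>x. nth_deriv_on {0..R} i (f' x)) (nth_deriv_on {0..R} i g') F"
    using Suc.IH[OF d(3)] unfolding Ck_tendsto_on_def by blast+
  note nt = at_within_Icc_nontrivial[OF R]
  have "Ck_on (Suc j) {0..R} g" by (rule Ck_on_Suc[OF nt bspec[OF d(2)] IH(1)])
  moreover have "\<forall>\<^sub>F x in F. Ck_on (Suc j) {0..R} (f x)"
    using d(1) IH(2)
  proof eventually_elim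
    case (elim x)
    show ?case by (rule Ck_on_Suc[OF nt bspec[OF elim(1)] elim(2)])
  qed
  moreover have "uniform_limit {0..R} (\<lambda>x. nth_deriv_on {0..R} i (f x)) (nth_deriv_on {0..R} i g) F" if i: "i \<le> Suc j" for i
  proof (cases i)
    case 0
    thus ?thesis using smooth_conv_uniform_limit[OF Suc.prems] by simp
  next
    case (Suc n)
    have n: "n \<le> j" using i Suc by simp
    have ev: "\<forall>\<^sub>F x in F. \<forall>t\<in>{0..R}. nth_deriv_on {0..R} (Suc n) (f x) t = nth_deriv_on {0..R} n (f' x) t"
      using d(1)
    proof eventually_elim
      case (elim x)
      show ?case by (intro ballI nth_deriv_on_Suc[OF nt bspec[OF elim]])
    qed
    have lim: "nth_deriv_on {0..R} (Suc n) g t = nth_deriv_on {0..R} n g' t" if "t \<in> {0..R}" for t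
      by (rule nth_deriv_on_Suc[OF nt bspec[OF d(2)] that])
    show ?thesis unfolding Suc by (rule uniform_limit_cong[THEN iffD2, OF ev _ IH(3)[OF n]]) (rule lim)
  qed
  ultimately show ?case unfolding Ck_tendsto_on_def by blast
qed

section \<open>Stability of the pendulum equation\<close>

lemma abs_sin_diff_le: "\<bar>sin x - sin y\<bar> \<le> \<bar>x - y\<bar>" for x y :: real
proof -
  have "\<bar>sin ((x - y) / 2)\<bar> * \<bar>cos ((x + y) / 2)\<bar> \<le> \<bar>(x - y) / 2\<bar> * 1"
    by (intro mult_mono abs_sin_x_le_abs_x abs_cos_le_one) auto
  thus ?thesis unfolding sin_diff_sin[of x y] by (simp add: abs_mult)
qed

lemma abs_cos_diff_le: "\<bar>cos x - cos y\<bar> \<le> \<bar>x - y\<bar>" for x y :: real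
  using abs_sin_diff_le[of "pi / 2 - x" "pi / 2 - y"] unfolding cos_sin_eq by simp

text \<open>Gronwall for the squared distance in the phase plane. The squared coefficient error is
  added to E as a constant; this makes E' \<le> 3 E homogeneous, so that exp (-3 s) E is
  nonincreasing.\<close>

lemma pendulum_gronwall:
  fixes \<Theta> P \<Theta>' P' :: "real \<Rightarrow> real"
  assumes d: "\<And>t. t \<in> {0..R} \<Longrightarrow> (\<Theta> has_real_derivative P t) (at t within {0..R})"
      "\<And>t. t \<in> {0..R} \<Longrightarrow> (P has_real_derivative m * sin (\<Theta> t - \<alpha>)) (at t within {0..R})"
    and d': "\<And>t. t \<in> {0..R} \<Longrightarrow> (\<Theta>' has_real_derivative P' t) (at t within {0..R})"
      "\<And>t. t \<in> {0..R} \<Longrightarrow> (P' has_real_derivative 1 / 2 * sin (\<Theta>' t)) (at t within {0..R})"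
    and ini: "\<Theta> 0 = \<Theta>' 0" and t: "t \<in> {0..R}"
  shows "(\<Theta> t - \<Theta>' t)\<^sup>2 + (P t - P' t)\<^sup>2 \<le> exp (3 * R) * ((P 0 - P' 0)\<^sup>2 + (\<bar>m - 1 / 2\<bar> + \<bar>\<alpha>\<bar>)\<^sup>2)"
proof -
  define \<kappa> where "\<kappa> = \<bar>m - 1 / 2\<bar> + \<bar>\<alpha>\<bar>"
  define E where "E s = (\<Theta> s - \<Theta>' s)\<^sup>2 + (P s - P' s)\<^sup>2 + \<kappa>\<^sup>2" for s
  define E' where "E' s = 2 * (\<Theta> s - \<Theta>' s) * (P s - P' s) + 2 * (P s - P' s) * (m * sin (\<Theta> s - \<alpha>) - 1 / 2 * sin (\<Theta>' s))" for s
  have dE: "(E has_real_derivative E' s) (at s within {0..R})" if s: "s \<in> {0..R}" for s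
  proof -
    have "((\<lambda>s. (\<Theta> s - \<Theta>' s) * (\<Theta> s - \<Theta>' s) + (P s - P' s) * (P s - P' s) + \<kappa>\<^sup>2) has_real_derivative
      (P s - P' s) * (\<Theta> s - \<Theta>' s) + (P s - P' s) * (\<Theta> s - \<Theta>' s) +
      ((m * sin (\<Theta> s - \<alpha>) - 1 / 2 * sin (\<Theta>' s)) * (P s - P' s) + (m * sin (\<Theta> s - \<alpha>) - 1 / 2 * sin (\<Theta>' s)) * (P s - P' s)) + 0) (at s within {0..R})"
      by (intro DERIV_add DERIV_mult DERIV_diff DERIV_const d(1)[OF s] d(2)[OF s] d'(1)[OF s] d'(2)[OF s])
    thus ?thesis unfolding E_def[abs_def] E'_def power2_eq_square[of "_ - _"] by (simp add: algebra_simps)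
  qed
  have bound: "E' s \<le> 3 * E s" if "s \<in> {0..R}" for s
  proof -
    let ?u = "\<Theta> s - \<Theta>' s" and ?v = "P s - P' s"
    \<comment> \<open>The two right-hand sides differ by a coefficient error and by a Lipschitz term
      in the angles.\<close>
    have "m * sin (\<Theta> s - \<alpha>) - 1 / 2 * sin (\<Theta>' s) = (m - 1 / 2) * sin (\<Theta> s - \<alpha>) + 1 / 2 * (sin (\<Theta> s - \<alpha>) - sin (\<Theta>' s))"
      by (simp add: algebra_simps)
    also have "\<bar>\<dots>\<bar> \<le> \<bar>(m - 1 / 2) * sin (\<Theta> s - \<alpha>)\<bar> + \<bar>1 / 2 * (sin (\<Theta> s - \<alpha>) - sin (\<Theta>' s))\<bar>" by (rule abs_triangle_ineq)
    also have "\<dots> \<le> \<bar>m - 1 / 2\<bar> * 1 + 1 / 2 * (\<bar>?u\<bar> + \<bar>\<alpha>\<bar>)"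
      unfolding abs_mult using abs_sin_diff_le[of "\<Theta> s - \<alpha>" "\<Theta>' s"] by (intro add_mono mult_mono) auto
    also have "\<dots> \<le> \<kappa> + \<bar>?u\<bar>" unfolding \<kappa>_def by (simp add: field_simps)
    finally have r: "\<bar>m * sin (\<Theta> s - \<alpha>) - 1 / 2 * sin (\<Theta>' s)\<bar> \<le> \<kappa> + \<bar>?u\<bar>" .
    have "E' s \<le> \<bar>E' s\<bar>" by simp
    also have "\<dots> \<le> 2 * \<bar>?u\<bar> * \<bar>?v\<bar> + 2 * \<bar>?v\<bar> * \<bar>m * sin (\<Theta> s - \<alpha>) - 1 / 2 * sin (\<Theta>' s)\<bar>"
    proof -
      have "\<bar>2 * u * v + 2 * v * w\<bar> \<le> 2 * \<bar>u\<bar> * \<bar>v\<bar> + 2 * \<bar>v\<bar> * \<bar>w\<bar>" for u v w :: real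
        by (rule order_trans[OF abs_triangle_ineq]) (simp add: abs_mult)
      thus ?thesis unfolding E'_def .
    qed
    also have "\<dots> \<le> 2 * \<bar>?u\<bar> * \<bar>?v\<bar> + 2 * \<bar>?v\<bar> * (\<kappa> + \<bar>?u\<bar>)" using r by (intro add_mono mult_left_mono) auto
    also have "\<dots> = 2 * (2 * (\<bar>?u\<bar> * \<bar>?v\<bar>)) + 2 * (\<bar>?v\<bar> * \<kappa>)" by (simp add: algebra_simps)
    also have "\<dots> \<le> 2 * (\<bar>?u\<bar>\<^sup>2 + \<bar>?v\<bar>\<^sup>2) + (\<bar>?v\<bar>\<^sup>2 + \<kappa>\<^sup>2)"
    proof -
      have sq: "2 * (x * y) \<le> x\<^sup>2 + y\<^sup>2" for x y :: real
        using zero_le_power2[of "x - y"] by (simp add: power2_diff)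
      show ?thesis by (rule add_mono[OF mult_left_mono[OF sq] sq]) simp
    qed
    also have "\<dots> \<le> 3 * E s" unfolding E_def power2_abs
      using zero_le_power2[of ?u] zero_le_power2[of \<kappa>] by (simp add: distrib_left)
    finally show ?thesis .
  qed
  define G where "G s = exp (- 3 * s) * E s" for s
  have dG: "(G has_real_derivative exp (- 3 * s) * (E' s - 3 * E s)) (at s within {0..R})" if s: "s \<in> {0..R}" for s
  proof -
    have "((\<lambda>s. exp (- 3 * s)) has_real_derivative exp (- 3 * s) * (- 3)) (at s within {0..R})"
      by (rule DERIV_chain2[OF DERIV_exp DERIV_cmult_Id])
    from DERIV_mult[OF this dE[OF s]] show ?thesis unfolding G_def[abs_def] by (simp add: algebra_simps)
  qed
  have "G t \<le> G 0"
  proof (cases "t = 0")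
    case False
    hence t0: "0 < t" "t \<le> R" using t by auto
    show ?thesis
    proof (rule DERIV_nonpos_imp_decreasing_open[OF less_imp_le[OF t0(1)]])
      show "continuous_on {0..t} G"
        by (rule continuous_on_subset[OF DERIV_continuous_on[OF dG]]) (use t0 in auto)
      fix s assume s: "0 < s" "s < t"
      have "at s within {0..R} = at s" by (rule at_within_interior) (use s t0 in simp)
      hence "(G has_real_derivative exp (- 3 * s) * (E' s - 3 * E s)) (at s)" using dG[of s] s t0 by simp
      moreover have "exp (- 3 * s) * (E' s - 3 * E s) \<le> 0" using bound[of s] s t0 by (simp add: mult_nonneg_nonpos)
      ultimately show "\<exists>y. (G has_real_derivative y) (at s) \<and> y \<le> 0" by blast
    qed
  qed simp
  hence "exp (3 * t) * (exp (- 3 * t) * E t) \<le> exp (3 * t) * E 0" unfolding G_def by simp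
  hence "E t \<le> exp (3 * t) * E 0" by (simp add: mult.assoc[symmetric] exp_add[symmetric])
  also have "\<dots> \<le> exp (3 * R) * E 0" using t unfolding E_def by (intro mult_right_mono) (auto intro!: add_nonneg_nonneg)
  also have "E 0 = (P 0 - P' 0)\<^sup>2 + (\<bar>m - 1 / 2\<bar> + \<bar>\<alpha>\<bar>)\<^sup>2" unfolding E_def \<kappa>_def ini by simp
  finally have "E t \<le> exp (3 * R) * ((P 0 - P' 0)\<^sup>2 + (\<bar>m - 1 / 2\<bar> + \<bar>\<alpha>\<bar>)\<^sup>2)" .
  moreover have "(\<Theta> t - \<Theta>' t)\<^sup>2 + (P t - P' t)\<^sup>2 \<le> E t" unfolding E_def by simp
  ultimately show ?thesis by (rule order_trans[rotated])
qed

text \<open>The derivatives of cos \<Theta>, sin \<Theta> and P are polynomials in these same three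
  functions with convergent coefficients. Uniform convergence therefore propagates to all orders by
  one simultaneous induction.\<close>

lemma pendulum_smooth_conv:
  fixes \<Theta> P :: "real \<Rightarrow> real \<Rightarrow> real"
  assumes R: "R > 0"
    and d: "\<forall>\<^sub>F x in F. \<forall>t\<in>{0..R}. (\<Theta> x has_real_derivative P x t) (at t within {0..R})"
      "\<forall>\<^sub>F x in F. \<forall>t\<in>{0..R}. (P x has_real_derivative m x * sin (\<Theta> x t - \<alpha> x)) (at t within {0..R})"
      "\<forall>\<^sub>F x in F. \<Theta> x 0 = \<Theta>' 0"
    and d': "\<And>t. t \<in> {0..R} \<Longrightarrow> (\<Theta>' has_real_derivative P' t) (at t within {0..R})"
      "\<And>t. t \<in> {0..R} \<Longrightarrow> (P' has_real_derivative 1 / 2 * sin (\<Theta>' t)) (at t within {0..R})"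
    and lim: "(m \<longlongrightarrow> 1 / 2) F" "(\<alpha> \<longlongrightarrow> 0) F" "((\<lambda>x. P x 0) \<longlongrightarrow> P' 0) F"
  shows "smooth_conv j R (\<lambda>x t. cos (\<Theta> x t)) (\<lambda>t. cos (\<Theta>' t)) F \<and>
     smooth_conv j R (\<lambda>x t. sin (\<Theta> x t)) (\<lambda>t. sin (\<Theta>' t)) F \<and> smooth_conv j R P P' F"
proof -
  have small: "\<forall>\<^sub>F x in F. \<forall>t\<in>{0..R}. \<bar>\<Theta> x t - \<Theta>' t\<bar> < e \<and> \<bar>P x t - P' t\<bar> < e" if e: "e > 0" for e
  proof -
    have "((\<lambda>x. exp (3 * R) * ((P x 0 - P' 0)\<^sup>2 + (\<bar>m x - 1 / 2\<bar> + \<bar>\<alpha> x\<bar>)\<^sup>2)) \<longlongrightarrow>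
        exp (3 * R) * ((P' 0 - P' 0)\<^sup>2 + (\<bar>1 / 2 - 1 / 2\<bar> + \<bar>0\<bar>)\<^sup>2)) F"
      by (intro tendsto_mult tendsto_add tendsto_power tendsto_diff tendsto_rabs tendsto_const lim)
    hence "\<forall>\<^sub>F x in F. exp (3 * R) * ((P x 0 - P' 0)\<^sup>2 + (\<bar>m x - 1 / 2\<bar> + \<bar>\<alpha> x\<bar>)\<^sup>2) < e\<^sup>2"
      by (rule order_tendstoD(2)) (use e in simp)
    thus ?thesis using d
    proof eventually_elim
      case (elim x)
      show ?case
      proof
        fix t assume t: "t \<in> {0..R}"
        have "(\<Theta> x t - \<Theta>' t)\<^sup>2 + (P x t - P' t)\<^sup>2 < e\<^sup>2"
          using pendulum_gronwall[OF bspec[OF elim(2)] bspec[OF elim(3)] d' elim(4) t] elim(1) by simp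
        hence "\<bar>\<Theta> x t - \<Theta>' t\<bar>\<^sup>2 < e\<^sup>2" "\<bar>P x t - P' t\<bar>\<^sup>2 < e\<^sup>2"
          using zero_le_power2[of "\<Theta> x t - \<Theta>' t"] zero_le_power2[of "P x t - P' t"] unfolding power2_abs by linarith+
        thus "\<bar>\<Theta> x t - \<Theta>' t\<bar> < e \<and> \<bar>P x t - P' t\<bar> < e"
          using e power_less_imp_less_base[of "\<bar>\<Theta> x t - \<Theta>' t\<bar>" 2 e] power_less_imp_less_base[of "\<bar>P x t - P' t\<bar>" 2 e] by simp
      qed
    qed
  qed
  have uc: "uniform_limit {0..R} (\<lambda>x t. cos (\<Theta> x t)) (\<lambda>t. cos (\<Theta>' t)) F"
  proof (rule uniform_limitI)
    fix e :: real assume "e > 0"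
    from small[OF this] show "\<forall>\<^sub>F x in F. \<forall>t\<in>{0..R}. dist (cos (\<Theta> x t)) (cos (\<Theta>' t)) < e"
    proof eventually_elim
      case (elim x)
      show ?case unfolding dist_real_def
        by (intro ballI le_less_trans[OF abs_cos_diff_le]) (use elim in blast)
    qed
  qed
  have us: "uniform_limit {0..R} (\<lambda>x t. sin (\<Theta> x t)) (\<lambda>t. sin (\<Theta>' t)) F"
  proof (rule uniform_limitI)
    fix e :: real assume "e > 0"
    from small[OF this] show "\<forall>\<^sub>F x in F. \<forall>t\<in>{0..R}. dist (sin (\<Theta> x t)) (sin (\<Theta>' t)) < e"
    proof eventually_elim
      case (elim x)
      show ?case unfolding dist_real_def
        by (intro ballI le_less_trans[OF abs_sin_diff_le]) (use elim in blast)
    qed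
  qed
  have up: "uniform_limit {0..R} P P' F"
  proof (rule uniform_limitI)
    fix e :: real assume "e > 0"
    from small[OF this] show "\<forall>\<^sub>F x in F. \<forall>t\<in>{0..R}. dist (P x t) (P' t) < e"
      by eventually_elim (auto simp: dist_real_def)
  qed
  show ?thesis
  proof (induction j)
    case 0
    have c\<Theta>: "\<forall>\<^sub>F x in F. continuous_on {0..R} (\<Theta> x)"
      using d(1)
    proof eventually_elim
      case (elim x) show ?case by (rule DERIV_continuous_on[OF bspec[OF elim]])
    qed
    have cP: "\<forall>\<^sub>F x in F. continuous_on {0..R} (P x)"
      using d(2)
    proof eventually_elim
      case (elim x) show ?case by (rule DERIV_continuous_on[OF bspec[OF elim]])
    qed
    have c': "continuous_on {0..R} \<Theta>'" "continuous_on {0..R} P'"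
      by (rule DERIV_continuous_on[OF d'(1)], assumption, rule DERIV_continuous_on[OF d'(2)], assumption)
    have "\<forall>\<^sub>F x in F. continuous_on {0..R} (\<lambda>t. cos (\<Theta> x t))" "\<forall>\<^sub>F x in F. continuous_on {0..R} (\<lambda>t. sin (\<Theta> x t))"
      by (rule eventually_mono[OF c\<Theta> continuous_on_cos], assumption, rule eventually_mono[OF c\<Theta> continuous_on_sin], assumption)
    thus ?case unfolding smooth_conv.simps using cP uc us up c' continuous_on_cos[OF c'(1)] continuous_on_sin[OF c'(1)] by blast
  next
    case (Suc j)
    hence cj: "smooth_conv j R (\<lambda>x t. cos (\<Theta> x t)) (\<lambda>t. cos (\<Theta>' t)) F"
      and sj: "smooth_conv j R (\<lambda>x t. sin (\<Theta> x t)) (\<lambda>t. sin (\<Theta>' t)) F" and pj: "smooth_conv j R P P' F" by blast+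
    have ncj: "smooth_conv j R (\<lambda>x t. (-1) *\<^sub>R sin (\<Theta> x t)) (\<lambda>t. (-1) *\<^sub>R sin (\<Theta>' t)) F"
      by (rule smooth_conv_scaleR[OF smooth_conv_const[OF tendsto_const] sj])
    have "smooth_conv (Suc j) R (\<lambda>x t. cos (\<Theta> x t)) (\<lambda>t. cos (\<Theta>' t)) F"
    proof (rule smooth_conv_SucI[OF uc _ _ smooth_conv_scaleR[OF ncj pj]])
      show "\<forall>\<^sub>F x in F. \<forall>t\<in>{0..R}. ((\<lambda>t. cos (\<Theta> x t)) has_vector_derivative ((-1) *\<^sub>R sin (\<Theta> x t)) *\<^sub>R P x t) (at t within {0..R})"
        using d(1)
      proof eventually_elim
        case (elim x)
        show ?case using DERIV_chain2[OF DERIV_cos bspec[OF elim]] by (simp add: has_real_derivative_iff_has_vector_derivative)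
      qed
      show "((\<lambda>t. cos (\<Theta>' t)) has_vector_derivative ((-1) *\<^sub>R sin (\<Theta>' t)) *\<^sub>R P' t) (at t within {0..R})" if "t \<in> {0..R}" for t
        using DERIV_chain2[OF DERIV_cos d'(1)[OF that]] by (simp add: has_real_derivative_iff_has_vector_derivative)
    qed
    moreover have "smooth_conv (Suc j) R (\<lambda>x t. sin (\<Theta> x t)) (\<lambda>t. sin (\<Theta>' t)) F"
    proof (rule smooth_conv_SucI[OF us _ _ smooth_conv_scaleR[OF cj pj]])
      show "\<forall>\<^sub>F x in F. \<forall>t\<in>{0..R}. ((\<lambda>t. sin (\<Theta> x t)) has_vector_derivative cos (\<Theta> x t) *\<^sub>R P x t) (at t within {0..R})"
        using d(1)
      proof eventually_elim
        case (elim x)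
        show ?case using DERIV_chain2[OF DERIV_sin bspec[OF elim]] by (simp add: has_real_derivative_iff_has_vector_derivative)
      qed
      show "((\<lambda>t. sin (\<Theta>' t)) has_vector_derivative cos (\<Theta>' t) *\<^sub>R P' t) (at t within {0..R})" if "t \<in> {0..R}" for t
        using DERIV_chain2[OF DERIV_sin d'(1)[OF that]] by (simp add: has_real_derivative_iff_has_vector_derivative)
    qed
    moreover have "smooth_conv (Suc j) R P P' F"
    proof -
      have l1: "((\<lambda>x. m x * cos (\<alpha> x)) \<longlongrightarrow> 1 / 2 * cos 0) F" "((\<lambda>x. - (m x * sin (\<alpha> x))) \<longlongrightarrow> - (1 / 2 * sin 0)) F"
        by (intro tendsto_minus tendsto_mult tendsto_cos tendsto_sin lim)+
      \<comment> \<open>The addition theorem separates the tilt from \<Theta>, so that it appears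
        only in coefficients constant in t.\<close>
      note conv = smooth_conv_add[OF smooth_conv_scaleR[OF smooth_conv_const[OF l1(1)] sj] smooth_conv_scaleR[OF smooth_conv_const[OF l1(2)] cj]]
      show ?thesis
      proof (rule smooth_conv_SucI[OF up _ _ conv])
        show "\<forall>\<^sub>F x in F. \<forall>t\<in>{0..R}. (P x has_vector_derivative (m x * cos (\<alpha> x)) *\<^sub>R sin (\<Theta> x t) + (- (m x * sin (\<alpha> x))) *\<^sub>R cos (\<Theta> x t)) (at t within {0..R})"
          using d(2)
        proof eventually_elim
          case (elim x)
          have "m x * sin (\<Theta> x t - \<alpha> x) = (m x * cos (\<alpha> x)) *\<^sub>R sin (\<Theta> x t) + (- (m x * sin (\<alpha> x))) *\<^sub>R cos (\<Theta> x t)" for t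
            unfolding sin_diff by (simp add: algebra_simps)
          thus ?case using elim unfolding has_real_derivative_iff_has_vector_derivative by simp
        qed
        show "(P' has_vector_derivative (1 / 2 * cos 0) *\<^sub>R sin (\<Theta>' t) + (- (1 / 2 * sin 0)) *\<^sub>R cos (\<Theta>' t)) (at t within {0..R})" if "t \<in> {0..R}" for t
          using d'(2)[OF that] by (simp add: has_real_derivative_iff_has_vector_derivative)
      qed
    qed
    ultimately show ?case by blast
  qed
qed

text \<open>Integrating the direction gains one order; the common starting point turns uniform
  convergence of directions into that of curves.\<close>

lemma curve_smooth_conv:
  fixes \<Gamma> :: "'b \<Rightarrow> real \<Rightarrow> real^2"
  assumes R: "R > 0"
    and c: "smooth_conv j R (\<lambda>x t. cos (\<Theta> x t)) (\<lambda>t. cos (\<Theta>' t)) F"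
    and s: "smooth_conv j R (\<lambda>x t. sin (\<Theta> x t)) (\<lambda>t. sin (\<Theta>' t)) F"
    and \<Gamma>: "\<forall>\<^sub>F x in F. \<forall>t\<in>{0..R}. (\<Gamma> x has_vector_derivative unit_vec (\<Theta> x t)) (at t within {0..R})"
      "\<forall>\<^sub>F x in F. \<Gamma> x 0 = 0"
    and G: "\<And>t. t \<in> {0..R} \<Longrightarrow> (G has_vector_derivative unit_vec (\<Theta>' t)) (at t within {0..R})" "G 0 = 0"
  shows "smooth_conv (Suc j) R \<Gamma> G F"
proof -
  have u: "smooth_conv j R (\<lambda>x t. unit_vec (\<Theta> x t)) (\<lambda>t. unit_vec (\<Theta>' t)) F"
    unfolding unit_vec_def vector_2_eq[of "cos _"]
    by (intro smooth_conv_add smooth_conv_scaleR c s smooth_conv_const tendsto_const)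
  have "uniform_limit {0..R} \<Gamma> G F"
  proof (rule uniform_limitI)
    fix e :: real assume e: "e > 0"
    define d where "d = e / (R + 1)"
    have d: "d > 0" "d * R < e" unfolding d_def using e R by (simp_all add: field_simps)
    have "\<forall>\<^sub>F x in F. \<forall>t\<in>{0..R}. dist (unit_vec (\<Theta> x t)) (unit_vec (\<Theta>' t)) < d"
      using smooth_conv_uniform_limit[OF u] d(1) by (rule uniform_limitD)
    thus "\<forall>\<^sub>F x in F. \<forall>t\<in>{0..R}. dist (\<Gamma> x t) (G t) < e"
      using \<Gamma>
    proof eventually_elim
      case (elim x)
      show ?case
      proof
        fix t assume t: "t \<in> {0..R}"
        have sub: "{0..t} \<subseteq> {0..R}" using t by auto
        have hi: "((\<lambda>s. unit_vec (\<Theta> x s) - unit_vec (\<Theta>' s)) has_integral (\<Gamma> x t - G t) - (\<Gamma> x 0 - G 0)) {0..t}"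
        proof (rule fundamental_theorem_of_calculus[where f="\<lambda>s. \<Gamma> x s - G s"])
          fix s assume "s \<in> {0..t}"
          hence "s \<in> {0..R}" using sub by blast
          hence "((\<lambda>s. \<Gamma> x s - G s) has_vector_derivative unit_vec (\<Theta> x s) - unit_vec (\<Theta>' s)) (at s within {0..R})"
            using has_vector_derivative_diff[OF bspec[OF elim(2)] G(1)] by blast
          thus "((\<lambda>s. \<Gamma> x s - G s) has_vector_derivative unit_vec (\<Theta> x s) - unit_vec (\<Theta>' s)) (at s within {0..t})"
            by (rule has_vector_derivative_within_subset[OF _ sub])
        qed (use t in simp)
        have "norm ((\<Gamma> x t - G t) - (\<Gamma> x 0 - G 0)) \<le> d * measure lborel {0..t}"
        proof (rule has_integral_bound_real[OF less_imp_le[OF d(1)] finite.emptyI hi])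
          fix s assume "s \<in> {0..t} - {}"
          hence "s \<in> {0..R}" using sub by blast
          thus "norm (unit_vec (\<Theta> x s) - unit_vec (\<Theta>' s)) \<le> d" using elim(1) by (simp add: dist_norm less_imp_le)
        qed
        also have "\<dots> \<le> d * R" using t d(1) by (simp add: mult_left_mono)
        finally show "dist (\<Gamma> x t) (G t) < e" using d(2) elim(3) G(2) by (simp add: dist_norm)
      qed
    qed
  qed
  from smooth_conv_SucI[OF this \<Gamma>(1) G(1) u] show ?thesis .
qed

section \<open>The borderline elastica as limit\<close>

text \<open>The first-order equation of the separatrix, from sin (2 arctan e) = 2 e / (1 + e^2) with
  e = exp (- u / sqrt 2). Differentiating it once more gives \<phi>'' = sin \<phi> / 2, the limit of
  the rescaled pendulum equation.\<close>

lemma borderline_angle_derivative: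
  "(borderline_angle has_real_derivative - sqrt 2 * sin (borderline_angle u / 2)) (at u)"
proof -
  let ?e = "exp (- u / sqrt 2)"
  have d: "((\<lambda>u. exp (- u / sqrt 2)) has_real_derivative ?e * (- 1 / sqrt 2)) (at u)"
    by (rule DERIV_chain2[OF DERIV_exp DERIV_cdivide[OF DERIV_minus[OF DERIV_ident]]])
  have "(borderline_angle has_real_derivative 4 * (inverse (1 + ?e\<^sup>2) * (?e * (- 1 / sqrt 2)))) (at u)"
    unfolding borderline_angle_def[abs_def] by (intro DERIV_cmult DERIV_chain2[OF DERIV_arctan d])
  moreover have "sin (borderline_angle u / 2) = 2 * ?e * inverse (1 + ?e\<^sup>2)"
  proof -
    have "sin (borderline_angle u / 2) = 2 * sin (arctan ?e) * cos (arctan ?e)"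
      unfolding borderline_angle_def using sin_double[of "arctan ?e"] by simp
    also have "\<dots> = 2 * (?e / sqrt (1 + ?e\<^sup>2)) * (1 / sqrt (1 + ?e\<^sup>2))" by (simp only: sin_arctan cos_arctan)
    also have "\<dots> = 2 * ?e * inverse (sqrt (1 + ?e\<^sup>2) * sqrt (1 + ?e\<^sup>2))" by (simp add: field_simps)
    also have "sqrt (1 + ?e\<^sup>2) * sqrt (1 + ?e\<^sup>2) = 1 + ?e\<^sup>2" by (simp add: add_nonneg_nonneg)
    finally show ?thesis .
  qed
  moreover have "4 * (i * (q * (- 1 / sqrt 2))) = - sqrt 2 * (2 * q * i)" for i q :: real
  proof -
    have h: "1 / sqrt 2 = sqrt 2 / (2::real)" by (simp add: field_simps)
    have "4 * (i * (q * (- 1 / sqrt 2))) = - (4 * (i * q)) * (1 / sqrt 2)" by simp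
    also have "\<dots> = - sqrt 2 * (2 * q * i)" unfolding h by simp
    finally show ?thesis .
  qed
  ultimately show ?thesis by (simp only:)
qed

lemma curves_converge_to_borderline:
  fixes \<Gamma> :: "real \<Rightarrow> real \<Rightarrow> real^2" and \<Theta> P :: "real \<Rightarrow> real \<Rightarrow> real"
  assumes \<theta>: "\<theta> \<in> {-pi<..<pi} - {0}"
    and d\<Theta>: "\<And>R. R > 0 \<Longrightarrow> \<forall>\<^sub>F x in F. \<forall>t\<in>{0..R}. (\<Theta> x has_real_derivative P x t) (at t within {0..R})"
    and dP: "\<And>R. R > 0 \<Longrightarrow> \<forall>\<^sub>F x in F. \<forall>t\<in>{0..R}. (P x has_real_derivative m x * sin (\<Theta> x t - \<alpha> x)) (at t within {0..R})"
    and d\<Gamma>: "\<And>R. R > 0 \<Longrightarrow> \<forall>\<^sub>F x in F. \<forall>t\<in>{0..R}. (\<Gamma> x has_vector_derivative unit_vec (\<Theta> x t)) (at t within {0..R})"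
    and ini: "\<forall>\<^sub>F x in F. \<Theta> x 0 = \<theta>" "\<forall>\<^sub>F x in F. \<Gamma> x 0 = 0"
    and lim: "(m \<longlongrightarrow> 1 / 2) F" "(\<alpha> \<longlongrightarrow> 0) F" "((\<lambda>x. P x 0) \<longlongrightarrow> - sqrt 2 * sin (\<theta> / 2)) F"
  shows "locally_smooth_tendsto \<Gamma> (borderline_elastica \<theta>) F"
proof -
  \<comment> \<open>Cosine is even and sine is odd, so the sign in the second component of
    \<open>borderline_elastica\<close> can be moved into the angle.\<close>
  define \<Theta>' where "\<Theta>' t = sgn \<theta> * borderline_angle (t + borderline_shift \<theta>)" for t
  define P' where "P' t = - sqrt 2 * sin (\<Theta>' t / 2)" for t
  have sg: "sgn \<theta> = 1 \<or> sgn \<theta> = -1" using \<theta> by (auto simp: sgn_if)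
  have sin_sg: "sin (sgn \<theta> * x) = sgn \<theta> * sin x" "cos (sgn \<theta> * x) = cos x" for x using sg by auto
  have d1: "(\<Theta>' has_real_derivative P' t) (at t)" for t
  proof -
    have "((\<lambda>t. borderline_angle (t + borderline_shift \<theta>)) has_real_derivative
        - sqrt 2 * sin (borderline_angle (t + borderline_shift \<theta>) / 2) * (1 + 0)) (at t)"
      by (rule DERIV_chain2[OF borderline_angle_derivative DERIV_add[OF DERIV_ident DERIV_const]])
    from DERIV_cmult[OF this, of "sgn \<theta>"]
    have "(\<Theta>' has_real_derivative sgn \<theta> * (- sqrt 2 * sin (borderline_angle (t + borderline_shift \<theta>) / 2) * (1 + 0))) (at t)"
      unfolding \<Theta>'_def[abs_def] .
    moreover have "sin (\<Theta>' t / 2) = sgn \<theta> * sin (borderline_angle (t + borderline_shift \<theta>) / 2)"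
      unfolding \<Theta>'_def using sin_sg(1)[of "borderline_angle (t + borderline_shift \<theta>) / 2"] by simp
    hence "sgn \<theta> * (- sqrt 2 * sin (borderline_angle (t + borderline_shift \<theta>) / 2) * (1 + 0)) = P' t"
      unfolding P'_def by simp
    ultimately show ?thesis by simp
  qed
  have d2: "(P' has_real_derivative 1 / 2 * sin (\<Theta>' t)) (at t)" for t
  proof -
    have "(P' has_real_derivative - sqrt 2 * (cos (\<Theta>' t / 2) * (P' t / 2))) (at t)"
      unfolding P'_def[abs_def] using DERIV_cmult[OF DERIV_chain2[OF DERIV_sin DERIV_cdivide[OF d1]], of "- sqrt 2" 2 t]
      unfolding P'_def .
    moreover have "- sqrt 2 * (cos (\<Theta>' t / 2) * (P' t / 2)) = 1 / 2 * sin (\<Theta>' t)"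
    proof -
      have "- r * (c * (- r * q / 2)) = (r * r) * (q * c) / 2" for r c q :: real by simp
      from this[of "sqrt 2" "cos (\<Theta>' t / 2)" "sin (\<Theta>' t / 2)"]
      have "- sqrt 2 * (cos (\<Theta>' t / 2) * (P' t / 2)) = (sqrt 2 * sqrt 2) * (sin (\<Theta>' t / 2) * cos (\<Theta>' t / 2)) / 2"
        unfolding P'_def .
      also have "\<dots> = 1 / 2 * sin (\<Theta>' t)" unfolding sin_half_angle[of "\<Theta>' t"] by simp
      finally show ?thesis .
    qed
    ultimately show ?thesis by (simp only:)
  qed
  \<comment> \<open>The shift is the time at which the separatrix has angle |\<theta>|; since
    |\<theta>| / 4 < \<pi> / 2, arctan undoes the tangent.\<close>
  have \<Theta>'0: "\<Theta>' 0 = \<theta>"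
  proof -
    have q: "0 < \<bar>\<theta>\<bar> / 4" "\<bar>\<theta>\<bar> / 4 < pi / 2" using \<theta> by auto
    hence "tan (\<bar>\<theta>\<bar> / 4) > 0" by (rule tan_gt_zero)
    hence "exp (- borderline_shift \<theta> / sqrt 2) = tan (\<bar>\<theta>\<bar> / 4)" unfolding borderline_shift_def by simp
    hence "borderline_angle (borderline_shift \<theta>) = 4 * arctan (tan (\<bar>\<theta>\<bar> / 4))" unfolding borderline_angle_def by simp
    also have "arctan (tan (\<bar>\<theta>\<bar> / 4)) = \<bar>\<theta>\<bar> / 4" using q by (intro arctan_tan) auto
    finally have "borderline_angle (borderline_shift \<theta>) = \<bar>\<theta>\<bar>" by simp
    thus ?thesis unfolding \<Theta>'_def by (simp add: sgn_mult_abs)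
  qed
  have G: "(borderline_elastica \<theta> has_vector_derivative unit_vec (\<Theta>' t)) (at t within {0..R})" if "t \<in> {0..R}" for t R
  proof -
    have c: "continuous_on {0..R} \<Theta>'"
      by (rule DERIV_continuous_on[OF has_field_derivative_at_within[OF d1]])
    have "borderline_elastica \<theta> = (\<lambda>s. integral {0..s} (\<lambda>u. unit_vec (\<Theta>' u)))"
      unfolding borderline_elastica_def[abs_def] unit_vec_def \<Theta>'_def sin_sg ..
    thus ?thesis using integral_has_vector_derivative[OF continuous_on_unit_vec[OF c] that] by simp
  qed
  have G0: "borderline_elastica \<theta> 0 = 0" unfolding borderline_elastica_def by simp
  have ini': "\<forall>\<^sub>F x in F. \<Theta> x 0 = \<Theta>' 0" using ini(1) unfolding \<Theta>'0 .
  have limP: "((\<lambda>x. P x 0) \<longlongrightarrow> P' 0) F" using lim(3) unfolding P'_def \<Theta>'0 .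
  show ?thesis unfolding locally_smooth_tendsto_def
  proof (intro allI impI)
    fix R :: real and j assume R: "R > 0"
    have "smooth_conv j R (\<lambda>x t. cos (\<Theta> x t)) (\<lambda>t. cos (\<Theta>' t)) F \<and>
       smooth_conv j R (\<lambda>x t. sin (\<Theta> x t)) (\<lambda>t. sin (\<Theta>' t)) F \<and> smooth_conv j R P P' F"
      by (rule pendulum_smooth_conv[OF R d\<Theta>[OF R] dP[OF R] ini' has_field_derivative_at_within[OF d1]
            has_field_derivative_at_within[OF d2] lim(1,2) limP])
    hence "smooth_conv (Suc j) R \<Gamma> (borderline_elastica \<theta>) F"
      by (intro curve_smooth_conv[OF R _ _ d\<Gamma>[OF R] ini(2) G G0]) blast+
    thus "Ck_tendsto_on j {0..R} \<Gamma> (borderline_elastica \<theta>) F"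
      by (rule smooth_conv_imp_Ck_tendsto_on[OF R smooth_conv_SucD])
  qed
qed

section \<open>Inflection points and minimality\<close>

lemma AE_interval_witness:
  assumes AE: "AE t in lebesgue. t \<in> {u<..<v} \<longrightarrow> Q t" and uv: "u < (v::real)"
  obtains t where "t \<in> {u<..<v}" "Q t"
proof -
  have "\<exists>t\<in>{u<..<v}. Q t"
  proof (rule ccontr)
    assume "\<not> ?thesis"
    hence "AE t in lebesgue. t \<notin> {u<..<v}" using AE by (auto elim!: eventually_mono)
    hence "{u<..<v} \<in> null_sets lebesgue" by (subst AE_iff_null_sets) auto
    hence "emeasure lebesgue {u<..<v} = 0" by (rule null_setsD1)
    thus False using uv by simp
  qed
  thus ?thesis using that by blast
qed

text \<open>The sign conditions of an inflection point hold almost everywhere and intervals have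
  positive measure, so each side of s would contain a point where K has the prescribed sign; the two
  signs are opposite.\<close>

lemma no_inflection_point_if_sign_constant:
  assumes AE: "AE t in lebesgue. t \<in> {0..L} \<longrightarrow> curvature L \<gamma> t = K t"
    and d: "d > 0" and sign: "\<And>t t'. t \<in> {s-d<..<s+d} \<inter> {0<..<L} \<Longrightarrow> t' \<in> {s-d<..<s+d} \<inter> {0<..<L} \<Longrightarrow> K t * K t' > 0"
  shows "\<not> inflection_point L \<gamma> s"
proof
  assume "inflection_point L \<gamma> s"
  then obtain e \<sigma> where e: "e > 0" "\<sigma> \<in> {-1, 1}" "{s-e<..<s+e} \<subseteq> {0<..<L}"
    and l: "AE t in lebesgue. t \<in> {s-e<..<s} \<longrightarrow> \<sigma> * curvature L \<gamma> t < 0"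
    and r: "AE t in lebesgue. t \<in> {s<..<s+e} \<longrightarrow> \<sigma> * curvature L \<gamma> t > 0"
    unfolding inflection_point_def by blast
  define f where "f = min d e"
  have f: "f > 0" "f \<le> d" "f \<le> e" unfolding f_def using d e by auto
  have "{s-f<..<s+f} \<subseteq> {s-e<..<s+e}" using f(3) by auto
  hence sub: "t \<in> {0<..<L}" if "t \<in> {s-f<..<s+f}" for t using e(3) that by blast
  have "AE t in lebesgue. t \<in> {s-f<..<s} \<longrightarrow> \<sigma> * K t < 0"
    using AE l
  proof eventually_elim
    case (elim t)
    show ?case
    proof
      assume t: "t \<in> {s-f<..<s}"
      hence "t \<in> {0..L}" "t \<in> {s-e<..<s}" using sub[of t] f by auto
      thus "\<sigma> * K t < 0" using elim by metis
    qed
  qed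
  then obtain t where t: "t \<in> {s-f<..<s}" "\<sigma> * K t < 0" by (rule AE_interval_witness) (use f in auto)
  have "AE t in lebesgue. t \<in> {s<..<s+f} \<longrightarrow> \<sigma> * K t > 0"
    using AE r
  proof eventually_elim
    case (elim t)
    show ?case
    proof
      assume t: "t \<in> {s<..<s+f}"
      hence "t \<in> {0..L}" "t \<in> {s<..<s+e}" using sub[of t] f by auto
      thus "\<sigma> * K t > 0" using elim by metis
    qed
  qed
  then obtain t' where t': "t' \<in> {s<..<s+f}" "\<sigma> * K t' > 0" by (rule AE_interval_witness) (use f in auto)
  have "t \<in> {s-d<..<s+d} \<inter> {0<..<L}" "t' \<in> {s-d<..<s+d} \<inter> {0<..<L}"
    using t(1) t'(1) f sub[of t] sub[of t'] by auto
  hence "K t * K t' > 0" by (rule sign)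
  moreover have "(\<sigma> * K t) * (\<sigma> * K t') < 0" using t(2) t'(2) by (rule mult_neg_pos)
  moreover have "(\<sigma> * K t) * (\<sigma> * K t') = K t * K t'" using e(2) by auto
  ultimately show False by simp
qed

lemma inflection_point_of_strictly_monotone_curvature:
  assumes AE: "AE t in lebesgue. t \<in> {0..L} \<longrightarrow> curvature L \<gamma> t = K t"
    and mono: "strictly_monotone_on {0..L} K" and s: "s \<in> {0<..<L}" "K s = 0"
  shows "\<exists>!s. inflection_point L \<gamma> s"
proof -
  \<comment> \<open>\<sigma> orients K, so that increasing and decreasing curvature are treated
    together; it is also the witness for the sign in \<open>inflection_point\<close>.\<close>
  obtain \<sigma> where \<sigma>: "\<sigma> \<in> {-1, 1::real}" and inc: "\<And>x y. x \<in> {0..L} \<Longrightarrow> y \<in> {0..L} \<Longrightarrow> x < y \<Longrightarrow> \<sigma> * K x < \<sigma> * K y"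
  proof (cases "strict_mono_on {0..L} K")
    case True
    show ?thesis by (rule that[of 1]) (use True in \<open>auto simp: strict_mono_on_def\<close>)
  next
    case False
    hence anti: "strict_antimono_on {0..L} K" using mono unfolding strictly_monotone_on_def by blast
    show ?thesis by (rule that[of "-1"]) (use anti in \<open>auto simp: monotone_on_def\<close>)
  qed
  have neg: "\<sigma> * K t < 0" if "t \<in> {0..L}" "t < s" for t using inc[of t s] that s by auto
  have pos: "\<sigma> * K t > 0" if "t \<in> {0..L}" "s < t" for t using inc[of s t] that s by auto
  have prod: "K t * K t' = (\<sigma> * K t) * (\<sigma> * K t')" for t t' using \<sigma> by auto
  show ?thesis
  proof (rule ex1I[of _ s])
    show "inflection_point L \<gamma> s" unfolding inflection_point_def
    proof (intro conjI exI[of _ "min s (L - s)"] bexI[OF _ \<sigma>] s(1))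
      show "min s (L - s) > 0" using s by simp
      show "{s - min s (L - s)<..<s + min s (L - s)} \<subseteq> {0<..<L}" by auto
      show "AE t in lebesgue. t \<in> {s - min s (L - s)<..<s} \<longrightarrow> \<sigma> * curvature L \<gamma> t < 0"
        using AE
      proof eventually_elim
        case (elim t)
        show ?case
        proof
          assume t: "t \<in> {s - min s (L - s)<..<s}"
          hence "t \<in> {0..L}" using s by auto
          thus "\<sigma> * curvature L \<gamma> t < 0" using elim neg[of t] t by simp
        qed
      qed
      show "AE t in lebesgue. t \<in> {s<..<s + min s (L - s)} \<longrightarrow> \<sigma> * curvature L \<gamma> t > 0"
        using AE
      proof eventually_elim
        case (elim t)
        show ?case
        proof
          assume t: "t \<in> {s<..<s + min s (L - s)}"
          hence "t \<in> {0..L}" using s by auto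
          thus "\<sigma> * curvature L \<gamma> t > 0" using elim pos[of t] t by simp
        qed
      qed
    qed
    fix r assume r: "inflection_point L \<gamma> r"
    show "r = s"
    proof (rule ccontr)
      assume ne: "r \<noteq> s"
      have "\<not> inflection_point L \<gamma> r"
      proof (rule no_inflection_point_if_sign_constant[OF AE, of "\<bar>r - s\<bar>"])
        show "\<bar>r - s\<bar> > 0" using ne by simp
        fix t t' assume t: "t \<in> {r - \<bar>r - s\<bar><..<r + \<bar>r - s\<bar>} \<inter> {0<..<L}" "t' \<in> {r - \<bar>r - s\<bar><..<r + \<bar>r - s\<bar>} \<inter> {0<..<L}"
        show "K t * K t' > 0"
        proof (cases "r < s")
          case True
          hence "t < s" "t' < s" "t \<in> {0..L}" "t' \<in> {0..L}" using t by auto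
          thus ?thesis unfolding prod using neg by (intro mult_neg_neg) auto
        next
          case False
          hence "s < t" "s < t'" "t \<in> {0..L}" "t' \<in> {0..L}" using t by auto
          hence "\<sigma> * K t > 0" "\<sigma> * K t' > 0" using pos by blast+
          thus ?thesis unfolding prod by (rule mult_pos_pos)
        qed
      qed
      thus False using r by simp
    qed
  qed
qed

section \<open>Sign and monotonicity of the curvature\<close>

text \<open>The derivative of the slope is \<open>elastica_sin\<close>, which is positive when both
  end values are. Up to reflection this is the case \<theta>0 \<theta>1 > 0.\<close>

lemma elastica_slope_mono:
  assumes W: "W > 0" and ab: "a > 0" "b > 0" and xy: "0 \<le> x" "x < y" "y \<le> W"
  shows "elastica_slope W a b x < elastica_slope W a b y"
proof (rule DERIV_pos_imp_increasing[OF xy(2)])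
  fix w assume w: "x \<le> w" "w \<le> y"
  have "elastica_sin W a b w > 0"
  proof (cases "w = 0")
    case True thus ?thesis using W ab by (simp add: elastica_sin_ends)
  next
    case False
    hence "sinh w > 0" "sinh (W - w) \<ge> 0" "sinh W > 0" using w xy W by auto
    thus ?thesis unfolding elastica_sin_def using ab by (intro divide_pos_pos add_nonneg_pos) auto
  qed
  thus "\<exists>d. (elastica_slope W a b has_real_derivative d) (at w) \<and> d > 0"
    using elastica_slope_derivative by blast
qed

text \<open>For end values of opposite sign both terms of the slope have the same sign, so the
  curvature never vanishes: up to reflection the case \<theta>0 \<theta>1 < 0.\<close>

lemma elastica_slope_neg:
  assumes W: "W > 0" and ab: "a < 0" "b > 0"
  shows "elastica_slope W a b w > 0"
proof -
  have "b * cosh w > 0" "a * cosh (W - w) < 0"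
    using ab cosh_real_pos[of w] cosh_real_pos[of "W - w"] by (simp_all add: mult_neg_pos)
  hence "b * cosh w - a * cosh (W - w) > 0" by linarith
  thus ?thesis unfolding elastica_slope_def using W by (intro divide_pos_pos) auto
qed

lemma elastica_slope_minus: "elastica_slope W (- a) (- b) w = - elastica_slope W a b w"
  unfolding elastica_slope_def by (simp add: diff_divide_distrib)

text \<open>The assertions about one fixed l, kept apart from the limits so that a solution can be
  chosen for every l beforehand.\<close>

definition straightened_elastica :: "real \<Rightarrow> real \<Rightarrow> real \<Rightarrow> real \<Rightarrow> (real \<Rightarrow> real^2) \<Rightarrow> bool" where
  "straightened_elastica L \<theta>0 \<theta>1 l \<gamma> \<longleftrightarrow>
       energy_minimiser L l \<theta>0 \<theta>1 \<gamma> \<and>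
       (\<forall>\<eta>. energy_minimiser L l \<theta>0 \<theta>1 \<eta> \<longrightarrow> (\<forall>s\<in>{0..L}. \<eta> s = \<gamma> s)) \<and>
       (\<theta>0 * \<theta>1 < 0 \<longrightarrow>
          (\<exists>\<theta>. tangential_angle L \<gamma> \<theta> \<and> strictly_monotone_on {0..L} \<theta> \<and>
               \<theta> 0 = \<theta>0 \<and> \<theta> L = \<theta>1) \<and>
          \<not> (\<exists>s. inflection_point L \<gamma> s)) \<and>
       (\<theta>0 * \<theta>1 > 0 \<longrightarrow>
          (\<exists>k. is_curvature L \<gamma> k \<and> continuous_on {0..L} k \<and>
               strictly_monotone_on {0..L} k \<and> (\<exists>!s. s \<in> {0..L} \<and> k s = 0)) \<and>
          (\<exists>!s. inflection_point L \<gamma> s))"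

lemma strict_mono_on_of_positive_derivative:
  fixes f f' :: "real \<Rightarrow> real"
  assumes d: "\<And>s. s \<in> {0..L} \<Longrightarrow> (f has_real_derivative f' s) (at s within {0..L})"
    and pos: "\<And>s. s \<in> {0..L} \<Longrightarrow> f' s > 0"
  shows "strict_mono_on {0..L} f"
proof (rule strict_mono_onI)
  fix r s assume rs: "r \<in> {0..L}" "s \<in> {0..L}" "r < s"
  show "f r < f s"
  proof (rule DERIV_pos_imp_increasing_open[OF rs(3)])
    show "continuous_on {r..s} f"
      by (rule continuous_on_subset[OF DERIV_continuous_on[OF d]]) (use rs in auto)
    fix x assume x: "r < x" "x < s"
    have "at x within {0..L} = at x" by (rule at_within_interior) (use x rs in auto)
    thus "\<exists>y. (f has_real_derivative y) (at x) \<and> y > 0" using d[of x] pos[of x] x rs by auto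
  qed
qed

lemma strictly_monotone_on_minus:
  "strict_mono_on S (\<lambda>x. - f x) \<Longrightarrow> strictly_monotone_on S f" for f :: "real \<Rightarrow> real"
  unfolding strictly_monotone_on_def by (rule disjI2) (auto simp: monotone_on_def)

text \<open>Besides the curve, its angle and the end values of the curvature are returned, because
  the limit is later taken in the pendulum equation and its initial data.\<close>

lemma elastica_solution:
  fixes z :: "real \<times> real"
  assumes L: "L > 0" and \<theta>0: "\<theta>0 \<in> {-pi<..<pi} - {0}" and \<theta>1: "\<theta>1 \<in> {-pi<..<pi} - {0}"
    and good: "good_param \<theta>0 \<theta>1 z" and height: "height_of \<theta>0 \<theta>1 z = 0" and defect: "defect_of \<theta>0 \<theta>1 z = (L - l) / L"
  shows "\<exists>\<Theta> K. (\<forall>s\<in>{0..L}. (\<Theta> has_real_derivative K s) (at s within {0..L})) \<and>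
    (\<forall>s\<in>{0..L}. (K has_real_derivative (time_of \<theta>0 \<theta>1 z / L)\<^sup>2 * sin (\<Theta> s - tilt z)) (at s within {0..L})) \<and>
    \<Theta> 0 = \<theta>0 \<and> \<Theta> L = \<theta>1 \<and>
    K 0 = 2 * time_of \<theta>0 \<theta>1 z / L * slope_of \<theta>0 \<theta>1 z 0 \<and>
    K L = 2 * time_of \<theta>0 \<theta>1 z / L * slope_of \<theta>0 \<theta>1 z (fst z) \<and>
    straightened_elastica L \<theta>0 \<theta>1 l (\<lambda>s. integral {0..s} (\<lambda>u. unit_vec (\<Theta> u)))"
proof -
  define W a b \<alpha> where "W = fst z" and "a = end_sin \<theta>0 z" and "b = end_sin \<theta>1 z" and "\<alpha> = tilt z"
  note g = good[unfolded good_param_def[OF \<theta>0 \<theta>1], folded W_def a_def b_def \<alpha>_def]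
  have W: "W > 0" and lt: "\<bar>\<theta>0 - \<alpha>\<bar> < pi" "\<bar>\<theta>1 - \<alpha>\<bar> < pi" and sa: "a * \<theta>0 > 0" and sb: "b * \<theta>1 > 0"
    using g by blast+
  have a: "\<bar>a\<bar> < 1" and b: "\<bar>b\<bar> < 1" using lt end_sin_lt_1[OF \<theta>0 \<theta>1] unfolding a_def b_def \<alpha>_def by blast+
  define T I J where "T = elastica_time W a b" and "I = elastica_potential W a b" and "J = elastica_impulse W a b"
  have T: "T > 0" unfolding T_def by (rule elastica_time_pos[OF W a b])
  have T_eq: "time_of \<theta>0 \<theta>1 z = T" unfolding time_of_def[OF \<theta>0 \<theta>1] T_def W_def a_def b_def ..
  have I_eq: "potential_of \<theta>0 \<theta>1 z = I" unfolding potential_of_def[OF \<theta>0 \<theta>1] I_def W_def a_def b_def ..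
  have J_eq: "impulse_of \<theta>0 \<theta>1 z = J" unfolding impulse_of_def[OF \<theta>0 \<theta>1] J_def W_def a_def b_def ..
  have E_eq: "energy_of \<theta>0 \<theta>1 z = elastica_energy W a b" unfolding energy_of_def[OF \<theta>0 \<theta>1] W_def a_def b_def ..
  have S_eq: "slope_of \<theta>0 \<theta>1 z = elastica_slope W a b" unfolding slope_of_def[OF \<theta>0 \<theta>1] W_def a_def b_def ..
  obtain \<nu> \<Theta> K where \<nu>: "\<nu> 0 = 0" "\<nu> L = W" "\<And>s. s \<in> {0..L} \<Longrightarrow> \<nu> s \<in> {0..W}" "strict_mono_on {0..L} \<nu>" "continuous_on {0..L} \<nu>"
    and \<Theta>: "\<And>s. \<Theta> s = \<alpha> + 2 * arcsin (elastica_sin W a b (\<nu> s))"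
    and K: "\<And>s. K s = 2 * T / L * elastica_slope W a b (\<nu> s)"
    and d\<Theta>: "\<And>s. s \<in> {0..L} \<Longrightarrow> (\<Theta> has_real_derivative K s) (at s within {0..L})"
    and dK: "\<And>s. s \<in> {0..L} \<Longrightarrow> (K has_real_derivative (T / L)\<^sup>2 * sin (\<Theta> s - \<alpha>)) (at s within {0..L})"
    and cosX: "\<And>s. s \<in> {0..L} \<Longrightarrow> cos ((\<Theta> s - \<alpha>) / 2) > 0"
    and ints: "integral {0..L} (\<lambda>s. sin (\<Theta> s)) = L / T * (J * cos \<alpha> + sin \<alpha> * (T - I))"
    "integral {0..L} (\<lambda>s. cos (\<Theta> s)) = L / T * (cos \<alpha> * (T - I) - sin \<alpha> * J)"
    and act: "pendulum_action L ((T / L)\<^sup>2) (\<lambda>s. \<Theta> s - \<alpha>) K = T / L * (4 * I + 4 * elastica_energy W a b * T)"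
    by (rule elastica_parametrisation[OF W a b L, of \<alpha>, folded T_def I_def J_def]) (rule that)
  define \<gamma> where "\<gamma> s = integral {0..s} (\<lambda>u. unit_vec (\<Theta> u))" for s
  \<comment> \<open>Since |\<theta> - \<alpha>| < \<pi>, arcsin recovers the prescribed angles
    themselves and not only modulo 2 \<pi>.\<close>
  have asin: "\<alpha> + 2 * arcsin (sin ((\<theta> - \<alpha>) / 2)) = \<theta>" if "\<bar>\<theta> - \<alpha>\<bar> < pi" for \<theta>
    using arcsin_sin[of "(\<theta> - \<alpha>) / 2"] that by (simp add: abs_less_iff)
  have e0: "\<Theta> 0 = \<theta>0"
    unfolding \<Theta> \<nu>(1) elastica_sin_ends(1)[OF W] unfolding a_def end_sin_def \<alpha>_def[symmetric] by (rule asin[OF lt(1)])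
  have e1: "\<Theta> L = \<theta>1"
    unfolding \<Theta> \<nu>(2) elastica_sin_ends(2)[OF W] unfolding b_def end_sin_def \<alpha>_def[symmetric] by (rule asin[OF lt(2)])
  have c2: "integral {0..L} (\<lambda>s. sin (\<Theta> s)) = 0"
    using height unfolding height_of_def[OF \<theta>0 \<theta>1] T_eq I_eq J_eq \<alpha>_def[symmetric] ints by simp
  have c1: "integral {0..L} (\<lambda>s. cos (\<Theta> s)) = l"
  proof -
    have "1 - (cos \<alpha> * (T - I) - sin \<alpha> * J) / T = (L - l) / L"
      using defect unfolding defect_of_def[OF \<theta>0 \<theta>1] T_eq I_eq J_eq \<alpha>_def[symmetric] .
    hence h: "(cos \<alpha> * (T - I) - sin \<alpha> * J) / T = l / L" using L by (simp add: diff_divide_distrib)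
    have e: "L / T * q = L * (q / T)" for q by simp
    have "L * (l / L) = l" using L by simp
    thus ?thesis unfolding ints(2) e h .
  qed
  define \<eta> where "\<eta> = gap_margin \<theta>0 \<theta>1"
  have \<eta>: "0 < \<eta>" "\<eta> < 1" unfolding \<eta>_def by (rule gap_margin[OF \<theta>0 \<theta>1])+
  have sq: "sqrt ((T / L)\<^sup>2) = T / L" using T L by simp
  \<comment> \<open>Division by T / L, the square root of the coefficient, turns this into the two
    inequalities for \<open>potential_of\<close> in \<open>good_param\<close>.\<close>
  have gap: "pendulum_action L ((T / L)\<^sup>2) (\<lambda>s. \<Theta> s - \<alpha>) K <
      min (8 * sqrt ((T / L)\<^sup>2) * (2 - 2 * \<eta> - \<bar>cos ((\<theta>0 - \<alpha>) / 2) - cos ((\<theta>1 - \<alpha>) / 2)\<bar>)) (4 * (T / L)\<^sup>2 * \<eta> * L)"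
  proof -
    have TL: "T / L > 0" using T L by simp
    have h: "4 * I + 4 * (elastica_energy W a b * T) < 8 * (2 - 2 * \<eta> - \<bar>cos ((\<theta>0 - \<alpha>) / 2) - cos ((\<theta>1 - \<alpha>) / 2)\<bar>)"
      "4 * I + 4 * (elastica_energy W a b * T) < 4 * T * \<eta>"
      using g unfolding T_eq I_eq E_eq \<eta>_def by blast+
    have "4 * (T / L)\<^sup>2 * \<eta> * L = T / L * (4 * T * \<eta>)" using L by (simp add: power2_eq_square)
    moreover have "8 * sqrt ((T / L)\<^sup>2) * q = T / L * (8 * q)" for q unfolding sq by simp
    moreover have "4 * elastica_energy W a b * T = 4 * (elastica_energy W a b * T)" by simp
    ultimately show ?thesis unfolding act min_less_iff_conj
      using mult_strict_left_mono[OF h(1) TL] mult_strict_left_mono[OF h(2) TL] by (simp only: simp_thms)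
  qed
  have \<rho>: "(T / L)\<^sup>2 > 0" using T L by simp
  note min = unique_minimiser[OF L \<rho> d\<Theta> dK cosX e0 e1 c1 c2 \<eta> gap \<gamma>_def]
  have cK: "continuous_on {0..L} K" by (rule DERIV_continuous_on[OF dK])
  have c\<Theta>: "continuous_on {0..L} \<Theta>" by (rule DERIV_continuous_on[OF d\<Theta>])
  have W22: "\<gamma> \<in> W22_arc L" by (rule curve_of_angle_W22_arc[OF L d\<Theta> cK \<gamma>_def])
  have curv: "is_curvature L \<gamma> K" by (rule curve_of_angle_is_curvature[OF L d\<Theta> cK \<gamma>_def])
  have AE: "AE t in lebesgue. t \<in> {0..L} \<longrightarrow> curvature L \<gamma> t = K t" by (rule curvature_AE_eq[OF W22 L curv])
  have TL2: "2 * T / L > 0" using T L by simp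
  have pa: "(\<exists>\<theta>. tangential_angle L \<gamma> \<theta> \<and> strictly_monotone_on {0..L} \<theta> \<and> \<theta> 0 = \<theta>0 \<and> \<theta> L = \<theta>1) \<and>
          \<not> (\<exists>s. inflection_point L \<gamma> s)" if neg: "\<theta>0 * \<theta>1 < 0"
  proof -
    have "(\<theta>0 < 0 \<and> \<theta>1 > 0) \<or> (\<theta>0 > 0 \<and> \<theta>1 < 0)" using neg by (auto simp: mult_less_0_iff)
    \<comment> \<open>By \<open>good_param\<close> the end sines have the signs of \<theta>0 and
      \<theta>1 in spite of the tilt.\<close>
    hence "(a < 0 \<and> b > 0) \<or> (a > 0 \<and> b < 0)" using sa sb by (auto simp: zero_less_mult_iff)
    hence sgnK: "(\<forall>s. K s > 0) \<or> (\<forall>s. - K s > 0)"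
    proof
      assume "a < 0 \<and> b > 0"
      hence "K s > 0" for s unfolding K using TL2 elastica_slope_neg[OF W] by (intro mult_pos_pos) auto
      thus ?thesis by blast
    next
      assume "a > 0 \<and> b < 0"
      hence "elastica_slope W (- a) (- b) w > 0" for w using elastica_slope_neg[OF W, of "- a" "- b"] by simp
      hence "- elastica_slope W a b w > 0" for w unfolding elastica_slope_minus .
      hence "2 * T / L * - elastica_slope W a b (\<nu> s) > 0" for s using TL2 by (intro mult_pos_pos)
      hence "- K s > 0" for s unfolding K by simp
      thus ?thesis by blast
    qed
    have "strictly_monotone_on {0..L} \<Theta>" using sgnK
    proof
      assume "\<forall>s. K s > 0"
      thus ?thesis unfolding strictly_monotone_on_def
        using strict_mono_on_of_positive_derivative[OF d\<Theta>] by blast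
    next
      assume *: "\<forall>s. - K s > 0"
      have "strict_mono_on {0..L} (\<lambda>s. - \<Theta> s)"
        by (rule strict_mono_on_of_positive_derivative[OF DERIV_minus[OF d\<Theta>]]) (use * in auto)
      thus ?thesis by (rule strictly_monotone_on_minus)
    qed
    moreover have "tangential_angle L \<gamma> \<Theta>" unfolding tangential_angle_def
      using c\<Theta> curve_of_angle_velocity[OF L d\<Theta> cK \<gamma>_def] by blast
    moreover have "\<not> inflection_point L \<gamma> s" for s
    proof (rule no_inflection_point_if_sign_constant[OF AE zero_less_one])
      show "K t * K t' > 0" for t t' using sgnK by (auto simp: zero_less_mult_iff)
    qed
    ultimately show ?thesis using e0 e1 by blast
  qed
  have pb: "(\<exists>k. is_curvature L \<gamma> k \<and> continuous_on {0..L} k \<and>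
               strictly_monotone_on {0..L} k \<and> (\<exists>!s. s \<in> {0..L} \<and> k s = 0)) \<and>
          (\<exists>!s. inflection_point L \<gamma> s)" if pos: "\<theta>0 * \<theta>1 > 0"
  proof -
    have sl: "elastica_slope W a b 0 * \<theta>0 < 0" "elastica_slope W a b W * \<theta>1 > 0"
      using g unfolding S_eq by blast+
    have sg\<theta>: "(\<theta>0 > 0 \<and> \<theta>1 > 0) \<or> (\<theta>0 < 0 \<and> \<theta>1 < 0)" using pos by (auto simp: zero_less_mult_iff)
    have \<nu>less: "0 \<le> \<nu> r \<and> \<nu> r < \<nu> s \<and> \<nu> s \<le> W" if "r \<in> {0..L}" "s \<in> {0..L}" "r < s" for r s
      using \<nu>(3)[OF that(1)] \<nu>(3)[OF that(2)] strict_mono_onD[OF \<nu>(4) that] by simp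
    have mono: "strictly_monotone_on {0..L} K" using sg\<theta>
    proof
      assume "\<theta>0 > 0 \<and> \<theta>1 > 0"
      hence ab: "a > 0" "b > 0" using sa sb by (auto simp: zero_less_mult_iff)
      have "strict_mono_on {0..L} K"
      proof (rule strict_mono_onI)
        fix r s assume "r \<in> {0..L}" "s \<in> {0..L}" "r < s"
        from \<nu>less[OF this] show "K r < K s" unfolding K
          using TL2 by (intro mult_strict_left_mono elastica_slope_mono[OF W ab]) auto
      qed
      thus ?thesis unfolding strictly_monotone_on_def by blast
    next
      assume "\<theta>0 < 0 \<and> \<theta>1 < 0"
      hence ab: "- a > 0" "- b > 0" using sa sb by (auto simp: zero_less_mult_iff)
      have "strict_mono_on {0..L} (\<lambda>s. - K s)"
      proof (rule strict_mono_onI)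
        fix r s assume "r \<in> {0..L}" "s \<in> {0..L}" "r < s"
        from \<nu>less[OF this] have "elastica_slope W (- a) (- b) (\<nu> r) < elastica_slope W (- a) (- b) (\<nu> s)"
          by (intro elastica_slope_mono[OF W ab]) auto
        from mult_strict_left_mono[OF this TL2] show "- K r < - K s" unfolding K elastica_slope_minus by simp
      qed
      thus ?thesis by (rule strictly_monotone_on_minus)
    qed
    \<comment> \<open>The angle first moves from \<theta>0 towards zero and finally away from zero
      to \<theta>1, so K has opposite signs at the ends and vanishes in between.\<close>
    have ends: "K 0 * \<theta>0 < 0" "K L * \<theta>1 > 0"
    proof -
      have "2 * T / L * (elastica_slope W a b 0 * \<theta>0) < 0" using TL2 sl(1) by (rule mult_pos_neg)
      thus "K 0 * \<theta>0 < 0" unfolding K \<nu>(1) by (simp only: mult.assoc)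
      have "2 * T / L * (elastica_slope W a b W * \<theta>1) > 0" using TL2 sl(2) by (rule mult_pos_pos)
      thus "K L * \<theta>1 > 0" unfolding K \<nu>(2) by (simp only: mult.assoc)
    qed
    have "\<exists>s\<in>{0<..<L}. K s = 0"
    proof -
      have "\<exists>s. 0 \<le> s \<and> s \<le> L \<and> K s = 0" using sg\<theta>
      proof
        assume "\<theta>0 > 0 \<and> \<theta>1 > 0"
        hence "K 0 < 0" "K L > 0" using ends by (auto simp: mult_less_0_iff zero_less_mult_iff)
        thus ?thesis using IVT'[of K 0 0 L] cK L by auto
      next
        assume "\<theta>0 < 0 \<and> \<theta>1 < 0"
        hence "K 0 > 0" "K L < 0" using ends by (auto simp: mult_less_0_iff zero_less_mult_iff)
        thus ?thesis using IVT2'[of K L 0 0] cK L by auto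
      qed
      then obtain s where s: "0 \<le> s" "s \<le> L" "K s = 0" by blast
      moreover have "s \<noteq> 0" "s \<noteq> L" using s(3) ends by auto
      ultimately show ?thesis by (intro bexI[of _ s]) auto
    qed
    then obtain s where s: "s \<in> {0<..<L}" "K s = 0" by blast
    have inj: "x = y" if "x \<in> {0..L}" "y \<in> {0..L}" "K x = K y" for x y
      using mono that unfolding strictly_monotone_on_def monotone_on_def
      by (cases x y rule: linorder_cases) (metis less_irrefl)+
    have "\<exists>!s. s \<in> {0..L} \<and> K s = 0"
    proof (rule ex1I[of _ s])
      show "s \<in> {0..L} \<and> K s = 0" using s by auto
      fix r assume "r \<in> {0..L} \<and> K r = 0"
      thus "r = s" using inj[of r s] s by auto
    qed
    thus ?thesis using curv cK mono inflection_point_of_strictly_monotone_curvature[OF AE mono s] by blast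
  qed
  have "straightened_elastica L \<theta>0 \<theta>1 l \<gamma>"
    unfolding straightened_elastica_def using min pa pb by blast
  hence SE: "straightened_elastica L \<theta>0 \<theta>1 l (\<lambda>s. integral {0..s} (\<lambda>u. unit_vec (\<Theta> u)))"
    unfolding \<gamma>_def[abs_def] .
  have K0: "K 0 = 2 * T / L * elastica_slope W a b 0" "K L = 2 * T / L * elastica_slope W a b W"
    unfolding K \<nu>(1) \<nu>(2) by (rule refl)+
  show ?thesis unfolding T_eq S_eq W_def[symmetric] \<alpha>_def[symmetric]
    by (intro exI[of _ \<Theta>] exI[of _ K] conjI ballI d\<Theta> dK e0 e1 K0 SE)
qed

section \<open>Blow-up at the two ends\<close>

text \<open>The affine map t \<mapsto> e t + c serves both ends: e = \<epsilon>, c = 0 at the start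
  and e = -\<epsilon>, c = L at the end. A negative e reverses the direction of travel, and the
  factor 1 / e restores the velocity \<open>unit_vec \<Theta>\<close>.\<close>

lemma rescaled_convergence:
  fixes \<Theta> K :: "real \<Rightarrow> real \<Rightarrow> real" and c e \<rho> \<alpha> :: "real \<Rightarrow> real" and \<Gamma> :: "real \<Rightarrow> real \<Rightarrow> real^2"
  assumes \<theta>: "\<theta> \<in> {-pi<..<pi} - {0}"
    and d\<Theta>: "\<forall>\<^sub>F l in F. \<forall>s\<in>{0..L}. (\<Theta> l has_real_derivative K l s) (at s within {0..L})"
    and dK: "\<forall>\<^sub>F l in F. \<forall>s\<in>{0..L}. (K l has_real_derivative \<rho> l * sin (\<Theta> l s - \<alpha> l)) (at s within {0..L})"
    and e: "\<forall>\<^sub>F l in F. e l \<noteq> 0" and maps: "\<And>R. R > 0 \<Longrightarrow> \<forall>\<^sub>F l in F. \<forall>t\<in>{0..R}. e l * t + c l \<in> {0..L}"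
    and ini: "\<forall>\<^sub>F l in F. \<Theta> l (c l) = \<theta>"
    and \<Gamma>: "\<forall>\<^sub>F l in F. \<forall>t. \<Gamma> l t = (1 / e l) *\<^sub>R (integral {0..e l * t + c l} (\<lambda>u. unit_vec (\<Theta> l u)) - integral {0..c l} (\<lambda>u. unit_vec (\<Theta> l u)))"
    and lim: "((\<lambda>l. (e l)\<^sup>2 * \<rho> l) \<longlongrightarrow> 1 / 2) F" "(\<alpha> \<longlongrightarrow> 0) F" "((\<lambda>l. e l * K l (c l)) \<longlongrightarrow> - sqrt 2 * sin (\<theta> / 2)) F"
  shows "locally_smooth_tendsto \<Gamma> (borderline_elastica \<theta>) F"
proof (rule curves_converge_to_borderline[OF \<theta>, where \<Theta>="\<lambda>l t. \<Theta> l (e l * t + c l)" and P="\<lambda>l t. e l * K l (e l * t + c l)"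
      and m="\<lambda>l. (e l)\<^sup>2 * \<rho> l" and \<alpha>=\<alpha>])
  have chain: "((\<lambda>t. h (p * t + q)) has_real_derivative h' * p) (at t within {0..R})"
    if "(h has_real_derivative h') (at (p * t + q) within {0..L})" "\<forall>t\<in>{0..R}. p * t + q \<in> {0..L}" for h p q h' t R
  proof -
    have "((\<lambda>t. p * t + q) has_real_derivative p + 0) (at t within {0..R})"
      by (rule DERIV_add[OF DERIV_cmult_Id DERIV_const])
    hence aff: "((\<lambda>t. p * t + q) has_real_derivative p) (at t within {0..R})" by simp
    have "(h has_real_derivative h') (at (p * t + q) within (\<lambda>t. p * t + q) ` {0..R})"
      by (rule DERIV_subset[OF that(1)]) (use that(2) in blast)
    from DERIV_image_chain[OF this aff] show ?thesis by (simp add: o_def)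
  qed
  fix R :: real assume R: "R > 0"
  show "\<forall>\<^sub>F l in F. \<forall>t\<in>{0..R}. ((\<lambda>t. \<Theta> l (e l * t + c l)) has_real_derivative e l * K l (e l * t + c l)) (at t within {0..R})"
    using d\<Theta> maps[OF R]
  proof eventually_elim
    case (elim l)
    show ?case
    proof
      fix t assume "t \<in> {0..R}"
      from chain[OF bspec[OF elim(1) bspec[OF elim(2) this]] elim(2)]
      show "((\<lambda>t. \<Theta> l (e l * t + c l)) has_real_derivative e l * K l (e l * t + c l)) (at t within {0..R})"
        by (simp only: mult.commute)
    qed
  qed
  show "\<forall>\<^sub>F l in F. \<forall>t\<in>{0..R}. ((\<lambda>t. e l * K l (e l * t + c l)) has_real_derivative (e l)\<^sup>2 * \<rho> l * sin (\<Theta> l (e l * t + c l) - \<alpha> l)) (at t within {0..R})"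
    using dK maps[OF R]
  proof eventually_elim
    case (elim l)
    show ?case
    proof
      fix t assume "t \<in> {0..R}"
      from DERIV_cmult[OF chain[OF bspec[OF elim(1) bspec[OF elim(2) this]] elim(2)], of "e l"]
      have "((\<lambda>t. e l * K l (e l * t + c l)) has_real_derivative e l * (\<rho> l * sin (\<Theta> l (e l * t + c l) - \<alpha> l) * e l)) (at t within {0..R})" .
      moreover have "e l * (r * q * e l) = (e l)\<^sup>2 * r * q" for r q by (simp add: power2_eq_square)
      ultimately show "((\<lambda>t. e l * K l (e l * t + c l)) has_real_derivative (e l)\<^sup>2 * \<rho> l * sin (\<Theta> l (e l * t + c l) - \<alpha> l)) (at t within {0..R})"
        by (simp only:)
    qed
  qed
  show "\<forall>\<^sub>F l in F. \<forall>t\<in>{0..R}. (\<Gamma> l has_vector_derivative unit_vec (\<Theta> l (e l * t + c l))) (at t within {0..R})"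
    using d\<Theta> maps[OF R] e \<Gamma>
  proof eventually_elim
    case (elim l)
    let ?g = "\<lambda>s. integral {0..s} (\<lambda>u. unit_vec (\<Theta> l u))"
    have c\<Theta>: "continuous_on {0..L} (\<lambda>u. unit_vec (\<Theta> l u))"
      by (rule continuous_on_unit_vec[OF DERIV_continuous_on[OF bspec[OF elim(1)]]])
    show ?case
    proof
      fix t assume t: "t \<in> {0..R}"
      have aff: "((\<lambda>t. e l * t + c l) has_vector_derivative e l) (at t within {0..R})"
        using DERIV_add[OF DERIV_cmult_Id DERIV_const, of "e l" "c l" t "{0..R}"]
        by (simp add: has_real_derivative_iff_has_vector_derivative)
      have "(?g has_vector_derivative unit_vec (\<Theta> l (e l * t + c l))) (at (e l * t + c l) within (\<lambda>t. e l * t + c l) ` {0..R})"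
        by (rule has_vector_derivative_within_subset[OF integral_has_vector_derivative[OF c\<Theta> bspec[OF elim(2) t]]]) (use elim(2) in blast)
      from vector_diff_chain_within[OF aff this]
      have "((\<lambda>t. ?g (e l * t + c l)) has_vector_derivative e l *\<^sub>R unit_vec (\<Theta> l (e l * t + c l))) (at t within {0..R})" by (simp only: o_def)
      from has_vector_derivative_scaleR[OF DERIV_const[of "1 / e l"] has_vector_derivative_diff[OF this has_vector_derivative_const[of "?g (c l)"]]]
      have "((\<lambda>t. (1 / e l) *\<^sub>R (?g (e l * t + c l) - ?g (c l))) has_vector_derivative unit_vec (\<Theta> l (e l * t + c l))) (at t within {0..R})"
        using elim(3) by simp
      moreover have "\<Gamma> l = (\<lambda>t. (1 / e l) *\<^sub>R (?g (e l * t + c l) - ?g (c l)))" using elim(4) by (intro ext) blast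
      ultimately show "(\<Gamma> l has_vector_derivative unit_vec (\<Theta> l (e l * t + c l))) (at t within {0..R})" by (simp only:)
    qed
  qed
next
  show "\<forall>\<^sub>F l in F. \<Theta> l (e l * 0 + c l) = \<theta>" using ini by simp
  show "\<forall>\<^sub>F l in F. \<Gamma> l 0 = 0" using \<Gamma> by eventually_elim simp
  show "((\<lambda>l. e l * K l (e l * 0 + c l)) \<longlongrightarrow> - sqrt 2 * sin (\<theta> / 2)) F" using lim(3) by simp
qed (use lim in auto)

theorem theorem1p4:
  fixes L \<theta>0 \<theta>1 :: real
  assumes "L > 0"
    and "\<theta>0 \<in> {-pi<..<pi} - {0}"
    and "\<theta>1 \<in> {-pi<..<pi} - {0}"
  shows "\<exists>lstar\<in>{0<..<L}. \<exists>\<gamma> :: real \<Rightarrow> real \<Rightarrow> real^2.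
    (\<forall>l\<in>{lstar<..<L}.
       energy_minimiser L l \<theta>0 \<theta>1 (\<gamma> l) \<and>
       (\<forall>\<eta>. energy_minimiser L l \<theta>0 \<theta>1 \<eta> \<longrightarrow> (\<forall>s\<in>{0..L}. \<eta> s = \<gamma> l s)) \<and>
       (\<theta>0 * \<theta>1 < 0 \<longrightarrow>
          (\<exists>\<theta>. tangential_angle L (\<gamma> l) \<theta> \<and> strictly_monotone_on {0..L} \<theta> \<and>
               \<theta> 0 = \<theta>0 \<and> \<theta> L = \<theta>1) \<and>
          \<not> (\<exists>s. inflection_point L (\<gamma> l) s)) \<and>
       (\<theta>0 * \<theta>1 > 0 \<longrightarrow>
          (\<exists>k. is_curvature L (\<gamma> l) k \<and> continuous_on {0..L} k \<and>
               strictly_monotone_on {0..L} k \<and> (\<exists>!s. s \<in> {0..L} \<and> k s = 0)) \<and>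
          (\<exists>!s. inflection_point L (\<gamma> l) s))) \<and>
    locally_smooth_tendsto
      (\<lambda>l s. (1 / rescaling_factor L \<theta>0 \<theta>1 l) *\<^sub>R \<gamma> l (rescaling_factor L \<theta>0 \<theta>1 l * s))
      (borderline_elastica \<theta>0) (at_left L) \<and>
    locally_smooth_tendsto
      (\<lambda>l s. (1 / rescaling_factor L \<theta>0 \<theta>1 l) *\<^sub>R
               (vector [l, 0] - \<gamma> l (L - rescaling_factor L \<theta>0 \<theta>1 l * s)))
      (borderline_elastica \<theta>1) (at_left L)"
proof -
  note \<theta> = assms(2,3) and L = assms(1)
  obtain \<delta>0 where \<delta>0: "\<delta>0 > 0" and exz: "\<And>\<delta>. 0 < \<delta> \<Longrightarrow> \<delta> < \<delta>0 \<Longrightarrow>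
      \<exists>z. good_param \<theta>0 \<theta>1 z \<and> snd z \<in> {-5..5} \<and> height_of \<theta>0 \<theta>1 z = 0 \<and> defect_of \<theta>0 \<theta>1 z = \<delta>"
    by (rule exists_good_param[OF \<theta>]) (rule that)
  \<comment> \<open>q bounds the relative defect: l > L - L q keeps (L - l) / L below \<delta>0, and
    q < 1 keeps \<open>lstar\<close> positive.\<close>
  obtain q where q: "0 < q" "q < 1" "q < \<delta>0"
    using dense[of 0 "min \<delta>0 1"] \<delta>0 by auto
  define lstar where "lstar = L - L * q"
  have "0 < L * q" using L q(1) by (rule mult_pos_pos)
  moreover have "L * q < L * 1" using L q(2) by (rule mult_strict_left_mono[rotated])
  ultimately have lstar: "lstar \<in> {0<..<L}" unfolding lstar_def by simp
  have \<delta>: "0 < (L - l) / L \<and> (L - l) / L < \<delta>0" if "l \<in> {lstar<..<L}" for l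
  proof
    show "0 < (L - l) / L" using that L by simp
    have "L - l < q * L" using that unfolding lstar_def by (simp add: mult.commute)
    hence "(L - l) / L < q" by (simp only: pos_divide_less_eq[OF L])
    thus "(L - l) / L < \<delta>0" using q(3) by (rule less_trans)
  qed
  have "\<forall>l\<in>{lstar<..<L}. \<exists>z. good_param \<theta>0 \<theta>1 z \<and> snd z \<in> {-5..5} \<and> height_of \<theta>0 \<theta>1 z = 0 \<and> defect_of \<theta>0 \<theta>1 z = (L - l) / L"
    using exz \<delta> by blast
  \<comment> \<open>The parameters are chosen separately for each l; in the limit they are
    controlled only through \<open>good_param\<close>, the bound on \<beta> and the closing
    equations.\<close>
  from bchoice[OF this] obtain Z where Z: "\<And>l. l \<in> {lstar<..<L} \<Longrightarrow> good_param \<theta>0 \<theta>1 (Z l) \<and> snd (Z l) \<in> {-5..5} \<and>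
      height_of \<theta>0 \<theta>1 (Z l) = 0 \<and> defect_of \<theta>0 \<theta>1 (Z l) = (L - l) / L" by blast
  define T where "T l = time_of \<theta>0 \<theta>1 (Z l)" for l
  define sol where "sol l \<Theta> K \<longleftrightarrow> (\<forall>s\<in>{0..L}. (\<Theta> has_real_derivative K s) (at s within {0..L})) \<and>
    (\<forall>s\<in>{0..L}. (K has_real_derivative (T l / L)\<^sup>2 * sin (\<Theta> s - tilt (Z l))) (at s within {0..L})) \<and>
    \<Theta> 0 = \<theta>0 \<and> \<Theta> L = \<theta>1 \<and>
    K 0 = 2 * T l / L * slope_of \<theta>0 \<theta>1 (Z l) 0 \<and>
    K L = 2 * T l / L * slope_of \<theta>0 \<theta>1 (Z l) (fst (Z l)) \<and>
    straightened_elastica L \<theta>0 \<theta>1 l (\<lambda>s. integral {0..s} (\<lambda>u. unit_vec (\<Theta> u)))" for l \<Theta> K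
  have "\<exists>\<Theta> K. sol l \<Theta> K" if "l \<in> {lstar<..<L}" for l
    unfolding sol_def T_def by (rule elastica_solution[OF L \<theta>]) (use Z[OF that] in blast)+
  hence "\<forall>l\<in>{lstar<..<L}. \<exists>\<Theta> K. sol l \<Theta> K" by blast
  from bchoice[OF this] obtain \<Theta> where "\<forall>l\<in>{lstar<..<L}. \<exists>K. sol l (\<Theta> l) K" ..
  from bchoice[OF this] obtain K where sol: "\<forall>l\<in>{lstar<..<L}. sol l (\<Theta> l) (K l)" ..
  define \<gamma> where "\<gamma> l s = integral {0..s} (\<lambda>u. unit_vec (\<Theta> l u))" for l s
  have \<gamma>eq: "\<gamma> l = (\<lambda>s. integral {0..s} (\<lambda>u. unit_vec (\<Theta> l u)))" for l by (rule ext) (rule \<gamma>_def)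
  have main: "straightened_elastica L \<theta>0 \<theta>1 l (\<gamma> l)" if "l \<in> {lstar<..<L}" for l
    using bspec[OF sol that] unfolding sol_def \<gamma>eq by blast
  let ?F = "at_left L"
  have evI: "\<forall>\<^sub>F l in ?F. l \<in> {lstar<..<L}" using lstar by (intro eventually_at_left_real) simp
  \<comment> \<open>W times the defect stays above half of \<open>layer_mass\<close>, so W must grow
    as the defect (L - l) / L tends to 0.\<close>
  have Zlim: "filterlim Z (param_filter) ?F"
    unfolding filterlim_iff
  proof (intro allI impI)
    fix Q assume "eventually Q param_filter"
    then obtain W1 where W1: "\<forall>W\<ge>W1. \<forall>\<beta>\<in>{-5..5}. Q (W, \<beta>)" unfolding eventually_param_filter by blast
    define w where "w = max W1 1"
    have w: "w > 0" "w \<ge> W1" unfolding w_def by auto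
    define m where "m = layer_mass \<theta>0 \<theta>1 / 2"
    have m: "m > 0" unfolding m_def using layer_mass_pos[OF \<theta>] by simp
    have "L - L * (m / w) < L" using L m w by simp
    hence "\<forall>\<^sub>F l in ?F. l \<in> {L - L * (m / w)<..<L}" by (rule eventually_at_left_real)
    thus "\<forall>\<^sub>F l in ?F. Q (Z l)" using evI
    proof eventually_elim
      case (elim l)
      have z: "m < fst (Z l) * ((L - l) / L)" "snd (Z l) \<in> {-5..5}"
        using Z[OF elim(2)] unfolding good_param_def[OF \<theta>] m_def by auto
      have d: "0 < (L - l) / L" using \<delta>[OF elim(2)] by blast
      have "(L - l) / L < m / w" using elim(1) L by (simp add: divide_less_eq mult.commute)
      have "fst (Z l) \<ge> w"
      proof (rule ccontr)
        assume "\<not> fst (Z l) \<ge> w"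
        hence "fst (Z l) * ((L - l) / L) \<le> w * ((L - l) / L)" using d by (intro mult_right_mono) auto
        also have "\<dots> \<le> w * (m / w)" using \<open>(L - l) / L < m / w\<close> w by (intro mult_left_mono) auto
        also have "\<dots> = m" using w by simp
        finally show False using z(1) by simp
      qed
      hence "Q (fst (Z l), snd (Z l))" using W1 w z(2) by (meson order_trans)
      thus ?case by simp
    qed
  qed
  define \<epsilon> where "\<epsilon> = rescaling_factor L \<theta>0 \<theta>1"
  \<comment> \<open>The ratio of \<epsilon> to the intrinsic length L / T; its square is the
    coefficient of the rescaled pendulum equation.\<close>
  define \<tau> where "\<tau> l = \<epsilon> l * (T l / L)" for l
  have \<epsilon>_eq: "\<epsilon> l = (L - l) / (sqrt 2 * layer_mass \<theta>0 \<theta>1)" for l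
    unfolding \<epsilon>_def rescaling_factor_def layer_mass_def[OF \<theta>] by (simp add: mult_ac)
  have lm: "layer_mass \<theta>0 \<theta>1 > 0" by (rule layer_mass_pos[OF \<theta>])
  \<comment> \<open>W (L - l) / L tends to \<open>layer_mass\<close> and T / W tends to 1. Division
    by sqrt 2 \<open>layer_mass\<close> in \<epsilon> is thus what produces 1 / sqrt 2, whose square
    is the coefficient 1 / 2 of the borderline equation.\<close>
  have \<tau>lim: "(\<tau> \<longlongrightarrow> 1 / sqrt 2) ?F"
  proof -
    have d: "((\<lambda>l. fst (Z l) * defect_of \<theta>0 \<theta>1 (Z l)) \<longlongrightarrow> layer_mass \<theta>0 \<theta>1) ?F"
      by (rule filterlim_compose[OF defect_of_tendsto[OF \<theta>] Zlim])
    have t: "((\<lambda>l. time_of \<theta>0 \<theta>1 (Z l) / fst (Z l)) \<longlongrightarrow> 1) ?F"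
      by (rule filterlim_compose[OF time_of_tendsto[OF \<theta>] Zlim])
    have c: "((\<lambda>l. fst (Z l) * defect_of \<theta>0 \<theta>1 (Z l) * (time_of \<theta>0 \<theta>1 (Z l) / fst (Z l)) * (1 / (sqrt 2 * layer_mass \<theta>0 \<theta>1))) \<longlongrightarrow>
       layer_mass \<theta>0 \<theta>1 * 1 * (1 / (sqrt 2 * layer_mass \<theta>0 \<theta>1))) ?F"
      by (intro tendsto_mult tendsto_const d t)
    have v: "layer_mass \<theta>0 \<theta>1 * 1 * (1 / (sqrt 2 * layer_mass \<theta>0 \<theta>1)) = 1 / sqrt 2" using lm by simp
    have ev: "\<forall>\<^sub>F l in ?F. fst (Z l) * defect_of \<theta>0 \<theta>1 (Z l) * (time_of \<theta>0 \<theta>1 (Z l) / fst (Z l)) * (1 / (sqrt 2 * layer_mass \<theta>0 \<theta>1)) = \<tau> l"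
      using evI
    proof eventually_elim
      case (elim l)
      have z: "fst (Z l) > 0" "defect_of \<theta>0 \<theta>1 (Z l) = (L - l) / L" using Z[OF elim] unfolding good_param_def[OF \<theta>] by auto
      have "q * d * (t / q) * (1 / y) = d * t / y" if "q > 0" for q d t y :: real using that by simp
      from this[OF z(1)] have "fst (Z l) * defect_of \<theta>0 \<theta>1 (Z l) * (time_of \<theta>0 \<theta>1 (Z l) / fst (Z l)) * (1 / (sqrt 2 * layer_mass \<theta>0 \<theta>1)) =
         (L - l) / L * T l / (sqrt 2 * layer_mass \<theta>0 \<theta>1)" unfolding z(2) T_def .
      also have "\<dots> = \<tau> l" unfolding \<tau>_def \<epsilon>_eq by simp
      finally show ?case .
    qed
    show ?thesis using Lim_transform_eventually[OF c ev] unfolding v .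
  qed
  have tiltlim: "((\<lambda>l. tilt (Z l)) \<longlongrightarrow> 0) ?F" by (rule filterlim_compose[OF tilt_tendsto Zlim])
  have sl: "((\<lambda>l. slope_of \<theta>0 \<theta>1 (Z l) 0) \<longlongrightarrow> - sin (\<theta>0 / 2)) ?F"
    "((\<lambda>l. slope_of \<theta>0 \<theta>1 (Z l) (fst (Z l))) \<longlongrightarrow> sin (\<theta>1 / 2)) ?F"
    by (rule filterlim_compose[OF slope_of_tendsto(1)[OF \<theta>] Zlim], rule filterlim_compose[OF slope_of_tendsto(2)[OF \<theta>] Zlim])
  have \<epsilon>lim: "(\<epsilon> \<longlongrightarrow> 0) ?F"
  proof -
    have "((\<lambda>l. (L - l) / (sqrt 2 * layer_mass \<theta>0 \<theta>1)) \<longlongrightarrow> (L - L) / (sqrt 2 * layer_mass \<theta>0 \<theta>1)) ?F"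
      by (intro tendsto_divide tendsto_diff tendsto_const tendsto_ident_at) (use lm in simp)
    hence "((\<lambda>l. \<epsilon> l) \<longlongrightarrow> 0) ?F" unfolding \<epsilon>_eq by simp
    thus ?thesis .
  qed
  have \<epsilon>pos: "\<forall>\<^sub>F l in ?F. \<epsilon> l > 0" using evI by eventually_elim (use lm in \<open>simp add: \<epsilon>_eq\<close>)
  have \<epsilon>R: "\<forall>\<^sub>F l in ?F. \<forall>t\<in>{0..R}. \<epsilon> l * t \<in> {0..L}" if R: "R > 0" for R
  proof -
    have "\<forall>\<^sub>F l in ?F. \<epsilon> l < L / R" by (rule order_tendstoD(2)[OF \<epsilon>lim]) (use L R in simp)
    thus ?thesis using \<epsilon>pos
    proof eventually_elim
      case (elim l)
      show ?case
      proof
        fix t assume t: "t \<in> {0..R}"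
        hence "\<epsilon> l * t \<le> L / R * R" using elim L R by (intro mult_mono) auto
        thus "\<epsilon> l * t \<in> {0..L}" using elim t R by simp
      qed
    qed
  qed
  have evsol: "\<forall>\<^sub>F l in ?F. sol l (\<Theta> l) (K l)" by (rule eventually_mono[OF evI]) (use sol in blast)
  have ev\<Theta>: "\<forall>\<^sub>F l in ?F. \<forall>s\<in>{0..L}. (\<Theta> l has_real_derivative K l s) (at s within {0..L})"
    and evK: "\<forall>\<^sub>F l in ?F. \<forall>s\<in>{0..L}. (K l has_real_derivative (T l / L)\<^sup>2 * sin (\<Theta> l s - tilt (Z l))) (at s within {0..L})"
    and ev0: "\<forall>\<^sub>F l in ?F. \<Theta> l 0 = \<theta>0" and ev1: "\<forall>\<^sub>F l in ?F. \<Theta> l L = \<theta>1"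
    and evK0: "\<forall>\<^sub>F l in ?F. K l 0 = 2 * T l / L * slope_of \<theta>0 \<theta>1 (Z l) 0"
    and evKL: "\<forall>\<^sub>F l in ?F. K l L = 2 * T l / L * slope_of \<theta>0 \<theta>1 (Z l) (fst (Z l))"
    by (rule eventually_mono[OF evsol], unfold sol_def, blast)+
  have sq2: "(1 / sqrt 2)\<^sup>2 = 1 / (2::real)" by (simp add: power_divide)
  have \<tau>2: "((\<lambda>l. (\<epsilon> l)\<^sup>2 * (T l / L)\<^sup>2) \<longlongrightarrow> 1 / 2) ?F"
    using tendsto_power[OF \<tau>lim, of 2] unfolding \<tau>_def power_mult_distrib sq2 .
  have r2: "1 / sqrt 2 * 2 = sqrt (2::real)" by (simp add: field_simps)
  have lim0: "((\<lambda>l. \<epsilon> l * K l 0) \<longlongrightarrow> - (sqrt 2 * sin (\<theta>0 / 2))) ?F"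
  proof -
    have c: "((\<lambda>l. \<tau> l * 2 * slope_of \<theta>0 \<theta>1 (Z l) 0) \<longlongrightarrow> 1 / sqrt 2 * 2 * (- sin (\<theta>0 / 2))) ?F"
      by (intro tendsto_mult tendsto_const \<tau>lim sl)
    have ev: "\<forall>\<^sub>F l in ?F. \<tau> l * 2 * slope_of \<theta>0 \<theta>1 (Z l) 0 = \<epsilon> l * K l 0"
      using evK0 by eventually_elim (simp add: \<tau>_def)
    show ?thesis using Lim_transform_eventually[OF c ev] unfolding r2 mult_minus_right mult_minus_left .
  qed
  \<comment> \<open>Traversing the curve backwards changes the sign of K, which turns the final
    slope sin (\<theta>1 / 2) into the negative initial slope of the separatrix equation.\<close>
  have lim1: "((\<lambda>l. - (\<epsilon> l * K l L)) \<longlongrightarrow> - (sqrt 2 * sin (\<theta>1 / 2))) ?F"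
  proof -
    have c: "((\<lambda>l. - (\<tau> l * 2 * slope_of \<theta>0 \<theta>1 (Z l) (fst (Z l)))) \<longlongrightarrow> - (1 / sqrt 2 * 2 * sin (\<theta>1 / 2))) ?F"
      by (intro tendsto_minus tendsto_mult tendsto_const \<tau>lim sl)
    have ev: "\<forall>\<^sub>F l in ?F. - (\<tau> l * 2 * slope_of \<theta>0 \<theta>1 (Z l) (fst (Z l))) = - (\<epsilon> l * K l L)"
      using evKL by eventually_elim (simp add: \<tau>_def)
    show ?thesis using Lim_transform_eventually[OF c ev] unfolding r2 mult_minus_right mult_minus_left .
  qed
  have conv0: "locally_smooth_tendsto (\<lambda>l s. (1 / \<epsilon> l) *\<^sub>R \<gamma> l (\<epsilon> l * s)) (borderline_elastica \<theta>0) ?F"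
  proof (rule rescaled_convergence[OF \<theta>(1) ev\<Theta> evK, where e=\<epsilon> and c="\<lambda>l. 0"])
    show "\<forall>\<^sub>F l in ?F. \<epsilon> l \<noteq> 0" using \<epsilon>pos by eventually_elim simp
    show "\<forall>\<^sub>F l in ?F. \<forall>t\<in>{0..R}. \<epsilon> l * t + 0 \<in> {0..L}" if "R > 0" for R using \<epsilon>R[OF that] by simp
    show "\<forall>\<^sub>F l in ?F. \<forall>t. (1 / \<epsilon> l) *\<^sub>R \<gamma> l (\<epsilon> l * t) =
        (1 / \<epsilon> l) *\<^sub>R (integral {0..\<epsilon> l * t + 0} (\<lambda>u. unit_vec (\<Theta> l u)) - integral {0..0} (\<lambda>u. unit_vec (\<Theta> l u)))"
      unfolding \<gamma>_def by simp
    show "((\<lambda>l. \<epsilon> l * K l 0) \<longlongrightarrow> - sqrt 2 * sin (\<theta>0 / 2)) ?F" using lim0 by simp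
  qed (rule ev0 tiltlim \<tau>2)+
  have conv1: "locally_smooth_tendsto (\<lambda>l s. (1 / \<epsilon> l) *\<^sub>R (vector [l, 0] - \<gamma> l (L - \<epsilon> l * s))) (borderline_elastica \<theta>1) ?F"
  proof (rule rescaled_convergence[OF \<theta>(2) ev\<Theta> evK, where e="\<lambda>l. - \<epsilon> l" and c="\<lambda>l. L"])
    show "\<forall>\<^sub>F l in ?F. - \<epsilon> l \<noteq> 0" using \<epsilon>pos by eventually_elim simp
    show "\<forall>\<^sub>F l in ?F. \<forall>t\<in>{0..R}. - \<epsilon> l * t + L \<in> {0..L}" if "R > 0" for R
      using \<epsilon>R[OF that] by eventually_elim simp
    show "\<forall>\<^sub>F l in ?F. \<forall>t. (1 / \<epsilon> l) *\<^sub>R (vector [l, 0] - \<gamma> l (L - \<epsilon> l * t)) =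
        (1 / - \<epsilon> l) *\<^sub>R (integral {0..- \<epsilon> l * t + L} (\<lambda>u. unit_vec (\<Theta> l u)) - integral {0..L} (\<lambda>u. unit_vec (\<Theta> l u)))"
      using evI
    proof eventually_elim
      case (elim l)
      have "\<gamma> l L = vector [l, 0]"
        using main[OF elim] unfolding straightened_elastica_def energy_minimiser_def admissible_def by blast
      hence e: "vector [l, 0] = integral {0..L} (\<lambda>u. unit_vec (\<Theta> l u))" unfolding \<gamma>_def by (rule sym)
      have f: "- \<epsilon> l * t + L = L - \<epsilon> l * t" for t by simp
      have g: "(1 / r) *\<^sub>R (p - q) = (1 / - r) *\<^sub>R (q - p)" for r and p q :: "real^2"
        by (simp add: scaleR_diff_right)
      show ?case unfolding e f \<gamma>_def by (intro allI g)
    qed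
    show "((\<lambda>l. (- \<epsilon> l)\<^sup>2 * (T l / L)\<^sup>2) \<longlongrightarrow> 1 / 2) ?F" using \<tau>2 by simp
    show "((\<lambda>l. - \<epsilon> l * K l L) \<longlongrightarrow> - sqrt 2 * sin (\<theta>1 / 2)) ?F" using lim1 by simp
  qed (rule ev1 tiltlim)+
  show ?thesis
  proof (rule bexI[OF _ lstar], rule exI[of _ \<gamma>], intro conjI ballI)
    fix l assume l: "l \<in> {lstar<..<L}"
    show "energy_minimiser L l \<theta>0 \<theta>1 (\<gamma> l)"
      "\<forall>\<eta>. energy_minimiser L l \<theta>0 \<theta>1 \<eta> \<longrightarrow> (\<forall>s\<in>{0..L}. \<eta> s = \<gamma> l s)"
      "\<theta>0 * \<theta>1 < 0 \<longrightarrow>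
          (\<exists>\<theta>. tangential_angle L (\<gamma> l) \<theta> \<and> strictly_monotone_on {0..L} \<theta> \<and>
               \<theta> 0 = \<theta>0 \<and> \<theta> L = \<theta>1) \<and>
          \<not> (\<exists>s. inflection_point L (\<gamma> l) s)"
      "\<theta>0 * \<theta>1 > 0 \<longrightarrow>
          (\<exists>k. is_curvature L (\<gamma> l) k \<and> continuous_on {0..L} k \<and>
               strictly_monotone_on {0..L} k \<and> (\<exists>!s. s \<in> {0..L} \<and> k s = 0)) \<and>
          (\<exists>!s. inflection_point L (\<gamma> l) s)"
      using main[OF l] unfolding straightened_elastica_def by blast+
  next
    show "locally_smooth_tendsto (\<lambda>l s. (1 / rescaling_factor L \<theta>0 \<theta>1 l) *\<^sub>R \<gamma> l (rescaling_factor L \<theta>0 \<theta>1 l * s))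
      (borderline_elastica \<theta>0) (at_left L)" using conv0 unfolding \<epsilon>_def .
    show "locally_smooth_tendsto (\<lambda>l s. (1 / rescaling_factor L \<theta>0 \<theta>1 l) *\<^sub>R
               (vector [l, 0] - \<gamma> l (L - rescaling_factor L \<theta>0 \<theta>1 l * s)))
      (borderline_elastica \<theta>1) (at_left L)" using conv1 unfolding \<epsilon>_def .
  qed
qed

end
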